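(* Let $F_0\in\mathcal{F}$ and suppose that for all $\{F_t\}\in\mathcal{C}$ (with score $\rho=\rho(\cdot;\{F_t\})$), as $t\to0+$, $$\operatorname{Var}_{F_0}(\overline u_{F_t}-\overline u_{F_0})\to0,\qquad \mathcal{L}(w_{F_t};F_t)\xrightarrow{D}\mathcal{L}(w_{F_0};F_0),\quad E_{F_t}w_{F_t}^2\to E_{F_0}w_{F_0}^2,$$ $$E_{F_0}(\overline u_{F_t}-\overline u_{F_0})/t\to E_{F_0}\phi(X)\rho(X)$$ for a certain $\phi(X)\equiv\phi(X;F_0)\in L_2(F_0)$ (not depending on the curve). Let $\phi_{*,0}$ be the projection of $\phi$ into the tangent space $H_*$, and let $\phi_*\equiv\overline u_{F_0}-\mu(F_0)+\phi_{*,0}$. (i) If $\widetilde S_n$ is a regular estimator of $S_n(F)$ at $F_0$ with limit variable $\xi_0$, then $\operatorname{Var}_{F_0}(\xi_0)\ge\operatorname{Var}_{F_0}(\phi_*-u_{F_0})$. Moreover, the lower bound is reached without bias, that is, $E_{F_0}\xi_0^2=\operatorname{Var}_{F_0}(\phi_*-u_{F_0})$, if and only if $$\frac{\widetilde S_n}{n}=\mu(F_0)+\frac1n\sum_{j=1}^n\phi_*(X_j)+o_{P_{F_0}}(n^{-1/2}).$$ (ii) If $\widetilde S_n$ is a regular estimator of $S_n(F)$ at $F_0$ with limit variable $\xi_0$ and the $L_2(F_0)$ closure $\overline{\mathcal{C}}_*$ of $\mathcal{C}_*$ is convex, then there exist a random variable $\tilde\xi_0$ and certain normal variables $Z(h)\sim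 N(0,\operatorname{Var}_{F_0}(h))$ such that, as $n\to\infty$, $$\mathcal{L}\left(\begin{pmatrix}\sqrt n\{\widetilde S_n/n-A_n(\phi_* )-\mu(F_0)\}\\ Z_n(\overline u_{F_0}+h-u_{F_0})\end{pmatrix};F_0\right)\xrightarrow{D}\mathcal{L}\left(\begin{pmatrix}\tilde\xi_0\\ Z(\overline u_{F_0}+h-u_{F_0})\end{pmatrix};F_0\right)$$ and $\tilde\xi_0$ is independent of $Z(\overline u_{F_0}+h-u_{F_0})$, for all $h\in H_*$. In particular, for $h=\phi_{*,0}$, $$\mathcal{L}(\xi_0;F_0)=\mathcal{L}(Z(\phi_*-u_{F_0});F_0)\star\mathcal{L}(\tilde\xi_0;F_0),$$ where $\star$ denotes convolution. (iii) Suppose $E_{F_t}\overline u^2(X;F_t)$ is bounded for all $\{F_t\}\in\mathcal{C}$. Let $\overline u_*$ be the projection of $\overline u_{F_0}$ to $H_*$. Then $\psi_*=\phi_{*,0}+\overline u_*$ is the efficient influence function for the estimation of $\mu(F)$; that is, for all $\{F_t\}\in\mathcal{C}$, $$\lim_{t\to0+}\{\mu(F_t)-\mu(F_0)\}/t=E_{F_0}\psi_*(X)\rho(X).$$ Consequently, $\phi_*=\psi_*+\overline u_{F_0}-\mu(F_0)-\overline u_*$.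
   Context: $\mathcal{F}$ is a family of joint distributions of $(X,\theta)$. Under $P_F$ (expectation $E_F$), $(X,\theta),(X_j,\theta_j)$, $j\ge1$, are i.i.d. with distribution $F\in\mathcal{F}$; the $X_j$ are observed, the $\theta_j$ and $F$ are unknown, and estimators are functions of $X_1,\dots,X_n$. $u(x,\vartheta;F)$ is a utility function, possibly depending on $F$; $S_n(F)\equiv\sum_{j=1}^nu(X_j,\theta_j;F)$ and $\mu(F)\equiv E_Fu(X,\theta;F)$. Write $u_F\equiv u(X,\theta;F)$, $\overline u(x;F)\equiv E_F[u(X,\theta;F)|X=x]$, $\overline u_F\equiv\overline u(X;F)$, $w_F\equiv\overline u_F-u_F$. $\mathcal{L}(U;F)$ is the distribution of $U$ under $P_F$. Scores and tangent space at $F_0$: $\mathcal{C}\equiv\mathcal{C}(F_0)$ is a collection of mappings $\{F_t,0\le t\le1\}$ from $[0,1]$ to $\mathcal{F}$ (with value $F_0$ at $t=0$) such that, as $t\to0+$, $$E_{F_0}\big(\sqrt{f_t(X)}-1-t\rho(X)/2\big)^2=o(t^2),\qquad E_{F_0}f_t(X)=1+o(t^2),$$ for a certain score function $\rho(x)\equiv\rho(x;\{F_t\})$, where $f_t$ is the Radon–Nikodym derivative of the absolutely continuous part of the marginal distribution $F_t^X$ of $X$ under $F_t$ with respect to $F_0^X$. $\mathcal{C}_*\equiv\{\rho(\cdot;\{F_t\}):\{F_t\}\in\mathcal{C}\}$, and the tangent space $H_*$ is the closure in $L_2(F_0)$ of the linear span of $\mathcal{C}_*$. Projections are orthogonal projections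 in $L_2(F_0)$. An estimator $\widetilde S_n$ of $S_n(F)$ is regular at $F_0$ with limit variable $\xi_0$ if for all $c>0$ and $\{F_t\}\in\mathcal{C}$, $\lim_{n\to\infty}\mathcal{L}(n^{-1/2}\{\widetilde S_n-S_n(F_{c/\sqrt n})\};F_{c/\sqrt n})=\mathcal{L}(\xi_0;F_0)$ (weak convergence, the limit law being the same for all $c$ and all curves). For a function $h(x,\vartheta)$: $A_n(h)\equiv\sum_{j=1}^nh(X_j,\theta_j)/n$ and $Z_n(h)\equiv\sqrt n\{A_n(h)-E_{F_0}h\}$; functions such as $u_{F_0}$, $\overline u_{F_0}$ and $\phi_*$ are identified with the corresponding functions of $(x,\vartheta)$. *)

theory Defs
  imports "HOL-Probability.Probability" "HOL-Library.Landau_Symbols"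
begin

section \<open>Weak convergence, variances, normal laws\<close>

text \<open>
  The library notion \<^const>\<open>weak_conv_m\<close> covers sequences of laws on the real line only. The
  following one also covers laws of random vectors and limits \<open>t \<rightarrow> 0+\<close>; the lemma below shows that
  it extends the library notion.
\<close>

definition weakly_tends ::
  "('i \<Rightarrow> 'a::topological_space measure) \<Rightarrow> 'a measure \<Rightarrow> 'i filter \<Rightarrow> bool" where
  "weakly_tends N M Fl \<longleftrightarrow>
     (\<forall>f::'a \<Rightarrow> real. continuous_on UNIV f \<and> bounded (range f) \<longrightarrow>
        ((\<lambda>i. \<integral>x. f x \<partial>N i) \<longlongrightarrow> (\<integral>x. f x \<partial>M)) Fl)"

lemma weakly_tends_iff_weak_conv_m:
  assumes N: "\<And>n. real_distribution (N n)" and M: "real_distribution M"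
  shows "weakly_tends N M sequentially \<longleftrightarrow> weak_conv_m N M"
proof
  assume *: "weakly_tends N M sequentially"
  show "weak_conv_m N M"
  proof (rule integral_bdd_continuous_conv_imp_weak_conv[OF N M])
    fix f :: "real \<Rightarrow> real"
    assume "\<And>x. isCont f x" and "\<And>x. \<bar>f x\<bar> \<le> 1"
    then have "continuous_on UNIV f" "bounded (range f)"
      by (auto intro: continuous_at_imp_continuous_on simp: bounded_iff)
    with * show "(\<lambda>n. integral\<^sup>L (N n) f) \<longlonglongrightarrow> integral\<^sup>L M f"
      unfolding weakly_tends_def by blast
  qed
next
  assume *: "weak_conv_m N M"
  show "weakly_tends N M sequentially"
    unfolding weakly_tends_def
  proof (intro allI impI, elim conjE)
    fix f :: "real \<Rightarrow> real"
    assume f: "continuous_on UNIV f" "bounded (range f)"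
    then obtain B where "\<And>x. norm (f x) \<le> B"
      by (auto simp: bounded_iff)
    with f show "(\<lambda>n. \<integral>x. f x \<partial>N n) \<longlonglongrightarrow> (\<integral>x. f x \<partial>M)"
      by (intro weak_conv_imp_integral_bdd_continuous_conv[OF N M *])
         (auto simp: continuous_on_eq_continuous_at)
  qed
qed

text \<open>
  The Bochner integral is \<open>0\<close> on non-integrable functions, so wherever finiteness is not known in
  advance the variance is taken in \<open>[0,\<infinity>]\<close>, with value \<open>\<infinity>\<close> if the mean does not exist.
\<close>

definition evar :: "'a measure \<Rightarrow> ('a \<Rightarrow> real) \<Rightarrow> ennreal" where
  "evar M f = (if integrable M f then \<integral>\<^sup>+z. ennreal ((f z - (\<integral>y. f y \<partial>M))\<^sup>2) \<partial>M else \<infinity>)"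

definition normal_law :: "real \<Rightarrow> real \<Rightarrow> real measure" where
  "normal_law m v =
     (if v = 0 then return borel m else density lborel (normal_density m (sqrt v)))"

section \<open>The Hilbert space of square integrable functions\<close>

text \<open>
  Elements of \<open>L\<^sub>2\<close> are represented by functions; all subsets below that are closures contain with a
  function every measurable function that is a.e. equal to it.
\<close>

definition L2_space :: "'a measure \<Rightarrow> ('a \<Rightarrow> real) set" where
  "L2_space M = {h \<in> borel_measurable M. integrable M (\<lambda>x. (h x)\<^sup>2)}"

definition L2_closure :: "'a measure \<Rightarrow> ('a \<Rightarrow> real) set \<Rightarrow> ('a \<Rightarrow> real) set" where
  "L2_closure M A =
     {h \<in> L2_space M. \<forall>e>0. \<exists>g\<in>A \<inter> L2_space M. sqrt (\<integral>x. (h x - g x)\<^sup>2 \<partial>M) < e}"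

definition linear_span :: "('a \<Rightarrow> real) set \<Rightarrow> ('a \<Rightarrow> real) set" where
  "linear_span A = {(\<lambda>x. \<Sum>i<k. a i * r i x) | (k::nat) a r. \<forall>i<k. r i \<in> A}"

definition convex_set_of_functions :: "('a \<Rightarrow> real) set \<Rightarrow> bool" where
  "convex_set_of_functions A \<longleftrightarrow>
     (\<forall>f\<in>A. \<forall>g\<in>A. \<forall>a::real. 0 \<le> a \<and> a \<le> 1 \<longrightarrow> (\<lambda>x. a * f x + (1 - a) * g x) \<in> A)"

definition is_L2_projection ::
  "'a measure \<Rightarrow> ('a \<Rightarrow> real) set \<Rightarrow> ('a \<Rightarrow> real) \<Rightarrow> ('a \<Rightarrow> real) \<Rightarrow> bool" where
  "is_L2_projection M H f p \<longleftrightarrow>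
     f \<in> L2_space M \<and> p \<in> H \<and> (\<forall>h\<in>H. (\<integral>x. (f x - p x) * h x \<partial>M) = 0)"

section \<open>The model\<close>

text \<open>
  A distribution \<open>F\<close> of \<open>(X, \<theta>)\<close> is a measure on the product \<open>MX \<Otimes>\<^sub>M MT\<close>. The law of the i.i.d. sequence
  is the infinite product of \<open>F\<close>; the pair numbered \<open>j \<ge> 1\<close> is coordinate \<open>j - 1\<close>.
\<close>

definition marginal_X :: "'x measure \<Rightarrow> ('x \<times> 't) measure \<Rightarrow> 'x measure" where
  "marginal_X MX F = distr F MX fst"

definition iid :: "('x \<times> 't) measure \<Rightarrow> (nat \<Rightarrow> 'x \<times> 't) measure" where
  "iid F = PiM UNIV (\<lambda>_. F)"

definition observed :: "nat \<Rightarrow> (nat \<Rightarrow> 'x \<times> 't) \<Rightarrow> (nat \<Rightarrow> 'x)" where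
  "observed n \<omega> = (\<lambda>j\<in>{..<n}. fst (\<omega> j))"

type_synonym ('x, 't) utility = "'x \<Rightarrow> 't \<Rightarrow> ('x \<times> 't) measure \<Rightarrow> real"

definition util :: "('x, 't) utility \<Rightarrow> ('x \<times> 't) measure \<Rightarrow> 'x \<times> 't \<Rightarrow> real" where
  "util u F = (\<lambda>(x, \<theta>). u x \<theta> F)"

definition mean_utility :: "('x, 't) utility \<Rightarrow> ('x \<times> 't) measure \<Rightarrow> real" where
  "mean_utility u F = (\<integral>z. util u F z \<partial>F)"

definition utility_sum ::
  "('x, 't) utility \<Rightarrow> nat \<Rightarrow> ('x \<times> 't) measure \<Rightarrow> (nat \<Rightarrow> 'x \<times> 't) \<Rightarrow> real" where
  "utility_sum u n F \<omega> = (\<Sum>j<n. util u F (\<omega> j))"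

text \<open>
  \<open>ubar x F\<close> is a version of \<open>E\<^sub>F[u(X,\<theta>;F) | X = x]\<close>. It is kept as an explicit function because the
  hypotheses of the theorem evaluate the version for \<open>F\<^sub>t\<close> under the distribution \<open>F\<^sub>0\<close>, which
  need not be dominated by \<open>F\<^sub>t\<close>.
\<close>

definition is_cond_mean_utility ::
  "'x measure \<Rightarrow> ('x, 't) utility \<Rightarrow> ('x \<times> 't) measure \<Rightarrow> ('x \<Rightarrow> real) \<Rightarrow> bool" where
  "is_cond_mean_utility MX u F g \<longleftrightarrow>
     g \<in> borel_measurable MX \<and>
     (AE z in F. g (fst z) = real_cond_exp F (vimage_algebra (space F) fst MX) (util u F) z)"

definition residual ::
  "('x, 't) utility \<Rightarrow> ('x \<Rightarrow> ('x \<times> 't) measure \<Rightarrow> real) \<Rightarrow> ('x \<times> 't) measure \<Rightarrow> 'x \<times> 't \<Rightarrow> real"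
  where "residual u ubar F = (\<lambda>(x, \<theta>). ubar x F - u x \<theta> F)"

definition emp_mean :: "nat \<Rightarrow> ('z \<Rightarrow> real) \<Rightarrow> (nat \<Rightarrow> 'z) \<Rightarrow> real" where
  "emp_mean n h \<omega> = (\<Sum>j<n. h (\<omega> j)) / real n"

definition emp_process :: "'z measure \<Rightarrow> nat \<Rightarrow> ('z \<Rightarrow> real) \<Rightarrow> (nat \<Rightarrow> 'z) \<Rightarrow> real" where
  "emp_process F0 n h \<omega> = sqrt (real n) * (emp_mean n h \<omega> - (\<integral>z. h z \<partial>F0))"

section \<open>Scores and tangent space\<close>

text \<open>
  \<open>f\<close> is the Radon--Nikodym derivative with respect to \<open>M\<close> of the absolutely continuous part of \<open>N\<close>.
  In the Lebesgue decomposition the singular part of \<open>N\<close> is its restriction to some \<open>M\<close>-null set \<open>S\<close>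
  and the absolutely continuous part is its restriction to the complement of \<open>S\<close>.
\<close>

definition is_ac_part_deriv :: "'a measure \<Rightarrow> 'a measure \<Rightarrow> ('a \<Rightarrow> real) \<Rightarrow> bool" where
  "is_ac_part_deriv M N f \<longleftrightarrow>
     f \<in> borel_measurable M \<and> (\<forall>x\<in>space M. 0 \<le> f x) \<and>
     (\<exists>S\<in>null_sets M. density N (indicator (space M - S)) = density M (\<lambda>x. ennreal (f x)))"

text \<open>
  A curve \<open>{F\<^sub>t, 0 \<le> t \<le> 1}\<close> is a function on the reals of which only the values on \<open>[0,1]\<close> matter.
  Square integrability of \<open>\<rho>\<close> follows from the differentiability condition; stating it makes the
  Bochner integrals meaningful.
\<close>

definition has_score ::
  "'x measure \<Rightarrow> ('x \<times> 't) measure \<Rightarrow> (real \<Rightarrow> ('x \<times> 't) measure) \<Rightarrow> ('x \<Rightarrow> real) \<Rightarrow> bool" where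
  "has_score MX F0 \<gamma> \<rho> \<longleftrightarrow>
     (let M0 = marginal_X MX F0 in
      \<rho> \<in> L2_space M0 \<and>
      (\<exists>f::real \<Rightarrow> 'x \<Rightarrow> real.
         (\<forall>t\<in>{0..1}. is_ac_part_deriv M0 (marginal_X MX (\<gamma> t)) (f t)) \<and>
         (\<lambda>t. \<integral>x. (sqrt (f t x) - 1 - t * \<rho> x / 2)\<^sup>2 \<partial>M0) \<in> o[at_right 0](\<lambda>t. t\<^sup>2) \<and>
         (\<lambda>t. (\<integral>x. f t x \<partial>M0) - 1) \<in> o[at_right 0](\<lambda>t. t\<^sup>2)))"

definition admissible_curves ::
  "'x measure \<Rightarrow> ('x \<times> 't) measure set \<Rightarrow> ('x \<times> 't) measure
    \<Rightarrow> (real \<Rightarrow> ('x \<times> 't) measure) set \<Rightarrow> bool" where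
  "admissible_curves MX \<F> F0 \<C> \<longleftrightarrow>
     \<C> \<noteq> {} \<and>
     (\<forall>\<gamma>\<in>\<C>. \<gamma> 0 = F0 \<and> (\<forall>t\<in>{0..1}. \<gamma> t \<in> \<F>) \<and> (\<exists>\<rho>. has_score MX F0 \<gamma> \<rho>))"

definition score_set ::
  "'x measure \<Rightarrow> ('x \<times> 't) measure \<Rightarrow> (real \<Rightarrow> ('x \<times> 't) measure) set \<Rightarrow> ('x \<Rightarrow> real) set" where
  "score_set MX F0 \<C> = {\<rho>. \<exists>\<gamma>\<in>\<C>. has_score MX F0 \<gamma> \<rho>}"

definition tangent_space ::
  "'x measure \<Rightarrow> ('x \<times> 't) measure \<Rightarrow> (real \<Rightarrow> ('x \<times> 't) measure) set \<Rightarrow> ('x \<Rightarrow> real) set" where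
  "tangent_space MX F0 \<C> = L2_closure (marginal_X MX F0) (linear_span (score_set MX F0 \<C>))"

definition efficient_influence_function ::
  "'x measure \<Rightarrow> ('x \<times> 't) measure \<Rightarrow> (real \<Rightarrow> ('x \<times> 't) measure) set
    \<Rightarrow> (('x \<times> 't) measure \<Rightarrow> real) \<Rightarrow> ('x \<Rightarrow> real) \<Rightarrow> bool" where
  "efficient_influence_function MX F0 \<C> \<mu> \<psi> \<longleftrightarrow>
     \<psi> \<in> tangent_space MX F0 \<C> \<and>
     (\<forall>\<gamma>\<in>\<C>. \<forall>\<rho>. has_score MX F0 \<gamma> \<rho> \<longrightarrow>
        ((\<lambda>t. (\<mu> (\<gamma> t) - \<mu> F0) / t) \<longlongrightarrow> (\<integral>x. \<psi> x * \<rho> x \<partial>marginal_X MX F0)) (at_right 0))"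

section \<open>Regular estimators\<close>

definition is_estimator :: "'x measure \<Rightarrow> (nat \<Rightarrow> (nat \<Rightarrow> 'x) \<Rightarrow> real) \<Rightarrow> bool" where
  "is_estimator MX S \<longleftrightarrow> (\<forall>n. S n \<in> borel_measurable (PiM {..<n} (\<lambda>_. MX)))"

text \<open>The limit variable \<open>\<xi>\<close> enters only through its law, so it may live on any probability space \<open>\<Omega>\<close>.\<close>

definition regular_estimator ::
  "'x measure \<Rightarrow> ('x, 't) utility \<Rightarrow> (real \<Rightarrow> ('x \<times> 't) measure) set
    \<Rightarrow> (nat \<Rightarrow> (nat \<Rightarrow> 'x) \<Rightarrow> real) \<Rightarrow> 'w measure \<Rightarrow> ('w \<Rightarrow> real) \<Rightarrow> bool" where
  "regular_estimator MX u \<C> S \<Omega> \<xi> \<longleftrightarrow>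
     is_estimator MX S \<and> prob_space \<Omega> \<and> \<xi> \<in> borel_measurable \<Omega> \<and>
     (\<forall>c>0. \<forall>\<gamma>\<in>\<C>.
        weak_conv_m
          (\<lambda>n. distr (iid (\<gamma> (c / sqrt (real n)))) borel
             (\<lambda>\<omega>. (S n (observed n \<omega>) - utility_sum u n (\<gamma> (c / sqrt (real n))) \<omega>) / sqrt (real n)))
          (distr \<Omega> borel \<xi>))"

definition tends_to_0_in_prob ::
  "'a measure \<Rightarrow> (nat \<Rightarrow> 'a \<Rightarrow> real) \<Rightarrow> bool" where
  "tends_to_0_in_prob P Y \<longleftrightarrow>
     (\<forall>e>0. (\<lambda>n. measure P {\<omega> \<in> space P. \<bar>Y n \<omega>\<bar> > e}) \<longlonglongrightarrow> 0)"

end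

theory Submission
  imports Defs "HOL-Complex_Analysis.Complex_Analysis"
begin

text \<open>
  Let \<open>X\<^sub>n\<close> be the estimation error after replacing \<open>u\<close> by \<open>ubar\<close>, normalised by \<open>\<surd>n\<close>; it depends on the
  observations only, and the residuals \<open>ubar - u\<close> act as independent Gaussian noise. Regularity along a curve
  with score \<open>\<rho>\<close> says, by local asymptotic normality, that \<open>E\<^sub>0 exp (i s X\<^sub>n)\<close> tilted by the local
  likelihood ratio for \<open>c \<rho>\<close> converges to \<open>\<Lambda>(s) exp (i s c E\<^sub>0 \<phi> \<rho>)\<close> up to normalisation.
  For a single direction this determines, by analytic continuation in the tilt, the limits of
  \<open>E\<^sub>0 exp (i s X\<^sub>n) D\<^sub>n(\<rho>)\<close>, where \<open>D\<^sub>n(h)\<close> is the normalised sum of \<open>h(X\<^sub>j)\<close>; these are linear in \<open>\<rho>\<close> and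
  extend to the tangent space, and the Cauchy--Schwarz inequality with \<open>D\<^sub>n(\<phi>\<^sub>0)\<close> yields the variance
  bound. If the closed score set is convex, continuation in two directions gives the joint characteristic
  function of \<open>X\<^sub>n\<close> and \<open>D\<^sub>n(h)\<close>, which factorises after subtracting \<open>D\<^sub>n(\<phi>\<^sub>0)\<close>.
\<close>

section \<open>Limits of powers and of entire functions\<close>

text \<open>Scores have only second moments, so exponential tilts \<open>exp (z fluct n h)\<close>
  need not be integrable, and the logarithm of a likelihood ratio has no direct Taylor expansion.
  The likelihood ratio is therefore replaced by the square of \<open>lik n h\<close>, a product of
  factors \<open>1 + h(X_j) / (2 sqrt n)\<close>: it is polynomial in h, and the second moment of
  \<open>lik n h\<close> is at most \<open>exp (|h|^2 / 4)\<close> for every n, also in complex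
  directions. Products are compared in L2, because the mean of \<open>|prod a - c prod b|^2\<close>
  is made of three nth powers. Regularity provides tilts with positive coefficients only. On the
  curve \<open>z k1 + (1 - z + z^2) k2\<close> both coefficients are positive for real z > 0, while
  at z = i the direction is \<open>i (k1 - k2)\<close>. One complex variable thus performs the
  continuation in two directions and reaches every difference of two elements of the cone over the
  scores.\<close>

lemma power_tendsto_exp:
  fixes a :: "nat \<Rightarrow> complex"
  assumes "(\<lambda>n. of_nat n * (a n - 1)) \<longlonglongrightarrow> \<beta>"
  shows "(\<lambda>n. a n ^ n) \<longlonglongrightarrow> exp \<beta>"
proof -
  \<comment> \<open>\<open>g\<close> is the continuous extension of \<open>Ln z / (z - 1)\<close> to
    z = 1. It turns \<open>a n ^ n\<close> into \<open>exp (n (a n - 1) g (a n))\<close>, where the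
    first part of the exponent converges by hypothesis and the branch of the logarithm matters only
    near 1.\<close>
  define g where "g z = (if z = 1 then 1 else Ln z / (z - 1))" for z :: complex
  have "(\<lambda>n. inverse (of_nat n) * (of_nat n * (a n - 1))) \<longlonglongrightarrow> 0 * \<beta>"
    by (intro tendsto_mult lim_inverse_n assms)
  then have "(\<lambda>n. inverse (of_nat n) * (of_nat n * (a n - 1))) \<longlonglongrightarrow> 0" by simp
  moreover have "\<forall>\<^sub>F n in sequentially. inverse (of_nat n) * (of_nat n * (a n - 1)) = a n - 1"
    using eventually_gt_at_top[of 0] by eventually_elim simp
  ultimately have "(\<lambda>n. a n - 1) \<longlonglongrightarrow> 0" by (rule Lim_transform_eventually)
  then have a: "a \<longlonglongrightarrow> 1" by (simp add: LIM_zero_iff)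
  have "((\<lambda>z. (Ln z - Ln 1) / (z - 1)) \<longlongrightarrow> inverse 1) (at 1)"
    using has_field_derivative_Ln[of 1] by (simp add: has_field_derivative_iff)
  then have "((\<lambda>z. Ln z / (z - 1)) \<longlongrightarrow> 1) (at 1)" by simp
  then have "(g \<longlongrightarrow> 1) (at 1)"
    by (rule Lim_transform_eventually) (auto simp: g_def eventually_at intro: exI[of _ 1])
  then have "isCont g 1" by (simp add: isCont_def g_def)
  with a have "(\<lambda>n. g (a n)) \<longlonglongrightarrow> g 1" by (rule isCont_tendsto_compose[rotated])
  then have "(\<lambda>n. exp (of_nat n * (a n - 1) * g (a n))) \<longlonglongrightarrow> exp (\<beta> * g 1)"
    by (intro tendsto_exp tendsto_mult assms)
  then have "(\<lambda>n. exp (of_nat n * (a n - 1) * g (a n))) \<longlonglongrightarrow> exp \<beta>" by (simp add: g_def)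
  moreover have "eventually (\<lambda>n. a n \<in> - {0}) sequentially"
    using a by (rule topological_tendstoD) auto
  then have "eventually (\<lambda>n. exp (of_nat n * (a n - 1) * g (a n)) = a n ^ n) sequentially"
  proof eventually_elim
    case (elim n)
    have "(a n - 1) * g (a n) = Ln (a n)" by (auto simp: g_def)
    then have "exp (of_nat n * (a n - 1) * g (a n)) = exp (Ln (a n)) ^ n"
      by (simp add: mult.assoc flip: exp_of_nat_mult)
    with elim show ?case by simp
  qed
  ultimately show ?thesis by (rule Lim_transform_eventually)
qed

lemma tendsto_if_subsequences:
  fixes x :: "nat \<Rightarrow> 'a::metric_space"
  assumes "\<And>s. strict_mono (s :: nat \<Rightarrow> nat) \<Longrightarrow> \<exists>r. strict_mono (r :: nat \<Rightarrow> nat) \<and> (\<lambda>n. x (s (r n))) \<longlonglongrightarrow> l"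
  shows "x \<longlonglongrightarrow> l"
proof (rule ccontr)
  assume "\<not> x \<longlonglongrightarrow> l"
  then obtain e where e: "e > 0" "\<not> (\<forall>\<^sub>F n in sequentially. dist (x n) l < e)"
    by (auto simp: tendsto_iff)
  define S where "S = {n. \<not> dist (x n) l < e}"
  have "infinite S"
    using e(2) by (simp add: S_def not_eventually frequently_cofinite flip: cofinite_eq_sequentially)
  then have s: "strict_mono (enumerate S)" "\<And>n. enumerate S n \<in> S"
    by (auto intro: strict_mono_enumerate enumerate_in_set)
  from assms[OF s(1)] obtain r where "(\<lambda>n. x (enumerate S (r n))) \<longlonglongrightarrow> l" by blast
  then have "\<forall>\<^sub>F n in sequentially. dist (x (enumerate S (r n))) l < e"
    using e(1) by (auto simp: tendsto_iff)
  with s(2) show False by (auto simp: S_def eventually_sequentially)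
qed

text \<open>Local bounds make every subsequence normal by Montel's theorem. A limit along a
  subsequence agrees with g on the positive reals, which accumulate at 1, hence everywhere by the
  identity theorem. Convergence is assumed on positive reals because regularity speaks of
  \<open>c > 0\<close>.\<close>

lemma Vitali_entire:
  fixes f :: "nat \<Rightarrow> complex \<Rightarrow> complex"
  assumes f: "\<And>n. f n holomorphic_on UNIV" and g: "g holomorphic_on UNIV"
    and bound: "\<And>R. \<exists>B. \<forall>n. \<forall>z\<in>cball 0 R. norm (f n z) \<le> B"
    and lim: "\<And>x::real. 0 < x \<Longrightarrow> (\<lambda>n. f n (of_real x)) \<longlonglongrightarrow> g (of_real x)"
  shows "(\<lambda>n. f n z) \<longlonglongrightarrow> g z"
proof (rule tendsto_if_subsequences)
  fix s :: "nat \<Rightarrow> nat" assume s: "strict_mono s"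
  have "\<exists>B. \<forall>h\<in>range (f \<circ> s). \<forall>z\<in>K. norm (h z) \<le> B" if "compact K" for K
  proof -
    from that obtain R where "K \<subseteq> cball 0 R"
      using bounded_subset_ballD[OF compact_imp_bounded, of K 0] ball_subset_cball by blast
    with bound[of R] show ?thesis by fastforce
  qed
  then obtain h r where h: "h holomorphic_on UNIV" "strict_mono (r :: nat \<Rightarrow> nat)"
    "\<And>x. (\<lambda>n. (f \<circ> s) (r n) x) \<longlonglongrightarrow> h x"
    using Montel[of UNIV "range (f \<circ> s)" "f \<circ> s" thesis] f by (metis UNIV_I comp_apply imageE open_UNIV subset_refl)
  have sr: "strict_mono (s \<circ> r)" using s h(2) by (rule strict_mono_o)
  have "h (of_real x) = g (of_real x)" if "0 < x" for x :: real
    using LIMSEQ_unique[OF h(3)[of "of_real x"]] LIMSEQ_subseq_LIMSEQ[OF lim[OF that] sr]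
    by (simp add: o_def)
  then have eq: "h w - g w = 0" if "w \<in> of_real ` {0<..}" for w using that by auto
  have "h z - g z = 0"
  proof (rule analytic_continuation[where f="\<lambda>w. h w - g w" and S=UNIV and U="of_real ` {0<..}" and \<xi>=1])
    show "(1::complex) islimpt of_real ` {0<..}" unfolding islimpt_approachable
    proof (intro allI impI)
      fix e :: real assume "e > 0"
      then show "\<exists>x'\<in>of_real ` {0<..}. x' \<noteq> (1::complex) \<and> dist x' 1 < e"
        by (intro bexI[of _ "of_real (1 + e/2)"] imageI) (auto simp: dist_norm)
    qed
  qed (use h(1) g eq in \<open>auto intro!: holomorphic_intros\<close>)
  with h(3)[of z] show "\<exists>r. strict_mono (r :: nat \<Rightarrow> nat) \<and> (\<lambda>n. f (s (r n)) z) \<longlonglongrightarrow> g z"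
    using h(2) by auto
qed

section \<open>Characteristic functions\<close>

lemma (in prob_space) integrable_bounded [intro]:
  fixes f :: "'a \<Rightarrow> 'b::{banach, second_countable_topology}"
  assumes "f \<in> borel_measurable M" "\<And>x. norm (f x) \<le> B"
  shows "integrable M f"
  using assms by (intro integrable_const_bound[where B=B]) auto

text \<open>Dividing the weight by its mean turns it into a density, and the tilted laws of
  \<open>X n\<close> satisfy Levy's continuity theorem. The lower bound 1 keeps the normalising
  constant and its limit away from 0.\<close>

lemma weighted_Levy_continuity:
  fixes X w :: "nat \<Rightarrow> 'a \<Rightarrow> real" and g :: "real \<Rightarrow> real"
  assumes N: "\<And>n. prob_space (N n)" and X: "\<And>n. X n \<in> borel_measurable (N n)"
    and w: "\<And>n. w n \<in> borel_measurable (N n)" and w1: "\<And>n x. 1 \<le> w n x" and wC: "\<And>n x. w n x \<le> C"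
    and m: "(\<lambda>n. LINT x|N n. w n x) \<longlonglongrightarrow> m" and \<nu>: "real_distribution \<nu>"
    and char: "\<And>s. (\<lambda>n. LINT x|N n. w n x *\<^sub>R iexp (s * X n x)) \<longlonglongrightarrow> of_real m * char \<nu> s"
    and g: "\<And>x. isCont g x" "\<And>x. norm (g x) \<le> B"
  shows "(\<lambda>n. LINT x|N n. w n x * g (X n x)) \<longlonglongrightarrow> m * (LINT x|\<nu>. g x)"
proof -
  note [measurable] = X w
  have w_bd: "norm (w n x) \<le> C" for n x using w1[of n x] wC[of n x] by simp
  define e where "e n = (LINT x|N n. w n x)" for n
  have int_w: "integrable (N n) (w n)" for n
    using w_bd by (intro prob_space.integrable_bounded[OF N]) auto
  have e1: "1 \<le> e n" for n
  proof -
    interpret prob_space "N n" by fact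
    have "(LINT x|N n. 1) \<le> e n" unfolding e_def using w1 int_w by (intro integral_mono) auto
    then show ?thesis by (simp add: prob_space)
  qed
  have m0: "m \<noteq> 0" using LIMSEQ_le_const[OF m, of 1] e1 by (force simp: e_def)
  define \<mu> where "\<mu> n = distr (density (N n) (\<lambda>x. ennreal (w n x / e n))) borel (X n)" for n
  have ge0: "0 \<le> w n x / e n" for n x using w1[of n x] e1[of n] by simp
  have \<mu>: "real_distribution (\<mu> n)" for n
  proof -
    have "(\<integral>\<^sup>+x. ennreal (w n x / e n) \<partial>N n) = ennreal (LINT x|N n. w n x / e n)"
      using int_w ge0 by (intro nn_integral_eq_integral) auto
    also have "(LINT x|N n. w n x / e n) = 1" using e1[of n] by (simp add: e_def[symmetric])
    finally have "prob_space (density (N n) (\<lambda>x. ennreal (w n x / e n)))"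
      by (intro prob_spaceI) (simp add: emeasure_density)
    then show ?thesis unfolding \<mu>_def by (intro prob_space.real_distribution_distr) auto
  qed
  have int_\<mu>: "(LINT x|\<mu> n. f x) = (LINT x|N n. w n x *\<^sub>R f (X n x)) /\<^sub>R e n"
    if [measurable]: "f \<in> borel_measurable borel" for f :: "real \<Rightarrow> 'b::{banach, second_countable_topology}" and n
    unfolding \<mu>_def using ge0
    by (simp add: integral_distr integral_density divide_inverse mult.commute flip: scaleR_scaleR)
  have "(\<lambda>n. char (\<mu> n) s) \<longlonglongrightarrow> char \<nu> s" for s
  proof -
    have "(\<lambda>n. (LINT x|N n. w n x *\<^sub>R iexp (s * X n x)) /\<^sub>R e n) \<longlonglongrightarrow> (of_real m * char \<nu> s) /\<^sub>R m"
      using m m0 by (intro tendsto_intros char) (auto simp: e_def)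
    also have "(of_real m * char \<nu> s) /\<^sub>R m = char \<nu> s" using m0 by (simp add: scaleR_conv_of_real)
    finally show ?thesis by (simp add: char_def int_\<mu>)
  qed
  then have "weak_conv_m \<mu> \<nu>" by (rule levy_continuity[OF \<mu> \<nu>])
  then have "(\<lambda>n. LINT x|\<mu> n. g x) \<longlonglongrightarrow> (LINT x|\<nu>. g x)"
    using g by (intro weak_conv_imp_integral_bdd_continuous_conv[OF \<mu> \<nu>]) auto
  moreover have "g \<in> borel_measurable borel"
    using g(1) by (intro borel_measurable_continuous_onI continuous_at_imp_continuous_on) auto
  ultimately have "(\<lambda>n. (LINT x|N n. w n x * g (X n x)) / e n) \<longlonglongrightarrow> (LINT x|\<nu>. g x)"
    by (simp add: int_\<mu> divide_inverse mult.commute)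
  then have "(\<lambda>n. e n * ((LINT x|N n. w n x * g (X n x)) / e n)) \<longlonglongrightarrow> m * (LINT x|\<nu>. g x)"
    using m by (intro tendsto_mult) (auto simp: e_def)
  moreover have "e n * ((LINT x|N n. w n x * g (X n x)) / e n) = (LINT x|N n. w n x * g (X n x))" for n
    using e1[of n] by simp
  ultimately show ?thesis by simp
qed

lemma (in prob_space) integrable_bounded_mult:
  fixes f g :: "'a \<Rightarrow> 'b::{real_normed_algebra, banach, second_countable_topology}"
  assumes "f \<in> borel_measurable M" "g \<in> borel_measurable M" "\<And>x. norm (f x) \<le> B" "\<And>x. norm (g x) \<le> C"
  shows "integrable M (\<lambda>x. f x * g x)"
proof (rule integrable_bounded[where B="B * C"])
  have "0 \<le> B" using assms(3) norm_ge_zero order_trans by blast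
  then show "norm (f x * g x) \<le> B * C" for x
    by (intro order_trans[OF norm_mult_ineq] mult_mono assms norm_ge_zero)
qed (use assms in measurable)

lemma borel_measurable_cnj [measurable (raw)]:
  "f \<in> borel_measurable M \<Longrightarrow> (\<lambda>x. cnj (f x)) \<in> borel_measurable M"
  by (rule borel_measurable_continuous_on[of cnj]) (auto intro: continuous_intros)

lemma char_uminus: "char M (- s) = cnj (char M s)"
proof -
  have eq: "iexp (- s * x) = cnj (iexp (s * x))" for x by (simp add: exp_cnj)
  show ?thesis unfolding char_def eq by (rule Bochner_Integration.integral_cnj)
qed

text \<open>Real and imaginary part of the weight are treated separately. Adding
  \<open>C + 1\<close> makes such a part at least 1, and the case of a constant weight removes the
  shift again.\<close>

lemma complex_weighted_Levy_continuity:
  fixes X :: "nat \<Rightarrow> 'a \<Rightarrow> real" and w :: "nat \<Rightarrow> 'a \<Rightarrow> complex" and g :: "real \<Rightarrow> real"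
  assumes N: "\<And>n. prob_space (N n)" and X: "\<And>n. X n \<in> borel_measurable (N n)"
    and w: "\<And>n. w n \<in> borel_measurable (N n)" and wC: "\<And>n x. norm (w n x) \<le> C"
    and \<nu>: "real_distribution \<nu>" and char1: "\<And>s. (\<lambda>n. LINT x|N n. iexp (s * X n x)) \<longlonglongrightarrow> char \<nu> s"
    and char: "\<And>s. (\<lambda>n. LINT x|N n. w n x * iexp (s * X n x)) \<longlonglongrightarrow> m * char \<nu> s"
    and g: "\<And>x. isCont g x" "\<And>x. norm (g x) \<le> B"
  shows "(\<lambda>n. LINT x|N n. w n x * of_real (g (X n x))) \<longlonglongrightarrow> m * of_real (LINT x|\<nu>. g x)"
proof -
  note [measurable] = X w
  have [measurable]: "g \<in> borel_measurable borel"
    using g(1) by (intro borel_measurable_continuous_onI continuous_at_imp_continuous_on) auto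
  interpret N: prob_space "N n" for n by fact
  interpret real_distribution \<nu> by fact
  have real: "(\<lambda>n. LINT x|N n. v n x * g (X n x)) \<longlonglongrightarrow> k * (LINT x|\<nu>. g x)"
    if v [measurable]: "\<And>n. v n \<in> borel_measurable (N n)" and vC: "\<And>n x. norm (v n x) \<le> C"
      and vlim: "\<And>s. (\<lambda>n. LINT x|N n. of_real (v n x) * iexp (s * X n x)) \<longlonglongrightarrow> of_real k * char \<nu> s" for v k
  proof -
    have vi: "integrable (N n) (v n)" for n using vC by (intro N.integrable_bounded) auto
    have vie: "integrable (N n) (\<lambda>x. complex_of_real (v n x) * iexp (s * X n x))" for n s
      by (rule N.integrable_bounded_mult[where B=C and C=1]) (use vC in auto)
    have ie: "integrable (N n) (\<lambda>x. iexp (s * X n x))" for n s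
      by (rule N.integrable_bounded[where B=1]) auto
    have vg: "integrable (N n) (\<lambda>x. v n x * g (X n x))" for n
      by (rule N.integrable_bounded_mult[where B=C and C=B]) (use vC g in auto)
    have gi: "integrable (N n) (\<lambda>x. g (X n x))" for n
      by (rule N.integrable_bounded[where B=B]) (use g in auto)
    have "(\<lambda>n. LINT x|N n. (C + 1 + v n x) * g (X n x)) \<longlonglongrightarrow> (C + 1 + k) * (LINT x|\<nu>. g x)"
    proof (rule weighted_Levy_continuity[OF N X _ _ _ _ \<nu> _ g])
      show "1 \<le> C + 1 + v n x" "C + 1 + v n x \<le> 2 * C + 1" for n x using vC[of n x] by simp_all
      have "(\<lambda>n. complex_of_real (LINT x|N n. v n x)) \<longlonglongrightarrow> of_real k"
        using vlim[of 0] by (simp add: char_zero)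
      then have "(\<lambda>n. (C + 1) + (LINT x|N n. v n x)) \<longlonglongrightarrow> C + 1 + k"
        by (intro tendsto_add tendsto_const) (simp only: tendsto_of_real_iff)
      then show "(\<lambda>n. LINT x|N n. C + 1 + v n x) \<longlonglongrightarrow> C + 1 + k" using vi by (simp add: N.prob_space)
      fix s
      have "(\<lambda>n. of_real (C + 1) * (LINT x|N n. iexp (s * X n x)) + (LINT x|N n. of_real (v n x) * iexp (s * X n x))) \<longlonglongrightarrow>
          of_real (C + 1) * char \<nu> s + of_real k * char \<nu> s" by (intro tendsto_intros char1 vlim)
      moreover have "(LINT x|N n. (C + 1 + v n x) *\<^sub>R iexp (s * X n x)) =
          of_real (C + 1) * (LINT x|N n. iexp (s * X n x)) + (LINT x|N n. of_real (v n x) * iexp (s * X n x))" for n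
      proof -
        have "(C + 1 + v n x) *\<^sub>R iexp (s * X n x) = of_real (C + 1) * iexp (s * X n x) + of_real (v n x) * iexp (s * X n x)" for x
          by (simp only: scaleR_conv_of_real of_real_add distrib_right)
        then show ?thesis
          using Bochner_Integration.integral_add[OF integrable_mult_right[OF ie] vie, of n "of_real (C + 1)" s s]
          by (simp only: integral_mult_right_zero)
      qed
      ultimately show "(\<lambda>n. LINT x|N n. (C + 1 + v n x) *\<^sub>R iexp (s * X n x)) \<longlonglongrightarrow> of_real (C + 1 + k) * char \<nu> s"
        by (simp only: of_real_add distrib_right)
    qed measurable
    moreover have "(\<lambda>n. LINT x|N n. 1 * g (X n x)) \<longlonglongrightarrow> 1 * (LINT x|\<nu>. g x)"
      by (rule weighted_Levy_continuity[OF N X, where w="\<lambda>_ _. 1" and C=1 and m=1 and \<nu>=\<nu> and g=g and B=B])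
        (use \<nu> g char1 in \<open>simp_all add: N.prob_space\<close>)
    ultimately have "(\<lambda>n. (LINT x|N n. (C + 1 + v n x) * g (X n x)) - (C + 1) * (LINT x|N n. 1 * g (X n x))) \<longlonglongrightarrow>
        (C + 1 + k) * (LINT x|\<nu>. g x) - (C + 1) * (1 * (LINT x|\<nu>. g x))" by (intro tendsto_intros)
    moreover have "(LINT x|N n. (C + 1 + v n x) * g (X n x)) = (C + 1) * (LINT x|N n. 1 * g (X n x)) + (LINT x|N n. v n x * g (X n x))" for n
      using vg gi by (simp add: distrib_right)
    ultimately show ?thesis by (simp add: distrib_right)
  qed
  have int: "integrable (N n) (\<lambda>x. w n x * iexp (s * X n x))" for n s
    by (rule N.integrable_bounded_mult[where B=C and C=1]) (use wC in auto)
  \<comment> \<open>Real and imaginary part are combinations of \<open>w\<close> and its conjugate.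
    The conjugate weight inherits a limit because conjugation maps the frequency s to -s.\<close>
  have lim_cnj: "(\<lambda>n. LINT x|N n. cnj (w n x) * iexp (s * X n x)) \<longlonglongrightarrow> cnj m * char \<nu> s" for s
  proof -
    have eq: "cnj (w n x) * iexp (s * X n x) = cnj (w n x * iexp (- s * X n x))" for n x by (simp add: exp_cnj)
    have "(\<lambda>n. cnj (LINT x|N n. w n x * iexp (- s * X n x))) \<longlonglongrightarrow> cnj (m * char \<nu> (- s))"
      by (intro tendsto_cnj char)
    then show ?thesis unfolding eq Bochner_Integration.integral_cnj by (simp add: char_uminus)
  qed
  have int_cnj: "integrable (N n) (\<lambda>x. cnj (w n x) * iexp (s * X n x))" for n s
    by (rule N.integrable_bounded_mult[where B=C and C=1]) (use wC in auto)
  have lin: "(\<lambda>n. LINT x|N n. of_real (v n x) * iexp (s * X n x)) \<longlonglongrightarrow> of_real k * char \<nu> s"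
    if "\<And>n x. complex_of_real (v n x) = c * w n x + d * cnj (w n x)" "complex_of_real k = c * m + d * cnj m" for v k c d s
  proof -
    have "(LINT x|N n. of_real (v n x) * iexp (s * X n x)) =
        c * (LINT x|N n. w n x * iexp (s * X n x)) + d * (LINT x|N n. cnj (w n x) * iexp (s * X n x))" for n
      unfolding that(1) distrib_right mult.assoc
      using Bochner_Integration.integral_add[OF integrable_mult_right[OF int] integrable_mult_right[OF int_cnj], of n c s d s]
      by (simp only: integral_mult_right_zero)
    moreover have "(\<lambda>n. c * (LINT x|N n. w n x * iexp (s * X n x)) + d * (LINT x|N n. cnj (w n x) * iexp (s * X n x))) \<longlonglongrightarrow>
        c * (m * char \<nu> s) + d * (cnj m * char \<nu> s)" by (intro tendsto_intros char lim_cnj)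
    ultimately show ?thesis unfolding that(2) by (simp only: distrib_right mult.assoc)
  qed
  have "(\<lambda>n. LINT x|N n. Re (w n x) * g (X n x)) \<longlonglongrightarrow> Re m * (LINT x|\<nu>. g x)"
    by (rule real[OF _ _ lin[of _ "1/2" "1/2"]]) (auto simp: complex_eq_iff intro: order_trans[OF abs_Re_le_cmod wC])
  moreover have "(\<lambda>n. LINT x|N n. Im (w n x) * g (X n x)) \<longlonglongrightarrow> Im m * (LINT x|\<nu>. g x)"
    by (rule real[OF _ _ lin[of _ "- \<i> / 2" "\<i> / 2"]]) (auto simp: complex_eq_iff intro: order_trans[OF abs_Im_le_cmod wC])
  moreover have wg: "integrable (N n) (\<lambda>x. w n x * of_real (g (X n x)))" for n
    by (rule N.integrable_bounded_mult[where B=C and C=B]) (use wC g in auto)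
  ultimately show ?thesis
    by (simp add: tendsto_complex_iff integral_Re[symmetric, OF wg] integral_Im[symmetric, OF wg] del: integral_Re integral_Im)
qed

text \<open>The weighted continuity theorem is applied twice. With weight
  \<open>iexp (s * X n x)\<close> it replaces the character in Y by \<open>h\<close>; the result,
  read with the roles exchanged, is its hypothesis for the weight \<open>h (Y n x)\<close>, and then
  the character in X is replaced by \<open>g\<close>.\<close>

lemma product_limit_if_char_limit:
  fixes X Y :: "nat \<Rightarrow> 'a \<Rightarrow> real" and g h :: "real \<Rightarrow> real"
  assumes N: "\<And>n. prob_space (N n)" and X: "\<And>n. X n \<in> borel_measurable (N n)"
    and Y: "\<And>n. Y n \<in> borel_measurable (N n)"
    and \<alpha>: "real_distribution \<alpha>" and \<beta>: "real_distribution \<beta>"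
    and char: "\<And>s r. (\<lambda>n. LINT x|N n. iexp (s * X n x + r * Y n x)) \<longlonglongrightarrow> char \<alpha> s * char \<beta> r"
    and g: "\<And>x. isCont g x" "\<And>x. \<bar>g x\<bar> \<le> B" and h: "\<And>x. isCont h x" "\<And>x. \<bar>h x\<bar> \<le> C"
  shows "(\<lambda>n. LINT x|N n. g (X n x) * h (Y n x)) \<longlonglongrightarrow> (LINT x|\<alpha>. g x) * (LINT x|\<beta>. h x)"
proof -
  note [measurable] = X Y
  have [measurable]: "h \<in> borel_measurable borel"
    using h(1) by (intro borel_measurable_continuous_onI continuous_at_imp_continuous_on) auto
  interpret A: real_distribution \<alpha> by fact
  interpret B: real_distribution \<beta> by fact
  have e: "iexp (s * x + r * y) = iexp (s * x) * iexp (r * y)" for s x r y by (simp add: distrib_left exp_add)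
  have cX: "(\<lambda>n. LINT x|N n. iexp (s * X n x)) \<longlonglongrightarrow> char \<alpha> s" and cY: "(\<lambda>n. LINT x|N n. iexp (s * Y n x)) \<longlonglongrightarrow> char \<beta> s" for s
    using char[of s 0] char[of 0 s] by (simp_all add: A.char_zero B.char_zero)
  have hX: "(\<lambda>n. LINT x|N n. iexp (s * X n x) * of_real (h (Y n x))) \<longlonglongrightarrow> char \<alpha> s * of_real (LINT x|\<beta>. h x)" for s
    by (rule complex_weighted_Levy_continuity[OF N Y _ _ \<beta> cY char[of s, unfolded e] h(1), where C=1 and B=C]) (use h(2) in auto)
  then have "(\<lambda>n. LINT x|N n. of_real (h (Y n x)) * iexp (s * X n x)) \<longlonglongrightarrow> of_real (LINT x|\<beta>. h x) * char \<alpha> s" for s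
    by (simp only: mult.commute)
  from complex_weighted_Levy_continuity[OF N X _ _ \<alpha> cX this g(1), of C B] g(2) h(2)
  have "(\<lambda>n. complex_of_real (LINT x|N n. h (Y n x) * g (X n x))) \<longlonglongrightarrow> of_real ((LINT x|\<beta>. h x) * (LINT x|\<alpha>. g x))"
    by (simp flip: of_real_mult)
  then show ?thesis by (simp only: tendsto_of_real_iff mult.commute)
qed

section \<open>Weak convergence of pairs, tested on sums of products\<close>

inductive tensor :: "(real \<times> real \<Rightarrow> real) \<Rightarrow> bool" where
  base: "\<lbrakk>\<And>x. isCont g x; \<And>x. isCont h x; \<And>x. \<bar>g x\<bar> \<le> B; \<And>x. \<bar>h x\<bar> \<le> C\<rbrakk>
    \<Longrightarrow> tensor (\<lambda>p. g (fst p) * h (snd p))"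
| add: "\<lbrakk>tensor F; tensor G\<rbrakk> \<Longrightarrow> tensor (\<lambda>p. F p + G p)"

text \<open>Closure under products makes the class an algebra. It is the algebraic tensor product of
  the bounded continuous functions on the line with themselves, a scalar being absorbed into a
  factor.\<close>

lemma tensor_mult:
  assumes "tensor F" "tensor G"
  shows "tensor (\<lambda>p. F p * G p)"
  using assms(1)
proof induction
  case F: (base g h B C)
  show ?case using assms(2)
  proof induction
    case G: (base g' h' B' C')
    have "tensor (\<lambda>p. (\<lambda>x. g x * g' x) (fst p) * (\<lambda>y. h y * h' y) (snd p))"
    proof (rule tensor.base[where B="B*B'" and C="C*C'"])
      show "\<bar>g x * g' x\<bar> \<le> B * B'" "\<bar>h x * h' x\<bar> \<le> C * C'" for x
        unfolding abs_mult using F(3)[of 0] F(4)[of 0]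
        by (intro mult_mono F(3,4) G(3,4) abs_ge_zero; simp)+
    qed (use F G in \<open>auto intro!: continuous_intros\<close>)
    then show ?case by (simp add: mult_ac)
  next
    case (add F' G')
    then show ?case by (simp add: distrib_left tensor.add)
  qed
next
  case (add F' G')
  then show ?case by (simp add: distrib_right tensor.add)
qed

text \<open>Clamping both coordinates to \<open>[-R, R]\<close> makes a polynomial bounded and, for
  \<open>R \<ge> 0\<close>, leaves it unchanged on the square, so that it becomes a test function on
  the whole plane.\<close>

lemma tensor_clamped_polynomial:
  fixes p :: "real \<times> real \<Rightarrow> real" and R :: real
  assumes "real_polynomial_function p"
  defines "cl \<equiv> \<lambda>x::real. max (-R) (min R x)"
  shows "tensor (\<lambda>q. p (cl (fst q), cl (snd q)))"
  using assms(1)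
proof induction
  case (linear f)
  have cont: "isCont cl x" for x unfolding cl_def by (intro continuous_intros)
  have bd: "\<bar>c * cl x\<bar> \<le> \<bar>c\<bar> * \<bar>R\<bar>" for x c unfolding abs_mult cl_def by (intro mult_left_mono) auto
  have f_eq: "f q = f (1,0) * fst q + f (0,1) * snd q" for q
  proof -
    interpret bounded_linear f by fact
    have "f q = f (fst q *\<^sub>R (1,0) + snd q *\<^sub>R (0,1))" by simp
    then show ?thesis by (simp only: add scaleR real_scaleR_def mult.commute)
  qed
  have eq: "(\<lambda>q. f (cl (fst q), cl (snd q))) =
      (\<lambda>q. (\<lambda>x. f (1,0) * cl x) (fst q) * (\<lambda>_. 1) (snd q) + (\<lambda>_. 1) (fst q) * (\<lambda>y. f (0,1) * cl y) (snd q))"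
  proof (intro ext)
    fix q
    from f_eq[of "(cl (fst q), cl (snd q))"]
    show "f (cl (fst q), cl (snd q)) = (\<lambda>x. f (1,0) * cl x) (fst q) * (\<lambda>_. 1) (snd q) + (\<lambda>_. 1) (fst q) * (\<lambda>y. f (0,1) * cl y) (snd q)"
      by simp
  qed
  show ?case unfolding eq
  proof (rule tensor.add)
    show "tensor (\<lambda>q. (\<lambda>x. f (1,0) * cl x) (fst q) * (\<lambda>_. 1) (snd q))"
      by (rule tensor.base[where B="\<bar>f (1,0)\<bar> * \<bar>R\<bar>" and C=1]) (use bd cont in \<open>auto intro!: continuous_intros\<close>)
    show "tensor (\<lambda>q. (\<lambda>_. 1) (fst q) * (\<lambda>y. f (0,1) * cl y) (snd q))"
      by (rule tensor.base[where C="\<bar>f (0,1)\<bar> * \<bar>R\<bar>" and B=1]) (use bd cont in \<open>auto intro!: continuous_intros\<close>)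
  qed
next
  case (const c)
  have "tensor (\<lambda>q. (\<lambda>_. c) (fst q) * (\<lambda>_. 1) (snd q))"
    by (rule tensor.base[where B="\<bar>c\<bar>" and C=1]) auto
  then show ?case by simp
next
  case (add f g)
  then show ?case by (intro tensor.add)
next
  case (mult f g)
  then show ?case by (intro tensor_mult)
qed

text \<open>The integrand is a continuous substitute for the indicator of the tail: it vanishes up
  to \<open>R'\<close> and equals 1 beyond \<open>R' + 1\<close>, so its integral passes through
  limits in law.\<close>

lemma (in real_distribution) small_tail:
  assumes "\<delta> > 0"
  obtains R where "R \<ge> 0" "\<And>R'. R' \<ge> R \<Longrightarrow> (LINT x|M. max 0 (min 1 (\<bar>x\<bar> - R'))) < \<delta>"
proof -
  define k :: "real \<Rightarrow> real \<Rightarrow> real" where "k R x = max 0 (min 1 (\<bar>x\<bar> - R))" for R x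
  have lim: "(\<lambda>i. k (real i) x) \<longlonglongrightarrow> 0" for x
  proof (rule tendsto_eventually)
    show "\<forall>\<^sub>F i in sequentially. k (real i) x = 0" using eventually_ge_at_top[of "nat \<lceil>\<bar>x\<bar>\<rceil>"]
    proof eventually_elim
      case (elim i)
      then have "\<bar>x\<bar> \<le> real i" by linarith
      then show ?case by (simp add: k_def)
    qed
  qed
  have "(\<lambda>i. LINT x|M. k (real i) x) \<longlonglongrightarrow> (LINT x|M. 0)"
    by (rule integral_dominated_convergence[where w="\<lambda>_. 1"]) (use lim in \<open>auto simp: k_def[abs_def]\<close>)
  then have "\<forall>\<^sub>F i in sequentially. (LINT x|M. k (real i) x) < \<delta>"
    using assms by (intro order_tendstoD) auto
  then obtain i where i: "(LINT x|M. k (real i) x) < \<delta>" by (auto simp: eventually_sequentially)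
  have int: "integrable M (k R)" for R
    by (rule integrable_bounded[where B=1]) (auto simp: k_def[abs_def])
  show thesis
  proof (rule that[of "real i"])
    fix R' assume "real i \<le> R'"
    then have "(LINT x|M. k R' x) \<le> (LINT x|M. k (real i) x)"
      by (intro integral_mono int) (auto simp: k_def)
    with i show "(LINT x|M. max 0 (min 1 (\<bar>x\<bar> - R'))) < \<delta>" by (simp add: k_def)
  qed simp
qed

text \<open>On a large square a continuous function is uniformly close to a polynomial by the
  Stone-Weierstrass theorem, and a clamped polynomial is a sum of products, for which the limit is
  known. Outside the square the tails of the two marginals control the error.\<close>

lemma weakly_tends_pair:
  fixes X Y :: "nat \<Rightarrow> 'a \<Rightarrow> real"
  assumes N: "\<And>n. prob_space (N n)" and X: "\<And>n. X n \<in> borel_measurable (N n)"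
    and Y: "\<And>n. Y n \<in> borel_measurable (N n)"
    and Q: "prob_space Q" and indep: "prob_space.indep_var Q borel A borel B"
    and char: "\<And>s r. (\<lambda>n. LINT x|N n. iexp (s * X n x + r * Y n x))
      \<longlonglongrightarrow> char (distr Q borel A) s * char (distr Q borel B) r"
  shows "weakly_tends (\<lambda>n. distr (N n) borel (\<lambda>x. (X n x, Y n x))) (distr Q borel (\<lambda>y. (A y, B y))) sequentially"
proof -
  note [measurable] = X Y
  interpret Q: prob_space Q by fact
  interpret N: prob_space "N n" for n by fact
  have [measurable]: "A \<in> borel_measurable Q" "B \<in> borel_measurable Q"
    using Q.indep_var_rv1[OF indep] Q.indep_var_rv2[OF indep] by auto
  define \<alpha> \<beta> where "\<alpha> = distr Q borel A" and "\<beta> = distr Q borel B"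
  interpret A: real_distribution \<alpha> unfolding \<alpha>_def by (rule Q.real_distribution_distr) simp
  interpret B: real_distribution \<beta> unfolding \<beta>_def by (rule Q.real_distribution_distr) simp
  have prod_lim: "(\<lambda>n. LINT x|N n. g (X n x) * h (Y n x)) \<longlonglongrightarrow> (LINT x|\<alpha>. g x) * (LINT x|\<beta>. h x)"
    if "\<And>x. isCont g x" "\<And>x. \<bar>g x\<bar> \<le> b" "\<And>x. isCont h x" "\<And>x. \<bar>h x\<bar> \<le> c" for g h :: "real \<Rightarrow> real" and b c
    by (rule product_limit_if_char_limit[OF N X Y A.real_distribution_axioms B.real_distribution_axioms
          char[folded \<alpha>_def \<beta>_def] that])
  have tensor_lim: "(\<lambda>n. LINT x|N n. G (X n x, Y n x)) \<longlonglongrightarrow> (LINT y|Q. G (A y, B y)) \<and>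
      G \<in> borel_measurable borel \<and> (\<exists>b. \<forall>p. \<bar>G p\<bar> \<le> b)" if "tensor G" for G using that
  proof induction
    case (base g h b c)
    have meas [measurable]: "g \<in> borel_measurable borel" "h \<in> borel_measurable borel"
      using base by (auto intro!: borel_measurable_continuous_onI continuous_at_imp_continuous_on)
    have "Q.indep_var borel (g \<circ> A) borel (h \<circ> B)" by (rule Q.indep_var_compose[OF indep]) auto
    then have "(LINT y|Q. (g \<circ> A) y * (h \<circ> B) y) = (LINT y|Q. (g \<circ> A) y) * (LINT y|Q. (h \<circ> B) y)"
      by (rule Q.indep_var_lebesgue_integral)
         (use base Q.integrable_bounded[of "g \<circ> A" b] Q.integrable_bounded[of "h \<circ> B" c] in auto)
    then have "(LINT y|Q. g (A y) * h (B y)) = (LINT x|\<alpha>. g x) * (LINT x|\<beta>. h x)"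
      by (simp add: \<alpha>_def \<beta>_def integral_distr)
    moreover have "\<forall>p. \<bar>g (fst p) * h (snd p)\<bar> \<le> b * c"
      unfolding abs_mult using base(3)[of 0] by (intro allI mult_mono base) auto
    ultimately show ?case
      using prod_lim[OF base(1,3,2,4)] by (intro conjI exI[of _ "b * c"]) (auto simp: borel_prod[symmetric])
  next
    case (add F G)
    then obtain b c where b: "\<And>p. \<bar>F p\<bar> \<le> b" "\<And>p. \<bar>G p\<bar> \<le> c"
      and [measurable]: "F \<in> borel_measurable borel" "G \<in> borel_measurable borel" by auto
    have "\<bar>F p + G p\<bar> \<le> b + c" for p using b(1)[of p] b(2)[of p] by linarith
    moreover have "integrable (N n) (\<lambda>x. F (X n x, Y n x))" "integrable (N n) (\<lambda>x. G (X n x, Y n x))"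
      "integrable Q (\<lambda>x. F (A x, B x))" "integrable Q (\<lambda>x. G (A x, B x))" for n
      using b by (auto intro!: N.integrable_bounded Q.integrable_bounded)
    ultimately show ?case using add by (auto intro!: tendsto_intros)
  qed
  show ?thesis unfolding weakly_tends_def
  proof (intro allI impI, elim conjE)
    fix f :: "real \<times> real \<Rightarrow> real"
    assume f: "continuous_on UNIV f" "bounded (range f)"
    have [measurable]: "f \<in> borel_measurable borel"
      using f(1) by (rule borel_measurable_continuous_onI)
    obtain b where b: "b > 0" "\<And>p. \<bar>f p\<bar> \<le> b" using f(2) by (auto simp: bounded_pos)
    have "(\<lambda>n. LINT x|N n. f (X n x, Y n x)) \<longlonglongrightarrow> (LINT y|Q. f (A y, B y))"
    proof (rule tendstoI)
      fix e :: real assume "e > 0"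
      \<comment> \<open>Replacing \<open>f\<close> by \<open>G\<close> costs at most
        \<open>\<epsilon> + 2 * b * (2 * \<delta>) = 2 * \<epsilon>\<close> for the sequence and as
        much for the limit, and the convergence for \<open>G\<close> costs another
        \<open>\<epsilon>\<close>: five eighths of e in all.\<close>
      define \<epsilon> \<delta> where "\<epsilon> = e / 8" and "\<delta> = e / (32 * b)"
      have \<epsilon>: "\<epsilon> > 0" "\<delta> > 0" using \<open>e > 0\<close> b by (auto simp: \<epsilon>_def \<delta>_def)
      obtain R1 where R1: "R1 \<ge> 0" "\<And>R'. R' \<ge> R1 \<Longrightarrow> (LINT x|\<alpha>. max 0 (min 1 (\<bar>x\<bar> - R'))) < \<delta>"
        using A.small_tail[OF \<epsilon>(2)] by blast
      obtain R2 where R2: "R2 \<ge> 0" "\<And>R'. R' \<ge> R2 \<Longrightarrow> (LINT x|\<beta>. max 0 (min 1 (\<bar>x\<bar> - R'))) < \<delta>"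
        using B.small_tail[OF \<epsilon>(2)] by blast
      define R where "R = max R1 R2"
      define k :: "real \<Rightarrow> real" where "k x = max 0 (min 1 (\<bar>x\<bar> - R))" for x
      have k: "isCont k x" "\<bar>k x\<bar> \<le> 1" "0 \<le> k x" for x
        unfolding k_def by (auto intro!: continuous_intros)
      have [measurable]: "k \<in> borel_measurable borel" unfolding k_def by measurable
      have k_small: "(LINT y|Q. k (A y)) < \<delta>" "(LINT y|Q. k (B y)) < \<delta>"
        using R1(2)[of R] R2(2)[of R] by (simp_all add: \<alpha>_def \<beta>_def integral_distr k_def[abs_def] R_def)
      have k_lim: "(\<lambda>n. LINT x|N n. k (X n x)) \<longlonglongrightarrow> (LINT y|Q. k (A y))" "(\<lambda>n. LINT x|N n. k (Y n x)) \<longlonglongrightarrow> (LINT y|Q. k (B y))"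
        using prod_lim[of k 1 "\<lambda>_. 1" 1] prod_lim[of "\<lambda>_. 1" 1 k 1] k B.prob_space A.prob_space
        by (simp_all add: \<alpha>_def \<beta>_def integral_distr)
      define cl where "cl x = max (-(R+1)) (min (R+1) x)" for x :: real
      \<comment> \<open>The radius is crude: the norm of a pair is at most the sum of the absolute
        values, so the ball contains the clamped square.\<close>
      obtain p where p: "real_polynomial_function p" "\<And>x. x \<in> cball 0 (2 * (R + 1)) \<Longrightarrow> \<bar>f x - p x\<bar> < \<epsilon>"
        using Stone_Weierstrass_real_polynomial_function[of "cball 0 (2 * (R + 1))" f \<epsilon>] continuous_on_subset[OF f(1)] \<epsilon>
        by auto
      define G where "G q = p (cl (fst q), cl (snd q))" for q
      have "tensor G" unfolding G_def cl_def by (rule tensor_clamped_polynomial[OF p(1)])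
      from tensor_lim[OF this] obtain c where G: "(\<lambda>n. LINT x|N n. G (X n x, Y n x)) \<longlonglongrightarrow> (LINT y|Q. G (A y, B y))"
        and [measurable]: "G \<in> borel_measurable borel" and c: "\<And>p. \<bar>G p\<bar> \<le> c"
        by auto
      have R0: "R \<ge> 0" using R1 by (simp add: R_def)
      have diff: "\<bar>f (x, y) - G (x, y)\<bar> \<le> \<epsilon> + 2 * b * (k x + k y)" for x y
      proof -
        have "norm (cl x, cl y) \<le> \<bar>cl x\<bar> + \<bar>cl y\<bar>" using norm_Pair_le[of "cl x" "cl y"] by simp
        also have "\<dots> \<le> 2 * (R + 1)" using R0 by (auto simp: cl_def)
        finally have "\<bar>f (cl x, cl y) - G (x, y)\<bar> \<le> \<epsilon>"
          using p(2)[of "(cl x, cl y)"] by (simp add: G_def less_imp_le)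
        moreover have "\<bar>f (x, y) - f (cl x, cl y)\<bar> \<le> 2 * b * (k x + k y)"
        proof (cases "\<bar>x\<bar> \<le> R + 1 \<and> \<bar>y\<bar> \<le> R + 1")
          case True
          then have "cl x = x" "cl y = y" by (auto simp: cl_def)
          then show ?thesis using k b by simp
        next
          case False
          \<comment> \<open>One coordinate lies beyond \<open>R + 1\<close>, where \<open>k\<close>
            is 1, and \<open>2 * b\<close> bounds the difference of any two values of
            \<open>f\<close>.\<close>
          then have "1 \<le> k x + k y" using k(3)[of x] k(3)[of y] by (auto simp: k_def)
          then have "2 * b * 1 \<le> 2 * b * (k x + k y)" using b by (intro mult_left_mono) auto
          then show ?thesis using b(2)[of "(x, y)"] b(2)[of "(cl x, cl y)"] by linarith
        qed
        ultimately show ?thesis by linarith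
      qed
      have close: "\<bar>(LINT x|P. f (U x, V x)) - (LINT x|P. G (U x, V x))\<bar> \<le> \<epsilon> + 2 * b * ((LINT x|P. k (U x)) + (LINT x|P. k (V x)))"
        if P: "prob_space P" and [measurable]: "U \<in> borel_measurable P" "V \<in> borel_measurable P" for P :: "'z measure" and U V
      proof -
        interpret P: prob_space P by fact
        have i: "integrable P (\<lambda>x. f (U x, V x))" "integrable P (\<lambda>x. G (U x, V x))"
            "integrable P (\<lambda>x. k (U x))" "integrable P (\<lambda>x. k (V x))"
          using b c k by (auto intro!: P.integrable_bounded)
        have "\<bar>(LINT x|P. f (U x, V x)) - (LINT x|P. G (U x, V x))\<bar> = \<bar>\<integral>x. f (U x, V x) - G (U x, V x) \<partial>P\<bar>"
          using i by simp
        also have "\<dots> \<le> (LINT x|P. \<bar>f (U x, V x) - G (U x, V x)\<bar>)" by (rule integral_abs_bound)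
        also have "\<dots> \<le> (LINT x|P. \<epsilon> + 2 * b * (k (U x) + k (V x)))"
          using i diff by (intro integral_mono) auto
        also have "\<dots> = \<epsilon> + 2 * b * ((LINT x|P. k (U x)) + (LINT x|P. k (V x)))"
          using i by (simp add: P.prob_space)
        finally show ?thesis .
      qed
      have bd: "\<epsilon> + 2 * b * (x + y) \<le> 2 * \<epsilon>" if "x < \<delta>" "y < \<delta>" for x y
      proof -
        have "2 * b * (x + y) \<le> 2 * b * (2 * \<delta>)" using that b by (intro mult_left_mono) auto
        also have "\<dots> = \<epsilon>" using b by (simp add: \<epsilon>_def \<delta>_def)
        finally show ?thesis by simp
      qed
      have "\<forall>\<^sub>F n in sequentially. (LINT x|N n. k (X n x)) < \<delta>" "\<forall>\<^sub>F n in sequentially. (LINT x|N n. k (Y n x)) < \<delta>"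
        using order_tendstoD(2)[OF k_lim(1) k_small(1)] order_tendstoD(2)[OF k_lim(2) k_small(2)] by auto
      moreover have "\<forall>\<^sub>F n in sequentially. dist (LINT x|N n. G (X n x, Y n x)) (LINT y|Q. G (A y, B y)) < \<epsilon>"
        using G \<epsilon> by (auto simp: tendsto_iff)
      ultimately show "\<forall>\<^sub>F n in sequentially. dist (LINT x|N n. f (X n x, Y n x)) (LINT y|Q. f (A y, B y)) < e"
      proof eventually_elim
        case (elim n)
        have 1: "\<bar>(LINT x|N n. f (X n x, Y n x)) - (LINT x|N n. G (X n x, Y n x))\<bar> \<le> 2 * \<epsilon>"
          using close[OF N X Y, of n] bd[OF elim(1,2)] by linarith
        have 2: "\<bar>(LINT x|Q. f (A x, B x)) - (LINT x|Q. G (A x, B x))\<bar> \<le> 2 * \<epsilon>"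
          using close[OF Q, of A B] bd[OF k_small] by simp
        have "8 * \<epsilon> = e" "\<epsilon> > 0" using \<epsilon> by (auto simp: \<epsilon>_def)
        with 1 2 elim(3) show ?case unfolding dist_real_def by linarith
      qed
    qed
    then show "(\<lambda>n. \<integral>x. f x \<partial>distr (N n) borel (\<lambda>x. (X n x, Y n x))) \<longlonglongrightarrow> (\<integral>x. f x \<partial>distr Q borel (\<lambda>y. (A y, B y)))"
      by (simp add: integral_distr)
  qed
qed

section \<open>Products over i.i.d. observations\<close>

lemma power_tendsto_exp_real:
  fixes a :: "nat \<Rightarrow> real"
  assumes "(\<lambda>n. real n * (a n - 1)) \<longlonglongrightarrow> \<beta>"
  shows "(\<lambda>n. a n ^ n) \<longlonglongrightarrow> exp \<beta>"
proof -
  have "(\<lambda>n. complex_of_real (real n * (a n - 1))) \<longlonglongrightarrow> of_real \<beta>"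
    using assms by (rule tendsto_of_real)
  then have "(\<lambda>n. complex_of_real (a n) ^ n) \<longlonglongrightarrow> exp (of_real \<beta>)" by (intro power_tendsto_exp) simp
  then have "(\<lambda>n. complex_of_real (a n ^ n)) \<longlonglongrightarrow> of_real (exp \<beta>)" by (simp add: exp_of_real)
  then show ?thesis by (simp only: tendsto_of_real_iff)
qed

lemma integrable_mult_square:
  fixes f g :: "'a \<Rightarrow> 'b::{real_normed_div_algebra, banach, second_countable_topology}"
  assumes [measurable]: "f \<in> borel_measurable M" "g \<in> borel_measurable M"
    and "integrable M (\<lambda>x. (norm (f x))^2)" "integrable M (\<lambda>x. (norm (g x))^2)"
  shows "integrable M (\<lambda>x. f x * g x)"
proof (rule Bochner_Integration.integrable_bound)
  show "integrable M (\<lambda>x. (norm (f x))^2 + (norm (g x))^2)" using assms by simp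
  have "norm (f x * g x) \<le> (norm (f x))^2 + (norm (g x))^2" for x
  proof -
    have "0 \<le> norm (f x) * norm (g x)" by simp
    then show ?thesis
      using sum_squares_bound[of "norm (f x)" "norm (g x)"] unfolding norm_mult by linarith
  qed
  then show "AE x in M. norm (f x * g x) \<le> norm ((norm (f x))^2 + (norm (g x))^2)"
    by (intro AE_I2) (simp add: abs_of_nonneg)
qed measurable

lemma integral_Cauchy_Schwarz:
  fixes f g :: "'a \<Rightarrow> real"
  assumes [measurable]: "f \<in> borel_measurable M" "g \<in> borel_measurable M"
    and f: "integrable M (\<lambda>x. (f x)^2)" and g: "integrable M (\<lambda>x. (g x)^2)"
  shows "(LINT x|M. f x * g x)^2 \<le> (LINT x|M. (f x)^2) * (LINT x|M. (g x)^2)"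
proof -
  define A B C where "A = (LINT x|M. (f x)^2)" and "B = (LINT x|M. (g x)^2)" and "C = (LINT x|M. f x * g x)"
  have fg: "integrable M (\<lambda>x. f x * g x)" using f g by (intro integrable_mult_square) auto
  have pos: "0 \<le> a\<^sup>2 * A + 2 * a * b * C + b^2 * B" for a b
  proof -
    have "0 \<le> (LINT x|M. (a * f x + b * g x)^2)" by simp
    also have "\<dots> = (LINT x|M. a\<^sup>2 * (f x)^2 + 2 * a * b * (f x * g x) + b^2 * (g x)^2)"
      by (intro Bochner_Integration.integral_cong) (auto simp: power2_eq_square algebra_simps)
    also have "\<dots> = a^2 * A + 2 * a * b * C + b^2 * B" using f g fg by (simp add: A_def B_def C_def)
    finally show ?thesis .
  qed
  have A: "A \<ge> 0" by (simp add: A_def)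
  show ?thesis
  proof (cases "A = 0")
    case True
    have "C = 0"
    proof (rule ccontr)
      assume "C \<noteq> 0"
      \<comment> \<open>For A = 0 the form is affine in a, and at this point its value is
        -1.\<close>
      then show False using pos[of "- (B + 1) / (2 * C)" 1] True by (simp add: field_simps)
    qed
    then show ?thesis using True by (simp add: A_def B_def C_def)
  next
    case False
    have "0 \<le> A * (A * B - C\<^sup>2)" using pos[of "- C" A] by (simp add: power2_eq_square algebra_simps)
    with False A have "0 \<le> A * B - C\<^sup>2" by (simp add: zero_le_mult_iff)
    then show ?thesis by (simp add: A_def B_def C_def)
  qed
qed

lemma integral_norm_mult_le:
  fixes f g :: "'a \<Rightarrow> 'b::{real_normed_div_algebra, banach, second_countable_topology}"
  assumes [measurable]: "f \<in> borel_measurable M" "g \<in> borel_measurable M"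
    and f: "integrable M (\<lambda>x. (norm (f x))^2)" and g: "integrable M (\<lambda>x. (norm (g x))^2)"
  shows "(LINT x|M. norm (f x * g x)) \<le> sqrt (LINT x|M. (norm (f x))^2) * sqrt (LINT x|M. (norm (g x))^2)"
  unfolding real_sqrt_mult[symmetric] norm_mult
  using integral_Cauchy_Schwarz[of "\<lambda>x. norm (f x)" M "\<lambda>x. norm (g x)"] f g
  by (intro real_le_rsqrt) simp

lemma prob_space_iid: "prob_space F \<Longrightarrow> prob_space (iid F)"
  unfolding iid_def by (intro prob_space_PiM)

lemma measurable_iid_component:
  assumes [measurable]: "a \<in> measurable F N"
  shows "(\<lambda>zs. a (zs j)) \<in> measurable (iid F) N"
  unfolding iid_def by measurable

lemma distr_iid_restrict:
  assumes "prob_space F"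
  shows "distr (iid F) (PiM {..<n} (\<lambda>_. F)) (\<lambda>zs. restrict zs {..<n}) = PiM {..<n} (\<lambda>_. F)"
proof -
  interpret product_prob_space "\<lambda>_. F" UNIV
    by (rule product_prob_spaceI) (rule assms)
  show ?thesis unfolding iid_def by (rule distr_PiM_restrict_finite) auto
qed

lemma measurable_iid_restrict [measurable]:
  "(\<lambda>zs. restrict zs {..<n}) \<in> measurable (iid F) (PiM {..<n} (\<lambda>_. F))"
  unfolding iid_def by (rule measurable_restrict_subset) auto

lemma
  fixes a :: "nat \<Rightarrow> 'x \<times> 't \<Rightarrow> 'b::{real_normed_field, banach, second_countable_topology}"
  assumes F: "prob_space F" and a: "\<And>j. j < n \<Longrightarrow> integrable F (a j)"
  shows integrable_iid_prod': "integrable (iid F) (\<lambda>zs. \<Prod>j<n. a j (zs j))"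
    and integral_iid_prod': "(LINT zs|iid F. (\<Prod>j<n. a j (zs j))) = (\<Prod>j<n. LINT z|F. a j z)"
proof -
  interpret F: prob_space F by fact
  interpret product_sigma_finite "\<lambda>_. F" by standard
  have meas: "(\<lambda>x. \<Prod>j<n. a j (x j)) \<in> borel_measurable (PiM {..<n} (\<lambda>_. F))"
    using a by (intro borel_measurable_prod) (auto intro!: measurable_compose[OF measurable_component_singleton])
  have "integrable (PiM {..<n} (\<lambda>_. F)) (\<lambda>x. \<Prod>j<n. a j (x j))"
    using a by (intro product_integrable_prod) auto
  then have "integrable (iid F) (\<lambda>zs. \<Prod>j<n. a j (restrict zs {..<n} j))"
    by (subst (asm) distr_iid_restrict[OF F, symmetric]) (rule integrable_distr[OF measurable_iid_restrict])
  then show "integrable (iid F) (\<lambda>zs. \<Prod>j<n. a j (zs j))" by simp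
  have "(LINT zs|iid F. (\<Prod>j<n. a j (zs j))) = (LINT zs|iid F. (\<Prod>j<n. a j (restrict zs {..<n} j)))"
    by simp
  also have "\<dots> = (\<integral>x. (\<Prod>j<n. a j (x j)) \<partial>distr (iid F) (PiM {..<n} (\<lambda>_. F)) (\<lambda>zs. restrict zs {..<n}))"
    by (rule integral_distr[symmetric, OF measurable_iid_restrict meas])
  also have "\<dots> = (\<integral>x. (\<Prod>j<n. a j (x j)) \<partial>PiM {..<n} (\<lambda>_. F))"
    by (simp only: distr_iid_restrict[OF F])
  also have "\<dots> = (\<Prod>j<n. LINT z|F. a j z)" using a by (intro product_integral_prod) auto
  finally show "(LINT zs|iid F. (\<Prod>j<n. a j (zs j))) = (\<Prod>j<n. LINT z|F. a j z)" .
qed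

lemma
  fixes a :: "'x \<times> 't \<Rightarrow> 'b::{real_normed_field, banach, second_countable_topology}"
  assumes "prob_space F" "integrable F a"
  shows integrable_iid_prod: "integrable (iid F) (\<lambda>zs. \<Prod>j<n. a (zs j))"
    and integral_iid_prod: "(LINT zs|iid F. (\<Prod>j<n. a (zs j))) = (LINT z|F. a z) ^ n"
  using integrable_iid_prod'[of F n "\<lambda>_. a"] integral_iid_prod'[of F n "\<lambda>_. a"] assms by simp_all

text \<open>The expanded square consists of three products over independent coordinates, and the
  expectation of each is an nth power.\<close>

lemma integral_iid_prod_diff:
  fixes a b :: "'x \<times> 't \<Rightarrow> complex"
  assumes F: "prob_space F" and [measurable]: "a \<in> borel_measurable F" "b \<in> borel_measurable F"
    and a: "integrable F (\<lambda>z. (norm (a z))^2)" and b: "integrable F (\<lambda>z. (norm (b z))^2)"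
  shows "integrable (iid F) (\<lambda>zs. (norm ((\<Prod>j<n. a (zs j)) - c * (\<Prod>j<n. b (zs j))))^2)" (is ?th1)
    and "(LINT zs|iid F. (norm ((\<Prod>j<n. a (zs j)) - c * (\<Prod>j<n. b (zs j))))^2) =
      (LINT z|F. (norm (a z))^2) ^ n + (norm c)^2 * (LINT z|F. (norm (b z))^2) ^ n
      - 2 * Re (cnj c * (LINT z|F. a z * cnj (b z)) ^ n)" (is ?th2)
proof -
  have ab: "integrable F (\<lambda>z. a z * cnj (b z))" using a b by (intro integrable_mult_square) auto
  have eq: "(norm ((\<Prod>j<n. a (zs j)) - c * (\<Prod>j<n. b (zs j))))^2 =
      (\<Prod>j<n. (norm (a (zs j)))^2) + (norm c)^2 * (\<Prod>j<n. (norm (b (zs j)))^2)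
      - 2 * Re (cnj c * (\<Prod>j<n. a (zs j) * cnj (b (zs j))))" for zs
  proof -
    have *: "(norm (x - c * y))^2 = (norm x)^2 + (norm c)^2 * (norm y)^2 - 2 * Re (cnj c * (x * cnj y))" for x y :: complex
    proof -
      have "(norm (x - c * y))^2 = (norm x)^2 + (norm (c * y))^2 - 2 * Re (cnj c * (x * cnj y))"
        unfolding cmod_power2 by (simp add: power2_eq_square algebra_simps)
      then show ?thesis by (simp add: norm_mult power_mult_distrib)
    qed
    show ?thesis unfolding * by (simp add: prod_norm[symmetric] prod_power_distrib prod.distrib)
  qed
  note i = integrable_iid_prod[OF F a, of n] integrable_iid_prod[OF F b, of n] integrable_iid_prod[OF F ab, of n]
  show ?th1
    unfolding eq using i by (intro Bochner_Integration.integrable_diff Bochner_Integration.integrable_add integrable_mult_right integrable_Re) auto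
  have "(LINT zs|iid F. Re (cnj c * (\<Prod>j<n. a (zs j) * cnj (b (zs j))))) = Re (cnj c * (LINT z|F. a z * cnj (b z)) ^ n)"
    using i(3) by (subst integral_Re) (simp_all add: integral_iid_prod[OF F ab])
  moreover have "integrable (iid F) (\<lambda>zs. Re (cnj c * (\<Prod>j<n. a (zs j) * cnj (b (zs j)))))"
    using i(3) by (intro integrable_Re integrable_mult_right) auto
  ultimately show ?th2 unfolding eq using i(1,2)
    by (simp only: Bochner_Integration.integral_diff Bochner_Integration.integral_add Bochner_Integration.integrable_add
          integrable_mult_right integral_mult_right_zero integral_iid_prod[OF F a] integral_iid_prod[OF F b] if_False)
qed

text \<open>With the right \<open>c\<close> the limit is 0. This is how
  \<open>conditional_CLT\<close>, \<open>lik_imaginary\<close>, \<open>lik_perturbation\<close> and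
  \<open>score_LAN\<close> show that two products agree asymptotically in L2; it takes only the
  moments of single factors up to o(1/n).\<close>

lemma iid_prod_approx:
  fixes a b :: "nat \<Rightarrow> 'x \<times> 't \<Rightarrow> complex"
  assumes N: "\<And>n. prob_space (N n)" and "\<And>n. a n \<in> borel_measurable (N n)" "\<And>n. b n \<in> borel_measurable (N n)"
    and "\<And>n. integrable (N n) (\<lambda>z. (norm (a n z))^2)" "\<And>n. integrable (N n) (\<lambda>z. (norm (b n z))^2)"
    and "(\<lambda>n. real n * ((LINT z|N n. (norm (a n z))^2) - 1)) \<longlonglongrightarrow> \<alpha>"
    and "(\<lambda>n. real n * ((LINT z|N n. (norm (b n z))^2) - 1)) \<longlonglongrightarrow> \<beta>"
    and "(\<lambda>n. of_nat n * ((LINT z|N n. a n z * cnj (b n z)) - 1)) \<longlonglongrightarrow> \<zeta>"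
  shows "(\<lambda>n. LINT zs|iid (N n). (norm ((\<Prod>j<n. a n (zs j)) - c * (\<Prod>j<n. b n (zs j))))^2) \<longlonglongrightarrow>
     exp \<alpha> + (norm c)^2 * exp \<beta> - 2 * Re (cnj c * exp \<zeta>)"
  unfolding integral_iid_prod_diff(2)[OF assms(1-5)]
  by (intro tendsto_intros power_tendsto_exp power_tendsto_exp_real assms)

section \<open>The law of the observations\<close>

lemma
  assumes F: "prob_space F" "sets F = sets (MX \<Otimes>\<^sub>M MT)"
  shows measurable_fst_sets: "fst \<in> measurable F MX"
    and prob_space_marginal: "prob_space (marginal_X MX F)"
    and sets_marginal: "sets (marginal_X MX F) = sets MX"
    and space_marginal: "space (marginal_X MX F) = space MX"
    and measurable_observed: "observed n \<in> measurable (iid F) (PiM {..<n} (\<lambda>_. MX))"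
proof -
  have [measurable_cong]: "sets F = sets (MX \<Otimes>\<^sub>M MT)" by fact
  show *[measurable]: "fst \<in> measurable F MX" by measurable
  show "prob_space (marginal_X MX F)" "sets (marginal_X MX F) = sets MX" "space (marginal_X MX F) = space MX"
    using F(1) by (auto simp: marginal_X_def intro!: prob_space.prob_space_distr)
  show "observed n \<in> measurable (iid F) (PiM {..<n} (\<lambda>_. MX))"
    unfolding observed_def[abs_def] iid_def by measurable
qed

lemma distr_observed:
  assumes F: "prob_space F" "sets F = sets (MX \<Otimes>\<^sub>M MT)"
  shows "distr (iid F) (PiM {..<n} (\<lambda>_. MX)) (observed n) = PiM {..<n} (\<lambda>_. marginal_X MX F)"
proof -
  note [measurable] = measurable_fst_sets[OF F]
  define M where "M = marginal_X MX F"
  have M: "prob_space M" and sets_M [measurable_cong]: "sets M = sets MX"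
    unfolding M_def using prob_space_marginal[OF F] sets_marginal[OF F] by auto
  have "distr (PiM {..<n} (\<lambda>_. F)) (PiM {..<n} (\<lambda>_. M)) (compose {..<n} fst) = PiM {..<n} (\<lambda>_. distr F M fst)"
    using F M by (intro distr_PiM_finite_prob_space') auto
  also have "distr F M fst = M" unfolding M_def marginal_X_def by (rule distr_cong) auto
  finally have "PiM {..<n} (\<lambda>_. M) = distr (distr (iid F) (PiM {..<n} (\<lambda>_. F)) (\<lambda>zs. restrict zs {..<n})) (PiM {..<n} (\<lambda>_. M)) (compose {..<n} fst)"
    by (simp add: distr_iid_restrict F)
  also have "\<dots> = distr (iid F) (PiM {..<n} (\<lambda>_. M)) (compose {..<n} fst \<circ> (\<lambda>zs. restrict zs {..<n}))"
  proof (rule distr_distr[OF _ measurable_iid_restrict])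
    show "compose {..<n} fst \<in> measurable (PiM {..<n} (\<lambda>_. F)) (PiM {..<n} (\<lambda>_. M))"
      unfolding compose_def
      by (intro measurable_restrict measurable_compose[OF measurable_component_singleton])
         (auto simp: measurable_cong_sets[OF refl sets_M])
  qed
  also have "compose {..<n} fst \<circ> (\<lambda>zs. restrict zs {..<n}) = observed n"
    by (auto simp: observed_def compose_def fun_eq_iff)
  also have "distr (iid F) (PiM {..<n} (\<lambda>_. M)) (observed n) = distr (iid F) (PiM {..<n} (\<lambda>_. MX)) (observed n)"
    by (rule distr_cong) (auto intro!: sets_PiM_cong sets_M)
  finally show ?thesis by (simp add: M_def)
qed

lemma density_PiM:
  assumes I: "finite I" and M: "sigma_finite_measure M" and f: "f \<in> borel_measurable M"
    and D: "sigma_finite_measure (density M f)"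
  shows "density (PiM I (\<lambda>_. M)) (\<lambda>x. \<Prod>i\<in>I. f (x i)) = PiM I (\<lambda>_. density M f)"
proof -
  interpret M: product_sigma_finite "\<lambda>_. M" using M by (simp add: product_sigma_finite_def)
  interpret D: product_sigma_finite "\<lambda>_. density M f" using D by (simp add: product_sigma_finite_def)
  note [measurable] = f
  show ?thesis
  proof (rule D.PiM_eqI[OF I])
    show "sets (density (PiM I (\<lambda>_. M)) (\<lambda>x. \<Prod>i\<in>I. f (x i))) = sets (PiM I (\<lambda>_. density M f))"
      by (simp cong: sets_PiM_cong)
    fix A assume "\<And>i. i \<in> I \<Longrightarrow> A i \<in> sets (density M f)"
    then have A [measurable]: "\<And>i. i \<in> I \<Longrightarrow> A i \<in> sets M" by simp
    have "emeasure (density (PiM I (\<lambda>_. M)) (\<lambda>x. \<Prod>i\<in>I. f (x i))) (Pi\<^sub>E I A) =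
        (\<integral>\<^sup>+x. (\<Prod>i\<in>I. f (x i)) * indicator (Pi\<^sub>E I A) x \<partial>PiM I (\<lambda>_. M))"
      using I A by (intro emeasure_density) (auto intro!: sets_PiM_I_finite)
    also have "\<dots> = (\<integral>\<^sup>+x. (\<Prod>i\<in>I. f (x i) * indicator (A i) (x i)) \<partial>PiM I (\<lambda>_. M))"
    proof (rule nn_integral_cong)
      fix x assume "x \<in> space (PiM I (\<lambda>_. M))"
      then have "x \<in> extensional I" by (auto simp: space_PiM PiE_def)
      then have "indicator (Pi\<^sub>E I A) x = (\<Prod>i\<in>I. indicator (A i) (x i) :: ennreal)"
        using I by (auto simp: indicator_def PiE_iff prod_zero_iff)
      then show "(\<Prod>i\<in>I. f (x i)) * indicator (Pi\<^sub>E I A) x = (\<Prod>i\<in>I. f (x i) * indicator (A i) (x i))"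
        by (simp add: prod.distrib)
    qed
    also have "\<dots> = (\<Prod>i\<in>I. \<integral>\<^sup>+x. f x * indicator (A i) x \<partial>M)"
      using I A by (intro M.product_nn_integral_prod) auto
    also have "\<dots> = (\<Prod>i\<in>I. emeasure (density M f) (A i))"
      using A by (intro prod.cong refl) (simp add: emeasure_density)
    finally show "emeasure (density (PiM I (\<lambda>_. M)) (\<lambda>x. \<Prod>i\<in>I. f (x i))) (Pi\<^sub>E I A) = (\<Prod>i\<in>I. emeasure (density M f) (A i))" .
  qed
qed

text \<open>The event that all n observations avoid the null set carrying the singular part has
  F-probability \<open>(\<integral> f)^n\<close>, and on it the law of the observations has the
  density \<open>prod f\<close> with respect to their law under F0. A function bounded by 1
  therefore changes its expectation by at most the probability of the complement.\<close>

lemma observed_change_of_measure: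
  fixes G :: "(nat \<Rightarrow> 'x) \<Rightarrow> complex"
  assumes F: "prob_space F" "sets F = sets (MX \<Otimes>\<^sub>M MT)" and F0: "prob_space F0" "sets F0 = sets (MX \<Otimes>\<^sub>M MT)"
    and ac: "is_ac_part_deriv (marginal_X MX F0) (marginal_X MX F) f"
    and G: "G \<in> borel_measurable (PiM {..<n} (\<lambda>_. MX))" "\<And>x. norm (G x) \<le> 1"
  shows "integrable (marginal_X MX F0) f"
    and "norm ((LINT zs|iid F. G (observed n zs)) - (LINT zs|iid F0. G (observed n zs) * of_real (\<Prod>j<n. f (fst (zs j)))))
      \<le> 1 - (LINT x|marginal_X MX F0. f x) ^ n"
proof -
  define M0 N where "M0 = marginal_X MX F0" and "N = marginal_X MX F"
  have M0: "prob_space M0" and [measurable_cong]: "sets M0 = sets MX"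
    unfolding M0_def using prob_space_marginal[OF F0] sets_marginal[OF F0] by auto
  have N: "prob_space N" and [measurable_cong]: "sets N = sets MX"
    unfolding N_def using prob_space_marginal[OF F] sets_marginal[OF F] by auto
  interpret M0: prob_space M0 by fact
  interpret N: prob_space N by fact
  obtain S where f [measurable]: "f \<in> borel_measurable M0" and f0: "\<And>x. x \<in> space M0 \<Longrightarrow> 0 \<le> f x"
    and S: "S \<in> null_sets M0" and D: "density N (indicator (space M0 - S)) = density M0 (\<lambda>x. ennreal (f x))"
    using ac unfolding is_ac_part_deriv_def M0_def[symmetric] N_def[symmetric] by auto
  have S_meas [measurable]: "S \<in> sets MX" using S \<open>sets M0 = sets MX\<close> by auto
  have space_eq: "space M0 = space MX" "space N = space MX"
    using sets_eq_imp_space_eq[of M0 MX] sets_eq_imp_space_eq[of N MX] \<open>sets M0 = sets MX\<close> \<open>sets N = sets MX\<close> by auto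
  define A where "A = space MX - S"
  have A [measurable]: "A \<in> sets MX" by (simp add: A_def)
  have "(\<integral>\<^sup>+x. ennreal (f x) \<partial>M0) = emeasure (density M0 (\<lambda>x. ennreal (f x))) (space M0)"
    by (subst emeasure_density) (auto intro!: nn_integral_cong)
  also have "\<dots> = emeasure (density N (indicator A)) (space N)"
    unfolding D[symmetric] space_eq A_def ..
  also have "\<dots> = (\<integral>\<^sup>+x. indicator A x \<partial>N)"
    by (subst emeasure_density) (auto intro!: nn_integral_cong)
  also have "\<dots> = emeasure N A" by simp
  finally have nn_f: "(\<integral>\<^sup>+x. ennreal (f x) \<partial>M0) = ennreal (measure N A)"
    by (simp add: N.emeasure_eq_measure)
  then show int_f: "integrable (marginal_X MX F0) f"
    unfolding M0_def[symmetric] by (intro integrableI_nonneg) (auto intro!: AE_I2 f0)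
  have int_f_eq: "(LINT x|M0. f x) = measure N A"
    using nn_f by (subst integral_eq_nn_integral) (auto intro!: AE_I2 f0)
  have "sigma_finite_measure (density M0 (\<lambda>x. ennreal (f x)))"
  proof -
    have "finite_measure (density M0 (\<lambda>x. ennreal (f x)))"
      by (rule finite_measureI) (simp add: emeasure_density nn_f cong: nn_integral_cong)
    then show ?thesis by (rule finite_measure.axioms)
  qed
  then have dens: "density (PiM {..<n} (\<lambda>_. N)) (\<lambda>x. \<Prod>i<n. indicator A (x i)) =
      density (PiM {..<n} (\<lambda>_. M0)) (\<lambda>x. \<Prod>i<n. ennreal (f (x i)))"
    using D density_PiM[of "{..<n}" N "indicator A"] density_PiM[of "{..<n}" M0 "\<lambda>x. ennreal (f x)"]
    by (simp add: N.sigma_finite_measure_axioms M0.sigma_finite_measure_axioms space_eq A_def)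
  note [measurable] = measurable_observed[OF F] measurable_observed[OF F0]
  have G_meas [measurable]: "G \<in> borel_measurable (PiM {..<n} (\<lambda>_. N))" "G \<in> borel_measurable (PiM {..<n} (\<lambda>_. M0))"
    using G(1) by (simp_all cong: measurable_cong_sets sets_PiM_cong)
  interpret PN: prob_space "PiM {..<n} (\<lambda>_. N)"
    by (rule prob_space_PiM) (rule N)
  \<comment> \<open>The indicator of the event that no observation falls into the null set of the
    singular part.\<close>
  define \<kappa> :: "(nat \<Rightarrow> 'x) \<Rightarrow> real" where "\<kappa> x = (\<Prod>i<n. indicator A (x i))" for x
  have \<kappa>: "0 \<le> \<kappa> x" "\<kappa> x \<le> 1" for x by (auto simp: \<kappa>_def intro!: prod_nonneg prod_le_1)
  have [measurable]: "\<kappa> \<in> borel_measurable (PiM {..<n} (\<lambda>_. N))" unfolding \<kappa>_def by measurable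
  have E1: "(LINT zs|iid F. G (observed n zs)) = (\<integral>x. G x \<partial>PiM {..<n} (\<lambda>_. N))"
    unfolding N_def distr_observed[OF F, symmetric] using G(1) by (subst integral_distr) auto
  have "(\<integral>x. \<kappa> x *\<^sub>R G x \<partial>PiM {..<n} (\<lambda>_. N)) = (\<integral>x. G x \<partial>density (PiM {..<n} (\<lambda>_. N)) (\<lambda>x. ennreal (\<kappa> x)))"
    using \<kappa> by (subst integral_density) auto
  also have "density (PiM {..<n} (\<lambda>_. N)) (\<lambda>x. ennreal (\<kappa> x)) = density (PiM {..<n} (\<lambda>_. M0)) (\<lambda>x. \<Prod>i<n. ennreal (f (x i)))"
    unfolding dens[symmetric] by (simp add: \<kappa>_def ennreal_indicator flip: prod_ennreal)
  also have "\<dots> = density (PiM {..<n} (\<lambda>_. M0)) (\<lambda>x. ennreal (\<Prod>i<n. f (x i)))"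
    by (rule density_cong) (auto intro!: AE_I2 prod_ennreal f0 simp: space_PiM)
  also have "(\<integral>x. G x \<partial>\<dots>) = (\<integral>x. (\<Prod>i<n. f (x i)) *\<^sub>R G x \<partial>PiM {..<n} (\<lambda>_. M0))"
    by (subst integral_density) (auto intro!: AE_I2 prod_nonneg f0 simp: space_PiM)
  also have "\<dots> = (LINT zs|iid F0. (\<Prod>i<n. f (observed n zs i)) *\<^sub>R G (observed n zs))"
    unfolding M0_def distr_observed[OF F0, symmetric] using G(1) by (subst integral_distr) (auto simp: M0_def[symmetric])
  also have "\<dots> = (LINT zs|iid F0. G (observed n zs) * of_real (\<Prod>j<n. f (fst (zs j))))"
    by (simp add: observed_def scaleR_conv_of_real mult.commute)
  finally have E2: "(LINT zs|iid F0. G (observed n zs) * of_real (\<Prod>j<n. f (fst (zs j)))) = (\<integral>x. \<kappa> x *\<^sub>R G x \<partial>PiM {..<n} (\<lambda>_. N))"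
    by simp
  have i1: "integrable (PiM {..<n} (\<lambda>_. N)) G" using G(2) by (intro PN.integrable_bounded) auto
  have i2: "integrable (PiM {..<n} (\<lambda>_. N)) (\<lambda>x. \<kappa> x *\<^sub>R G x)"
    using G(2) \<kappa> by (intro PN.integrable_bounded[where B=1]) (auto intro!: mult_le_one)
  have i3: "integrable (PiM {..<n} (\<lambda>_. N)) \<kappa>"
    using \<kappa> by (intro PN.integrable_bounded[where B=1]) auto
  interpret product_sigma_finite "\<lambda>_. N" by standard
  have \<kappa>_int: "(\<integral>x. \<kappa> x \<partial>PiM {..<n} (\<lambda>_. N)) = measure N A ^ n"
    unfolding \<kappa>_def using N.integrable_bounded[of "indicat_real A" 1]
    by (subst product_integral_prod) (auto simp: indicator_le_1)
  have "norm ((\<integral>x. G x \<partial>PiM {..<n} (\<lambda>_. N)) - (\<integral>x. \<kappa> x *\<^sub>R G x \<partial>PiM {..<n} (\<lambda>_. N))) =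
      norm (\<integral>x. G x - \<kappa> x *\<^sub>R G x \<partial>PiM {..<n} (\<lambda>_. N))" using i1 i2 by simp
  also have "\<dots> \<le> (\<integral>x. norm (G x - \<kappa> x *\<^sub>R G x) \<partial>PiM {..<n} (\<lambda>_. N))" by (rule integral_norm_bound)
  also have "\<dots> \<le> (\<integral>x. 1 - \<kappa> x \<partial>PiM {..<n} (\<lambda>_. N))"
  proof (rule integral_mono)
    fix x
    have "norm (G x - \<kappa> x *\<^sub>R G x) = (1 - \<kappa> x) * norm (G x)"
      using \<kappa>[of x] by (simp flip: scaleR_left_diff_distrib[of 1, simplified])
    also have "\<dots> \<le> (1 - \<kappa> x) * 1" using \<kappa>[of x] G(2) by (intro mult_left_mono) auto
    finally show "norm (G x - \<kappa> x *\<^sub>R G x) \<le> 1 - \<kappa> x" by simp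
  qed (use i1 i2 i3 in auto)
  also have "\<dots> = 1 - measure N A ^ n" using i3 by (simp add: PN.prob_space \<kappa>_int)
  finally show "norm ((LINT zs|iid F. G (observed n zs)) - (LINT zs|iid F0. G (observed n zs) * of_real (\<Prod>j<n. f (fst (zs j)))))
      \<le> 1 - (LINT x|marginal_X MX F0. f x) ^ n" unfolding E1 E2 M0_def[symmetric] int_f_eq .
qed

section \<open>A conditional central limit theorem\<close>

text \<open>This is \<open>E[w | X] = 0\<close>, expressed as orthogonality to bounded functions of
  X. In this form it can be applied under the integral over a single coordinate, without conditional
  expectations on the product space.\<close>

definition cond_centered :: "'x measure \<Rightarrow> ('x \<times> 't) measure \<Rightarrow> ('x \<times> 't \<Rightarrow> real) \<Rightarrow> bool" where
  "cond_centered MX F w \<longleftrightarrow> integrable F w \<and>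
    (\<forall>k\<in>borel_measurable MX. (\<forall>x. \<bar>k x\<bar> \<le> 1) \<longrightarrow> (LINT z|F. k (fst z) * w z) = (0::real))"

lemma cond_centered_complex:
  fixes k :: "'x \<Rightarrow> complex"
  assumes F: "prob_space F" "sets F = sets (MX \<Otimes>\<^sub>M MT)" and w: "cond_centered MX F w"
    and k [measurable]: "k \<in> borel_measurable MX" and k1: "\<And>x. norm (k x) \<le> 1"
  shows "(LINT z|F. k (fst z) * of_real (w z)) = 0"
proof -
  note [measurable] = measurable_fst_sets[OF F]
  have wi: "integrable F w" and w0: "\<And>k. k \<in> borel_measurable MX \<Longrightarrow> (\<And>x. \<bar>k x\<bar> \<le> 1) \<Longrightarrow> (LINT z|F. k (fst z) * w z) = 0"
    using w by (auto simp: cond_centered_def)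
  have [measurable]: "w \<in> borel_measurable F" using wi by simp
  have i: "integrable F (\<lambda>z. k (fst z) * of_real (w z))"
  proof (rule Bochner_Integration.integrable_bound[OF wi])
    show "AE z in F. norm (k (fst z) * of_real (w z)) \<le> norm (w z)"
      using k1 by (intro AE_I2) (simp add: norm_mult mult_left_le_one_le)
  qed measurable
  have k_Re: "\<bar>Re (k x)\<bar> \<le> 1" and k_Im: "\<bar>Im (k x)\<bar> \<le> 1" for x
    using k1[of x] abs_Re_le_cmod[of "k x"] abs_Im_le_cmod[of "k x"] by linarith+
  have "Re (LINT z|F. k (fst z) * of_real (w z)) = (LINT z|F. Re (k (fst z)) * w z)"
    using i by (subst integral_Re[symmetric]) auto
  moreover have "Im (LINT z|F. k (fst z) * of_real (w z)) = (LINT z|F. Im (k (fst z)) * w z)"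
    using i by (subst integral_Im[symmetric]) auto
  ultimately show ?thesis
    using w0[of "\<lambda>x. Re (k x)"] w0[of "\<lambda>x. Im (k x)"] k_Re k_Im by (simp add: complex_eq_iff)
qed

text \<open>The factors are removed one at a time. Integrated over coordinate m alone, the observed
  part depends on this coordinate only through its X-component, so its product with \<open>w\<close>
  at that coordinate has mean 0. Independence alone would not do, since \<open>G\<close> couples all
  observations.\<close>

lemma integral_observed_martingale:
  fixes G :: "(nat \<Rightarrow> 'x) \<Rightarrow> complex" and F :: "('x \<times> 't) measure"
  assumes F: "prob_space F" "sets F = sets (MX \<Otimes>\<^sub>M MT)" and w: "cond_centered MX F w"
    and G: "G \<in> borel_measurable (PiM {..<n} (\<lambda>_. MX))" "\<And>x. norm (G x) \<le> 1"
  shows "(LINT zs|iid F. G (observed n zs) * (\<Prod>j<n. 1 + c * of_real (w (zs j)))) = (LINT zs|iid F. G (observed n zs))"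
proof -
  note [measurable] = measurable_fst_sets[OF F] G(1)
  interpret F: prob_space F by fact
  interpret product_sigma_finite "\<lambda>_. F" by standard
  have wi: "integrable F w" using w by (simp add: cond_centered_def)
  then have [measurable]: "w \<in> borel_measurable F" by simp
  have obs [measurable]: "observed n \<in> measurable (PiM {..<n} (\<lambda>_. F)) (PiM {..<n} (\<lambda>_. MX))"
    unfolding observed_def[abs_def] by measurable
  define P where "P = PiM {..<n} (\<lambda>_. F)"
  define Q where "Q m x = G (observed n x) * (\<Prod>j<m. 1 + c * of_real (w (x j)))" for m x
  have Q_meas [measurable]: "Q m \<in> borel_measurable P" if "m \<le> n" for m
    unfolding Q_def[abs_def] P_def
    by (intro borel_measurable_times measurable_compose[OF obs G(1)] borel_measurable_prod
        measurable_compose[OF measurable_component_singleton, where g="\<lambda>z. 1 + c * of_real (w z)"])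
      (use that in auto)
  have int: "integrable P (\<lambda>x. G (observed n x) * (\<Prod>j<n. a j (x j)))" if a: "\<And>j. integrable F (a j)" for a :: "nat \<Rightarrow> 'x \<times> 't \<Rightarrow> complex"
  proof (rule Bochner_Integration.integrable_bound)
    show "integrable P (\<lambda>x. \<Prod>j<n. a j (x j))"
      unfolding P_def using a by (intro product_integrable_prod) auto
    then have [measurable]: "(\<lambda>x. \<Prod>j<n. a j (x j)) \<in> borel_measurable P" by simp
    show "(\<lambda>x. G (observed n x) * (\<Prod>j<n. a j (x j))) \<in> borel_measurable P"
      using obs unfolding P_def[symmetric] by measurable
    show "AE x in P. norm (G (observed n x) * (\<Prod>j<n. a j (x j))) \<le> norm (\<Prod>j<n. a j (x j))"
      using G(2) by (intro AE_I2) (simp add: norm_mult mult_left_le_one_le)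
  qed
  have Q_int: "integrable P (Q m)" if "m \<le> n" for m
  proof -
    have "(\<Prod>j<n. if j < m then 1 + c * of_real (w (x j)) else 1) = (\<Prod>j<m. 1 + c * of_real (w (x j)))" for x
      using that by (subst prod.mono_neutral_cong_right[of "{..<n}" "{..<m}"]) auto
    moreover have "integrable F (\<lambda>z. if j < m then 1 + c * complex_of_real (w z) else 1)" for j
      using wi by (cases "j < m") auto
    ultimately show ?thesis using int[of "\<lambda>j z. if j < m then 1 + c * of_real (w z) else 1"]
      by (simp add: Q_def[abs_def])
  qed
  have step: "(LINT x|P. Q (Suc m) x) = (LINT x|P. Q m x)" if m: "m < n" for m
  proof -
    define R where "R x = Q m x * of_real (w (x m))" for x
    have R_int: "integrable P R"
    proof -
      have "(\<Prod>j<n. if j < m then 1 + c * of_real (w (x j)) else if j = m then of_real (w (x j)) else 1) =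
          (\<Prod>j<m. 1 + c * of_real (w (x j))) * of_real (w (x m))" for x
        using that by (subst prod.mono_neutral_cong_right[of "{..<n}" "{..<Suc m}"]) auto
      moreover have "integrable F (\<lambda>z. if j < m then 1 + c * complex_of_real (w z) else if j = m then of_real (w z) else 1)" for j
        using wi by (cases "j < m"; cases "j = m") auto
      ultimately show ?thesis
        using int[of "\<lambda>j z. if j < m then 1 + c * of_real (w z) else if j = m then of_real (w z) else 1"]
        by (simp add: Q_def[abs_def] R_def[abs_def] mult.assoc)
    qed
    have ins: "{..<n} = insert m ({..<n} - {m})" using m by auto
    have "(LINT x|P. R x) = (\<integral>x. (LINT y|F. R (x(m := y))) \<partial>PiM ({..<n} - {m}) (\<lambda>_. F))"
      unfolding P_def by (subst (1) ins, rule product_integral_insert) (use R_int in \<open>auto simp: P_def insert_absorb m\<close>)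
    also have "\<dots> = (\<integral>x. 0 \<partial>PiM ({..<n} - {m}) (\<lambda>_. F))"
    proof (rule Bochner_Integration.integral_cong[OF refl])
      fix x assume x: "x \<in> space (PiM ({..<n} - {m}) (\<lambda>_. F))"
      \<comment> \<open>The section of \<open>G\<close> in observation m with all other observations
        fixed; it is the bounded test function to which conditional centring applies.\<close>
      define k where "k \<xi> = G (\<lambda>j\<in>{..<n}. if j = m then \<xi> else fst (x j))" for \<xi>
      have "fst (x j) \<in> space MX" if "j < n" "j \<noteq> m" for j
        using x that measurable_space[OF measurable_fst_sets[OF F], of "x j"] by (auto simp: space_PiM PiE_iff)
      then have "(\<lambda>\<xi>. if j = m then \<xi> else fst (x j)) \<in> measurable MX MX" if "j < n" for j
        using that by (cases "j = m") auto
      then have "(\<lambda>\<xi>. (\<lambda>j\<in>{..<n}. if j = m then \<xi> else fst (x j))) \<in> measurable MX (PiM {..<n} (\<lambda>_. MX))"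
        by (intro measurable_restrict) auto
      then have k_meas: "k \<in> borel_measurable MX" unfolding k_def[abs_def] by measurable
      have "R (x(m := y)) = (\<Prod>j<m. 1 + c * of_real (w (x j))) * (k (fst y) * of_real (w y))" for y
      proof -
        have "observed n (x(m := y)) = (\<lambda>j\<in>{..<n}. if j = m then fst y else fst (x j))"
          by (auto simp: observed_def fun_eq_iff)
        moreover have "(\<Prod>j<m. 1 + c * of_real (w ((x(m := y)) j))) = (\<Prod>j<m. 1 + c * of_real (w (x j)))"
          by (intro prod.cong) auto
        ultimately show ?thesis by (simp add: R_def Q_def k_def mult_ac)
      qed
      then show "(LINT y|F. R (x(m := y))) = 0"
        using cond_centered_complex[OF F w k_meas] G(2) by (simp add: k_def)
    qed
    finally have "(LINT x|P. R x) = 0" by simp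
    moreover have "Q (Suc m) x = Q m x + c * R x" for x by (simp add: Q_def R_def algebra_simps)
    ultimately show ?thesis using Q_int[of m] R_int m by simp
  qed
  have "m \<le> n \<Longrightarrow> (LINT x|P. Q m x) = (LINT x|P. Q 0 x)" for m
    by (induction m) (use step in \<open>simp_all add: Suc_le_eq\<close>)
  from this[of n] have eq: "(LINT x|P. Q n x) = (LINT x|P. Q 0 x)" by blast
  have transfer: "(LINT zs|iid F. Q m zs) = (LINT x|P. Q m x)" if "m \<le> n" for m
  proof -
    have "(LINT x|P. Q m x) = (\<integral>x. Q m x \<partial>distr (iid F) P (\<lambda>zs. restrict zs {..<n}))"
      by (simp add: P_def distr_iid_restrict F)
    also have "\<dots> = (LINT zs|iid F. Q m (restrict zs {..<n}))"
      using that by (intro integral_distr Q_meas) (simp add: P_def)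
    also have "\<dots> = (LINT zs|iid F. Q m zs)"
    proof (rule Bochner_Integration.integral_cong[OF refl])
      fix zs :: "nat \<Rightarrow> 'x \<times> 't"
      have "observed n (restrict zs {..<n}) = observed n zs" by (auto simp: observed_def fun_eq_iff)
      moreover have "(\<Prod>j<m. 1 + c * of_real (w (restrict zs {..<n} j))) = (\<Prod>j<m. 1 + c * of_real (w (zs j)))"
        using that by (intro prod.cong) auto
      ultimately show "Q m (restrict zs {..<n}) = Q m zs" by (simp add: Q_def)
    qed
    finally show ?thesis by simp
  qed
  show ?thesis using eq transfer[of n] transfer[of 0] by (simp add: Q_def)
qed

text \<open>At \<open>x = v / sqrt n\<close> the quadratic term contributes
  \<open>\<beta> E v^2\<close> after multiplication by n, and the bound on the remainder becomes
  exactly the integral in \<open>ui\<close>, a continuous form of Lindeberg's condition.\<close>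

lemma tendsto_second_order:
  fixes a :: "real \<Rightarrow> 'b::{real_normed_field, banach, second_countable_topology}"
  assumes N: "\<And>n. prob_space (N n)" and v: "\<And>n. v n \<in> borel_measurable (N n)"
    and v2: "\<And>n. integrable (N n) (\<lambda>z. (v n z)^2)"
    and V: "(\<lambda>n. LINT z|N n. (v n z)^2) \<longlonglongrightarrow> V"
    and ui: "(\<lambda>n. LINT z|N n. (v n z)^2 * min 1 (\<bar>v n z\<bar> / sqrt (real n))) \<longlonglongrightarrow> 0"
    and a: "a \<in> borel_measurable borel"
    and bound: "\<And>x. norm (a x - 1 - \<beta> * of_real (x^2)) \<le> C * (x^2 * min 1 \<bar>x\<bar>)"
  shows "(\<lambda>n. of_nat n * ((LINT z|N n. a (v n z / sqrt (real n))) - 1)) \<longlonglongrightarrow> \<beta> * of_real V"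
proof -
  note [measurable] = v a
  define d where "d n = of_nat n * ((LINT z|N n. a (v n z / sqrt (real n))) - 1) - \<beta> * of_real (LINT z|N n. (v n z)^2)" for n
  have "d \<longlonglongrightarrow> 0"
  proof (rule Lim_null_comparison)
    show "(\<lambda>n. C * (LINT z|N n. (v n z)^2 * min 1 (\<bar>v n z\<bar> / sqrt (real n)))) \<longlonglongrightarrow> 0"
      using tendsto_mult[OF tendsto_const ui, of C] by simp
    show "\<forall>\<^sub>F n in sequentially. norm (d n) \<le> C * (LINT z|N n. (v n z)^2 * min 1 (\<bar>v n z\<bar> / sqrt (real n)))"
      using eventually_gt_at_top[of 0]
    proof eventually_elim
      case (elim n)
      interpret prob_space "N n" by fact
      define y where "y z = v n z / sqrt (real n)" for z
      have y2: "(y z)^2 = (v n z)^2 / real n" for z by (simp add: y_def power_divide)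
      have [measurable]: "y \<in> borel_measurable (N n)" unfolding y_def by measurable
      have i2: "integrable (N n) (\<lambda>z. (y z)^2)" using v2 by (simp add: y2)
      define r where "r z = a (y z) - 1 - \<beta> * of_real ((y z)^2)" for z
      have im: "integrable (N n) (\<lambda>z. (y z)^2 * min 1 \<bar>y z\<bar>)"
      proof (rule Bochner_Integration.integrable_bound[OF i2])
        show "AE z in N n. norm ((y z)^2 * min 1 \<bar>y z\<bar>) \<le> norm ((y z)^2)"
          by (intro AE_I2) (auto simp: abs_mult intro!: mult_right_le_one_le)
      qed measurable
      have ir: "integrable (N n) r"
      proof (rule Bochner_Integration.integrable_bound)
        show "integrable (N n) (\<lambda>z. C * ((y z)^2 * min 1 \<bar>y z\<bar>))" using im by simp
        show "AE z in N n. norm (r z) \<le> norm (C * ((y z)^2 * min 1 \<bar>y z\<bar>))"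
          unfolding r_def real_norm_def by (intro AE_I2 order_trans[OF bound abs_ge_self])
      qed (unfold r_def, measurable)
      have a_eq: "a (y z) = r z + 1 + \<beta> * of_real ((y z)^2)" for z by (simp add: r_def)
      have "(LINT z|N n. a (y z)) = (LINT z|N n. r z) + 1 + \<beta> * of_real (LINT z|N n. (y z)^2)"
        unfolding a_eq using ir i2 by (simp add: prob_space del: of_real_power)
      moreover have "(LINT z|N n. (v n z)^2) = real n * (LINT z|N n. (y z)^2)"
        using elim by (simp add: y2)
      ultimately have "d n = of_nat n * (LINT z|N n. r z)"
        by (simp add: d_def flip: y_def) (simp add: algebra_simps)
      then have "norm (d n) = real n * norm (LINT z|N n. r z)" by (simp add: norm_mult)
      also have "norm (LINT z|N n. r z) \<le> (LINT z|N n. norm (r z))" by (rule integral_norm_bound)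
      also have "\<dots> \<le> (LINT z|N n. C * ((y z)^2 * min 1 \<bar>y z\<bar>))"
        using bound by (intro integral_mono integrable_norm ir integrable_mult_right im) (simp add: r_def)
      finally have "norm (d n) \<le> real n * (C * (LINT z|N n. (y z)^2 * min 1 \<bar>y z\<bar>))"
        by (simp add: mult_left_mono)
      also have "(LINT z|N n. (y z)^2 * min 1 \<bar>y z\<bar>) = (LINT z|N n. (v n z)^2 * min 1 (\<bar>v n z\<bar> / sqrt (real n))) / real n"
        by (subst integral_divide_zero[symmetric], rule Bochner_Integration.integral_cong) (simp_all only: y2, simp_all add: y_def)
      finally show ?case using elim by simp
    qed
  qed
  then have "(\<lambda>n. d n + \<beta> * of_real (LINT z|N n. (v n z)^2)) \<longlonglongrightarrow> 0 + \<beta> * of_real V"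
    by (intro tendsto_intros V)
  then show ?thesis by (simp add: d_def)
qed

text \<open>These are the functions to which \<open>tendsto_second_order\<close> is applied:
  \<open>iexp y / (1 + i y)\<close> for \<open>conditional_CLT\<close>, the squared modulus of such
  a quotient, and for \<open>lik_imaginary\<close> the product of
  \<open>iexp (2 y) / (1 + i y)\<close> with the conjugate of \<open>1 + i y\<close>, whose first
  and second order terms cancel. A cubic bound near 0 and a quadratic one far away combine into
  \<open>y^2 min 1 |y|\<close>.\<close>

lemma second_order_ratio:
  fixes y :: real
  shows "norm (iexp y / (1 + \<i> * y) - 1 - (- 1/2) * of_real (y^2)) \<le> 2 * (y^2 * min 1 \<bar>y\<bar>)"
    and "\<bar>1 / (1 + y^2) - 1 - (- 1) * y^2\<bar> \<le> 2 * (y^2 * min 1 \<bar>y\<bar>)"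
    and "norm (iexp (2 * y) * (1 - \<i> * y) / (1 + \<i> * y) - 1 - 0 * of_real (y^2)) \<le> 8 * (y^2 * min 1 \<bar>y\<bar>)"
proof -
  define r where "r x = iexp x - (1 + \<i> * x - x\<^sup>2 / 2)" for x :: real
  have r: "norm (r x) \<le> \<bar>x\<bar> ^ 3 / 6" "norm (r x) \<le> x\<^sup>2" for x
    using iexp_approx1[of x 2] iexp_approx2[of x 2]
    by (simp_all add: r_def numeral_eq_Suc power2_eq_square algebra_simps)
  have den: "1 \<le> norm (1 + \<i> * y)" "\<bar>y\<bar> \<le> norm (1 + \<i> * y)" "1 + \<i> * y \<noteq> 0"
  proof -
    show "1 \<le> norm (1 + \<i> * y)" using abs_Re_le_cmod[of "1 + \<i> * y"] by simp
    then show "1 + \<i> * y \<noteq> 0" by auto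
    show "\<bar>y\<bar> \<le> norm (1 + \<i> * y)" using abs_Im_le_cmod[of "1 + \<i> * y"] by simp
  qed
  have y3: "\<bar>y\<bar> ^ 3 = y^2 * \<bar>y\<bar>" by (simp add: power3_eq_cube power2_eq_square)
  have ratio: "norm (z / (1 + \<i> * y)) \<le> norm z" "norm (of_real (\<bar>y\<bar>^3) / (1 + \<i> * y)) \<le> y\<^sup>2 * min 1 \<bar>y\<bar>" for z
  proof -
    show "norm (z / (1 + \<i> * y)) \<le> norm z"
      using den(1) by (simp add: norm_divide divide_le_eq mult_le_cancel_left1)
    have "\<bar>y\<bar> / norm (1 + \<i> * y) \<le> min 1 \<bar>y\<bar>"
      using den(1,2) by (auto simp: divide_le_eq mult_le_cancel_left1 intro: order_trans[OF _ mult_left_mono])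
    then have "y\<^sup>2 * (\<bar>y\<bar> / norm (1 + \<i> * y)) \<le> y\<^sup>2 * min 1 \<bar>y\<bar>" by (rule mult_left_mono) simp
    then show "norm (of_real (\<bar>y\<bar>^3) / (1 + \<i> * y)) \<le> y\<^sup>2 * min 1 \<bar>y\<bar>"
      unfolding y3 by (simp add: norm_divide norm_mult norm_power)
  qed
  have ratio': "norm (of_real (y ^ 3) * w / (1 + \<i> * y)) \<le> norm w * (y^2 * min 1 \<bar>y\<bar>)" for w
  proof -
    have "norm (of_real (y ^ 3) * w / (1 + \<i> * y)) = norm w * norm (of_real (\<bar>y\<bar>^3) / (1 + \<i> * y))"
      by (simp add: norm_mult norm_divide norm_power)
    then show ?thesis using ratio(2) by (simp add: mult_left_mono)
  qed
  have rr: "norm (r y) \<le> y\<^sup>2 * min 1 \<bar>y\<bar>" "norm (r (2 * y)) \<le> 4 * (y^2 * min 1 \<bar>y\<bar>)"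
  proof -
    define K where "K = y^2 * \<bar>y\<bar>"
    have K: "0 \<le> K" "norm (r y) \<le> K / 6" "norm (r (2 * y)) \<le> 8 * K / 6" "norm (r y) \<le> y\<^sup>2" "norm (r (2 * y)) \<le> 4 * y^2"
      using r[of y] r[of "2 * y"] by (simp_all add: K_def power_mult_distrib y3 abs_mult)
    have "y\<^sup>2 * min 1 \<bar>y\<bar> = (if 1 \<le> \<bar>y\<bar> then y\<^sup>2 else K)" by (simp add: K_def)
    with K show "norm (r y) \<le> y\<^sup>2 * min 1 \<bar>y\<bar>" "norm (r (2 * y)) \<le> 4 * (y^2 * min 1 \<bar>y\<bar>)" by auto
  qed
  \<comment> \<open>Over the common denominator the numerator reduces to the Taylor remainder
    \<open>r\<close> and one cubic term, and division by \<open>1 + i y\<close> does not increase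
    the modulus.\<close>
  have split: "x / (1 + \<i> * y) - 1 - c = (x - (1 + \<i> * y) - c * (1 + \<i> * y)) / (1 + \<i> * y)" for x c
    using den(3) by (simp add: diff_divide_distrib)
  have "iexp y - (1 + \<i> * y) - (- 1/2) * of_real (y^2) * (1 + \<i> * y) = r y + of_real (y ^ 3) * (\<i> / 2)"
    by (simp add: r_def algebra_simps power2_eq_square power3_eq_cube)
  then have "iexp y / (1 + \<i> * y) - 1 - (- 1/2) * of_real (y^2) = r y / (1 + \<i> * y) + of_real (y ^ 3) * (\<i> / 2) / (1 + \<i> * y)"
    unfolding split by (simp only: add_divide_distrib)
  also have "norm \<dots> \<le> y\<^sup>2 * min 1 \<bar>y\<bar> + norm (\<i> / 2) * (y^2 * min 1 \<bar>y\<bar>)"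
    by (intro norm_triangle_le add_mono ratio' order_trans[OF ratio(1) rr(1)])
  also have "\<dots> \<le> 2 * (y^2 * min 1 \<bar>y\<bar>)" by (simp add: norm_divide)
  finally show "norm (iexp y / (1 + \<i> * y) - 1 - (- 1/2) * of_real (y^2)) \<le> 2 * (y^2 * min 1 \<bar>y\<bar>)" .
  have "iexp (2 * y) * (1 - \<i> * y) - (1 + \<i> * y) - 0 * of_real (y^2) * (1 + \<i> * y) =
      r (2 * y) * (1 - \<i> * y) + of_real (y ^ 3) * (2 * \<i>)"
    by (simp add: r_def algebra_simps power2_eq_square power3_eq_cube)
  then have "iexp (2 * y) * (1 - \<i> * y) / (1 + \<i> * y) - 1 - 0 * of_real (y^2) =
      r (2 * y) * ((1 - \<i> * y) / (1 + \<i> * y)) + of_real (y ^ 3) * (2 * \<i>) / (1 + \<i> * y)"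
    unfolding split by (simp only: add_divide_distrib times_divide_eq_right)
  also have "norm \<dots> \<le> 4 * (y^2 * min 1 \<bar>y\<bar>) + norm (2 * \<i>) * (y^2 * min 1 \<bar>y\<bar>)"
  proof (intro norm_triangle_le add_mono ratio')
    have "norm (1 - \<i> * y) = norm (1 + \<i> * y)" by (simp add: cmod_def)
    then have "norm ((1 - \<i> * y) / (1 + \<i> * y)) = 1" using den(3) by (simp add: norm_divide)
    then show "norm (r (2 * y) * ((1 - \<i> * y) / (1 + \<i> * y))) \<le> 4 * (y^2 * min 1 \<bar>y\<bar>)"
      using rr(2) by (simp only: norm_mult)
  qed
  also have "\<dots> \<le> 8 * (y^2 * min 1 \<bar>y\<bar>)" by (simp add: norm_mult)
  finally show "norm (iexp (2 * y) * (1 - \<i> * y) / (1 + \<i> * y) - 1 - 0 * of_real (y^2)) \<le> 8 * (y^2 * min 1 \<bar>y\<bar>)" .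
  have "1 + y^2 \<noteq> 0"
    by (metis add_pos_nonneg less_numeral_extra(1) less_numeral_extra(3) zero_le_power2)
  then have eq: "1 / (1 + y^2) - 1 - (- 1) * y^2 = y^2 * (y^2 / (1 + y^2))"
    by (simp add: field_simps)
  have le: "y\<^sup>2 / (1 + y^2) \<le> min 1 \<bar>y\<bar>"
  proof -
    have "y\<^sup>2 / (1 + y^2) \<le> 1" by (simp add: divide_le_eq add_pos_nonneg)
    moreover have "y\<^sup>2 / (1 + y^2) \<le> \<bar>y\<bar>"
    proof (cases "\<bar>y\<bar> \<le> 1")
      case True
      have "y\<^sup>2 / (1 + y^2) \<le> y\<^sup>2" by (simp add: divide_le_eq add_pos_nonneg mult_le_cancel_left1)
      also have "\<dots> \<le> \<bar>y\<bar>" using mult_right_mono[OF True, of "\<bar>y\<bar>"] by (simp add: power2_eq_square)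
      finally show ?thesis .
    next
      case False
      with \<open>y\<^sup>2 / (1 + y^2) \<le> 1\<close> show ?thesis by linarith
    qed
    ultimately show ?thesis by simp
  qed
  have "\<bar>y\<^sup>2 * (y^2 / (1 + y^2))\<bar> = y^2 * (y^2 / (1 + y^2))"
    by (intro abs_of_nonneg mult_nonneg_nonneg divide_nonneg_nonneg) auto
  also have "\<dots> \<le> y\<^sup>2 * min 1 \<bar>y\<bar>" using le by (rule mult_left_mono) simp
  also have "\<dots> \<le> 2 * (y^2 * min 1 \<bar>y\<bar>)" by (simp add: mult_nonneg_nonneg)
  finally show "\<bar>1 / (1 + y^2) - 1 - (- 1) * y^2\<bar> \<le> 2 * (y^2 * min 1 \<bar>y\<bar>)" unfolding eq .
qed


lemma tendsto_min_scaled: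
  fixes w :: "nat \<Rightarrow> 'a \<Rightarrow> real"
  assumes w: "\<And>n. w n \<in> borel_measurable (N n)" and w2: "\<And>n. integrable (N n) (\<lambda>z. (w n z)^2)"
    and ui: "(\<lambda>n. LINT z|N n. (w n z)^2 * min 1 (\<bar>w n z\<bar> / sqrt (real n))) \<longlonglongrightarrow> 0"
  shows "(\<lambda>n. LINT z|N n. (s * w n z)^2 * min 1 (\<bar>s * w n z\<bar> / sqrt (real n))) \<longlonglongrightarrow> 0"
proof (rule tendsto_sandwich[OF _ _ tendsto_const])
  note [measurable] = w
  define m where "m t n z = (t * w n z)^2 * min 1 (\<bar>t * w n z\<bar> / sqrt (real n))" for t n z
  have i: "integrable (N n) (m t n)" for t n
  proof (rule Bochner_Integration.integrable_bound)
    show "integrable (N n) (\<lambda>z. t\<^sup>2 * (w n z)^2)" using w2 by simp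
    show "AE z in N n. norm (m t n z) \<le> norm (t^2 * (w n z)^2)"
      by (intro AE_I2) (auto simp: m_def abs_mult power_mult_distrib intro!: mult_right_le_one_le)
  qed (unfold m_def, measurable)
  have le: "m s n z \<le> s\<^sup>2 * (1 + \<bar>s\<bar>) * m 1 n z" for n z
  proof -
    have "min 1 (\<bar>s * w n z\<bar> / sqrt (real n)) \<le> (1 + \<bar>s\<bar>) * min 1 (\<bar>w n z\<bar> / sqrt (real n))"
    proof (cases "1 \<le> \<bar>w n z\<bar> / sqrt (real n)")
      case True
      have "min 1 (\<bar>s * w n z\<bar> / sqrt (real n)) \<le> 1" by simp
      with True show ?thesis by simp
    next
      case False
      have "\<bar>s * w n z\<bar> / sqrt (real n) = \<bar>s\<bar> * (\<bar>w n z\<bar> / sqrt (real n))" by (simp add: abs_mult)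
      also have "\<dots> \<le> (1 + \<bar>s\<bar>) * (\<bar>w n z\<bar> / sqrt (real n))" by (intro mult_right_mono) auto
      finally show ?thesis using False by (simp add: min_def)
    qed
    then have "(s * w n z)^2 * min 1 (\<bar>s * w n z\<bar> / sqrt (real n)) \<le> (s * w n z)^2 * ((1 + \<bar>s\<bar>) * min 1 (\<bar>w n z\<bar> / sqrt (real n)))"
      by (rule mult_left_mono) simp
    then show ?thesis by (simp add: m_def power_mult_distrib mult_ac)
  qed
  show "\<forall>\<^sub>F n in sequentially. 0 \<le> (LINT z|N n. (s * w n z)^2 * min 1 (\<bar>s * w n z\<bar> / sqrt (real n)))"
    by (intro always_eventually allI integral_nonneg_AE AE_I2) simp
  show "\<forall>\<^sub>F n in sequentially. (LINT z|N n. (s * w n z)^2 * min 1 (\<bar>s * w n z\<bar> / sqrt (real n))) \<le> s\<^sup>2 * (1 + \<bar>s\<bar>) * (LINT z|N n. m 1 n z)"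
    unfolding m_def[symmetric] using i le
    by (intro always_eventually allI) (subst integral_mult_right_zero[symmetric], intro integral_mono, auto)
  show "(\<lambda>n. s\<^sup>2 * (1 + \<bar>s\<bar>) * (LINT z|N n. m 1 n z)) \<longlonglongrightarrow> 0"
    using tendsto_mult[OF tendsto_const ui, of "s\<^sup>2 * (1 + \<bar>s\<bar>)"] by (simp add: m_def)
qed

text \<open>
  The factorisation \<open>e\<^bsup>iy\<^esup> = (1 + iy) q(y)\<close> with \<open>|q| \<le> 1\<close> reduces the claim to i.i.d. products:
  the products of \<open>1 + iy\<close> drop out by conditional centring and are bounded in \<open>L\<^sub>2\<close>, while the
  products of \<open>q\<close> converge in \<open>L\<^sub>2\<close> to a constant.
\<close>

lemma conditional_CLT:
  fixes w :: "nat \<Rightarrow> 'x \<times> 't \<Rightarrow> real" and G :: "nat \<Rightarrow> (nat \<Rightarrow> 'x) \<Rightarrow> complex"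
  assumes N: "\<And>n. prob_space (N n)" "\<And>n. sets (N n) = sets (MX \<Otimes>\<^sub>M MT)"
    and cc: "\<And>n. cond_centered MX (N n) (w n)" and w2: "\<And>n. integrable (N n) (\<lambda>z. (w n z)^2)"
    and V: "(\<lambda>n. LINT z|N n. (w n z)^2) \<longlonglongrightarrow> V"
    and ui: "(\<lambda>n. LINT z|N n. (w n z)^2 * min 1 (\<bar>w n z\<bar> / sqrt (real n))) \<longlonglongrightarrow> 0"
    and G: "\<And>n. G n \<in> borel_measurable (PiM {..<n} (\<lambda>_. MX))" "\<And>n x. norm (G n x) \<le> 1"
  shows "(\<lambda>n. (LINT zs|iid (N n). G n (observed n zs) * iexp (s * ((\<Sum>j<n. w n (zs j)) / sqrt (real n))))
      - of_real (exp (- (s^2 * V) / 2)) * (LINT zs|iid (N n). G n (observed n zs))) \<longlonglongrightarrow> 0"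
proof -
  have w [measurable]: "w n \<in> borel_measurable (N n)" for n
    using cc[of n] by (auto simp: cond_centered_def)
  define v where "v n z = s * w n z" for n z
  have v: "\<And>n. v n \<in> borel_measurable (N n)" unfolding v_def by measurable
  have v2: "\<And>n. integrable (N n) (\<lambda>z. (v n z)^2)" using w2 by (simp add: v_def power_mult_distrib)
  have vV: "(\<lambda>n. LINT z|N n. (v n z)^2) \<longlonglongrightarrow> s\<^sup>2 * V"
    using tendsto_mult[OF tendsto_const V, of "s\<^sup>2"] by (simp add: v_def power_mult_distrib)
  have vui: "(\<lambda>n. LINT z|N n. (v n z)^2 * min 1 (\<bar>v n z\<bar> / sqrt (real n))) \<longlonglongrightarrow> 0"
    unfolding v_def by (rule tendsto_min_scaled[OF w w2 ui])
  note tendsto = tendsto_second_order[OF N(1) v v2 vV vui]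
  define q where "q x = iexp x / (1 + \<i> * x)" for x :: real
  have [measurable]: "q \<in> borel_measurable borel" unfolding q_def by measurable
  have norm_D: "(norm (1 + \<i> * of_real x))^2 = 1 + x^2" for x :: real by (simp add: cmod_power2)
  have q_norm: "(norm (q x))^2 = 1 / (1 + x^2)" for x
    by (simp add: q_def norm_divide power_divide norm_D)
  define y where "y n z = v n z / sqrt (real n)" for n z
  have [measurable]: "y n \<in> borel_measurable (N n)" for n using v unfolding y_def by measurable
  have y2: "integrable (N n) (\<lambda>z. (y n z)^2)" for n using v2 by (simp add: y_def power_divide)
  \<comment> \<open>The three rates have the limits \<open>- s^2 V\<close>, 0 and
    \<open>- s^2 V / 2\<close>, and for this c the expression
    \<open>e^(- s^2 V) + c^2 - 2 c e^(- s^2 V / 2)\<close> vanishes.\<close>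
  define c where "c = exp (- (s^2 * V) / 2)"
  have q_int: "integrable (N n) (\<lambda>z. (norm (q (y n z)))^2)" for n
  proof -
    have "1 / (1 + x^2) \<le> 1" for x :: real by (simp add: divide_le_eq add_pos_nonneg)
    then show ?thesis
      unfolding q_norm by (intro prob_space.integrable_bounded[OF N(1), where B=1]) auto
  qed
  have one_int: "integrable (N n) (\<lambda>z. (norm (1::complex))^2)" for n
    using prob_space.finite_measure[OF N(1)] by (simp add: finite_measure.integrable_const)
  have D_lim: "(\<lambda>n. LINT zs|iid (N n). (norm ((\<Prod>j<n. q (y n (zs j))) - of_real c * (\<Prod>j<n. 1)))^2) \<longlonglongrightarrow>
     exp (- (s^2 * V)) + (norm (of_real c :: complex))^2 * exp 0 - 2 * Re (cnj (of_real c) * exp (- (1/2) * of_real (s^2 * V)))"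
  proof (rule iid_prod_approx[OF N(1)])
    show "(\<lambda>n. real n * ((LINT z|N n. (norm (q (y n z)))^2) - 1)) \<longlonglongrightarrow> - (s^2 * V)"
      unfolding q_norm y_def using tendsto[of "\<lambda>x. 1 / (1 + x^2)" "-1" 2] second_order_ratio(2) by simp
    show "(\<lambda>n. real n * ((LINT z|N n. (norm (1::complex))^2) - 1)) \<longlonglongrightarrow> 0"
      using N(1) by (simp add: prob_space.prob_space)
    show "(\<lambda>n. of_nat n * ((LINT z|N n. q (y n z) * cnj 1) - 1)) \<longlonglongrightarrow> - (1/2) * of_real (s^2 * V)"
      using tendsto[of q "-1/2" 2] second_order_ratio(1) by (simp add: y_def q_def)
  qed (rule q_int one_int | simp)+
  define D where "D n = (LINT zs|iid (N n). (norm ((\<Prod>j<n. q (y n (zs j))) - of_real c))^2)" for n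
  have cc': "c\<^sup>2 = exp (- (s^2 * V))" "c * exp (- (s^2 * V) / 2) = exp (- (s^2 * V))"
    by (simp_all add: c_def power2_eq_square flip: exp_add)
  have "complex_of_real (exp (- (s^2 * V) / 2)) = exp (- (1/2) * of_real (s^2 * V))"
    by (subst exp_of_real[symmetric]) simp
  then have "Re (cnj (of_real c) * exp (- (1/2) * of_real (s^2 * V))) = c * exp (- (s^2 * V) / 2)"
    by (metis Re_complex_of_real complex_cnj_complex_of_real of_real_mult)
  then have "exp (- (s^2 * V)) + (norm (of_real c :: complex))^2 * exp 0 - 2 * Re (cnj (of_real c) * exp (- (1/2) * of_real (s^2 * V))) = 0"
    by (simp only: cc'(2)) (simp add: cc'(1))
  with D_lim have D: "D \<longlonglongrightarrow> 0" unfolding D_def by (simp only: prod.neutral_const mult_1_right)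
  \<comment> \<open>The squared modulus of \<open>1 + i y\<close> is \<open>1 + y^2\<close>, so the
    second moment of the product is an nth power with a finite limit.\<close>
  have P2: "(LINT zs|iid (N n). (norm (\<Prod>j<n. 1 + \<i> * of_real (y n (zs j))))^2) = (LINT z|N n. 1 + (y n z)^2) ^ n" and
    P2i: "integrable (iid (N n)) (\<lambda>zs. (norm (\<Prod>j<n. 1 + \<i> * of_real (y n (zs j))))^2)" for n
  proof -
    interpret prob_space "N n" by (rule N)
    have i: "integrable (N n) (\<lambda>z. 1 + (y n z)^2)" using y2 by simp
    have eq: "(norm (\<Prod>j<n. 1 + \<i> * of_real (y n (zs j))))^2 = (\<Prod>j<n. 1 + (y n (zs j))^2)" for zs
      by (simp add: prod_norm[symmetric] prod_power_distrib norm_D)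
    show "(LINT zs|iid (N n). (norm (\<Prod>j<n. 1 + \<i> * of_real (y n (zs j))))^2) = (LINT z|N n. 1 + (y n z)^2) ^ n"
      "integrable (iid (N n)) (\<lambda>zs. (norm (\<Prod>j<n. 1 + \<i> * of_real (y n (zs j))))^2)"
      unfolding eq using integral_iid_prod[OF N(1) i] integrable_iid_prod[OF N(1) i] by auto
  qed
  have P2_lim: "(\<lambda>n. (LINT z|N n. 1 + (y n z)^2) ^ n) \<longlonglongrightarrow> exp (s^2 * V)"
    using tendsto[of "\<lambda>x. 1 + x^2" 1 0] by (intro power_tendsto_exp_real) (simp add: y_def)
  show ?thesis
  proof (rule Lim_null_comparison)
    show "(\<lambda>n. sqrt ((LINT z|N n. 1 + (y n z)^2) ^ n) * sqrt (D n)) \<longlonglongrightarrow> 0"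
      using tendsto_mult[OF tendsto_real_sqrt[OF P2_lim] tendsto_real_sqrt[OF D]] by simp
    show "\<forall>\<^sub>F n in sequentially. norm ((LINT zs|iid (N n). G n (observed n zs) * iexp (s * ((\<Sum>j<n. w n (zs j)) / sqrt (real n))))
      - of_real (exp (- (s^2 * V) / 2)) * (LINT zs|iid (N n). G n (observed n zs))) \<le> sqrt ((LINT z|N n. 1 + (y n z)^2) ^ n) * sqrt (D n)"
    proof (intro always_eventually allI)
      fix n
      interpret iid: prob_space "iid (N n)" by (intro prob_space_iid N)
      note [measurable] = measurable_iid_component measurable_observed[OF N] G(1)
      define P Q where "P zs = (\<Prod>j<n. 1 + \<i> * of_real (y n (zs j)))" and "Q zs = (\<Prod>j<n. q (y n (zs j)))" for zs
      have [measurable]: "(\<lambda>zs. y n (zs j)) \<in> borel_measurable (iid (N n))" for j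
        by (rule measurable_iid_component) simp
      have [measurable]: "P \<in> borel_measurable (iid (N n))" "Q \<in> borel_measurable (iid (N n))"
        unfolding P_def Q_def by measurable
      have g [measurable]: "(\<lambda>zs. G n (observed n zs)) \<in> borel_measurable (iid (N n))" by measurable
      have PQ: "P zs * Q zs = iexp (s * ((\<Sum>j<n. w n (zs j)) / sqrt (real n)))" for zs
      proof -
        have "1 + \<i> * of_real x \<noteq> 0" for x :: real by (auto simp: complex_eq_iff)
        then have "(1 + \<i> * of_real x) * q x = iexp x" for x by (simp add: q_def)
        then have "P zs * Q zs = (\<Prod>j<n. iexp (y n (zs j)))"
          by (simp add: P_def Q_def flip: prod.distrib)
        also have "\<dots> = exp (\<Sum>j<n. \<i> * of_real (y n (zs j)))" by (simp add: exp_sum)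
        also have "(\<Sum>j<n. \<i> * of_real (y n (zs j))) = \<i> * of_real (s * ((\<Sum>j<n. w n (zs j)) / sqrt (real n)))"
          by (simp add: y_def v_def sum_distrib_left sum_divide_distrib)
        finally show ?thesis .
      qed
      have iP: "integrable (iid (N n)) (\<lambda>zs. (norm (P zs))^2)" using P2i by (simp add: P_def)
      have iQ: "integrable (iid (N n)) (\<lambda>zs. (norm (Q zs - of_real c))^2)"
        using integral_iid_prod_diff(1)[OF N(1) _ _ q_int one_int, of n n c] by (simp add: Q_def)
      have PG: "(LINT zs|iid (N n). G n (observed n zs) * P zs) = (LINT zs|iid (N n). G n (observed n zs))"
        using integral_observed_martingale[OF N(1)[of n] N(2)[of n] cc[of n] G, where c="\<i> * of_real (s / sqrt (real n))"]
        by (simp only: P_def y_def v_def) (simp add: ac_simps)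
      have iP1: "integrable (iid (N n)) P"
        using integrable_mult_square[of P "iid (N n)" "\<lambda>_. 1"] iP iid.integrable_bounded[of "\<lambda>_. 1::real" 1] by simp
      have iGP: "integrable (iid (N n)) (\<lambda>zs. G n (observed n zs) * P zs)"
        by (rule Bochner_Integration.integrable_bound[OF iP1])
          (use G(2) in \<open>auto simp: norm_mult intro!: mult_left_le_one_le\<close>)
      have iGE: "integrable (iid (N n)) (\<lambda>zs. G n (observed n zs) * (P zs * Q zs))"
        using G(2) by (intro iid.integrable_bounded[where B=1]) (auto simp: PQ norm_mult)
      \<comment> \<open>By \<open>PG\<close>, \<open>c E G\<close> equals \<open>c E (G P)\<close>,
        so the difference is \<open>E (G P (Q - c))\<close>, to which the Cauchy-Schwarz inequality
        applies.\<close>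
      have "norm ((LINT zs|iid (N n). G n (observed n zs) * (P zs * Q zs)) - c * (LINT zs|iid (N n). G n (observed n zs))) =
         norm (LINT zs|iid (N n). G n (observed n zs) * (P zs * Q zs) - c * (G n (observed n zs) * P zs))"
        using iGE iGP by (simp add: PG)
      also have "\<dots> \<le> (LINT zs|iid (N n). norm (G n (observed n zs) * (P zs * Q zs) - c * (G n (observed n zs) * P zs)))"
        by (rule integral_norm_bound)
      also have "\<dots> \<le> (LINT zs|iid (N n). norm (P zs * (Q zs - c)))"
      proof (rule integral_mono)
        show "integrable (iid (N n)) (\<lambda>zs. norm (P zs * (Q zs - c)))"
          using iP iQ by (intro integrable_norm integrable_mult_square) auto
        fix zs
        have "G n (observed n zs) * (P zs * Q zs) - c * (G n (observed n zs) * P zs) = G n (observed n zs) * (P zs * (Q zs - c))"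
          by (simp add: algebra_simps)
        then show "norm (G n (observed n zs) * (P zs * Q zs) - c * (G n (observed n zs) * P zs)) \<le> norm (P zs * (Q zs - c))"
          using G(2) by (simp add: norm_mult[of "G n _"] mult_left_le_one_le del: norm_mult)
      qed (use iGE iGP in auto)
      also have "\<dots> \<le> sqrt (LINT zs|iid (N n). (norm (P zs))^2) * sqrt (LINT zs|iid (N n). (norm (Q zs - c))^2)"
        using iP iQ by (intro integral_norm_mult_le) auto
      also have "\<dots> = sqrt ((LINT z|N n. 1 + (y n z)^2) ^ n) * sqrt (D n)"
        unfolding P2[symmetric] by (simp add: P_def Q_def D_def)
      finally show "norm ((LINT zs|iid (N n). G n (observed n zs) * iexp (s * ((\<Sum>j<n. w n (zs j)) / sqrt (real n))))
          - of_real (exp (- (s^2 * V) / 2)) * (LINT zs|iid (N n). G n (observed n zs))) \<le> sqrt ((LINT z|N n. 1 + (y n z)^2) ^ n) * sqrt (D n)"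
        unfolding PQ c_def .
    qed
  qed
qed

text \<open>Convergence in law and of second moments makes the squares uniformly integrable: the
  mean excess of \<open>w^2\<close> over a level K is the second moment minus the mean of
  \<open>min (w^2) K\<close>, and both converge.\<close>

lemma uniformly_integrable_square:
  fixes w :: "nat \<Rightarrow> 'a \<Rightarrow> real" and w0 :: "'b \<Rightarrow> real"
  assumes w: "\<And>n. w n \<in> borel_measurable (N n)" and w2: "\<And>n. integrable (N n) (\<lambda>z. (w n z)^2)"
    and N: "\<And>n. prob_space (N n)" and w0: "w0 \<in> borel_measurable F" "integrable F (\<lambda>z. (w0 z)^2)"
    and law: "weakly_tends (\<lambda>n. distr (N n) borel (w n)) (distr F borel w0) sequentially"
    and V: "(\<lambda>n. LINT z|N n. (w n z)^2) \<longlonglongrightarrow> (LINT z|F. (w0 z)^2)"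
  shows "(\<lambda>n. LINT z|N n. (w n z)^2 * min 1 (\<bar>w n z\<bar> / sqrt (real n))) \<longlonglongrightarrow> 0"
proof (rule tendstoI)
  note [measurable] = w w0(1)
  fix e :: real assume "e > 0"
  define g where "g K x = min (x^2) K" for K x :: real
  have g: "continuous_on UNIV (g K)" "bounded (range (g K))" if "K \<ge> 0" for K
  proof -
    show "continuous_on UNIV (g K)" unfolding g_def by (intro continuous_intros)
    show "bounded (range (g K))"
      using that by (auto simp: bounded_iff g_def min_def intro!: exI[of _ K])
  qed
  have [measurable]: "g K \<in> borel_measurable borel" for K unfolding g_def by measurable
  have "(\<lambda>i. LINT z|F. g (real i) (w0 z)) \<longlonglongrightarrow> (LINT z|F. (w0 z)^2)"
  proof (rule integral_dominated_convergence[where w="\<lambda>z. (w0 z)^2"])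
    show "AE z in F. (\<lambda>i. g (real i) (w0 z)) \<longlonglongrightarrow> (w0 z)\<^sup>2"
    proof (intro AE_I2 tendsto_eventually)
      fix z
      show "\<forall>\<^sub>F i in sequentially. g (real i) (w0 z) = (w0 z)^2"
        using eventually_ge_at_top[of "nat \<lceil>(w0 z)\<^sup>2\<rceil>"]
      proof eventually_elim
        case (elim i)
        then have "(w0 z)^2 \<le> real i" by linarith
        then show ?case by (simp add: g_def)
      qed
    qed
  qed (use w0 in \<open>auto simp: g_def\<close>)
  then have "\<forall>\<^sub>F i in sequentially. \<bar>(LINT z|F. g (real i) (w0 z)) - (LINT z|F. (w0 z)^2)\<bar> < e / 8"
    using \<open>e > 0\<close> unfolding tendsto_iff dist_real_def by (auto dest: spec[of _ "e/8"])
  then obtain i where i: "\<bar>(LINT z|F. g (real i) (w0 z)) - (LINT z|F. (w0 z)^2)\<bar> < e / 8"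
    by (auto simp: eventually_sequentially)
  define K where "K = real i"
  have K: "K \<ge> 0" by (simp add: K_def)
  have "(\<lambda>n. LINT x|distr (N n) borel (w n). g K x) \<longlonglongrightarrow> (LINT x|distr F borel w0. g K x)"
    using law g[OF K] unfolding weakly_tends_def by blast
  then have "(\<lambda>n. LINT z|N n. g K (w n z)) \<longlonglongrightarrow> (LINT z|F. g K (w0 z))" by (simp add: integral_distr)
  then have "(\<lambda>n. 2 * ((LINT z|N n. (w n z)^2) - (LINT z|N n. g K (w n z))) + 2 * K * sqrt (2 * K) * inverse (sqrt (real n))) \<longlonglongrightarrow>
      2 * ((LINT z|F. (w0 z)^2) - (LINT z|F. g K (w0 z))) + 2 * K * sqrt (2 * K) * 0"
    by (intro tendsto_intros V tendsto_inverse_0_at_top filterlim_compose[OF sqrt_at_top] filterlim_real_sequentially)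
  then have "\<forall>\<^sub>F n in sequentially. 2 * ((LINT z|N n. (w n z)^2) - (LINT z|N n. g K (w n z))) + 2 * K * sqrt (2 * K) * inverse (sqrt (real n)) < e"
  proof (rule order_tendstoD(2))
    have "(LINT z|F. (w0 z)^2) - (LINT z|F. g K (w0 z)) < e / 8" using i unfolding K_def by linarith
    then show "2 * ((LINT z|F. (w0 z)^2) - (LINT z|F. g K (w0 z))) + 2 * K * sqrt (2 * K) * 0 < e"
      using \<open>e > 0\<close> by simp
  qed
  then show "\<forall>\<^sub>F n in sequentially. dist (LINT z|N n. (w n z)^2 * min 1 (\<bar>w n z\<bar> / sqrt (real n))) 0 < e"
    using eventually_gt_at_top[of 0]
  proof eventually_elim
    case (elim n)
    interpret prob_space "N n" by (rule N)
    have ig: "integrable (N n) (\<lambda>z. g K (w n z))"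
      using K by (intro integrable_bounded[where B=K]) (auto simp: g_def)
    \<comment> \<open>If \<open>x^2 \<le> 2 K\<close> the left-hand side is of order 1 / sqrt n.
      Otherwise \<open>x^2 < 2 (x^2 - K)\<close>, so the excess over K dominates.\<close>
    have bound: "x\<^sup>2 * min 1 (\<bar>x\<bar> / sqrt (real n)) \<le> 2 * (x^2 - g K x) + 2 * K * sqrt (2 * K) * inverse (sqrt (real n))" for x
    proof (cases "x\<^sup>2 \<le> 2 * K")
      case True
      then have "\<bar>x\<bar> \<le> sqrt (2 * K)" by (simp add: real_le_rsqrt)
      have "x\<^sup>2 * min 1 (\<bar>x\<bar> / sqrt (real n)) \<le> x\<^sup>2 * (\<bar>x\<bar> / sqrt (real n))"
        by (intro mult_left_mono) auto
      also have "\<dots> \<le> (2 * K) * (sqrt (2 * K) / sqrt (real n))"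
        using True K \<open>\<bar>x\<bar> \<le> sqrt (2 * K)\<close> by (intro mult_mono divide_right_mono) auto
      finally show ?thesis by (simp add: g_def divide_inverse)
    next
      case False
      have "x\<^sup>2 * min 1 (\<bar>x\<bar> / sqrt (real n)) \<le> x\<^sup>2 * 1" by (intro mult_left_mono) auto
      moreover have "0 \<le> 2 * K * sqrt (2 * K) * inverse (sqrt (real n))" using K by simp
      moreover have "g K x = K" using False K by (simp add: g_def)
      moreover have "A \<le> 2 * (y - G) + T" if "A \<le> y * 1" "0 \<le> T" "G = K" "\<not> y \<le> 2 * K" for A T G y :: real
        using that by simp
      ultimately show ?thesis using False by blast
    qed
    have im: "integrable (N n) (\<lambda>z. (w n z)^2 * min 1 (\<bar>w n z\<bar> / sqrt (real n)))"
    proof (rule Bochner_Integration.integrable_bound[OF w2])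
      show "AE z in N n. norm ((w n z)^2 * min 1 (\<bar>w n z\<bar> / sqrt (real n))) \<le> norm ((w n z)^2)"
        by (intro AE_I2) (auto simp: abs_mult intro!: mult_right_le_one_le)
    qed measurable
    have "(LINT z|N n. (w n z)^2 * min 1 (\<bar>w n z\<bar> / sqrt (real n))) \<le>
        (LINT z|N n. 2 * ((w n z)^2 - g K (w n z)) + 2 * K * sqrt (2 * K) * inverse (sqrt (real n)))"
      using im w2 ig bound by (intro integral_mono) auto
    also have "\<dots> = 2 * ((LINT z|N n. (w n z)^2) - (LINT z|N n. g K (w n z))) + 2 * K * sqrt (2 * K) * inverse (sqrt (real n))"
      using w2 ig by (simp add: prob_space)
    finally have "(LINT z|N n. (w n z)^2 * min 1 (\<bar>w n z\<bar> / sqrt (real n))) < e" using elim by simp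
    moreover have "0 \<le> (LINT z|N n. (w n z)^2 * min 1 (\<bar>w n z\<bar> / sqrt (real n)))"
      by (intro integral_nonneg_AE AE_I2) simp
    ultimately show ?case by simp
  qed
qed

lemma integrable_truncation:
  fixes g :: "'a \<Rightarrow> real"
  assumes g: "integrable M g" "\<And>x. 0 \<le> g x" and "e > 0"
  obtains K :: real where "K > 0" "(LINT x|M. g x - min (g x) K) < e"
proof -
  have "(\<lambda>i. LINT x|M. g x - min (g x) (real i)) \<longlonglongrightarrow> (LINT x|M. 0)"
  proof (rule integral_dominated_convergence[where w=g])
    show "AE x in M. (\<lambda>i. g x - min (g x) (real i)) \<longlonglongrightarrow> 0"
    proof (intro AE_I2 tendsto_eventually)
      fix x
      show "\<forall>\<^sub>F i in sequentially. g x - min (g x) (real i) = 0"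
        using eventually_ge_at_top[of "nat \<lceil>g x\<rceil>"]
      proof eventually_elim
        case (elim i)
        then have "g x \<le> real i" by linarith
        then show ?case by simp
      qed
    qed
  qed (use g in \<open>auto simp: min_def\<close>)
  then have "\<forall>\<^sub>F i in sequentially. (LINT x|M. g x - min (g x) (real i)) < e"
    using \<open>e > 0\<close> by (intro order_tendstoD) auto
  then have "\<forall>\<^sub>F i in sequentially. 0 < i \<and> (LINT x|M. g x - min (g x) (real i)) < e"
    using eventually_gt_at_top[of 0] by eventually_elim auto
  then obtain i where "0 < i" "(LINT x|M. g x - min (g x) (real i)) < e"
    by (auto simp: eventually_sequentially)
  then show thesis by (intro that[of "real i"]) auto
qed

text \<open>Splitting \<open>g\<close> at a level K leaves K times the mean of Z, which vanishes in
  the limit, and B times a small tail of \<open>g\<close>. Convergence of Z in mean thus suffices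
  against an unbounded integrable weight.\<close>

lemma integral_mult_tendsto_0:
  fixes g :: "'a \<Rightarrow> real" and Z :: "'i \<Rightarrow> 'a \<Rightarrow> real"
  assumes g: "integrable M g" "\<And>x. 0 \<le> g x"
    and Z: "\<forall>\<^sub>F n in A. Z n \<in> borel_measurable M" "\<And>n x. 0 \<le> Z n x" "\<And>n x. Z n x \<le> B"
    and int: "\<forall>\<^sub>F n in A. integrable M (Z n)" and lim: "((\<lambda>n. LINT x|M. Z n x) \<longlongrightarrow> 0) A"
  shows "((\<lambda>n. LINT x|M. g x * Z n x) \<longlongrightarrow> 0) A"
proof (rule tendstoI)
  fix e :: real assume "e > 0"
  have B: "0 \<le> B" using Z(2,3) order_trans by blast
  obtain K where K: "K > 0" "(LINT x|M. g x - min (g x) K) < e / (2 * (B + 1))"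
    using integrable_truncation[OF g, of "e / (2 * (B + 1))"] \<open>e > 0\<close> B by auto
  have ig: "integrable M (\<lambda>x. g x - min (g x) K)"
    using g K(1) by (intro Bochner_Integration.integrable_bound[OF g(1)]) (auto simp: min_def)
  have "\<forall>\<^sub>F n in A. (LINT x|M. Z n x) < e / (2 * K)"
    using lim \<open>e > 0\<close> K(1) by (intro order_tendstoD) auto
  with Z(1) int show "\<forall>\<^sub>F n in A. dist (LINT x|M. g x * Z n x) 0 < e"
  proof eventually_elim
    case (elim n)
    have igZ: "integrable M (\<lambda>x. g x * Z n x)"
    proof (rule Bochner_Integration.integrable_bound)
      show "integrable M (\<lambda>x. B * g x)" using g by simp
      show "AE x in M. norm (g x * Z n x) \<le> norm (B * g x)"
        using mult_left_mono[OF Z(3) g(2)] Z(2) g(2) B by (intro AE_I2) (simp add: abs_mult mult.commute)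
    qed (use g elim in auto)
    have "(LINT x|M. g x * Z n x) \<le> (LINT x|M. K * Z n x + B * (g x - min (g x) K))"
    proof (rule integral_mono)
      fix x
      have "g x * Z n x = min (g x) K * Z n x + (g x - min (g x) K) * Z n x" by (simp add: algebra_simps)
      also have "\<dots> \<le> K * Z n x + (g x - min (g x) K) * B"
        using Z(2,3) K(1) by (intro add_mono mult_mono) auto
      finally show "g x * Z n x \<le> K * Z n x + B * (g x - min (g x) K)" by (simp add: mult.commute)
    qed (use igZ ig elim in auto)
    also have "\<dots> = K * (LINT x|M. Z n x) + B * (LINT x|M. g x - min (g x) K)" using ig elim by simp
    also have "\<dots> < K * (e / (2 * K)) + e / 2"
    proof (rule add_less_le_mono)
      show "K * (LINT x|M. Z n x) < K * (e / (2 * K))"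
        using elim K(1) by (intro mult_strict_left_mono) auto
      have "B * (LINT x|M. g x - min (g x) K) \<le> (B + 1) * (e / (2 * (B + 1)))"
        using K B by (intro mult_mono) (auto intro!: integral_nonneg_AE)
      also have "(B + 1) * (e / (2 * (B + 1))) = e / 2" using B by (simp add: divide_simps)
      finally show "B * (LINT x|M. g x - min (g x) K) \<le> e / 2" .
    qed
    also have "\<dots> = e" using K(1) by simp
    finally show ?case using g(2) Z(2) by (simp add: abs_of_nonneg integral_nonneg_AE)
  qed
qed

section \<open>Local asymptotics of the likelihood ratio\<close>

lemma integral_marginal:
  fixes h :: "'x \<Rightarrow> 'b::{banach, second_countable_topology}"
  assumes F: "prob_space F" "sets F = sets (MX \<Otimes>\<^sub>M MT)" and h: "h \<in> borel_measurable MX"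
  shows "(LINT x|marginal_X MX F. h x) = (LINT z|F. h (fst z))"
    and "integrable (marginal_X MX F) h \<longleftrightarrow> integrable F (\<lambda>z. h (fst z))"
  using measurable_fst_sets[OF F] h unfolding marginal_X_def
  by (auto simp: integral_distr integrable_distr_eq)

text \<open>The cap at 1 keeps the parameter in the interval on which a curve is controlled and
  affects finitely many n only. At n = 0 the quotient is 0 by convention.\<close>

lemma local_parameter:
  fixes c :: real
  assumes "c > 0"
  defines "t \<equiv> \<lambda>n. min 1 (c / sqrt (real n))"
  shows "t n \<in> {0..1}" "\<forall>\<^sub>F n in sequentially. t n = c / sqrt (real n) \<and> n > 0"
    "filterlim t (at_right 0) sequentially"
proof -
  show "t n \<in> {0..1}" using assms by auto
  have lim: "(\<lambda>n. c / sqrt (real n)) \<longlonglongrightarrow> 0"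
    unfolding divide_inverse using tendsto_mult[OF tendsto_const tendsto_inverse_0_at_top, of "\<lambda>n. sqrt (real n)" sequentially c]
    by (simp add: filterlim_compose[OF sqrt_at_top filterlim_real_sequentially])
  then have "\<forall>\<^sub>F n in sequentially. c / sqrt (real n) < 1" by (rule order_tendstoD) simp
  then show ev: "\<forall>\<^sub>F n in sequentially. t n = c / sqrt (real n) \<and> n > 0"
    using eventually_gt_at_top[of 0] by eventually_elim (simp add: t_def)
  have "t \<longlonglongrightarrow> 0" using lim by (rule Lim_transform_eventually) (use ev in eventually_elim, simp)
  moreover have "\<forall>\<^sub>F n in sequentially. t n \<in> {0<..} \<and> t n \<noteq> 0"
    using ev by eventually_elim (use assms in auto)
  ultimately show "filterlim t (at_right 0) sequentially"
    unfolding filterlim_at by (auto elim: eventually_mono)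
qed

text \<open>
  Writing \<open>\<surd>f\<^sub>t = 1 + t\<rho>/2 + r\<close>, the two conditions on \<open>f\<^sub>t\<close> force \<open>E\<rho> = 0\<close> at first order and
  \<open>Er \<approx> - t\<^sup>2 E\<rho>\<^sup>2/8\<close> at second order.
\<close>

lemma score_expansion:
  fixes t :: "nat \<Rightarrow> real"
  assumes M: "prob_space M" and \<rho>: "\<rho> \<in> borel_measurable M" "integrable M (\<lambda>x. (\<rho> x)^2)"
    and f: "\<And>n. f n \<in> borel_measurable M" "\<And>n x. x \<in> space M \<Longrightarrow> 0 \<le> f n x" "\<And>n. integrable M (f n)"
    and t: "filterlim t (at_right 0) sequentially"
    and r: "(\<lambda>n. (LINT x|M. (sqrt (f n x) - 1 - t n * \<rho> x / 2)^2) / (t n)^2) \<longlonglongrightarrow> 0"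
    and mass: "(\<lambda>n. ((LINT x|M. f n x) - 1) / (t n)^2) \<longlonglongrightarrow> 0"
  shows "(LINT x|M. \<rho> x) = 0"
    and "(\<lambda>n. ((LINT x|M. sqrt (f n x) * (1 + t n * \<rho> x / 2)) - 1) / (t n)^2) \<longlonglongrightarrow> (LINT x|M. (\<rho> x)^2) / 8"
proof -
  interpret prob_space M by fact
  note [measurable] = \<rho>(1) f(1)
  define R where "R n x = sqrt (f n x) - 1 - t n * \<rho> x / 2" for n x
  have [measurable]: "R n \<in> borel_measurable M" for n unfolding R_def by measurable
  have one: "integrable M (\<lambda>x. (1::real)^2)" by simp
  have \<rho>i: "integrable M \<rho>" using integrable_mult_square[of "\<lambda>_. 1::real" M \<rho>] \<rho> by simp
  have sf2: "integrable M (\<lambda>x. (sqrt (f n x))^2)" for n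
    using f(3)[of n] by (subst Bochner_Integration.integrable_cong[OF refl]) (auto simp: f(2))
  have sfi: "integrable M (\<lambda>x. sqrt (f n x))" for n
    using integrable_mult_square[of "\<lambda>_. 1::real" M "\<lambda>x. sqrt (f n x)"] sf2[of n] by simp
  have sf\<rho>: "integrable M (\<lambda>x. sqrt (f n x) * \<rho> x)" for n
    using integrable_mult_square[of "\<lambda>x. sqrt (f n x)" M \<rho>] sf2[of n] \<rho> by simp
  have Ri: "integrable M (R n)" for n unfolding R_def using sfi \<rho>i by simp
  have R\<rho>: "integrable M (\<lambda>x. R n x * \<rho> x)" for n
    unfolding R_def using sf\<rho>[of n] \<rho>i \<rho>(2) by (simp add: left_diff_distrib power2_eq_square[symmetric] mult.assoc)
  have R2: "integrable M (\<lambda>x. (R n x)^2)" for n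
  proof -
    have "(R n x)^2 = (sqrt (f n x))^2 + 1 + (t n)^2 / 4 * (\<rho> x)^2 - 2 * sqrt (f n x) - t n * (sqrt (f n x) * \<rho> x) + t n * \<rho> x" for x
      unfolding R_def by (simp add: power2_eq_square algebra_simps)
    then show ?thesis using sf2[of n] sfi[of n] sf\<rho>[of n] \<rho>i \<rho>(2) by simp
  qed
  define a b where "a = (LINT x|M. \<rho> x)" and "b = (LINT x|M. (\<rho> x)^2)"
  define r1 r2 r\<rho> where "r1 n = (LINT x|M. R n x)" and "r2 n = (LINT x|M. (R n x)^2)" and "r\<rho> n = (LINT x|M. R n x * \<rho> x)" for n
  have sf_eq: "sqrt (f n x) = R n x + 1 + t n * \<rho> x / 2" for n x by (simp add: R_def)
  have mass_eq: "(LINT x|M. f n x) - 1 = t n * a + (t n)^2 * b / 4 + 2 * r1 n + t n * r\<rho> n + r2 n" for n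
  proof -
    have "(LINT x|M. f n x) = (LINT x|M. (sqrt (f n x))^2)"
      by (intro Bochner_Integration.integral_cong) (auto simp: f(2))
    also have "\<dots> = (LINT x|M. 1 + t n * \<rho> x + (t n)^2 / 4 * (\<rho> x)^2 + 2 * R n x + t n * (R n x * \<rho> x) + (R n x)^2)"
      unfolding sf_eq by (intro Bochner_Integration.integral_cong) (auto simp: power2_eq_square algebra_simps)
    also have "\<dots> = 1 + t n * a + (t n)^2 / 4 * b + 2 * r1 n + t n * r\<rho> n + r2 n"
      using Ri[of n] R\<rho>[of n] R2[of n] \<rho>i \<rho>(2) by (simp add: a_def b_def r1_def r2_def r\<rho>_def prob_space)
    finally show ?thesis by simp
  qed
  have mix_eq: "(LINT x|M. sqrt (f n x) * (1 + t n * \<rho> x / 2)) - 1 = t n * a + (t n)^2 * b / 4 + r1 n + t n / 2 * r\<rho> n" for n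
  proof -
    have "(LINT x|M. sqrt (f n x) * (1 + t n * \<rho> x / 2)) = (LINT x|M. 1 + t n * \<rho> x + (t n)^2 / 4 * (\<rho> x)^2 + R n x + t n / 2 * (R n x * \<rho> x))"
      unfolding sf_eq by (intro Bochner_Integration.integral_cong) (auto simp: power2_eq_square algebra_simps)
    also have "\<dots> = 1 + t n * a + (t n)^2 / 4 * b + r1 n + t n / 2 * r\<rho> n"
      using Ri[of n] R\<rho>[of n] \<rho>i \<rho>(2) by (simp add: a_def b_def r1_def r\<rho>_def prob_space)
    finally show ?thesis by simp
  qed
  have t0: "t \<longlonglongrightarrow> 0" and tpos: "\<forall>\<^sub>F n in sequentially. t n > 0"
    using t by (auto simp: filterlim_at elim: eventually_mono)
  have r2_lim: "(\<lambda>n. r2 n / (t n)^2) \<longlonglongrightarrow> 0" using r by (simp add: r2_def R_def)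
  have CS: "\<bar>\<integral>x. R n x * g x \<partial>M\<bar> \<le> sqrt (r2 n) * sqrt (LINT x|M. (g x)^2)"
    if [measurable]: "g \<in> borel_measurable M" and "integrable M (\<lambda>x. (g x)^2)" for g n
    using integral_Cauchy_Schwarz[of "R n" M g] R2[of n] that
    by (simp add: r2_def real_sqrt_mult[symmetric] real_le_rsqrt)
  have root_lim: "(\<lambda>n. sqrt (r2 n) / t n * k) \<longlonglongrightarrow> 0" for k
  proof -
    have "(\<lambda>n. sqrt (r2 n / (t n)^2) * k) \<longlonglongrightarrow> sqrt 0 * k" by (intro tendsto_intros r2_lim)
    then have "(\<lambda>n. sqrt (r2 n / (t n)^2) * k) \<longlonglongrightarrow> 0" by simp
    then show ?thesis
      by (rule Lim_transform_eventually) (use tpos in eventually_elim, simp add: real_sqrt_divide)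
  qed
  have r1_lim: "(\<lambda>n. r1 n / t n) \<longlonglongrightarrow> 0"
  proof (rule Lim_null_comparison[OF _ root_lim[of 1]])
    show "\<forall>\<^sub>F n in sequentially. norm (r1 n / t n) \<le> sqrt (r2 n) / t n * 1"
      using tpos by eventually_elim (use CS[of "\<lambda>_. 1"] in \<open>simp add: r1_def prob_space divide_right_mono\<close>)
  qed
  have r\<rho>_lim: "(\<lambda>n. r\<rho> n / t n) \<longlonglongrightarrow> 0"
  proof (rule Lim_null_comparison[OF _ root_lim[of "sqrt b"]])
    show "\<forall>\<^sub>F n in sequentially. norm (r\<rho> n / t n) \<le> sqrt (r2 n) / t n * sqrt b"
      using tpos by eventually_elim (use CS[of \<rho>] \<rho> in \<open>simp add: r\<rho>_def b_def divide_right_mono\<close>)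
  qed
  define m where "m n = ((LINT x|M. f n x) - 1) / (t n)^2" for n
  have m: "m \<longlonglongrightarrow> 0" unfolding m_def by (rule mass)
  \<comment> \<open>The mass identity divided by t and solved for the constant
    \<open>E \<rho>\<close>; every term of the resulting expression tends to 0.\<close>
  have "(\<lambda>n. t n * m n - t n * b / 4 - 2 * (r1 n / t n) - t n * (r\<rho> n / t n) - t n * (r2 n / (t n)^2)) \<longlonglongrightarrow>
      0 * 0 - 0 * b / 4 - 2 * 0 - 0 * 0 - 0 * 0"
    by (intro tendsto_intros t0 m r1_lim r\<rho>_lim r2_lim) simp_all
  moreover have "\<forall>\<^sub>F n in sequentially. t n * m n - t n * b / 4 - 2 * (r1 n / t n) - t n * (r\<rho> n / t n) - t n * (r2 n / (t n)^2) = a"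
    using tpos
  proof eventually_elim
    case (elim n)
    then show ?case unfolding m_def mass_eq by (simp add: field_simps power2_eq_square)
  qed
  ultimately have "(\<lambda>n. a) \<longlonglongrightarrow> 0" by (auto intro: Lim_transform_eventually)
  then have a0: "a = 0" by (simp add: LIMSEQ_const_iff)
  then show "(LINT x|M. \<rho> x) = 0" by (simp add: a_def)
  \<comment> \<open>With \<open>E \<rho> = 0\<close>, the integrals \<open>r1\<close> and
    \<open>r\<rho>\<close> enter both identities only through \<open>r1 + t r\<rho> / 2\<close>. The
    mass identity determines this combination, and substituting it into \<open>mix_eq\<close> gives
    the present expression.\<close>
  have "(\<lambda>n. (m n + b / 4 - r2 n / (t n)^2) / 2) \<longlonglongrightarrow> (0 + b / 4 - 0) / 2"
    by (intro tendsto_intros m r2_lim) simp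
  then have lim: "(\<lambda>n. (m n + b / 4 - r2 n / (t n)^2) / 2) \<longlonglongrightarrow> b / 8" by simp
  show "(\<lambda>n. ((LINT x|M. sqrt (f n x) * (1 + t n * \<rho> x / 2)) - 1) / (t n)^2) \<longlonglongrightarrow> (LINT x|M. (\<rho> x)^2) / 8"
    unfolding b_def[symmetric]
  proof (rule Lim_transform_eventually[OF lim])
    show "\<forall>\<^sub>F n in sequentially. (m n + b / 4 - r2 n / (t n)^2) / 2 = ((LINT x|M. sqrt (f n x) * (1 + t n * \<rho> x / 2)) - 1) / (t n)^2"
      using tpos
    proof eventually_elim
      case (elim n)
      then show ?case unfolding m_def mass_eq mix_eq a0 by (simp add: field_simps)
    qed
  qed
qed

text \<open>An exchange of limits: the error of \<open>g i\<close> has the limit \<open>B i\<close>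
  in n, and \<open>B i\<close> vanishes as i grows. The closure lemmas use it with i indexing
  approximating directions, and \<open>good_score_limits\<close> with i indexing vanishing
  tilts.\<close>

lemma tendsto_approximation:
  fixes f :: "nat \<Rightarrow> 'a::real_normed_vector"
  assumes g: "\<And>i. g i \<longlonglongrightarrow> L i" and b: "\<And>i. b i \<longlonglongrightarrow> B i" and le: "\<And>i n. norm (f n - g i n) \<le> b i n"
    and B: "B \<longlonglongrightarrow> (0::real)" and L: "L \<longlonglongrightarrow> l"
  shows "f \<longlonglongrightarrow> l"
proof (rule tendstoI)
  fix e :: real assume "e > 0"
  have "\<forall>\<^sub>F i in sequentially. B i < e / 3" "\<forall>\<^sub>F i in sequentially. dist (L i) l < e / 3"
    using order_tendstoD(2)[OF B, of "e / 3"] tendstoD[OF L, of "e / 3"] \<open>e > 0\<close> by auto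
  then have "\<forall>\<^sub>F i in sequentially. B i < e / 3 \<and> dist (L i) l < e / 3" by eventually_elim auto
  then obtain i where i: "B i < e / 3" "dist (L i) l < e / 3"
    by (auto simp: eventually_sequentially)
  have "\<forall>\<^sub>F n in sequentially. b i n < e / 3" "\<forall>\<^sub>F n in sequentially. dist (g i n) (L i) < e / 3"
    using order_tendstoD(2)[OF b i(1)] tendstoD[OF g[of i], of "e/3"] \<open>e > 0\<close> by auto
  then show "\<forall>\<^sub>F n in sequentially. dist (f n) l < e"
  proof eventually_elim
    case (elim n)
    have "dist (f n) l \<le> dist (f n) (g i n) + dist (g i n) (L i) + dist (L i) l"
      using dist_triangle[of "f n" l "g i n"] dist_triangle[of "g i n" l "L i"] by linarith
    then show ?case using elim i le[of n i] by (simp add: dist_norm)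
  qed
qed

section \<open>Likelihood products and normalised sums under F0\<close>

locale local_model =
  fixes MX :: "'x measure" and MT :: "'t measure" and F0 :: "('x \<times> 't) measure"
  assumes prob_F0: "prob_space F0" and sets_F0: "sets F0 = sets (MX \<Otimes>\<^sub>M MT)"
begin

abbreviation "M0 \<equiv> marginal_X MX F0"
abbreviation "P0 \<equiv> iid F0"

sublocale F0: prob_space F0 by (rule prob_F0)
sublocale M0: prob_space M0 by (rule prob_space_marginal[OF prob_F0 sets_F0])
sublocale P0: prob_space P0 by (rule prob_space_iid[OF prob_F0])

lemmas sets_M0 [measurable_cong] = sets_marginal[OF prob_F0 sets_F0]
lemmas measurable_fst_F0 [measurable] = measurable_fst_sets[OF prob_F0 sets_F0]
lemmas integral_M0 = integral_marginal[OF prob_F0 sets_F0]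

lemma measurable_P0_fst [measurable]: "(\<lambda>zs. fst (zs j)) \<in> measurable P0 MX"
  by (rule measurable_iid_component) (rule measurable_fst_F0)

text \<open>Centring is built in because it makes the linear term of every factor of
  \<open>lik\<close> integrate to 0. Scores satisfy it by \<open>score_LAN\<close>.\<close>

definition L20 :: "('x \<Rightarrow> real) set" where
  "L20 = {h \<in> borel_measurable MX. integrable M0 (\<lambda>x. (h x)^2) \<and> (LINT x|M0. h x) = 0}"

definition ip :: "('x \<Rightarrow> real) \<Rightarrow> ('x \<Rightarrow> real) \<Rightarrow> real" where
  "ip h k = (LINT x|M0. h x * k x)"

text \<open>Asymptotically, and up to a constant, this is the product of the roots of the densities
  of the observations along a curve with score h: a root density is \<open>1 + t h / 2\<close> to
  first order, taken at \<open>t = 1 / sqrt n\<close>. Its square stands for the likelihood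
  ratio.\<close>

definition lik :: "nat \<Rightarrow> ('x \<Rightarrow> complex) \<Rightarrow> (nat \<Rightarrow> 'x \<times> 't) \<Rightarrow> complex" where
  "lik n h zs = (\<Prod>j<n. 1 + h (fst (zs j)) / of_real (2 * sqrt (real n)))"

text \<open>This is \<open>D\<^sub>n(h)\<close> of the overview.\<close>

definition fluct :: "nat \<Rightarrow> ('x \<Rightarrow> real) \<Rightarrow> (nat \<Rightarrow> 'x \<times> 't) \<Rightarrow> real" where
  "fluct n h zs = (\<Sum>j<n. h (fst (zs j))) / sqrt (real n)"

lemma L2_space_iff: "h \<in> L2_space M0 \<longleftrightarrow> h \<in> borel_measurable MX \<and> integrable M0 (\<lambda>x. (h x)^2)"
  by (simp add: L2_space_def measurable_cong_sets[OF sets_M0 refl])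

lemma L20D:
  assumes "h \<in> L20"
  shows "h \<in> borel_measurable MX" "integrable M0 (\<lambda>x. (h x)^2)" "(LINT x|M0. h x) = 0" "integrable M0 h" "h \<in> L2_space M0"
proof -
  show *: "h \<in> borel_measurable MX" "integrable M0 (\<lambda>x. (h x)^2)" "(LINT x|M0. h x) = 0"
    using assms by (auto simp: L20_def)
  then show "integrable M0 h"
    using integrable_mult_square[of "\<lambda>_. 1::real" M0 h] by (simp add: measurable_cong_sets[OF sets_M0 refl])
  show "h \<in> L2_space M0" using * by (simp add: L2_space_iff)
qed

lemma L2_mult_integrable:
  assumes "h \<in> L2_space M0" "k \<in> L2_space M0"
  shows "integrable M0 (\<lambda>x. h x * k x)"
  using assms unfolding L2_space_def by (intro integrable_mult_square) auto

lemma ip_commute: "ip h k = ip k h"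
  by (simp add: ip_def mult.commute)

lemma L2_lincomb:
  assumes "h \<in> L2_space M0" "k \<in> L2_space M0"
  shows "(\<lambda>x. a * h x + b * k x) \<in> L2_space M0"
proof -
  have "integrable M0 (\<lambda>x. a\<^sup>2 * (h x)^2 + b^2 * (k x)^2 + 2 * a * b * (h x * k x))"
    using L2_mult_integrable[OF assms] assms by (simp add: L2_space_def)
  then have "integrable M0 (\<lambda>x. (a * h x + b * k x)^2)"
    by (rule Bochner_Integration.integrable_cong[THEN iffD1, rotated 2]) (auto simp: power2_eq_square algebra_simps)
  then show ?thesis using assms by (auto simp: L2_space_def)
qed

lemma L20_lincomb:
  assumes "h \<in> L20" "k \<in> L20"
  shows "(\<lambda>x. a * h x + b * k x) \<in> L20"
  using L2_lincomb[of h k a b] L20D[OF assms(1)] L20D[OF assms(2)]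
  by (simp add: L20_def L2_space_iff)

lemma L20_scale: "h \<in> L20 \<Longrightarrow> (\<lambda>x. a * h x) \<in> L20"
  using L20_lincomb[of h h a 0] by simp

lemma L20_diff: "h \<in> L20 \<Longrightarrow> k \<in> L20 \<Longrightarrow> (\<lambda>x. h x - k x) \<in> L20"
  using L20_lincomb[of h k 1 "-1"] by simp

lemma ip_lincomb:
  assumes "h \<in> L2_space M0" "k \<in> L2_space M0" "g \<in> L2_space M0"
  shows "ip (\<lambda>x. a * h x + b * k x) g = a * ip h g + b * ip k g"
    and "ip g (\<lambda>x. a * h x + b * k x) = a * ip g h + b * ip g k"
proof -
  show *: "ip (\<lambda>x. a * h x + b * k x) g = a * ip h g + b * ip k g"
    using L2_mult_integrable[OF assms(1,3)] L2_mult_integrable[OF assms(2,3)]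
    by (simp add: ip_def distrib_right mult.assoc)
  show "ip g (\<lambda>x. a * h x + b * k x) = a * ip g h + b * ip g k" using * by (simp add: ip_commute)
qed

lemma ip_diff:
  assumes "h \<in> L2_space M0" "k \<in> L2_space M0"
  shows "ip (\<lambda>x. h x - k x) (\<lambda>x. h x - k x) = ip h h - 2 * ip h k + ip k k"
  using ip_lincomb[OF assms L2_lincomb[OF assms, of 1 "-1"], of 1 "-1"] ip_lincomb(2)[OF assms assms(1), of 1 "-1"]
    ip_lincomb(2)[OF assms assms(2), of 1 "-1"] by (simp add: ip_commute)

lemma ip_CS:
  assumes "h \<in> L2_space M0" "k \<in> L2_space M0"
  shows "\<bar>ip h k\<bar> \<le> sqrt (ip h h) * sqrt (ip k k)"
  using integral_Cauchy_Schwarz[of h M0 k] assms unfolding real_sqrt_mult[symmetric]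
  by (intro real_le_rsqrt) (simp add: ip_def L2_space_def power2_eq_square)

lemma ip_self_nonneg: "0 \<le> ip h h"
  by (simp add: ip_def)

lemma ip_tendsto:
  assumes h: "h \<in> L2_space M0" and k: "\<And>i::nat. k i \<in> L2_space M0"
    and lim: "(\<lambda>i. ip (\<lambda>x. h x - k i x) (\<lambda>x. h x - k i x)) \<longlonglongrightarrow> 0"
  shows "g \<in> L2_space M0 \<Longrightarrow> (\<lambda>i. ip g (k i)) \<longlonglongrightarrow> ip g h" and "(\<lambda>i. ip (k i) (k i)) \<longlonglongrightarrow> ip h h"
proof -
  define d where "d i = (\<lambda>x. h x - k i x)" for i
  have d: "d i \<in> L2_space M0" for i
    using L2_lincomb[OF h k, where a=1 and b="-1"] by (simp add: d_def)
  show conv: "(\<lambda>i. ip g (k i)) \<longlonglongrightarrow> ip g h" if g: "g \<in> L2_space M0" for g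
  proof -
    have "(\<lambda>i. sqrt (ip g g) * sqrt (ip (d i) (d i))) \<longlonglongrightarrow> sqrt (ip g g) * sqrt 0"
      using lim by (intro tendsto_intros) (simp add: d_def)
    then have lim0: "(\<lambda>i. sqrt (ip g g) * sqrt (ip (d i) (d i))) \<longlonglongrightarrow> 0" by simp
    have "\<forall>\<^sub>F i in sequentially. norm (ip g (d i)) \<le> sqrt (ip g g) * sqrt (ip (d i) (d i))"
      unfolding real_norm_def by (intro always_eventually allI ip_CS[OF g d])
    then have "(\<lambda>i. ip g (d i)) \<longlonglongrightarrow> 0" by (rule Lim_null_comparison[OF _ lim0])
    moreover have "ip g (d i) = ip g h - ip g (k i)" for i
      using ip_lincomb(2)[OF h k[of i] g, of 1 "-1"] by (simp add: d_def)
    ultimately have "(\<lambda>i. ip g h - ip g (k i)) \<longlonglongrightarrow> 0" by simp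
    from tendsto_diff[OF tendsto_const[of "ip g h"] this] show ?thesis by simp
  qed
  have "(\<lambda>i. ip (d i) (d i) - ip h h + 2 * ip h (k i)) \<longlonglongrightarrow> 0 - ip h h + 2 * ip h h"
    using lim by (intro tendsto_intros conv h) (simp add: d_def)
  then show "(\<lambda>i. ip (k i) (k i)) \<longlonglongrightarrow> ip h h" using ip_diff[OF h k] by (simp add: d_def)
qed

definition CL20 :: "('x \<Rightarrow> complex) set" where
  "CL20 = {h \<in> borel_measurable MX. integrable M0 (\<lambda>x. (norm (h x))^2) \<and> (LINT x|M0. h x) = 0}"

lemma CL20D:
  assumes "h \<in> CL20"
  shows "h \<in> borel_measurable MX" "integrable M0 (\<lambda>x. (norm (h x))^2)" "(LINT x|M0. h x) = 0" "integrable M0 h"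
proof -
  show *: "h \<in> borel_measurable MX" "integrable M0 (\<lambda>x. (norm (h x))^2)" "(LINT x|M0. h x) = 0"
    using assms by (auto simp: CL20_def)
  then show "integrable M0 h"
    using integrable_mult_square[of "\<lambda>_. 1::complex" M0 h] by (simp add: measurable_cong_sets[OF sets_M0 refl])
qed

lemma CL20_of_real: "h \<in> L20 \<Longrightarrow> (\<lambda>x. complex_of_real (h x)) \<in> CL20"
  using L20D[of h] by (simp add: CL20_def)

lemma CL20_lincomb:
  assumes "h \<in> CL20" "k \<in> CL20"
  shows "(\<lambda>x. a * h x + b * k x) \<in> CL20"
proof -
  note [measurable] = CL20D(1)[OF assms(1)] CL20D(1)[OF assms(2)]
  have "integrable M0 (\<lambda>x. (norm (a * h x + b * k x))^2)"
  proof (rule Bochner_Integration.integrable_bound)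
    show "integrable M0 (\<lambda>x. 2 * ((norm a)^2 * (norm (h x))^2) + 2 * ((norm b)^2 * (norm (k x))^2))"
      using CL20D(2)[OF assms(1)] CL20D(2)[OF assms(2)] by simp
    show "AE x in M0. norm ((norm (a * h x + b * k x))^2) \<le> norm (2 * ((norm a)^2 * (norm (h x))^2) + 2 * ((norm b)^2 * (norm (k x))^2))"
    proof (rule AE_I2)
      fix x
      have "(norm (a * h x + b * k x))^2 \<le> (norm (a * h x) + norm (b * k x))^2"
        by (intro power_mono norm_triangle_ineq) auto
      also have "\<dots> \<le> 2 * (norm (a * h x))^2 + 2 * (norm (b * k x))^2"
        using sum_squares_bound[of "norm (a * h x)" "norm (b * k x)"] by (simp add: power2_sum)
      finally show "norm ((norm (a * h x + b * k x))^2) \<le> norm (2 * ((norm a)^2 * (norm (h x))^2) + 2 * ((norm b)^2 * (norm (k x))^2))"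
        by (simp add: norm_mult power_mult_distrib)
    qed
  qed measurable
  then show ?thesis using CL20D[OF assms(1)] CL20D[OF assms(2)] by (simp add: CL20_def)
qed

text \<open>Centring removes the linear terms, so the moments are exact, 1 plus an inner product
  over 4 n, with no remainder. The exactness is what makes the bound in \<open>lik_norm2\<close>
  uniform in n.\<close>

lemma lik_factor:
  fixes n :: nat
  assumes h: "h \<in> CL20" and k: "k \<in> CL20"
  defines "a \<equiv> \<lambda>h z. 1 + h (fst z) / of_real (2 * sqrt (real n))"
  shows "a h \<in> borel_measurable F0" "integrable F0 (\<lambda>z. (norm (a h z))^2)"
    "(LINT z|F0. a h z * cnj (a k z)) = 1 + (LINT x|M0. h x * cnj (k x)) / of_nat (4 * n)"
    "(LINT z|F0. (norm (a h z))^2) = 1 + (LINT x|M0. (norm (h x))^2) / real (4 * n)"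
proof -
  note [measurable] = CL20D(1)[OF h] CL20D(1)[OF k]
  show meas: "a h \<in> borel_measurable F0" unfolding a_def by measurable
  have hk: "integrable M0 (\<lambda>x. h x * cnj (k x))"
    using CL20D(2)[OF h] CL20D(2)[OF k] by (intro integrable_mult_square) auto
  define d where "d = complex_of_real (2 * sqrt (real n))"
  have "d * d = of_real ((2 * sqrt (real n)) * (2 * sqrt (real n)))"
    unfolding d_def by (simp only: of_real_mult)
  then have dd: "d * d = of_nat (4 * n)" "cnj d = d" by (simp_all add: d_def)
  have "(LINT z|F0. a h z * cnj (a k z)) = (LINT x|M0. (1 + h x / d) * cnj (1 + k x / d))"
    by (subst integral_M0(1)) (auto simp: a_def d_def)
  also have "\<dots> = (LINT x|M0. 1 + h x / d + cnj (k x) / d + (h x * cnj (k x)) / (d * d))"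
    using dd(2) by (intro Bochner_Integration.integral_cong) (auto simp: algebra_simps)
  also have "\<dots> = 1 + (LINT x|M0. h x) / d + cnj (LINT x|M0. k x) / d + (LINT x|M0. h x * cnj (k x)) / (d * d)"
    using CL20D(4)[OF h] CL20D(4)[OF k] hk by (simp add: M0.prob_space)
  finally show "(LINT z|F0. a h z * cnj (a k z)) = 1 + (LINT x|M0. h x * cnj (k x)) / of_nat (4 * n)"
    using CL20D(3)[OF h] CL20D(3)[OF k] dd by simp
  have eq: "(norm (1 + h x / d))^2 = 1 + 2 * Re (h x / d) + (norm (h x))^2 / real (4 * n)" for x
  proof -
    have "(norm (1 + w))^2 = 1 + 2 * Re w + (norm w)^2" for w
      unfolding cmod_power2 by (simp add: power2_eq_square algebra_simps)
    then show ?thesis by (simp add: norm_divide power_divide d_def power_mult_distrib)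
  qed
  have i: "integrable M0 (\<lambda>x. 1 + 2 * Re (h x / d) + (norm (h x))^2 / real (4 * n))"
    using CL20D(4)[OF h] CL20D(2)[OF h] by (intro Bochner_Integration.integrable_add integrable_mult_right integrable_Re) auto
  show "integrable F0 (\<lambda>z. (norm (a h z))^2)"
    unfolding a_def d_def[symmetric] eq using i by (subst (asm) integral_M0(2)) auto
  have "(LINT z|F0. (norm (a h z))^2) = (LINT x|M0. 1 + 2 * Re (h x / d) + (norm (h x))^2 / real (4 * n))"
    unfolding a_def d_def[symmetric] eq by (subst integral_M0(1)) auto
  also have "\<dots> = 1 + 2 * (LINT x|M0. Re (h x / d)) + (LINT x|M0. (norm (h x))^2) / real (4 * n)"
    using CL20D(4)[OF h] CL20D(2)[OF h] integrable_Re[of M0 "\<lambda>x. h x / d"] by (simp add: M0.prob_space)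
  also have "(LINT x|M0. Re (h x / d)) = 0" using CL20D(3,4)[OF h] by (subst integral_Re) auto
  finally show "(LINT z|F0. (norm (a h z))^2) = 1 + (LINT x|M0. (norm (h x))^2) / real (4 * n)"
    by simp
qed

lemma lik_measurable [measurable]:
  assumes "h \<in> borel_measurable MX"
  shows "lik n h \<in> borel_measurable P0"
  using assms unfolding lik_def[abs_def] by measurable

lemma fluct_measurable [measurable]:
  assumes "h \<in> borel_measurable MX"
  shows "fluct n h \<in> borel_measurable P0"
  using assms unfolding fluct_def[abs_def] by measurable

lemma lik_norm2:
  assumes h: "h \<in> CL20"
  shows "integrable P0 (\<lambda>zs. (norm (lik n h zs))^2)"
    and "(LINT zs|P0. (norm (lik n h zs))^2) \<le> exp ((LINT x|M0. (norm (h x))^2) / 4)"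
proof -
  note f = lik_factor[OF h h, of n]
  have eq: "(norm (lik n h zs))^2 = (\<Prod>j<n. (norm (1 + h (fst (zs j)) / of_real (2 * sqrt (real n))))^2)" for zs
    by (simp add: lik_def prod_norm[symmetric] prod_power_distrib)
  show "integrable P0 (\<lambda>zs. (norm (lik n h zs))^2)"
    unfolding eq using integrable_iid_prod[OF prob_F0 f(2)] .
  have "(LINT zs|P0. (norm (lik n h zs))^2) = (1 + (LINT x|M0. (norm (h x))^2) / real (4 * n)) ^ n"
    unfolding eq integral_iid_prod[OF prob_F0 f(2)] f(4) ..
  also have "\<dots> \<le> exp ((LINT x|M0. (norm (h x))^2) / real (4 * n)) ^ n"
    by (intro power_mono exp_ge_add_one_self) simp
  also have "\<dots> = exp (real n * ((LINT x|M0. (norm (h x))^2) / real (4 * n)))"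
    by (simp flip: exp_of_nat_mult)
  also have "\<dots> \<le> exp ((LINT x|M0. (norm (h x))^2) / 4)" by (cases "n = 0") auto
  finally show "(LINT zs|P0. (norm (lik n h zs))^2) \<le> exp ((LINT x|M0. (norm (h x))^2) / 4)" .
qed

lemma tendsto_eventually_mult_n:
  fixes C :: "'b::real_normed_field"
  shows "(\<lambda>n. of_nat n * (1 + C / of_nat (4 * n) - 1)) \<longlonglongrightarrow> C / 4"
proof (rule tendsto_eventually)
  show "\<forall>\<^sub>F n in sequentially. of_nat n * (1 + C / of_nat (4 * n) - 1) = C / 4"
    using eventually_gt_at_top[of 0] by eventually_elim simp
qed

text \<open>For \<open>c = 1\<close> the limit vanishes as k approaches h, and for
  \<open>c = -1\<close> it stays bounded; these two cases yield \<open>good_closure\<close>. The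
  case \<open>c = 0\<close> is the limit of the second moment of \<open>lik\<close>.\<close>

lemma lik_combination:
  assumes h: "h \<in> L20" and k: "k \<in> L20"
  shows "(\<lambda>n. LINT zs|P0. (norm (lik n (\<lambda>x. of_real (h x)) zs - of_real c * lik n (\<lambda>x. of_real (k x)) zs))^2)
    \<longlonglongrightarrow> exp (ip h h / 4) + c^2 * exp (ip k k / 4) - 2 * c * exp (ip h k / 4)"
proof -
  note H = CL20_of_real[OF h] and K = CL20_of_real[OF k]
  have lim: "(\<lambda>n. LINT zs|iid F0. (norm ((\<Prod>j<n. 1 + complex_of_real (h (fst (zs j))) / of_real (2 * sqrt (real n)))
      - of_real c * (\<Prod>j<n. 1 + of_real (k (fst (zs j))) / of_real (2 * sqrt (real n)))))^2)
    \<longlonglongrightarrow> exp (ip h h / 4) + (norm (complex_of_real c))^2 * exp (ip k k / 4) - 2 * Re (cnj (of_real c) * exp (of_real (ip h k) / 4))"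
  proof (rule iid_prod_approx[OF prob_F0, where a="\<lambda>n z. 1 + of_real (h (fst z)) / of_real (2 * sqrt (real n))"
        and b="\<lambda>n z. 1 + of_real (k (fst z)) / of_real (2 * sqrt (real n))"])
    show "(\<lambda>n. real n * ((LINT z|F0. (norm (1 + complex_of_real (h (fst z)) / of_real (2 * sqrt (real n))))^2) - 1)) \<longlonglongrightarrow> ip h h / 4"
      unfolding lik_factor(4)[OF H H] using tendsto_eventually_mult_n[of "ip h h"] by (simp add: ip_def power2_eq_square)
    show "(\<lambda>n. real n * ((LINT z|F0. (norm (1 + complex_of_real (k (fst z)) / of_real (2 * sqrt (real n))))^2) - 1)) \<longlonglongrightarrow> ip k k / 4"
      unfolding lik_factor(4)[OF K K] using tendsto_eventually_mult_n[of "ip k k"] by (simp add: ip_def power2_eq_square)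
    have eq: "(LINT x|M0. complex_of_real (h x) * cnj (complex_of_real (k x))) = of_real (ip h k)"
      unfolding ip_def by (subst integral_complex_of_real[symmetric]) simp
    show "(\<lambda>n. of_nat n * ((LINT z|F0. (1 + complex_of_real (h (fst z)) / of_real (2 * sqrt (real n))) *
        cnj (1 + complex_of_real (k (fst z)) / of_real (2 * sqrt (real n)))) - 1)) \<longlonglongrightarrow> of_real (ip h k) / 4"
      unfolding lik_factor(3)[OF H K] eq by (rule tendsto_eventually_mult_n)
  qed (use lik_factor(1,2)[OF H H] lik_factor(1,2)[OF K K] in auto)
  have "Re (exp (complex_of_real (ip h k) / 4)) = exp (ip h k / 4)" by (simp add: Re_exp)
  with lim show ?thesis by (simp add: lik_def mult.assoc)
qed

lemma lik_comb_integrable: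
  assumes "h \<in> CL20" "k \<in> CL20"
  shows "integrable P0 (\<lambda>zs. (norm (lik n h zs - c * lik n k zs))^2)"
  unfolding lik_def using lik_factor(1,2)[OF assms(1,1)] lik_factor(1,2)[OF assms(2,2)]
  by (intro integral_iid_prod_diff(1)[OF prob_F0]) auto

text \<open>Here \<open>q(y) = e\<^bsup>2iy\<^esup> / (1 + iy)\<close> is the factor that turns \<open>lik n (ih)\<close> into \<open>exp (i fluct n h)\<close>.\<close>

lemma lik_imaginary:
  assumes h: "h \<in> L20"
  shows "(\<lambda>n. LINT zs|P0. norm (iexp (fluct n h zs) - of_real (exp (- ip h h / 4)) * (lik n (\<lambda>x. \<i> * of_real (h x)) zs)^2)) \<longlonglongrightarrow> 0"
proof -
  note [measurable] = L20D(1)[OF h]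
  have ih: "(\<lambda>x. \<i> * complex_of_real (h x)) \<in> CL20"
    using CL20_lincomb[OF CL20_of_real[OF h] CL20_of_real[OF h], of \<i> 0] by simp
  \<comment> \<open>A factor of \<open>lik n (i h)\<close> is \<open>1 + i y\<close> at
    \<open>y = v / sqrt n\<close>, and the corresponding factor of \<open>iexp (fluct n h)\<close>
    is \<open>iexp (2 y)\<close>.\<close>
  define v where "v z = h (fst z) / 2" for z :: "'x \<times> 't"
  have v [measurable]: "v \<in> borel_measurable F0" unfolding v_def by measurable
  have v2: "integrable F0 (\<lambda>z. (v z)^2)"
    using L20D(2)[OF h] by (subst (asm) integral_M0(2)) (auto simp: v_def power_divide)
  have vV: "(LINT z|F0. (v z)^2) = ip h h / 4"
    unfolding ip_def by (subst integral_M0(1)) (auto simp: v_def power2_eq_square)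
  have ui: "(\<lambda>n. LINT z|F0. (v z)^2 * min 1 (\<bar>v z\<bar> / sqrt (real n))) \<longlonglongrightarrow> 0"
  proof -
    have "(\<lambda>n. LINT z|F0. (v z)^2 * min 1 (\<bar>v z\<bar> / sqrt (real n))) \<longlonglongrightarrow> (LINT z|F0. 0)"
    proof (rule integral_dominated_convergence[where w="\<lambda>z. (v z)^2"])
      show "AE z in F0. (\<lambda>n. (v z)^2 * min 1 (\<bar>v z\<bar> / sqrt (real n))) \<longlonglongrightarrow> 0"
      proof (rule AE_I2)
        fix z
        have "(\<lambda>n. (v z)^2 * min 1 (\<bar>v z\<bar> * inverse (sqrt (real n)))) \<longlonglongrightarrow> (v z)\<^sup>2 * min 1 (\<bar>v z\<bar> * 0)"
          by (intro tendsto_intros tendsto_inverse_0_at_top filterlim_compose[OF sqrt_at_top] filterlim_real_sequentially)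
        then show "(\<lambda>n. (v z)^2 * min 1 (\<bar>v z\<bar> / sqrt (real n))) \<longlonglongrightarrow> 0" by (simp add: divide_inverse)
      qed
      show "AE z in F0. norm ((v z)^2 * min 1 (\<bar>v z\<bar> / sqrt (real n))) \<le> (v z)^2" for n
        by (intro AE_I2) (auto simp: abs_mult intro!: mult_right_le_one_le)
    qed (use v2 in auto)
    then show ?thesis by simp
  qed
  note tendsto = tendsto_second_order[OF prob_F0, of "\<lambda>_. v", OF v v2 tendsto_const ui]
  define q where "q y = iexp (2 * y) / (1 + \<i> * y)" for y :: real
  have [measurable]: "q \<in> borel_measurable borel" unfolding q_def by measurable
  have q_norm: "(norm (q x))^2 = 1 / (1 + x^2)" for x :: real
    by (simp add: q_def norm_divide power_divide cmod_power2)
  define a where "a n z = q (v z / sqrt (real n))" for n z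
  define b where "b n z = 1 + \<i> * of_real (v z / sqrt (real n))" for n z
  have b_eq: "b n z = 1 + \<i> * of_real (h (fst z)) / of_real (2 * sqrt (real n))" for n z
    by (simp add: b_def v_def)
  \<comment> \<open>With \<open>a = ip h h / 4\<close> the rates have the limits -a, a and 0, and
    \<open>e^(-a) + c^2 e^a - 2 c\<close> vanishes at \<open>c = e^(-a)\<close>.\<close>
  define c where "c = exp (- ip h h / 4)"
  have a2: "integrable F0 (\<lambda>z. (norm (a n z))^2)" for n
  proof -
    have "1 / (1 + x^2) \<le> 1" for x :: real by (simp add: divide_le_eq add_pos_nonneg)
    then show ?thesis unfolding a_def q_norm by (intro F0.integrable_bounded[where B=1]) auto
  qed
  have b2: "b n \<in> borel_measurable F0" "integrable F0 (\<lambda>z. (norm (b n z))^2)" for n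
    using lik_factor(1,2)[OF ih ih, of n] unfolding b_eq[abs_def] by simp_all
  have "(\<lambda>n. LINT zs|iid F0. (norm ((\<Prod>j<n. a n (zs j)) - of_real c * (\<Prod>j<n. b n (zs j))))^2) \<longlonglongrightarrow>
     exp (- (ip h h / 4)) + (norm (complex_of_real c))^2 * exp (ip h h / 4) - 2 * Re (cnj (of_real c) * exp 0)"
  proof (rule iid_prod_approx[OF prob_F0])
    show "(\<lambda>n. real n * ((LINT z|F0. (norm (a n z))^2) - 1)) \<longlonglongrightarrow> - (ip h h / 4)"
      unfolding a_def q_norm using tendsto[of "\<lambda>x. 1 / (1 + x^2)" "-1" 2] second_order_ratio(2) by (simp add: vV)
    show "(\<lambda>n. real n * ((LINT z|F0. (norm (b n z))^2) - 1)) \<longlonglongrightarrow> ip h h / 4"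
      unfolding b_eq lik_factor(4)[OF ih ih] using tendsto_eventually_mult_n[of "ip h h"]
      by (simp add: ip_def power2_eq_square norm_mult)
    have "a n z * cnj (b n z) = iexp (2 * (v z / sqrt (real n))) * (1 - \<i> * of_real (v z / sqrt (real n))) / (1 + \<i> * of_real (v z / sqrt (real n)))" for n z
      by (simp add: a_def b_def q_def)
    then show "(\<lambda>n. of_nat n * ((LINT z|F0. a n z * cnj (b n z)) - 1)) \<longlonglongrightarrow> 0"
      using tendsto[of "\<lambda>y. iexp (2 * y) * (1 - \<i> * y) / (1 + \<i> * y)" 0 8] second_order_ratio(3) by simp
  qed (use a2 b2 in \<open>auto simp: a_def[abs_def]\<close>)
  moreover have "exp (- (ip h h / 4)) + (norm (complex_of_real c))^2 * exp (ip h h / 4) - 2 * Re (cnj (of_real c) * exp 0) = 0"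
  proof -
    have "c * exp (ip h h / 4) = 1" "exp (- (ip h h / 4)) = c"
      by (simp_all add: c_def flip: exp_add)
    then show ?thesis by (simp add: power2_eq_square mult.assoc)
  qed
  ultimately have lim: "(\<lambda>n. LINT zs|P0. (norm ((\<Prod>j<n. a n (zs j)) - of_real c * (\<Prod>j<n. b n (zs j))))^2) \<longlonglongrightarrow> 0"
    by simp
  define U where "U = exp ((LINT x|M0. (norm (\<i> * complex_of_real (h x)))^2) / 4)"
  show ?thesis
  proof (rule Lim_null_comparison)
    show "(\<lambda>n. sqrt U * sqrt (LINT zs|P0. (norm ((\<Prod>j<n. a n (zs j)) - of_real c * (\<Prod>j<n. b n (zs j))))^2)) \<longlonglongrightarrow> 0"
      using tendsto_mult[OF tendsto_const tendsto_real_sqrt[OF lim], of "sqrt U"] by simp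
    show "\<forall>\<^sub>F n in sequentially. norm (LINT zs|P0. norm (iexp (fluct n h zs) - of_real (exp (- ip h h / 4)) * (lik n (\<lambda>x. \<i> * of_real (h x)) zs)^2))
       \<le> sqrt U * sqrt (LINT zs|P0. (norm ((\<Prod>j<n. a n (zs j)) - of_real c * (\<Prod>j<n. b n (zs j))))^2)"
    proof (intro always_eventually allI)
      fix n
      define L where "L = lik n (\<lambda>x. \<i> * of_real (h x))"
      define A where "A zs = (\<Prod>j<n. a n (zs j))" for zs
      have L_eq: "L zs = (\<Prod>j<n. b n (zs j))" for zs by (simp add: L_def lik_def b_eq)
      have L_meas [measurable]: "L \<in> borel_measurable P0" unfolding L_def by measurable
      have [measurable]: "(\<lambda>zs. v (zs j)) \<in> borel_measurable P0" for j
        by (rule measurable_iid_component) simp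
      have [measurable]: "A \<in> borel_measurable P0" unfolding A_def a_def by measurable
      have LA: "L zs * A zs = iexp (fluct n h zs)" for zs
      proof -
        have "b n z * a n z = iexp (h (fst z) / sqrt (real n))" for z
        proof -
          have "1 + \<i> * complex_of_real (v z / sqrt (real n)) \<noteq> 0" by (auto simp: complex_eq_iff)
          then show ?thesis by (simp add: a_def b_def q_def) (simp add: v_def)
        qed
        then have "L zs * A zs = (\<Prod>j<n. iexp (h (fst (zs j)) / sqrt (real n)))"
          by (simp add: L_eq A_def flip: prod.distrib)
        also have "\<dots> = exp (\<Sum>j<n. \<i> * of_real (h (fst (zs j)) / sqrt (real n)))"
          by (simp add: exp_sum)
        also have "(\<Sum>j<n. \<i> * of_real (h (fst (zs j)) / sqrt (real n))) = \<i> * of_real (fluct n h zs)"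
          by (simp add: fluct_def sum_distrib_left sum_divide_distrib)
        finally show ?thesis .
      qed
      \<comment> \<open>Since \<open>L A\<close> is the exponential, its difference from
        \<open>c L^2\<close> factors as \<open>L (A - c L)\<close>, with L bounded and the other
        factor small in L2.\<close>
      have "norm (LINT zs|P0. norm (iexp (fluct n h zs) - of_real (exp (- ip h h / 4)) * (L zs)^2)) = (LINT zs|P0. norm (L zs * (A zs - of_real c * L zs)))"
        unfolding c_def[symmetric] LA[symmetric] by (simp add: abs_of_nonneg power2_eq_square algebra_simps)
      also have "\<dots> \<le> sqrt (LINT zs|P0. (norm (L zs))^2) * sqrt (LINT zs|P0. (norm (A zs - of_real c * L zs))^2)"
      proof (rule integral_norm_mult_le)
        show "integrable P0 (\<lambda>x. (norm (A x - of_real c * L x))^2)"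
          unfolding A_def L_eq using a2 b2 by (intro integral_iid_prod_diff(1)[OF prob_F0]) (auto simp: a_def[abs_def])
      qed (use lik_norm2(1)[OF ih] in \<open>auto simp: L_def\<close>)
      also have "\<dots> \<le> sqrt U * sqrt (LINT zs|P0. (norm (A zs - of_real c * L zs))^2)"
        using lik_norm2(2)[OF ih] by (intro mult_right_mono) (auto simp: L_def U_def)
      finally show "norm (LINT zs|P0. norm (iexp (fluct n h zs) - of_real (exp (- ip h h / 4)) * (lik n (\<lambda>x. \<i> * of_real (h x)) zs)^2))
       \<le> sqrt U * sqrt (LINT zs|P0. (norm ((\<Prod>j<n. a n (zs j)) - of_real c * (\<Prod>j<n. b n (zs j))))^2)"
        by (simp add: L_def[symmetric] A_def L_eq)
    qed
  qed
qed

end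

section \<open>Moments of the normalised sums\<close>

context local_model
begin

lemma integral_P0_pair:
  assumes g: "g \<in> L20" and h: "h \<in> L20" and jk: "j < n" "k < n"
  shows "integrable P0 (\<lambda>zs. g (fst (zs j)) * h (fst (zs k)))"
    and "(LINT zs|P0. g (fst (zs j)) * h (fst (zs k))) = (if j = k then ip g h else 0)"
proof -
  note [measurable] = L20D(1)[OF g] L20D(1)[OF h]
  \<comment> \<open>Two separate conditional factors, so that for j = k the product g h appears in a
    single coordinate.\<close>
  define a where "a i z = (if i = j then g (fst z) else 1) * (if i = k then h (fst z) else 1)" for i and z :: "'x \<times> 't"
  have gh: "integrable F0 (\<lambda>z. g (fst z))" "integrable F0 (\<lambda>z. h (fst z))" "integrable F0 (\<lambda>z. g (fst z) * h (fst z))"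
    using L20D(4)[OF g] L20D(4)[OF h] L2_mult_integrable[OF L20D(5)[OF g] L20D(5)[OF h]]
    using integral_M0(2)[of g] integral_M0(2)[of h] integral_M0(2)[of "\<lambda>x. g x * h x"] by simp_all
  have a: "integrable F0 (a i)" for i
    using gh by (cases "i = j"; cases "i = k") (simp_all add: a_def[abs_def])
  have eq: "g (fst (zs j)) * h (fst (zs k)) = (\<Prod>i<n. a i (zs i))" for zs
    using jk by (simp add: a_def prod.distrib)
  show "integrable P0 (\<lambda>zs. g (fst (zs j)) * h (fst (zs k)))"
    unfolding eq by (rule integrable_iid_prod'[OF prob_F0 a])
  have "(LINT zs|P0. g (fst (zs j)) * h (fst (zs k))) = (\<Prod>i<n. LINT z|F0. a i z)"
    unfolding eq by (rule integral_iid_prod'[OF prob_F0 a])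
  also have "\<dots> = (if j = k then ip g h else 0)"
  proof (cases "j = k")
    case True
    have "(LINT z|F0. a i z) = (if i = j then ip g h else 1)" for i
      using True by (cases "i = j") (simp_all add: a_def ip_def integral_M0(1) F0.prob_space)
    then show ?thesis using True jk by simp
  next
    case False
    have "(LINT z|F0. a j z) = 0" using False L20D(3)[OF g] by (simp add: a_def integral_M0(1))
    then show ?thesis using False jk(1) by (auto intro!: prod_zero)
  qed
  finally show "(LINT zs|P0. g (fst (zs j)) * h (fst (zs k))) = (if j = k then ip g h else 0)" .
qed

text \<open>Off the diagonal, independence and centring give 0. Hence \<open>fluct n\<close> is an
  isometry into L2 for n > 0; at n = 0 it is identically 0.\<close>

lemma fluct_ip:
  assumes g: "g \<in> L20" and h: "h \<in> L20"
  shows "integrable P0 (\<lambda>zs. fluct n g zs * fluct n h zs)"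
    and "n > 0 \<Longrightarrow> (LINT zs|P0. fluct n g zs * fluct n h zs) = ip g h"
proof -
  have eq: "fluct n g zs * fluct n h zs = (\<Sum>j<n. \<Sum>k<n. g (fst (zs j)) * h (fst (zs k))) / real n" for zs
    by (simp add: fluct_def sum_product)
  have i: "integrable P0 (\<lambda>zs. \<Sum>k<n. g (fst (zs j)) * h (fst (zs k)))" if "j < n" for j
    using integral_P0_pair(1)[OF g h that] by (intro Bochner_Integration.integrable_sum) auto
  then show "integrable P0 (\<lambda>zs. fluct n g zs * fluct n h zs)"
    unfolding eq by (intro integrable_divide, rule Bochner_Integration.integrable_sum) simp
  assume "n > 0"
  have "(LINT zs|P0. (\<Sum>j<n. \<Sum>k<n. g (fst (zs j)) * h (fst (zs k)))) = (\<Sum>j<n. \<Sum>k<n. if j = k then ip g h else 0)"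
    using i integral_P0_pair[OF g h] by (subst Bochner_Integration.integral_sum) (auto intro!: sum.cong simp: Bochner_Integration.integral_sum)
  also have "\<dots> = real n * ip g h" by simp
  finally show "(LINT zs|P0. fluct n g zs * fluct n h zs) = ip g h" unfolding eq using \<open>n > 0\<close> by simp
qed

lemma fluct_norm2:
  assumes g: "g \<in> L20"
  shows "integrable P0 (\<lambda>zs. (fluct n g zs)^2)" "(LINT zs|P0. (fluct n g zs)^2) \<le> ip g g"
    "n > 0 \<Longrightarrow> (LINT zs|P0. (fluct n g zs)^2) = ip g g"
proof -
  show "integrable P0 (\<lambda>zs. (fluct n g zs)^2)" "n > 0 \<Longrightarrow> (LINT zs|P0. (fluct n g zs)^2) = ip g g"
    using fluct_ip[OF g g, of n] by (simp_all add: power2_eq_square)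
  then show "(LINT zs|P0. (fluct n g zs)^2) \<le> ip g g"
    by (cases "n = 0") (simp_all add: fluct_def ip_self_nonneg)
qed

lemma fluct_integrable:
  assumes g: "g \<in> L20"
  shows "integrable P0 (fluct n g)" "(LINT zs|P0. \<bar>fluct n g zs\<bar>) \<le> sqrt (ip g g)" "(LINT zs|P0. fluct n g zs) = 0"
proof -
  note [measurable] = L20D(1)[OF g]
  show i: "integrable P0 (fluct n g)"
    using integrable_mult_square[of "\<lambda>_. 1::real" P0 "fluct n g"] fluct_norm2(1)[OF g, of n] by simp
  have "(LINT zs|P0. \<bar>fluct n g zs\<bar>) \<le> sqrt (LINT zs|P0. (fluct n g zs)^2)"
    using integral_norm_mult_le[of "\<lambda>_. 1::real" P0 "fluct n g"] fluct_norm2(1)[OF g, of n] by (simp add: P0.prob_space)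
  also have "\<dots> \<le> sqrt (ip g g)" using fluct_norm2(2)[OF g] by simp
  finally show "(LINT zs|P0. \<bar>fluct n g zs\<bar>) \<le> sqrt (ip g g)" .
  have gF: "integrable F0 (\<lambda>z. g (fst z))" "(LINT z|F0. g (fst z)) = 0"
    using L20D(3,4)[OF g] by (simp_all add: integral_M0)
  have "integrable P0 (\<lambda>zs. g (fst (zs j)))" "(LINT zs|P0. g (fst (zs j))) = 0" if "j < n" for j
  proof -
    define a where "a i z = (if i = j then g (fst z) else 1)" for i and z :: "'x \<times> 't"
    have a: "integrable F0 (a i)" "(LINT z|F0. a i z) = (if i = j then 0 else 1)" for i
      using gF by (cases "i = j"; simp add: a_def[abs_def] F0.prob_space)+
    have eq: "g (fst (zs j)) = (\<Prod>i<n. a i (zs i))" for zs using that by (simp add: a_def)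
    show "integrable P0 (\<lambda>zs. g (fst (zs j)))" "(LINT zs|P0. g (fst (zs j))) = 0"
      unfolding eq using integrable_iid_prod'[OF prob_F0 a(1)] integral_iid_prod'[OF prob_F0 a(1)] a(2) that by auto
  qed
  then show "(LINT zs|P0. fluct n g zs) = 0" by (simp add: fluct_def[abs_def])
qed

lemma fluct_lincomb: "fluct n (\<lambda>x. a * g x + b * h x) zs = a * fluct n g zs + b * fluct n h zs"
  by (simp add: fluct_def sum.distrib sum_distrib_left add_divide_distrib)

end

section \<open>Analytic continuation in the tilt\<close>

lemma norm_iexp_diff: "norm (iexp x - iexp y) \<le> \<bar>x - y\<bar>"
proof -
  have "iexp x - iexp y = iexp y * (iexp (x - y) - 1)" by (simp add: algebra_simps flip: exp_add)
  then show ?thesis using iexp_approx1[of "x - y" 0] by (simp add: norm_mult)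
qed

text \<open>
  \<open>\<Psi>\<close> stands for \<open>exp (i s V\<^sub>n)\<close> with \<open>V\<^sub>n\<close> a statistic. The shape of the limit in \<open>good\<close> is the one that
  local asymptotic normality produces along a curve with score \<open>h\<close>; being polynomial in \<open>h\<close>, the left-hand
  side may be continued analytically, which turns real tilts into characteristic functions.
\<close>

locale local_limit = local_model MX MT F0
  for MX :: "'x measure" and MT :: "'t measure" and F0 :: "('x \<times> 't) measure" +
  fixes \<Psi> :: "nat \<Rightarrow> (nat \<Rightarrow> 'x \<times> 't) \<Rightarrow> complex" and \<phi> :: "'x \<Rightarrow> real" and \<kappa> \<Lambda> :: complex
  assumes \<Psi>_meas [measurable]: "\<And>n. \<Psi> n \<in> borel_measurable P0" and \<Psi>_le: "\<And>n zs. norm (\<Psi> n zs) \<le> 1"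
    and \<phi>: "\<phi> \<in> L2_space M0"
begin

definition good :: "('x \<Rightarrow> real) \<Rightarrow> bool" where
  "good h \<longleftrightarrow> h \<in> L20 \<and>
    (\<lambda>n. LINT zs|P0. \<Psi> n zs * (lik n (\<lambda>x. of_real (h x)) zs)^2) \<longlonglongrightarrow> \<Lambda> * exp (of_real (ip h h) / 4 + \<kappa> * of_real (ip \<phi> h))"

text \<open>Formally this is \<open>good\<close> at the imaginary direction i h: the quadratic term
  changes sign, and the factor \<open>exp (- ip h h / 4)\<close> from \<open>lik_imaginary\<close>
  doubles it.\<close>

definition iexp_good :: "('x \<Rightarrow> real) \<Rightarrow> bool" where
  "iexp_good h \<longleftrightarrow> h \<in> L20 \<and>
    (\<lambda>n. LINT zs|P0. \<Psi> n zs * iexp (fluct n h zs)) \<longlonglongrightarrow> \<Lambda> * exp (- of_real (ip h h) / 2 + \<i> * \<kappa> * of_real (ip \<phi> h))"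

text \<open>The first-order term, at h = 0, of the limit in \<open>good\<close>.\<close>

definition lin_good :: "('x \<Rightarrow> real) \<Rightarrow> bool" where
  "lin_good h \<longleftrightarrow> h \<in> L20 \<and>
    (\<lambda>n. LINT zs|P0. \<Psi> n zs * of_real (fluct n h zs)) \<longlonglongrightarrow> \<Lambda> * \<kappa> * of_real (ip \<phi> h)"

lemma \<Psi>_mult_integrable:
  assumes "integrable P0 f"
  shows "integrable P0 (\<lambda>zs. \<Psi> n zs * f zs)"
  by (rule Bochner_Integration.integrable_bound[OF assms])
    (use assms \<Psi>_le in \<open>auto simp: norm_mult intro!: mult_left_le_one_le\<close>)

lemma \<Psi>_integral_le:
  assumes f: "integrable P0 f"
  shows "norm (LINT zs|P0. \<Psi> n zs * f zs) \<le> (LINT zs|P0. norm (f zs))"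
proof -
  have "norm (LINT zs|P0. \<Psi> n zs * f zs) \<le> (LINT zs|P0. norm (\<Psi> n zs * f zs))"
    by (rule integral_norm_bound)
  also have "\<dots> \<le> (LINT zs|P0. norm (f zs))" using \<Psi>_mult_integrable[OF f] f \<Psi>_le
    by (intro integral_mono integrable_norm) (auto simp: norm_mult intro!: mult_left_le_one_le)
  finally show ?thesis .
qed

lemma lik_square_integrable:
  assumes "h \<in> CL20"
  shows "integrable P0 (\<lambda>zs. (lik n h zs)^2)"
  using integrable_mult_square[of "lik n h" P0 "lik n h"] lik_norm2(1)[OF assms] CL20D(1)[OF assms]
  by (simp add: power2_eq_square)

text \<open>The difference of two squared likelihood products is their difference times their sum.
  By \<open>lik_combination\<close> the L2 norm of the difference tends, as n grows, to a number
  that is small when k is near h, while that of the sum tends to one that stays bounded.\<close>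

lemma good_closure:
  assumes h: "h \<in> L20" and k: "\<And>i. good (k i)" and lim: "(\<lambda>i. ip (\<lambda>x. h x - k i x) (\<lambda>x. h x - k i x)) \<longlonglongrightarrow> 0"
  shows "good h"
proof -
  have k0: "k i \<in> L20" for i using k by (simp add: good_def)
  note H = CL20_of_real[OF h] and K = CL20_of_real[OF k0]
  note ipl = ip_tendsto[OF L20D(5)[OF h] L20D(5)[OF k0] lim]
  define Lh where "Lh n = lik n (\<lambda>x. of_real (h x))" for n
  define Lk where "Lk i n = lik n (\<lambda>x. of_real (k i x))" for i n
  define b where "b i n = sqrt (LINT zs|P0. (norm (Lh n zs - of_real 1 * Lk i n zs))^2) * sqrt (LINT zs|P0. (norm (Lh n zs - of_real (-1) * Lk i n zs))^2)" for i n
  define B where "B i = sqrt (exp (ip h h / 4) + 1\<^sup>2 * exp (ip (k i) (k i) / 4) - 2 * 1 * exp (ip h (k i) / 4)) *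
     sqrt (exp (ip h h / 4) + (-1)^2 * exp (ip (k i) (k i) / 4) - 2 * (-1) * exp (ip h (k i) / 4))" for i
  have "(\<lambda>n. LINT zs|P0. \<Psi> n zs * (Lh n zs)^2) \<longlonglongrightarrow> \<Lambda> * exp (of_real (ip h h) / 4 + \<kappa> * of_real (ip \<phi> h))"
  proof (rule tendsto_approximation)
    show "(\<lambda>n. LINT zs|P0. \<Psi> n zs * (Lk i n zs)^2) \<longlonglongrightarrow> \<Lambda> * exp (of_real (ip (k i) (k i)) / 4 + \<kappa> * of_real (ip \<phi> (k i)))" for i
      using k[of i] by (simp add: good_def Lk_def)
    show "b i \<longlonglongrightarrow> B i" for i
      unfolding b_def B_def Lh_def Lk_def by (intro tendsto_mult tendsto_real_sqrt lik_combination h k0)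
    have "B \<longlonglongrightarrow> sqrt (exp (ip h h / 4) + 1\<^sup>2 * exp (ip h h / 4) - 2 * 1 * exp (ip h h / 4)) *
     sqrt (exp (ip h h / 4) + (-1)^2 * exp (ip h h / 4) - 2 * (-1) * exp (ip h h / 4))"
      unfolding B_def[abs_def] by (intro tendsto_intros ipl L20D(5)[OF h]) auto
    then show "B \<longlonglongrightarrow> 0" by simp
    show "(\<lambda>i. \<Lambda> * exp (of_real (ip (k i) (k i)) / 4 + \<kappa> * of_real (ip \<phi> (k i)))) \<longlonglongrightarrow> \<Lambda> * exp (of_real (ip h h) / 4 + \<kappa> * of_real (ip \<phi> h))"
      by (intro tendsto_intros ipl \<phi>) auto
    fix i n
    have m [measurable]: "Lh n \<in> borel_measurable P0" "Lk i n \<in> borel_measurable P0"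
      using CL20D(1)[OF H] CL20D(1)[OF K] by (auto simp: Lh_def Lk_def)
    have i2: "integrable P0 (\<lambda>zs. (Lh n zs)^2)" "integrable P0 (\<lambda>zs. (Lk i n zs)^2)"
      unfolding Lh_def Lk_def by (intro lik_square_integrable H K)+
    have "norm ((LINT zs|P0. \<Psi> n zs * (Lh n zs)^2) - (LINT zs|P0. \<Psi> n zs * (Lk i n zs)^2)) = norm (LINT zs|P0. \<Psi> n zs * ((Lh n zs)^2 - (Lk i n zs)\<^sup>2))"
      using \<Psi>_mult_integrable[OF i2(1)] \<Psi>_mult_integrable[OF i2(2)] by (simp add: right_diff_distrib)
    also have "\<dots> \<le> (LINT zs|P0. norm ((Lh n zs)^2 - (Lk i n zs)\<^sup>2))"
      using i2 by (intro \<Psi>_integral_le) auto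
    also have "\<dots> = (LINT zs|P0. norm ((Lh n zs - of_real 1 * Lk i n zs) * (Lh n zs - of_real (-1) * Lk i n zs)))"
      by (simp add: power2_eq_square algebra_simps)
    also have "\<dots> \<le> b i n" unfolding b_def
    proof (rule integral_norm_mult_le)
      show "integrable P0 (\<lambda>zs. (norm (Lh n zs - of_real 1 * Lk i n zs))^2)" "integrable P0 (\<lambda>zs. (norm (Lh n zs - of_real (-1) * Lk i n zs))^2)"
        unfolding Lh_def Lk_def by (intro lik_comb_integrable H K)+
    qed auto
    finally show "norm ((LINT zs|P0. \<Psi> n zs * (Lh n zs)^2) - (LINT zs|P0. \<Psi> n zs * (Lk i n zs)^2)) \<le> b i n" .
  qed
  then show ?thesis using h by (simp add: good_def Lh_def)
qed

text \<open>Each squared factor is a polynomial in z with integrable coefficients, so expanding the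
  product over the observations turns the integral into a finite sum of powers of z.\<close>

lemma holomorphic_lik_integral:
  assumes k1: "k1 \<in> L20" and k2: "k2 \<in> L20"
  shows "(\<lambda>z. LINT zs|P0. \<Psi> n zs * (lik n (\<lambda>x. z * of_real (k1 x) + (1 - z + z^2) * of_real (k2 x)) zs)^2) holomorphic_on UNIV"
proof -
  note [measurable] = L20D(1)[OF k1] L20D(1)[OF k2]
  define d where "d = complex_of_real (2 * sqrt (real n))"
  \<comment> \<open>The coefficients of 1, z and z^2 in one factor of \<open>lik\<close> on the
    curve \<open>z k1 + (1 - z + z^2) k2\<close>.\<close>
  define A :: "nat \<Rightarrow> 'x \<Rightarrow> complex" where
    "A i x = (if i = 0 then 1 + k2 x / d else if i = 1 then (k1 x - k2 x) / d else k2 x / d)" for i x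
  define T where "T = {..2::nat} \<times> {..2::nat}"
  define C where "C \<tau> z = A (fst \<tau>) (fst z) * A (snd \<tau>) (fst z)" for \<tau> and z :: "'x \<times> 't"
  have A_meas [measurable]: "A i \<in> borel_measurable MX" for i
    unfolding A_def by (cases "i = 0"; cases "i = 1") auto
  have A2: "integrable M0 (\<lambda>x. (norm (A i x))^2)" for i
  proof -
    have 1: "(\<lambda>x. 1 * of_real 1) \<in> borel_measurable MX" by simp
    have r: "integrable M0 (\<lambda>x. (norm (h x / d))^2)" if "h \<in> L20" for h
      using L20D(2)[OF that] by (simp add: norm_divide power_divide)
    have "integrable M0 (\<lambda>x. (norm (1 + complex_of_real (k2 x) / d))^2)"
      using lik_factor(2)[OF CL20_of_real[OF k2] CL20_of_real[OF k2], of n]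
      unfolding d_def by (subst integral_M0(2)) auto
    then show ?thesis
      using r[OF k2] r[OF L20_diff[OF k1 k2]] unfolding A_def by (cases "i = 0"; cases "i = 1") auto
  qed
  have C: "integrable F0 (C \<tau>)" for \<tau> using integrable_mult_square[of "A (fst \<tau>)" M0 "A (snd \<tau>)"] A2
      integral_M0(2)[of "\<lambda>x. A (fst \<tau>) x * A (snd \<tau>) x"] by (simp add: C_def[abs_def])
  have sq: "(1 + (z * of_real (k1 x) + (1 - z + z^2) * of_real (k2 x)) / d)^2 = (\<Sum>\<tau>\<in>T. A (fst \<tau>) x * A (snd \<tau>) x * z ^ (fst \<tau> + snd \<tau>))" for z x
  proof -
    have "1 + (z * of_real (k1 x) + (1 - z + z^2) * of_real (k2 x)) / d = (\<Sum>i\<le>2. A i x * z ^ i)"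
      by (simp add: A_def numeral_2_eq_2 algebra_simps add_divide_distrib diff_divide_distrib)
    then have "(1 + (z * of_real (k1 x) + (1 - z + z^2) * of_real (k2 x)) / d)^2 = (\<Sum>i\<le>2. A i x * z ^ i) * (\<Sum>i\<le>2. A i x * z ^ i)"
      by (simp add: power2_eq_square)
    also have "\<dots> = (\<Sum>i\<le>2. \<Sum>j\<le>2. A i x * A j x * z ^ (i + j))"
      by (simp add: sum_product power_add mult_ac)
    also have "\<dots> = (\<Sum>\<tau>\<in>T. A (fst \<tau>) x * A (snd \<tau>) x * z ^ (fst \<tau> + snd \<tau>))"
      unfolding T_def by (simp add: sum.cartesian_product split_beta)
    finally show ?thesis .
  qed
  have T: "finite T" by (simp add: T_def)
  \<comment> \<open>The index \<open>\<pi>\<close> chooses, for every observation, one term from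
    each of the two copies of its factor.\<close>
  have lik_eq: "(lik n (\<lambda>x. z * of_real (k1 x) + (1 - z + z^2) * of_real (k2 x)) zs)^2 =
      (\<Sum>\<pi>\<in>PiE {..<n} (\<lambda>_. T). (\<Prod>j<n. C (\<pi> j) (zs j)) * (\<Prod>j<n. z ^ (fst (\<pi> j) + snd (\<pi> j))))" for z zs
    unfolding lik_def prod_power_distrib d_def[symmetric] sq
    using T by (subst prod_sum_PiE) (auto simp: C_def prod.distrib)
  have "(LINT zs|P0. \<Psi> n zs * (lik n (\<lambda>x. z * of_real (k1 x) + (1 - z + z^2) * of_real (k2 x)) zs)^2) =
      (\<Sum>\<pi>\<in>PiE {..<n} (\<lambda>_. T). (LINT zs|P0. \<Psi> n zs * (\<Prod>j<n. C (\<pi> j) (zs j))) * (\<Prod>j<n. z ^ (fst (\<pi> j) + snd (\<pi> j))))" for z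
  proof -
    have i: "integrable P0 (\<lambda>zs. \<Psi> n zs * (\<Prod>j<n. C (\<pi> j) (zs j)))" for \<pi>
      by (intro \<Psi>_mult_integrable integrable_iid_prod'[OF prob_F0] C)
    show ?thesis unfolding lik_eq sum_distrib_left mult.assoc[symmetric]
      using i by (subst Bochner_Integration.integral_sum) auto
  qed
  then show ?thesis by (simp only:) (intro holomorphic_intros)
qed

text \<open>The uniform bound on \<open>lik\<close> allows the limit to be continued from the
  positive reals to z = i, where the direction is \<open>i (k1 - k2)\<close>;
  \<open>lik_imaginary\<close> then converts the squared product into a character. Since the
  conclusion concerns a difference, k1 and k2 may be confined to a cone.\<close>

lemma iexp_goodI:
  assumes k1: "k1 \<in> L20" and k2: "k2 \<in> L20"
    and good: "\<And>z. 0 < z \<Longrightarrow> good (\<lambda>x. z * k1 x + (1 - z + z^2) * k2 x)"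
  shows "iexp_good (\<lambda>x. k1 x - k2 x)"
proof -
  define a b where "a = ip k1 k1" and "b = ip k2 k2"
  define J where "J n z = (LINT zs|P0. \<Psi> n zs * (lik n (\<lambda>x. z * of_real (k1 x) + (1 - z + z^2) * of_real (k2 x)) zs)^2)" for n z
  define q where "q z = z^2 * a + 2 * z * (1 - z + z^2) * ip k1 k2 + (1 - z + z^2)^2 * b" for z :: complex
  define l where "l z = z * of_real (ip \<phi> k1) + (1 - z + z^2) * of_real (ip \<phi> k2)" for z :: complex
  define g where "g z = \<Lambda> * exp (q z / 4 + \<kappa> * l z)" for z
  have CL: "(\<lambda>x. z * of_real (k1 x) + w * of_real (k2 x)) \<in> CL20" for z w
    by (intro CL20_lincomb CL20_of_real k1 k2)
  have "(\<lambda>n. J n \<i>) \<longlonglongrightarrow> g \<i>"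
  proof (rule Vitali_entire[where f=J and g=g and z=\<i>])
    show "J n holomorphic_on UNIV" for n
      unfolding J_def by (rule holomorphic_lik_integral[OF k1 k2])
    show "g holomorphic_on UNIV" unfolding g_def q_def l_def by (intro holomorphic_intros) auto
    show "\<exists>B. \<forall>n. \<forall>z\<in>cball 0 R. norm (J n z) \<le> B" for R
    proof (intro exI allI ballI)
      fix n and z :: complex assume z: "z \<in> cball 0 R"
      then have zR: "norm z \<le> R" "0 \<le> R" by (auto intro: order_trans[OF norm_ge_zero])
      define w where "w = 1 - z + z^2"
      have "norm w \<le> norm (1::complex) + norm z + norm (z^2)"
        unfolding w_def by (intro norm_triangle_le add_right_mono norm_triangle_ineq4)
      also have "\<dots> \<le> 1 + R + R^2" using zR by (auto simp: norm_power intro!: add_mono power_mono)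
      finally have w: "norm w \<le> 1 + R + R^2" .
      note h = CL[of z w]
      have "norm (J n z) \<le> (LINT zs|P0. norm ((lik n (\<lambda>x. z * of_real (k1 x) + w * of_real (k2 x)) zs)^2))"
        unfolding J_def w_def[symmetric] by (rule \<Psi>_integral_le[OF lik_square_integrable[OF h]])
      also have "\<dots> \<le> exp ((LINT x|M0. (norm (z * of_real (k1 x) + w * of_real (k2 x)))^2) / 4)"
        using lik_norm2(2)[OF h, of n] by (simp add: norm_power)
      also have "(LINT x|M0. (norm (z * of_real (k1 x) + w * of_real (k2 x)))^2) \<le> (LINT x|M0. 2 * R^2 * (k1 x)^2 + 2 * (1 + R + R^2)^2 * (k2 x)^2)"
      proof (rule integral_mono)
        show "integrable M0 (\<lambda>x. (norm (z * of_real (k1 x) + w * of_real (k2 x)))^2)" by (rule CL20D(2)[OF h])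
        show "integrable M0 (\<lambda>x. 2 * R^2 * (k1 x)^2 + 2 * (1 + R + R^2)^2 * (k2 x)^2)"
          using L20D(2)[OF k1] L20D(2)[OF k2] by simp
        fix x
        have "(norm (z * of_real (k1 x) + w * of_real (k2 x)))^2 \<le> (norm (z * of_real (k1 x)) + norm (w * of_real (k2 x)))^2"
          by (intro power_mono norm_triangle_ineq) auto
        also have "\<dots> \<le> 2 * (norm (z * of_real (k1 x)))^2 + 2 * (norm (w * of_real (k2 x)))^2"
          using sum_squares_bound[of "norm (z * of_real (k1 x))" "norm (w * of_real (k2 x))"] by (simp add: power2_sum)
        also have "\<dots> = 2 * ((norm z)^2 * (k1 x)^2) + 2 * ((norm w)^2 * (k2 x)^2)"
          by (simp add: norm_mult power_mult_distrib)
        also have "\<dots> \<le> 2 * (R^2 * (k1 x)^2) + 2 * ((1 + R + R^2)^2 * (k2 x)^2)"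
          using zR w by (intro add_mono mult_left_mono mult_right_mono power_mono) auto
        finally show "(norm (z * of_real (k1 x) + w * of_real (k2 x)))^2 \<le> 2 * R^2 * (k1 x)^2 + 2 * (1 + R + R^2)^2 * (k2 x)^2"
          by simp
      qed
      finally show "norm (J n z) \<le> exp ((LINT x|M0. 2 * R^2 * (k1 x)^2 + 2 * (1 + R + R^2)^2 * (k2 x)^2) / 4)"
        by simp
    qed
    show "(\<lambda>n. J n (of_real x)) \<longlonglongrightarrow> g (of_real x)" if "0 < x" for x
    proof -
      define w where "w = 1 - x + x^2"
      have k1': "k1 \<in> L2_space M0" and k2': "k2 \<in> L2_space M0" using k1 k2 L20D(5) by auto
      note c = L2_lincomb[OF k1' k2', of x w]
      have ipq: "ip (\<lambda>y. x * k1 y + w * k2 y) (\<lambda>y. x * k1 y + w * k2 y) = x^2 * a + 2 * x * w * ip k1 k2 + w^2 * b"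
        unfolding ip_lincomb(1)[OF k1' k2' c] ip_lincomb(2)[OF k1' k2' k1'] ip_lincomb(2)[OF k1' k2' k2']
        by (simp add: a_def b_def ip_commute power2_eq_square algebra_simps)
      have ipl: "ip \<phi> (\<lambda>y. x * k1 y + w * k2 y) = x * ip \<phi> k1 + w * ip \<phi> k2"
        by (rule ip_lincomb(2)[OF k1' k2' \<phi>])
      have "(\<lambda>n. LINT zs|P0. \<Psi> n zs * (lik n (\<lambda>y. of_real (x * k1 y + w * k2 y)) zs)^2) \<longlonglongrightarrow>
          \<Lambda> * exp (of_real (x^2 * a + 2 * x * w * ip k1 k2 + w^2 * b) / 4 + \<kappa> * of_real (x * ip \<phi> k1 + w * ip \<phi> k2))"
        using good[OF that] by (simp only: good_def w_def[symmetric] ipq ipl)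
      then show ?thesis by (simp add: J_def g_def q_def l_def w_def)
    qed
  qed
  have k1': "k1 \<in> L2_space M0" and k2': "k2 \<in> L2_space M0" using k1 k2 L20D(5) by auto
  define h where "h = (\<lambda>x. k1 x - k2 x)"
  have h: "h \<in> L20" unfolding h_def by (rule L20_diff[OF k1 k2])
  note [measurable] = L20D(1)[OF h]
  have ih: "(\<lambda>x. \<i> * complex_of_real (h x)) \<in> CL20"
    using CL20_lincomb[OF CL20_of_real[OF h] CL20_of_real[OF h], of \<i> 0] by simp
  \<comment> \<open>The coefficient \<open>1 - z + z^2\<close> equals -i at z = i.\<close>
  have q\<i>: "q \<i> = - of_real (ip h h)" and l\<i>: "l \<i> = \<i> * of_real (ip \<phi> h)"
  proof -
    have e: "ip h h = a - 2 * ip k1 k2 + b" "ip \<phi> h = ip \<phi> k1 - ip \<phi> k2"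
      using ip_diff[OF k1' k2'] ip_lincomb(2)[OF k1' k2' \<phi>, of 1 "-1"] by (simp_all add: h_def a_def b_def)
    show "q \<i> = - of_real (ip h h)" "l \<i> = \<i> * of_real (ip \<phi> h)"
      unfolding q_def l_def e by (simp_all add: algebra_simps)
  qed
  have J\<i>: "J n \<i> = (LINT zs|P0. \<Psi> n zs * (lik n (\<lambda>x. \<i> * of_real (h x)) zs)^2)" for n
    by (simp add: J_def h_def algebra_simps)
  define c where "c = exp (- ip h h / 4)"
  have "(\<lambda>n. LINT zs|P0. \<Psi> n zs * (iexp (fluct n h zs) - of_real c * (lik n (\<lambda>x. \<i> * of_real (h x)) zs)^2)) \<longlonglongrightarrow> 0"
  proof (rule Lim_null_comparison[OF _ lik_imaginary[OF h]])
    have i: "integrable P0 (\<lambda>zs. iexp (fluct n h zs) - of_real c * (lik n (\<lambda>x. \<i> * of_real (h x)) zs)^2)" for n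
      using lik_square_integrable[OF ih] P0.integrable_bounded[of "\<lambda>zs. iexp (fluct n h zs)" 1] by auto
    show "\<forall>\<^sub>F n in sequentially. norm (LINT zs|P0. \<Psi> n zs * (iexp (fluct n h zs) - of_real c * (lik n (\<lambda>x. \<i> * of_real (h x)) zs)^2))
      \<le> (LINT zs|P0. norm (iexp (fluct n h zs) - of_real (exp (- ip h h / 4)) * (lik n (\<lambda>x. \<i> * of_real (h x)) zs)^2))"
      unfolding c_def[symmetric] by (intro always_eventually allI \<Psi>_integral_le i)
  qed
  moreover have "(LINT zs|P0. \<Psi> n zs * (iexp (fluct n h zs) - of_real c * (lik n (\<lambda>x. \<i> * of_real (h x)) zs)^2)) =
      (LINT zs|P0. \<Psi> n zs * iexp (fluct n h zs)) - of_real c * J n \<i>" for n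
    using \<Psi>_mult_integrable[OF lik_square_integrable[OF ih]] \<Psi>_mult_integrable[OF P0.integrable_bounded[of "\<lambda>zs. iexp (fluct n h zs)" 1]]
    by (simp add: J\<i> right_diff_distrib mult.left_commute[of _ "complex_of_real c"])
  ultimately have "(\<lambda>n. (LINT zs|P0. \<Psi> n zs * iexp (fluct n h zs)) - of_real c * J n \<i>) \<longlonglongrightarrow> 0" by simp
  from tendsto_add[OF this tendsto_mult[OF tendsto_const \<open>(\<lambda>n. J n \<i>) \<longlonglongrightarrow> g \<i>\<close>, of "of_real c"]]
  have lim: "(\<lambda>n. LINT zs|P0. \<Psi> n zs * iexp (fluct n h zs)) \<longlonglongrightarrow> of_real c * g \<i>" by simp
  have "of_real c * g \<i> = \<Lambda> * (exp (- of_real (ip h h) / 4) * exp (- of_real (ip h h) / 4 + \<kappa> * (\<i> * of_real (ip \<phi> h))))"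
    by (simp add: g_def c_def q\<i> l\<i> exp_of_real[symmetric])
  also have "\<dots> = \<Lambda> * exp (- of_real (ip h h) / 2 + \<i> * \<kappa> * of_real (ip \<phi> h))"
    by (simp add: mult_ac flip: exp_add)
  finally show ?thesis using lim h by (simp add: iexp_good_def h_def)
qed

text \<open>Characters are Lipschitz with constant 1 and the L1 norm of \<open>fluct n d\<close> is
  at most the L2 norm of d, so the approximation is uniform in n.\<close>

lemma iexp_good_closure:
  assumes h: "h \<in> L20" and k: "\<And>i. iexp_good (k i)" and lim: "(\<lambda>i. ip (\<lambda>x. h x - k i x) (\<lambda>x. h x - k i x)) \<longlonglongrightarrow> 0"
  shows "iexp_good h"
proof -
  have k0: "k i \<in> L20" for i using k by (simp add: iexp_good_def)
  note ipl = ip_tendsto[OF L20D(5)[OF h] L20D(5)[OF k0] lim]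
  note [measurable] = L20D(1)[OF h] L20D(1)[OF k0]
  define d where "d i = (\<lambda>x. h x - k i x)" for i
  have d: "d i \<in> L20" for i unfolding d_def by (intro L20_diff h k0)
  have "(\<lambda>n. LINT zs|P0. \<Psi> n zs * iexp (fluct n h zs)) \<longlonglongrightarrow> \<Lambda> * exp (- of_real (ip h h) / 2 + \<i> * \<kappa> * of_real (ip \<phi> h))"
  proof (rule tendsto_approximation)
    show "(\<lambda>n. LINT zs|P0. \<Psi> n zs * iexp (fluct n (k i) zs)) \<longlonglongrightarrow> \<Lambda> * exp (- of_real (ip (k i) (k i)) / 2 + \<i> * \<kappa> * of_real (ip \<phi> (k i)))" for i
      using k[of i] by (simp add: iexp_good_def)
    show "(\<lambda>n::nat. sqrt (ip (d i) (d i))) \<longlonglongrightarrow> sqrt (ip (d i) (d i))" for i by simp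
    show "(\<lambda>i. sqrt (ip (d i) (d i))) \<longlonglongrightarrow> 0" using tendsto_real_sqrt[OF lim] by (simp add: d_def)
    show "(\<lambda>i. \<Lambda> * exp (- of_real (ip (k i) (k i)) / 2 + \<i> * \<kappa> * of_real (ip \<phi> (k i)))) \<longlonglongrightarrow> \<Lambda> * exp (- of_real (ip h h) / 2 + \<i> * \<kappa> * of_real (ip \<phi> h))"
      by (intro tendsto_intros ipl \<phi>) auto
    fix i n
    have ii: "integrable P0 (\<lambda>zs. iexp (fluct n h zs))" "integrable P0 (\<lambda>zs. iexp (fluct n (k i) zs))"
      by (auto intro!: P0.integrable_bounded[where B=1])
    have "norm ((LINT zs|P0. \<Psi> n zs * iexp (fluct n h zs)) - (LINT zs|P0. \<Psi> n zs * iexp (fluct n (k i) zs))) =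
       norm (LINT zs|P0. \<Psi> n zs * (iexp (fluct n h zs) - iexp (fluct n (k i) zs)))"
      using \<Psi>_mult_integrable[OF ii(1)] \<Psi>_mult_integrable[OF ii(2)] by (simp add: right_diff_distrib)
    also have "\<dots> \<le> (LINT zs|P0. norm (iexp (fluct n h zs) - iexp (fluct n (k i) zs)))"
      using ii by (intro \<Psi>_integral_le) auto
    also have "\<dots> \<le> (LINT zs|P0. \<bar>fluct n (d i) zs\<bar>)"
    proof (rule integral_mono)
      fix zs
      show "norm (iexp (fluct n h zs) - iexp (fluct n (k i) zs)) \<le> \<bar>fluct n (d i) zs\<bar>"
        using norm_iexp_diff[of "fluct n h zs" "fluct n (k i) zs"] fluct_lincomb[of n 1 h "-1" "k i" zs]
        by (simp add: d_def)
    qed (use ii fluct_integrable(1)[OF d] in auto)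
    also have "\<dots> \<le> sqrt (ip (d i) (d i))" by (rule fluct_integrable(2)[OF d])
    finally show "norm ((LINT zs|P0. \<Psi> n zs * iexp (fluct n h zs)) - (LINT zs|P0. \<Psi> n zs * iexp (fluct n (k i) zs))) \<le> sqrt (ip (d i) (d i))" .
  qed
  then show ?thesis using h by (simp add: iexp_good_def)
qed

end

context local_model
begin

text \<open>Being centred is orthogonality to the constant 1, a closed condition.\<close>

lemma L2_closure_subset_L20:
  assumes A: "A \<subseteq> L20" and h: "h \<in> L2_closure M0 A"
  shows "h \<in> L20" and "\<exists>k. (\<forall>i::nat. k i \<in> A) \<and> (\<lambda>i. ip (\<lambda>x. h x - k i x) (\<lambda>x. h x - k i x)) \<longlonglongrightarrow> 0"
proof -
  have h2: "h \<in> L2_space M0" using h by (simp add: L2_closure_def)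
  have ex: "\<exists>g\<in>A. sqrt (LINT x|M0. (h x - g x)^2) < e" if "e > 0" for e
    using h that by (auto simp: L2_closure_def)
  have "\<exists>g\<in>A. sqrt (ip (\<lambda>x. h x - g x) (\<lambda>x. h x - g x)) < inverse (real (Suc i))" for i
    using ex[of "inverse (real (Suc i))"] by (simp add: ip_def power2_eq_square)
  then obtain k where k: "\<And>i. k i \<in> A" "\<And>i. sqrt (ip (\<lambda>x. h x - k i x) (\<lambda>x. h x - k i x)) < inverse (real (Suc i))"
    by metis
  have lim: "(\<lambda>i. sqrt (ip (\<lambda>x. h x - k i x) (\<lambda>x. h x - k i x))) \<longlonglongrightarrow> 0"
  proof (rule Lim_null_comparison[OF _ LIMSEQ_inverse_real_of_nat])
    show "\<forall>\<^sub>F i in sequentially. norm (sqrt (ip (\<lambda>x. h x - k i x) (\<lambda>x. h x - k i x))) \<le> inverse (real (Suc i))"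
      using k(2) by (intro always_eventually allI) (simp add: ip_self_nonneg less_imp_le)
  qed
  have "(\<lambda>i. (sqrt (ip (\<lambda>x. h x - k i x) (\<lambda>x. h x - k i x)))^2) \<longlonglongrightarrow> 0\<^sup>2" by (intro tendsto_intros lim)
  then have lim2: "(\<lambda>i. ip (\<lambda>x. h x - k i x) (\<lambda>x. h x - k i x)) \<longlonglongrightarrow> 0" by (simp add: ip_self_nonneg)
  with k(1) show "\<exists>k. (\<forall>i::nat. k i \<in> A) \<and> (\<lambda>i. ip (\<lambda>x. h x - k i x) (\<lambda>x. h x - k i x)) \<longlonglongrightarrow> 0"
    by blast
  have "(\<lambda>i. ip (\<lambda>_. 1) (k i)) \<longlonglongrightarrow> ip (\<lambda>_. 1) h"
  proof (rule ip_tendsto(1)[OF h2 _ lim2])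
    show "k i \<in> L2_space M0" for i using k(1) A L20D(5) by blast
  qed (simp add: L2_space_iff)
  moreover have "ip (\<lambda>_. 1) (k i) = 0" for i using L20D(3)[of "k i"] k(1) A by (auto simp: ip_def)
  ultimately have "ip (\<lambda>_. 1) h = 0" by (simp add: LIMSEQ_const_iff)
  then show "h \<in> L20" using h2 by (simp add: L20_def L2_space_iff ip_def)
qed

lemma linear_span_subset_L20:
  assumes "A \<subseteq> L20"
  shows "linear_span A \<subseteq> L20"
proof
  fix h assume "h \<in> linear_span A"
  then obtain k :: nat and a r where h: "h = (\<lambda>x. \<Sum>i<k. a i * r i x)" "\<forall>i<k. r i \<in> A"
    by (auto simp: linear_span_def)
  have "(\<lambda>x. \<Sum>i<m. a i * r i x) \<in> L20" if "m \<le> k" for m using that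
  proof (induction m)
    case 0
    then show ?case by (simp add: L20_def)
  next
    case (Suc m)
    then have "(\<lambda>x. \<Sum>i<m. a i * r i x) \<in> L20" "r m \<in> L20" using h(2) assms by auto
    from L20_lincomb[OF this, of 1 "a m"] show ?case by simp
  qed
  then show "h \<in> L20" by (simp add: h(1))
qed

end

context local_limit
begin

lemma lin_good_lincomb:
  assumes h: "lin_good h" and k: "lin_good k"
  shows "lin_good (\<lambda>x. a * h x + b * k x)"
proof -
  have L: "h \<in> L20" "k \<in> L20" using h k by (auto simp: lin_good_def)
  note [measurable] = L20D(1)[OF L(1)] L20D(1)[OF L(2)]
  have i: "integrable P0 (\<lambda>zs. \<Psi> n zs * of_real (fluct n h zs))" "integrable P0 (\<lambda>zs. \<Psi> n zs * of_real (fluct n k zs))" for n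
    using fluct_integrable(1)[OF L(1), of n] fluct_integrable(1)[OF L(2), of n] by (auto intro!: \<Psi>_mult_integrable)
  have "(LINT zs|P0. \<Psi> n zs * of_real (fluct n (\<lambda>x. a * h x + b * k x) zs)) =
      of_real a * (LINT zs|P0. \<Psi> n zs * of_real (fluct n h zs)) + of_real b * (LINT zs|P0. \<Psi> n zs * of_real (fluct n k zs))" for n
  proof -
    have "\<Psi> n zs * of_real (fluct n (\<lambda>x. a * h x + b * k x) zs) =
        of_real a * (\<Psi> n zs * of_real (fluct n h zs)) + of_real b * (\<Psi> n zs * of_real (fluct n k zs))" for zs
      unfolding fluct_lincomb by (simp add: algebra_simps)
    then show ?thesis using i by simp
  qed
  moreover have "(\<lambda>n. of_real a * (LINT zs|P0. \<Psi> n zs * of_real (fluct n h zs)) + of_real b * (LINT zs|P0. \<Psi> n zs * of_real (fluct n k zs))) \<longlonglongrightarrow>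
      of_real a * (\<Lambda> * \<kappa> * of_real (ip \<phi> h)) + of_real b * (\<Lambda> * \<kappa> * of_real (ip \<phi> k))"
    using h k by (intro tendsto_intros) (auto simp: lin_good_def)
  moreover have "of_real a * (\<Lambda> * \<kappa> * of_real (ip \<phi> h)) + of_real b * (\<Lambda> * \<kappa> * of_real (ip \<phi> k)) = \<Lambda> * \<kappa> * of_real (ip \<phi> (\<lambda>x. a * h x + b * k x))"
    using ip_lincomb(2)[OF L20D(5)[OF L(1)] L20D(5)[OF L(2)] \<phi>, of a b] by (simp add: algebra_simps)
  ultimately show ?thesis using L20_lincomb[OF L] by (simp add: lin_good_def)
qed

lemma lin_good_closure:
  assumes h: "h \<in> L20" and k: "\<And>i. lin_good (k i)" and lim: "(\<lambda>i. ip (\<lambda>x. h x - k i x) (\<lambda>x. h x - k i x)) \<longlonglongrightarrow> 0"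
  shows "lin_good h"
proof -
  have k0: "k i \<in> L20" for i using k by (simp add: lin_good_def)
  note ipl = ip_tendsto[OF L20D(5)[OF h] L20D(5)[OF k0] lim]
  note [measurable] = L20D(1)[OF h] L20D(1)[OF k0]
  define d where "d i = (\<lambda>x. h x - k i x)" for i
  have d: "d i \<in> L20" for i unfolding d_def by (intro L20_diff h k0)
  have "(\<lambda>n. LINT zs|P0. \<Psi> n zs * of_real (fluct n h zs)) \<longlonglongrightarrow> \<Lambda> * \<kappa> * of_real (ip \<phi> h)"
  proof (rule tendsto_approximation)
    show "(\<lambda>n. LINT zs|P0. \<Psi> n zs * of_real (fluct n (k i) zs)) \<longlonglongrightarrow> \<Lambda> * \<kappa> * of_real (ip \<phi> (k i))" for i
      using k[of i] by (simp add: lin_good_def)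
    show "(\<lambda>n::nat. sqrt (ip (d i) (d i))) \<longlonglongrightarrow> sqrt (ip (d i) (d i))" for i by simp
    show "(\<lambda>i. sqrt (ip (d i) (d i))) \<longlonglongrightarrow> 0" using tendsto_real_sqrt[OF lim] by (simp add: d_def)
    show "(\<lambda>i. \<Lambda> * \<kappa> * of_real (ip \<phi> (k i))) \<longlonglongrightarrow> \<Lambda> * \<kappa> * of_real (ip \<phi> h)"
      by (intro tendsto_intros ipl \<phi>)
    fix i n
    have i1: "integrable P0 (\<lambda>zs. \<Psi> n zs * of_real (fluct n h zs))" "integrable P0 (\<lambda>zs. \<Psi> n zs * of_real (fluct n (k i) zs))"
      using fluct_integrable(1)[OF h, of n] fluct_integrable(1)[OF k0, of n] by (auto intro!: \<Psi>_mult_integrable)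
    have "fluct n (d i) zs = fluct n h zs - fluct n (k i) zs" for zs
      using fluct_lincomb[of n 1 h "-1" "k i" zs] by (simp add: d_def)
    then have "norm ((LINT zs|P0. \<Psi> n zs * of_real (fluct n h zs)) - (LINT zs|P0. \<Psi> n zs * of_real (fluct n (k i) zs))) =
       norm (LINT zs|P0. \<Psi> n zs * of_real (fluct n (d i) zs))"
      using i1 by (simp add: right_diff_distrib)
    also have "\<dots> \<le> (LINT zs|P0. norm (complex_of_real (fluct n (d i) zs)))"
      using fluct_integrable(1)[OF d] by (intro \<Psi>_integral_le) auto
    also have "\<dots> \<le> sqrt (ip (d i) (d i))" using fluct_integrable(2)[OF d] by simp
    finally show "norm ((LINT zs|P0. \<Psi> n zs * of_real (fluct n h zs)) - (LINT zs|P0. \<Psi> n zs * of_real (fluct n (k i) zs))) \<le> sqrt (ip (d i) (d i))" .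
  qed
  then show ?thesis using h by (simp add: lin_good_def)
qed

lemma zero_L20: "(\<lambda>_. 0) \<in> L20"
  by (simp add: L20_def)

lemma lin_good_zero: "lin_good (\<lambda>_. 0)"
  by (simp add: lin_good_def zero_L20 fluct_def ip_def)

text \<open>Continuation along the ray of a single score gives the limit of
  \<open>E (\<Psi> iexp (t fluct n \<rho>))\<close> for every t > 0. Letting t tend to 0 yields
  \<open>\<Lambda>\<close>, and the difference quotient in t yields the linear functional. Both
  exchanges of limits rest on moments of \<open>fluct\<close> that are bounded in n.\<close>

lemma good_score_limits:
  assumes \<rho>: "\<rho> \<in> L20" and good: "\<And>\<tau>. 0 < \<tau> \<Longrightarrow> good (\<lambda>x. \<tau> * \<rho> x)"
  shows "(\<lambda>n. LINT zs|P0. \<Psi> n zs) \<longlonglongrightarrow> \<Lambda>" and "lin_good \<rho>"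
proof -
  note [measurable] = L20D(1)[OF \<rho>]
  define b p where "b = ip \<rho> \<rho>" and "p = ip \<phi> \<rho>"
  define \<tau> where "\<tau> i = inverse (real (Suc i))" for i
  have \<tau>: "\<tau> i > 0" for i by (simp add: \<tau>_def)
  have \<tau>_lim: "\<tau> \<longlonglongrightarrow> 0" unfolding \<tau>_def by (rule LIMSEQ_inverse_real_of_nat)
  define E where "E x = \<Lambda> * exp (- of_real (x^2 * b) / 2 + \<i> * \<kappa> * of_real (x * p))" for x :: real
  have E: "(\<lambda>n. LINT zs|P0. \<Psi> n zs * iexp (t * fluct n \<rho> zs)) \<longlonglongrightarrow> E t" if t: "0 < t" for t
  proof -
    \<comment> \<open>With 0 as second direction the continuation stays on positive multiples of
      \<open>\<rho>\<close>.\<close>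
    have "iexp_good (\<lambda>x. t * \<rho> x - (\<lambda>_. 0) x)"
    proof (rule iexp_goodI[OF L20_scale[OF \<rho>] zero_L20])
      fix z :: real assume "0 < z"
      then show "good (\<lambda>x. z * (t * \<rho> x) + (1 - z + z^2) * 0)"
        using good[of "z * t"] t by (simp add: mult.assoc)
    qed
    moreover have "fluct n (\<lambda>x. t * \<rho> x) zs = t * fluct n \<rho> zs" for n zs
      using fluct_lincomb[of n t \<rho> 0 \<rho>] by simp
    moreover have "ip (\<lambda>x. t * \<rho> x) (\<lambda>x. t * \<rho> x) = t^2 * b" "ip \<phi> (\<lambda>x. t * \<rho> x) = t * p"
      by (simp_all add: ip_def b_def p_def power2_eq_square mult_ac flip: integral_mult_right_zero)
    ultimately show ?thesis by (simp add: iexp_good_def E_def)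
  qed
  have fi: "integrable P0 (\<lambda>zs. iexp (t * fluct n \<rho> zs))" for t n
    by (auto intro!: P0.integrable_bounded[where B=1])
  have \<Psi>i: "integrable P0 (\<Psi> n)" for n using \<Psi>_le by (intro P0.integrable_bounded[where B=1]) auto
  show \<Psi>_lim: "(\<lambda>n. LINT zs|P0. \<Psi> n zs) \<longlonglongrightarrow> \<Lambda>"
  proof (rule tendsto_approximation)
    show "(\<lambda>n. LINT zs|P0. \<Psi> n zs * iexp (\<tau> i * fluct n \<rho> zs)) \<longlonglongrightarrow> E (\<tau> i)" for i by (rule E[OF \<tau>])
    show "(\<lambda>n::nat. \<tau> i * sqrt b) \<longlonglongrightarrow> \<tau> i * sqrt b" for i by simp
    show "(\<lambda>i. \<tau> i * sqrt b) \<longlonglongrightarrow> 0" using tendsto_mult[OF \<tau>_lim tendsto_const] by simp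
    have "(\<lambda>i. E (\<tau> i)) \<longlonglongrightarrow> \<Lambda> * exp (- of_real (0\<^sup>2 * b) / 2 + \<i> * \<kappa> * of_real (0 * p))"
      unfolding E_def by (intro tendsto_intros \<tau>_lim) auto
    then show "(\<lambda>i. E (\<tau> i)) \<longlonglongrightarrow> \<Lambda>" by simp
    fix i n
    have "norm ((LINT zs|P0. \<Psi> n zs) - (LINT zs|P0. \<Psi> n zs * iexp (\<tau> i * fluct n \<rho> zs))) = norm (LINT zs|P0. \<Psi> n zs * (1 - iexp (\<tau> i * fluct n \<rho> zs)))"
      using \<Psi>i[of n] \<Psi>_mult_integrable[OF fi[of "\<tau> i" n], of n] by (simp add: right_diff_distrib)
    also have "\<dots> \<le> (LINT zs|P0. norm (1 - iexp (\<tau> i * fluct n \<rho> zs)))"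
      using fi by (intro \<Psi>_integral_le) auto
    also have "\<dots> \<le> (LINT zs|P0. \<tau> i * \<bar>fluct n \<rho> zs\<bar>)"
    proof (rule integral_mono)
      fix zs
      show "norm (1 - iexp (\<tau> i * fluct n \<rho> zs)) \<le> \<tau> i * \<bar>fluct n \<rho> zs\<bar>"
        using norm_iexp_diff[of 0 "\<tau> i * fluct n \<rho> zs"] \<tau>[of i] by (simp add: abs_mult)
    qed (use fi fluct_integrable(1)[OF \<rho>] in auto)
    also have "\<dots> \<le> \<tau> i * sqrt b" using fluct_integrable(2)[OF \<rho>, of n] \<tau>[of i] by (simp add: b_def)
    finally show "norm ((LINT zs|P0. \<Psi> n zs) - (LINT zs|P0. \<Psi> n zs * iexp (\<tau> i * fluct n \<rho> zs))) \<le> \<tau> i * sqrt b" .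
  qed
  have "(\<lambda>n. LINT zs|P0. \<Psi> n zs * of_real (fluct n \<rho> zs)) \<longlonglongrightarrow> \<Lambda> * \<kappa> * of_real p"
  proof (rule tendsto_approximation)
    show "(\<lambda>n. ((LINT zs|P0. \<Psi> n zs * iexp (\<tau> i * fluct n \<rho> zs)) - (LINT zs|P0. \<Psi> n zs)) / (\<i> * of_real (\<tau> i))) \<longlonglongrightarrow> (E (\<tau> i) - \<Lambda>) / (\<i> * of_real (\<tau> i))" for i
      using \<tau>[of i] by (intro tendsto_intros E \<Psi>_lim) auto
    show "(\<lambda>n::nat. \<tau> i * (b / 2)) \<longlonglongrightarrow> \<tau> i * (b / 2)" for i by simp
    show "(\<lambda>i. \<tau> i * (b / 2)) \<longlonglongrightarrow> 0" using tendsto_mult[OF \<tau>_lim tendsto_const] by simp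
    show "(\<lambda>i. (E (\<tau> i) - \<Lambda>) / (\<i> * of_real (\<tau> i))) \<longlonglongrightarrow> \<Lambda> * \<kappa> * of_real p"
    proof -
      \<comment> \<open>\<open>E\<close> extended to complex arguments; its derivative at 0 is the
        limit of the difference quotients.\<close>
      define e where "e z = \<Lambda> * exp (- (z^2 * of_real b) / 2 + \<i> * \<kappa> * (z * of_real p))" for z :: complex
      have "(e has_field_derivative \<Lambda> * (\<i> * \<kappa> * of_real p)) (at 0)"
        unfolding e_def by (auto intro!: derivative_eq_intros)
      then have "((\<lambda>z. (e z - e 0) / (z - 0)) \<longlongrightarrow> \<Lambda> * (\<i> * \<kappa> * of_real p)) (at 0)"
        by (simp only: has_field_derivative_iff)
      moreover have "filterlim (\<lambda>i. complex_of_real (\<tau> i)) (at 0) sequentially"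
        unfolding filterlim_at using \<tau> tendsto_of_real[OF \<tau>_lim, where 'a=complex]
        by (auto simp: less_imp_neq[symmetric])
      ultimately have "(\<lambda>i. (e (of_real (\<tau> i)) - e 0) / (of_real (\<tau> i) - 0)) \<longlonglongrightarrow> \<Lambda> * (\<i> * \<kappa> * of_real p)"
        by (rule filterlim_compose)
      then have "(\<lambda>i. (e (of_real (\<tau> i)) - e 0) / (of_real (\<tau> i) - 0) * (1 / \<i>)) \<longlonglongrightarrow> \<Lambda> * (\<i> * \<kappa> * of_real p) * (1 / \<i>)"
        by (intro tendsto_mult tendsto_const)
      moreover have "E x = e (of_real x)" "e 0 = \<Lambda>" for x by (simp_all add: E_def e_def)
      moreover have "\<Lambda> * (\<i> * \<kappa> * of_real p) * (1 / \<i>) = \<Lambda> * \<kappa> * of_real p * (\<i> * (1 / \<i>))"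
        by (simp only: mult_ac)
      then have "\<Lambda> * (\<i> * \<kappa> * of_real p) * (1 / \<i>) = \<Lambda> * \<kappa> * of_real p" by simp
      ultimately show ?thesis
        by (simp only: diff_zero times_divide_times_eq mult_1_right mult.commute[of "of_real _" \<i>])
    qed
    fix i n
    have f2: "integrable P0 (\<lambda>zs. complex_of_real (fluct n \<rho> zs))"
      using fluct_integrable(1)[OF \<rho>] by simp
    \<comment> \<open>The Taylor remainder of the exponential, scaled so that it is at most
      \<open>\<tau> i / 2\<close> times the square of \<open>fluct\<close>, whose mean is bounded in
      n.\<close>
    define R where "R zs = of_real (fluct n \<rho> zs) - (iexp (\<tau> i * fluct n \<rho> zs) - 1) / (\<i> * of_real (\<tau> i))" for zs
    have R: "integrable P0 R" unfolding R_def using f2 fi[of "\<tau> i" n] by auto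
    have "(LINT zs|P0. \<Psi> n zs * R zs) = (LINT zs|P0. \<Psi> n zs * of_real (fluct n \<rho> zs) - (\<Psi> n zs * iexp (\<tau> i * fluct n \<rho> zs) - \<Psi> n zs) / (\<i> * of_real (\<tau> i)))"
      unfolding R_def by (intro Bochner_Integration.integral_cong refl) (simp add: right_diff_distrib diff_divide_distrib)
    also have "\<dots> = (LINT zs|P0. \<Psi> n zs * of_real (fluct n \<rho> zs)) - ((LINT zs|P0. \<Psi> n zs * iexp (\<tau> i * fluct n \<rho> zs)) - (LINT zs|P0. \<Psi> n zs)) / (\<i> * of_real (\<tau> i))"
      using \<Psi>i[of n] \<Psi>_mult_integrable[OF fi[of "\<tau> i" n], of n] \<Psi>_mult_integrable[OF f2, of n] by simp
    finally have "norm ((LINT zs|P0. \<Psi> n zs * of_real (fluct n \<rho> zs)) - ((LINT zs|P0. \<Psi> n zs * iexp (\<tau> i * fluct n \<rho> zs)) - (LINT zs|P0. \<Psi> n zs)) / (\<i> * of_real (\<tau> i))) = norm (LINT zs|P0. \<Psi> n zs * R zs)"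
      by simp
    also have "\<dots> \<le> (LINT zs|P0. norm (R zs))" by (rule \<Psi>_integral_le[OF R])
    also have "\<dots> \<le> (LINT zs|P0. \<tau> i / 2 * (fluct n \<rho> zs)^2)"
    proof (rule integral_mono)
      fix zs
      define y where "y = \<tau> i * fluct n \<rho> zs"
      have "R zs = - (iexp y - 1 - \<i> * of_real y) / (\<i> * of_real (\<tau> i))"
        using \<tau>[of i] by (simp add: R_def y_def field_simps)
      then have "norm (R zs) = norm (iexp y - 1 - \<i> * of_real y) / \<tau> i"
        using \<tau>[of i] by (simp add: norm_divide norm_mult norm_minus_commute)
      also have "\<dots> \<le> (y^2 / 2) / \<tau> i"
        using iexp_approx1[of y 1] \<tau>[of i] by (intro divide_right_mono) (auto simp: power2_eq_square algebra_simps)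
      also have "\<dots> = \<tau> i / 2 * (fluct n \<rho> zs)^2" using \<tau>[of i] by (simp add: y_def power2_eq_square)
      finally show "norm (R zs) \<le> \<tau> i / 2 * (fluct n \<rho> zs)^2" .
    qed (use R fluct_norm2(1)[OF \<rho>] in auto)
    also have "\<dots> \<le> \<tau> i * (b / 2)" using fluct_norm2(2)[OF \<rho>, of n] \<tau>[of i] by (simp add: b_def)
    finally show "norm ((LINT zs|P0. \<Psi> n zs * of_real (fluct n \<rho> zs)) - ((LINT zs|P0. \<Psi> n zs * iexp (\<tau> i * fluct n \<rho> zs)) - (LINT zs|P0. \<Psi> n zs)) / (\<i> * of_real (\<tau> i))) \<le> \<tau> i * (b / 2)" .
  qed
  then show "lin_good \<rho>" using \<rho> by (simp add: lin_good_def p_def)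
qed

lemma lin_good_tangent:
  assumes A: "A \<subseteq> L20" and good: "\<And>\<rho>. \<rho> \<in> A \<Longrightarrow> lin_good \<rho>" and h: "h \<in> L2_closure M0 (linear_span A)"
  shows "lin_good h"
proof -
  have span: "lin_good g" if "g \<in> linear_span A" for g
  proof -
    obtain k :: nat and a r where g: "g = (\<lambda>x. \<Sum>i<k. a i * r i x)" "\<forall>i<k. r i \<in> A"
      using \<open>g \<in> linear_span A\<close> by (auto simp: linear_span_def)
    have "lin_good (\<lambda>x. \<Sum>i<m. a i * r i x)" if "m \<le> k" for m using that
    proof (induction m)
      case 0
      then show ?case by (simp add: lin_good_zero)
    next
      case (Suc m)
      then have "lin_good (\<lambda>x. \<Sum>i<m. a i * r i x)" "lin_good (r m)" using g(2) good by auto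
      from lin_good_lincomb[OF this, of 1 "a m"] show ?case by simp
    qed
    then show ?thesis by (simp add: g(1))
  qed
  note cl = L2_closure_subset_L20[OF linear_span_subset_L20[OF A] h]
  from cl(2) obtain k where "\<And>i::nat. k i \<in> linear_span A" "(\<lambda>i. ip (\<lambda>x. h x - k i x) (\<lambda>x. h x - k i x)) \<longlonglongrightarrow> 0"
    by blast
  then show ?thesis by (intro lin_good_closure[OF cl(1)]) (auto intro: span)
qed

text \<open>
  Convexity of the closed score set makes the positive cone over it closed under addition, so that every
  element of the linear span is a difference of two elements of the cone.
\<close>

lemma iexp_good_tangent:
  assumes A: "A \<subseteq> L20" "A \<noteq> {}" and good: "\<And>\<rho> c. \<rho> \<in> A \<Longrightarrow> 0 < c \<Longrightarrow> good (\<lambda>x. c * \<rho> x)"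
    and convex: "convex_set_of_functions (L2_closure M0 A)" and h: "h \<in> L2_closure M0 (linear_span A)"
  shows "iexp_good h"
proof -
  define K where "K = {(\<lambda>x. c * k x) | c k. 0 < (c::real) \<and> k \<in> L2_closure M0 A}"
  have A_cl: "\<rho> \<in> L2_closure M0 A" if "\<rho> \<in> A" for \<rho>
    using that A(1) L20D(5)[of \<rho>] by (auto simp: L2_closure_def intro!: bexI[of _ \<rho>])
  have K_good: "good g" and K_L20: "g \<in> L20" if "g \<in> K" for g
  proof -
    obtain c k where g: "g = (\<lambda>x. c * k x)" "0 < c" "k \<in> L2_closure M0 A"
      using \<open>g \<in> K\<close> by (auto simp: K_def)
    note cl = L2_closure_subset_L20[OF A(1) g(3)]
    show "g \<in> L20" unfolding g(1) by (rule L20_scale[OF cl(1)])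
    from cl(2) obtain r where r: "\<And>i::nat. r i \<in> A" "(\<lambda>i. ip (\<lambda>x. k x - r i x) (\<lambda>x. k x - r i x)) \<longlonglongrightarrow> 0"
      by blast
    have "ip (\<lambda>x. g x - c * r i x) (\<lambda>x. g x - c * r i x) = c^2 * ip (\<lambda>x. k x - r i x) (\<lambda>x. k x - r i x)" for i
    proof -
      have "(g x - c * r i x) * (g x - c * r i x) = c^2 * ((k x - r i x) * (k x - r i x))" for x
        by (simp add: g(1) power2_eq_square algebra_simps)
      then show ?thesis by (simp add: ip_def)
    qed
    then have "(\<lambda>i. ip (\<lambda>x. g x - c * r i x) (\<lambda>x. g x - c * r i x)) \<longlonglongrightarrow> 0"
      using tendsto_mult[OF tendsto_const r(2), of "c\<^sup>2"] by simp
    then show "good g" by (intro good_closure[OF \<open>g \<in> L20\<close>]) (auto intro: good r g(2))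
  qed
  have K_scale: "(\<lambda>x. c * g x) \<in> K" if "g \<in> K" "0 < c" for g c
  proof -
    obtain d k where "g = (\<lambda>x. d * k x)" "0 < d" "k \<in> L2_closure M0 A"
      using \<open>g \<in> K\<close> by (auto simp: K_def)
    then show ?thesis
      using \<open>0 < c\<close> by (auto simp: K_def mult.assoc[symmetric] intro!: exI[of _ "c * d"] exI[of _ k])
  qed
  have K_add: "(\<lambda>x. g x + g' x) \<in> K" if "g \<in> K" "g' \<in> K" for g g'
  proof -
    obtain c k where g: "g = (\<lambda>x. c * k x)" "0 < c" "k \<in> L2_closure M0 A"
      using \<open>g \<in> K\<close> by (auto simp: K_def)
    obtain c' k' where g': "g' = (\<lambda>x. c' * k' x)" "0 < c'" "k' \<in> L2_closure M0 A"
      using \<open>g' \<in> K\<close> by (auto simp: K_def)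
    define a where "a = c / (c + c')"
    have a: "0 \<le> a" "a \<le> 1" "(c + c') * a = c" "(c + c') * (1 - a) = c'"
      using g(2) g'(2) by (simp_all add: a_def field_simps)
    have "(\<lambda>x. a * k x + (1 - a) * k' x) \<in> L2_closure M0 A"
      using convex g(3) g'(3) a(1,2) by (simp add: convex_set_of_functions_def)
    moreover have "(\<lambda>x. g x + g' x) = (\<lambda>x. (c + c') * (a * k x + (1 - a) * k' x))"
    proof
      fix x
      have "(c + c') * (a * k x + (1 - a) * k' x) = ((c + c') * a) * k x + ((c + c') * (1 - a)) * k' x"
        by (simp add: algebra_simps)
      then show "g x + g' x = (c + c') * (a * k x + (1 - a) * k' x)"
        unfolding a(3,4) by (simp add: g(1) g'(1))
    qed
    ultimately show ?thesis using g(2) g'(2) unfolding K_def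
      by (intro CollectI exI[of _ "c + c'"] exI[of _ "\<lambda>x. a * k x + (1 - a) * k' x"]) auto
  qed
  have A_K: "(\<lambda>x. c * \<rho> x) \<in> K" if "\<rho> \<in> A" "0 < c" for \<rho> c
    using A_cl[OF that(1)] that(2) by (auto simp: K_def)
  obtain \<rho>0 where \<rho>0: "\<rho>0 \<in> A" using A(2) by blast
  have span: "iexp_good g" if "g \<in> linear_span A" for g
  proof -
    obtain m :: nat and a r where g: "g = (\<lambda>x. \<Sum>i<m. a i * r i x)" "\<forall>i<m. r i \<in> A"
      using \<open>g \<in> linear_span A\<close> by (auto simp: linear_span_def)
    have "\<exists>k1\<in>K. \<exists>k2\<in>K. (\<lambda>x. \<Sum>i<l. a i * r i x) = (\<lambda>x. k1 x - k2 x)" if "l \<le> m" for l using that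
    proof (induction l)
      case 0
      \<comment> \<open>The empty sum is written as a difference of equal elements, since the cone
        consists of strictly positive multiples and may miss 0.\<close>
      then show ?case using A_K[OF \<rho>0, of 1] by (intro bexI[of _ "\<lambda>x. 1 * \<rho>0 x"]) auto
    next
      case (Suc l)
      then obtain k1 k2 where k: "k1 \<in> K" "k2 \<in> K" "(\<lambda>x. \<Sum>i<l. a i * r i x) = (\<lambda>x. k1 x - k2 x)" by auto
      have r: "r l \<in> A" using g(2) Suc.prems by simp
      \<comment> \<open>Every real coefficient is a difference of two positive ones, which covers
        both signs of \<open>a l\<close>.\<close>
      define p q where "p = \<bar>a l\<bar> + 1" and "q = \<bar>a l\<bar> + 1 - a l"
      have pq: "0 < p" "0 < q" "a l = p - q" by (auto simp: p_def q_def)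
      have "(\<lambda>x. \<Sum>i<Suc l. a i * r i x) = (\<lambda>x. (k1 x + p * r l x) - (k2 x + q * r l x))"
      proof
        fix x
        show "(\<Sum>i<Suc l. a i * r i x) = (k1 x + p * r l x) - (k2 x + q * r l x)"
          using fun_cong[OF k(3), of x] by (simp add: pq(3) left_diff_distrib)
      qed
      then show ?case
        by (intro bexI[where x="\<lambda>x. k1 x + p * r l x"] bexI[where x="\<lambda>x. k2 x + q * r l x"]
            K_add[OF k(1) A_K[OF r pq(1)]] K_add[OF k(2) A_K[OF r pq(2)]])
    qed
    from this[of m] obtain k1 k2 where k: "k1 \<in> K" "k2 \<in> K" "g = (\<lambda>x. k1 x - k2 x)"
      by (auto simp: g(1))
    have "good (\<lambda>x. z * k1 x + (1 - z + z^2) * k2 x)" if "0 < z" for z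
    proof -
      have "0 < (z - 1/2)^2 + 3/4" by (intro add_nonneg_pos) auto
      also have "\<dots> = 1 - z + z^2" by (simp add: power2_eq_square algebra_simps)
      finally show ?thesis using that by (intro K_good K_add K_scale k)
    qed
    then show ?thesis unfolding k(3) by (intro iexp_goodI K_L20 k)
  qed
  note cl = L2_closure_subset_L20[OF linear_span_subset_L20[OF A(1)] h]
  from cl(2) obtain k where "\<And>i::nat. k i \<in> linear_span A" "(\<lambda>i. ip (\<lambda>x. h x - k i x) (\<lambda>x. h x - k i x)) \<longlonglongrightarrow> 0"
    by blast
  then show ?thesis by (intro iexp_good_closure[OF cl(1)]) (auto intro: span)
qed

end

section \<open>Small perturbations of likelihood products\<close>

context local_model
begin

text \<open>The exponential factors have modulus 1, so only the cross moment of one factor is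
  affected, and its change must be o(1/n). The part linear in \<open>r n\<close> integrates to 0;
  the rest is bounded through \<open>(r n)^2\<close>, \<open>|h| |r n|\<close> and
  \<open>h^2\<close> times a bounded sequence vanishing in mean. The lemma serves to exchange the
  conditional mean under a local alternative for the one under F0.\<close>

lemma lik_perturbation:
  assumes h: "h \<in> L20" and r: "\<And>n. r n \<in> L20" and lim: "(\<lambda>n. ip (r n) (r n)) \<longlonglongrightarrow> 0"
  shows "(\<lambda>n. LINT zs|P0. (norm (iexp (fluct n (r n) zs) * lik n (\<lambda>x. of_real (h x)) zs - lik n (\<lambda>x. of_real (h x)) zs))^2) \<longlonglongrightarrow> 0"
proof -
  note [measurable] = L20D(1)[OF h] L20D(1)[OF r]
  note H = CL20_of_real[OF h]
  define y where "y n x = r n x / sqrt (real n)" for n x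
  have [measurable]: "y n \<in> borel_measurable MX" for n unfolding y_def by measurable
  define b where "b n z = 1 + complex_of_real (h (fst z)) / of_real (2 * sqrt (real n))" for n and z :: "'x \<times> 't"
  define a where "a n z = iexp (y n (fst z)) * b n z" for n z
  have b: "b n \<in> borel_measurable F0" "integrable F0 (\<lambda>z. (norm (b n z))^2)" for n
    using lik_factor(1,2)[OF H H, of n] by (simp_all add: b_def[abs_def])
  have [measurable]: "b n \<in> borel_measurable F0" for n by (rule b)
  have a_meas: "a n \<in> borel_measurable F0" for n unfolding a_def by measurable
  have norm_a: "norm (a n z) = norm (b n z)" for n z by (simp add: a_def norm_mult)
  have beta: "(\<lambda>n. real n * ((LINT z|F0. (norm (b n z))^2) - 1)) \<longlonglongrightarrow> ip h h / 4"
    unfolding b_def lik_factor(4)[OF H H] using tendsto_eventually_mult_n[of "ip h h"] by (simp add: ip_def power2_eq_square)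
  define B where "B n x = (1 + h x / (2 * sqrt (real n)))^2" for n x
  have [measurable]: "B n \<in> borel_measurable MX" for n unfolding B_def by measurable
  have norm_b: "(norm (b n z))^2 = B n (fst z)" for n z
  proof -
    have "b n z = of_real (1 + h (fst z) / (2 * sqrt (real n)))" by (simp add: b_def)
    then show ?thesis by (simp only: norm_of_real B_def power2_abs)
  qed
  have B_int: "integrable M0 (B n)" for n
    using b(2)[of n] integral_M0(2)[of "B n"] by (simp add: norm_b)
  have ab: "a n z * cnj (b n z) = of_real (B n (fst z)) + of_real (B n (fst z)) * (iexp (y n (fst z)) - 1)" for n z
  proof -
    have "a n z * cnj (b n z) = iexp (y n (fst z)) * of_real ((norm (b n z))^2)"
      by (simp add: a_def complex_norm_square mult.assoc del: of_real_power)
    then show ?thesis unfolding norm_b by (simp add: algebra_simps)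
  qed
  define \<delta> where "\<delta> n = (LINT x|M0. of_real (B n x) * (iexp (y n x) - 1))" for n
  have Bi: "integrable M0 (\<lambda>x. of_real (B n x) * (iexp (y n x) - 1))" for n
  proof (rule Bochner_Integration.integrable_bound)
    show "integrable M0 (\<lambda>x. B n x * 2)" using B_int by simp
    show "AE x in M0. norm (of_real (B n x) * (iexp (y n x) - 1)) \<le> norm (B n x * 2)"
    proof (rule AE_I2)
      fix x
      have "norm (iexp (y n x) - 1) \<le> 2" by (rule order_trans[OF norm_triangle_ineq4]) simp
      then show "norm (of_real (B n x) * (iexp (y n x) - 1)) \<le> norm (B n x * 2)"
        unfolding norm_mult by (intro mult_mono) auto
    qed
  qed measurable
  have int_ab: "(LINT z|F0. a n z * cnj (b n z)) = of_real (LINT z|F0. (norm (b n z))^2) + \<delta> n" for n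
  proof -
    have "(LINT z|F0. a n z * cnj (b n z)) = (LINT x|M0. of_real (B n x) + of_real (B n x) * (iexp (y n x) - 1))"
      unfolding ab by (subst integral_M0(1)) auto
    also have "\<dots> = (LINT x|M0. complex_of_real (B n x)) + \<delta> n"
      unfolding \<delta>_def using Bi[of n] B_int[of n] by (intro Bochner_Integration.integral_add) auto
    also have "(LINT x|M0. complex_of_real (B n x)) = of_real (LINT z|F0. (norm (b n z))^2)"
      unfolding norm_b by (subst integral_complex_of_real) (simp add: integral_M0(1))
    finally show ?thesis .
  qed
  \<comment> \<open>\<open>Z\<close> bounds \<open>|iexp y - 1|\<close>. The cut at 2 is kept
    because \<open>h^2\<close> is merely integrable and cannot absorb a factor
    \<open>|y n x|\<close>.\<close>
  define Z where "Z n x = min 2 \<bar>y n x\<bar>" for n x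
  have [measurable]: "Z n \<in> borel_measurable MX" for n unfolding Z_def by measurable
  have r2: "integrable M0 (\<lambda>x. (r n x)^2)" "integrable M0 (r n)" "(LINT x|M0. r n x) = 0" for n
    using L20D[OF r[of n]] by auto
  have h2: "integrable M0 (\<lambda>x. (h x)^2)" "integrable M0 h" using L20D[OF h] by auto
  have Zi: "integrable M0 (Z n)" for n by (rule M0.integrable_bounded[where B=2]) (auto simp: Z_def)
  have sq_lim: "(\<lambda>n. sqrt (ip (r n) (r n))) \<longlonglongrightarrow> 0" using tendsto_real_sqrt[OF lim] by simp
  have abs_r: "(LINT x|M0. \<bar>r n x\<bar>) \<le> sqrt (ip (r n) (r n))" for n
    using integral_norm_mult_le[of "\<lambda>_. 1::real" M0 "r n"] r2(1)[of n] by (simp add: M0.prob_space ip_def power2_eq_square)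
  have Z_lim: "(\<lambda>n. LINT x|M0. (h x)^2 / 4 * Z n x) \<longlonglongrightarrow> 0"
  proof (rule integral_mult_tendsto_0[where B=2])
    show "(\<lambda>n. LINT x|M0. Z n x) \<longlonglongrightarrow> 0"
    proof (rule Lim_null_comparison[OF _ sq_lim])
      show "\<forall>\<^sub>F n in sequentially. norm (LINT x|M0. Z n x) \<le> sqrt (ip (r n) (r n))"
        using eventually_gt_at_top[of 0]
      proof eventually_elim
        case (elim n)
        have "(LINT x|M0. Z n x) \<le> (LINT x|M0. \<bar>r n x\<bar>)"
        proof (rule integral_mono)
          fix x
          have "\<bar>r n x\<bar> / sqrt (real n) \<le> \<bar>r n x\<bar> / 1" using elim by (intro divide_left_mono) auto
          then show "Z n x \<le> \<bar>r n x\<bar>" by (simp add: Z_def y_def)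
        qed (use Zi r2 in auto)
        moreover have "0 \<le> (LINT x|M0. Z n x)" by (intro integral_nonneg_AE AE_I2) (simp add: Z_def)
        ultimately show ?case using abs_r[of n] by simp
      qed
    qed
    show "\<forall>\<^sub>F n in sequentially. integrable M0 (Z n)" using Zi by simp
  qed (use h2 in \<open>auto simp: Z_def\<close>)
  have "(\<lambda>n. of_nat n * \<delta> n) \<longlonglongrightarrow> 0"
  proof (rule Lim_null_comparison)
    have "(\<lambda>n. ip (r n) (r n) / 2 + sqrt (ip h h) * sqrt (ip (r n) (r n)) + (LINT x|M0. (h x)^2 / 4 * Z n x)) \<longlonglongrightarrow> 0 / 2 + sqrt (ip h h) * 0 + 0"
      by (intro tendsto_intros lim sq_lim Z_lim) simp
    then show "(\<lambda>n. ip (r n) (r n) / 2 + sqrt (ip h h) * sqrt (ip (r n) (r n)) + (LINT x|M0. (h x)^2 / 4 * Z n x)) \<longlonglongrightarrow> 0" by simp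
    show "\<forall>\<^sub>F n in sequentially. norm (of_nat n * \<delta> n) \<le> ip (r n) (r n) / 2 + sqrt (ip h h) * sqrt (ip (r n) (r n)) + (LINT x|M0. (h x)^2 / 4 * Z n x)"
      using eventually_gt_at_top[of 0]
    proof eventually_elim
      case (elim n)
      then have n: "sqrt (real n) > 0" "real n > 0" by auto
      have rh: "integrable M0 (\<lambda>x. \<bar>h x\<bar> * \<bar>r n x\<bar>)"
        using L2_mult_integrable[OF L20D(5)[OF h] L20D(5)[OF r[of n]]] by (simp add: abs_mult[symmetric])
      have hZ: "integrable M0 (\<lambda>x. (h x)^2 / 4 * Z n x)"
      proof (rule Bochner_Integration.integrable_bound)
        show "integrable M0 (\<lambda>x. (h x)^2 / 4 * 2)" using h2 by simp
        show "AE x in M0. norm ((h x)^2 / 4 * Z n x) \<le> norm ((h x)^2 / 4 * 2)"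
          unfolding norm_mult by (intro AE_I2 mult_left_mono) (auto simp: Z_def)
      qed measurable
      \<comment> \<open>Subtracting \<open>i y\<close>, which has mean 0, removes the only term of
        order 1 / sqrt n.\<close>
      define e where "e x = of_real (B n x) * (iexp (y n x) - 1) - \<i> * of_real (y n x)" for x
      have yi: "integrable M0 (\<lambda>x. \<i> * complex_of_real (y n x))" "(LINT x|M0. \<i> * complex_of_real (y n x)) = 0"
        using r2[of n] by (simp_all add: y_def[abs_def])
      have ei: "integrable M0 e" unfolding e_def using Bi yi by auto
      have "\<delta> n = (LINT x|M0. e x)" unfolding \<delta>_def e_def using Bi[of n] yi by simp
      then have "norm (of_nat n * \<delta> n) \<le> real n * (LINT x|M0. norm (e x))"
        by (simp add: norm_mult mult_left_mono)
      also have "\<dots> = (LINT x|M0. real n * norm (e x))" by simp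
      also have "\<dots> \<le> (LINT x|M0. (r n x)^2 / 2 + \<bar>h x\<bar> * \<bar>r n x\<bar> + (h x)^2 / 4 * Z n x)"
      proof (rule integral_mono)
        fix x
        define t where "t = h x / (2 * sqrt (real n))"
        have B_eq: "B n x = 1 + 2 * t + t^2" by (simp add: B_def t_def power2_eq_square algebra_simps)
        have e_eq: "e x = (iexp (y n x) - 1 - \<i> * of_real (y n x)) + of_real (2 * t) * (iexp (y n x) - 1) + of_real (t^2) * (iexp (y n x) - 1)"
          unfolding e_def B_eq by (simp add: algebra_simps)
        have 1: "norm (iexp (y n x) - 1 - \<i> * of_real (y n x)) \<le> (y n x)^2 / 2"
          using iexp_approx1[of "y n x" 1] by (simp add: power2_eq_square algebra_simps)
        have d: "norm (iexp (y n x) - 1) \<le> \<bar>y n x\<bar>" using norm_iexp_diff[of "y n x" 0] by simp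
        moreover have "norm (iexp (y n x) - 1) \<le> 2" by (rule order_trans[OF norm_triangle_ineq4]) simp
        ultimately have dZ: "norm (iexp (y n x) - 1) \<le> Z n x" by (simp add: Z_def)
        have "norm (e x) \<le> (y n x)^2 / 2 + \<bar>2 * t\<bar> * \<bar>y n x\<bar> + t^2 * Z n x"
          unfolding e_eq using 1 d dZ
          by (intro norm_triangle_le add_mono) (auto simp: norm_mult simp del: of_real_mult of_real_power intro!: mult_left_mono)
        then have "real n * norm (e x) \<le> real n * ((y n x)^2 / 2 + \<bar>2 * t\<bar> * \<bar>y n x\<bar> + t^2 * Z n x)"
          by (intro mult_left_mono) auto
        also have "\<dots> = (r n x)^2 / 2 + \<bar>h x\<bar> * \<bar>r n x\<bar> + (h x)^2 / 4 * Z n x"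
        proof -
          have "real n * (y n x)^2 = (r n x)^2" using n by (simp add: y_def power_divide)
          moreover have "real n * (\<bar>2 * t\<bar> * \<bar>y n x\<bar>) = \<bar>h x\<bar> * \<bar>r n x\<bar>"
            using n by (simp add: y_def t_def abs_mult)
          moreover have "real n * t^2 = (h x)^2 / 4"
            using n by (simp add: t_def power_divide power_mult_distrib)
          moreover have "real n * (A / 2 + B + C * D) = (real n * A) / 2 + real n * B + (real n * C) * D" for A B C D
            by (simp add: distrib_left)
          ultimately show ?thesis by simp
        qed
        finally show "real n * norm (e x) \<le> (r n x)^2 / 2 + \<bar>h x\<bar> * \<bar>r n x\<bar> + (h x)^2 / 4 * Z n x" .
      qed (use ei r2 rh hZ in auto)
      also have "\<dots> = (LINT x|M0. (r n x)^2) / 2 + (LINT x|M0. \<bar>h x\<bar> * \<bar>r n x\<bar>) + (LINT x|M0. (h x)^2 / 4 * Z n x)"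
        using r2 rh hZ by simp
      also have "(LINT x|M0. \<bar>h x\<bar> * \<bar>r n x\<bar>) \<le> sqrt (ip h h) * sqrt (ip (r n) (r n))"
        using integral_norm_mult_le[of h M0 "r n"] h2 r2(1)[of n] by (simp add: ip_def power2_eq_square abs_mult)
      finally show ?case by (simp add: ip_def power2_eq_square)
    qed
  qed
  then have zeta: "(\<lambda>n. of_real (real n * ((LINT z|F0. (norm (b n z))^2) - 1)) + of_nat n * \<delta> n) \<longlonglongrightarrow> of_real (ip h h / 4) + 0"
    by (intro tendsto_intros beta)
  have "(\<lambda>n. LINT zs|iid F0. (norm ((\<Prod>j<n. a n (zs j)) - 1 * (\<Prod>j<n. b n (zs j))))^2) \<longlonglongrightarrow>
     exp (ip h h / 4) + (norm (1::complex))^2 * exp (ip h h / 4) - 2 * Re (cnj 1 * exp (of_real (ip h h / 4)))"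
  proof (rule iid_prod_approx[OF prob_F0])
    show "(\<lambda>n. of_nat n * ((LINT z|F0. a n z * cnj (b n z)) - 1)) \<longlonglongrightarrow> of_real (ip h h / 4)"
      unfolding int_ab using zeta by (simp add: algebra_simps)
  qed (use b beta a_meas in \<open>auto simp: norm_a\<close>)
  then have "(\<lambda>n. LINT zs|P0. (norm ((\<Prod>j<n. a n (zs j)) - (\<Prod>j<n. b n (zs j))))^2) \<longlonglongrightarrow> 0"
    by (simp add: Re_exp)
  moreover have "(\<Prod>j<n. a n (zs j)) = iexp (fluct n (r n) zs) * lik n (\<lambda>x. of_real (h x)) zs" for n zs
  proof -
    have "(\<Prod>j<n. iexp (y n (fst (zs j)))) = exp (\<Sum>j<n. \<i> * of_real (y n (fst (zs j))))"
      by (simp add: exp_sum)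
    also have "(\<Sum>j<n. \<i> * complex_of_real (y n (fst (zs j)))) = \<i> * of_real (fluct n (r n) zs)"
      by (simp add: y_def fluct_def sum_distrib_left sum_divide_distrib)
    finally show ?thesis by (simp add: a_def b_def lik_def prod.distrib)
  qed
  ultimately show ?thesis by (simp add: lik_def b_def)
qed

end

section \<open>The estimation model and its residuals\<close>

locale estimation_model =
  fixes MX :: "'x measure" and MT :: "'t measure"
    and \<F> :: "('x \<times> 't) measure set" and F0 :: "('x \<times> 't) measure"
    and u :: "('x, 't) utility"
    and ubar :: "'x \<Rightarrow> ('x \<times> 't) measure \<Rightarrow> real"
    and \<C> :: "(real \<Rightarrow> ('x \<times> 't) measure) set"
    and \<phi> :: "'x \<Rightarrow> real"
  assumes model: "\<And>F. F \<in> \<F> \<Longrightarrow> prob_space F \<and> sets F = sets (MX \<Otimes>\<^sub>M MT)"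
    and utility: "\<And>F. F \<in> \<F> \<Longrightarrow> integrable F (util u F)"
    and ubar: "\<And>F. F \<in> \<F> \<Longrightarrow> is_cond_mean_utility MX u F (\<lambda>x. ubar x F)"
    and F0: "F0 \<in> \<F>"
    and curves: "admissible_curves MX \<F> F0 \<C>"
    and var_diff: "\<And>\<gamma>. \<gamma> \<in> \<C> \<Longrightarrow>
          ((\<lambda>t. evar (marginal_X MX F0) (\<lambda>x. ubar x (\<gamma> t) - ubar x F0)) \<longlongrightarrow> 0) (at_right 0)"
    and law_w: "\<And>\<gamma>. \<gamma> \<in> \<C> \<Longrightarrow>
          weakly_tends (\<lambda>t. distr (\<gamma> t) borel (residual u ubar (\<gamma> t)))
            (distr F0 borel (residual u ubar F0)) (at_right 0)"
    and finite_w: "(\<integral>\<^sup>+z. ennreal ((residual u ubar F0 z)^2) \<partial>F0) < \<infinity>"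
    and moment_w: "\<And>\<gamma>. \<gamma> \<in> \<C> \<Longrightarrow>
          ((\<lambda>t. \<integral>\<^sup>+z. ennreal ((residual u ubar (\<gamma> t) z)^2) \<partial>\<gamma> t) \<longlongrightarrow>
             (\<integral>\<^sup>+z. ennreal ((residual u ubar F0 z)^2) \<partial>F0)) (at_right 0)"
    and phi_L2: "\<phi> \<in> L2_space (marginal_X MX F0)"
    and phi: "\<And>\<gamma> \<rho>. \<gamma> \<in> \<C> \<Longrightarrow> has_score MX F0 \<gamma> \<rho> \<Longrightarrow>
          ((\<lambda>t. (LINT x|marginal_X MX F0. ubar x (\<gamma> t) - ubar x F0) / t) \<longlongrightarrow>
             (LINT x|marginal_X MX F0. \<phi> x * \<rho> x)) (at_right 0)"
begin

sublocale local_model MX MT F0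
  by (rule local_model.intro) (rule model[OF F0, THEN conjunct1] model[OF F0, THEN conjunct2])+

lemma curveD:
  assumes "\<gamma> \<in> \<C>"
  shows "\<gamma> 0 = F0" "t \<in> {0..1} \<Longrightarrow> \<gamma> t \<in> \<F>"
  using curves assms by (auto simp: admissible_curves_def)

lemma
  assumes F: "F \<in> \<F>"
  shows prob_F: "prob_space F" and sets_F: "sets F = sets (MX \<Otimes>\<^sub>M MT)"
    and ubar_meas: "(\<lambda>x. ubar x F) \<in> borel_measurable MX"
    and ubar_integrable: "integrable F (\<lambda>z. ubar (fst z) F)"
    and integral_ubar: "(LINT z|F. ubar (fst z) F) = mean_utility u F"
    and residual_cond_centered: "cond_centered MX F (residual u ubar F)"
proof -
  show p: "prob_space F" and s: "sets F = sets (MX \<Otimes>\<^sub>M MT)" using model[OF F] by auto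
  interpret prob_space F by fact
  note [measurable] = measurable_fst_sets[OF p s]
  show m [measurable]: "(\<lambda>x. ubar x F) \<in> borel_measurable MX"
    using ubar[OF F] by (simp add: is_cond_mean_utility_def)
  define A where "A = vimage_algebra (space F) fst MX"
  have AE: "AE z in F. ubar (fst z) F = real_cond_exp F A (util u F) z"
    using ubar[OF F] by (simp add: is_cond_mean_utility_def A_def)
  have sub: "subalgebra F A" unfolding subalgebra_def A_def using measurable_fst_sets[OF p s]
    by (auto simp: sets_vimage_algebra2 measurable_def)
  interpret finite_measure_subalgebra F A
    by unfold_locales (rule sub)
  have fst_A: "fst \<in> measurable A MX"
    unfolding A_def using measurable_space[OF measurable_fst_sets[OF p s]] by (intro measurable_vimage_algebra1) auto
  have u: "integrable F (util u F)" by (rule utility[OF F])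
  then have [measurable]: "util u F \<in> borel_measurable F" by simp
  have ce_int: "integrable F (real_cond_exp F A (util u F))" "(LINT z|F. real_cond_exp F A (util u F) z) = (LINT z|F. util u F z)"
    using real_cond_exp_int[OF u] by auto
  show ui: "integrable F (\<lambda>z. ubar (fst z) F)"
    using ce_int(1) AE by (subst integrable_cong_AE[OF _ _ AE]) auto
  show "(LINT z|F. ubar (fst z) F) = mean_utility u F"
    using integral_cong_AE[OF _ _ AE] ce_int(2) by (simp add: mean_utility_def)
  have w_eq: "residual u ubar F = (\<lambda>z. ubar (fst z) F - util u F z)"
    by (auto simp: residual_def util_def)
  show "cond_centered MX F (residual u ubar F)" unfolding cond_centered_def
  proof (intro conjI ballI impI)
    show "integrable F (residual u ubar F)" unfolding w_eq using ui u by simp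
    fix k :: "'x \<Rightarrow> real" assume k [measurable]: "k \<in> borel_measurable MX" and k1: "\<forall>x. \<bar>k x\<bar> \<le> 1"
    have kb: "integrable F (\<lambda>z. k (fst z) * g z)" if "integrable F g" for g
      by (rule Bochner_Integration.integrable_bound[OF that])
        (use that k1 in \<open>auto simp: abs_mult intro!: mult_left_le_one_le\<close>)
    have "(\<lambda>z. k (fst z)) \<in> borel_measurable A" using fst_A k by (rule measurable_compose)
    from real_cond_exp_intg(2)[OF kb[OF u] this]
    have "(LINT z|F. k (fst z) * real_cond_exp F A (util u F) z) = (LINT z|F. k (fst z) * util u F z)"
      by simp
    moreover have "(LINT z|F. k (fst z) * ubar (fst z) F) = (LINT z|F. k (fst z) * real_cond_exp F A (util u F) z)"
      using AE by (intro integral_cong_AE) (auto elim: AE_mp)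
    ultimately show "(LINT z|F. k (fst z) * residual u ubar F z) = 0"
      unfolding w_eq using kb[OF ui] kb[OF u] by (simp add: right_diff_distrib)
  qed
qed

text \<open>The variance of the residual noise; it is the part of the bound that does not depend on
  the tangent space.\<close>

definition sig2 :: real where
  "sig2 = (LINT z|F0. (residual u ubar F0 z)^2)"

lemma residual_meas: "F \<in> \<F> \<Longrightarrow> residual u ubar F \<in> borel_measurable F"
  using residual_cond_centered by (auto simp: cond_centered_def)

lemma residual_F0_square: "integrable F0 (\<lambda>z. (residual u ubar F0 z)^2)"
  using finite_w residual_meas[OF F0] by (intro integrableI_bounded) auto

lemma nn_residual: "(\<integral>\<^sup>+z. ennreal ((residual u ubar F0 z)^2) \<partial>F0) = ennreal sig2"
  unfolding sig2_def using residual_F0_square by (intro nn_integral_eq_integral) auto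

text \<open>Along a curve, convergence of the second moments and of the laws of the residuals yields
  Lindeberg's condition. The alternative \<open>t n = 0\<close> makes the same statement available
  under F0 itself.\<close>

lemma residual_CLT:
  fixes G :: "nat \<Rightarrow> (nat \<Rightarrow> 'x) \<Rightarrow> complex" and t :: "nat \<Rightarrow> real"
  assumes \<gamma>: "\<gamma> \<in> \<C>" and t: "\<And>n. t n \<in> {0..1}" "filterlim t (at_right 0) sequentially \<or> (\<forall>n. t n = 0)"
    and G: "\<And>n. G n \<in> borel_measurable (PiM {..<n} (\<lambda>_. MX))" "\<And>n x. norm (G n x) \<le> 1"
  shows "(\<lambda>n. (LINT zs|iid (\<gamma> (t n)). G n (observed n zs) * iexp (s * ((\<Sum>j<n. residual u ubar (\<gamma> (t n)) (zs j)) / sqrt (real n))))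
      - of_real (exp (- (s^2 * sig2) / 2)) * (LINT zs|iid (\<gamma> (t n)). G n (observed n zs))) \<longlonglongrightarrow> 0"
proof -
  define N where "N n = \<gamma> (t n)" for n
  have N: "N n \<in> \<F>" for n unfolding N_def by (rule curveD(2)[OF \<gamma> t(1)])
  define M2 where "M2 F = (\<integral>\<^sup>+z. ennreal ((residual u ubar F z)^2) \<partial>F)" for F
  have M2_lim: "(\<lambda>n. M2 (N n)) \<longlonglongrightarrow> M2 F0" using t(2)
  proof
    assume "filterlim t (at_right 0) sequentially"
    from filterlim_compose[OF moment_w[OF \<gamma>] this] show ?thesis by (simp add: M2_def N_def)
  next
    assume "\<forall>n. t n = 0"
    then show ?thesis by (simp add: N_def curveD(1)[OF \<gamma>])
  qed
  have law: "weakly_tends (\<lambda>n. distr (N n) borel (residual u ubar (N n))) (distr F0 borel (residual u ubar F0)) sequentially"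
    using t(2)
  proof
    assume t: "filterlim t (at_right 0) sequentially"
    show ?thesis
      using law_w[OF \<gamma>] unfolding weakly_tends_def N_def by (auto intro!: filterlim_compose[OF _ t])
  next
    assume "\<forall>n. t n = 0"
    then show ?thesis by (simp add: N_def curveD(1)[OF \<gamma>] weakly_tends_def)
  qed
  have M20: "M2 F0 < \<infinity>" using finite_w by (simp add: M2_def)
  then have ev: "\<forall>\<^sub>F n in sequentially. M2 (N n) < \<infinity>"
    using order_tendstoD(2)[OF M2_lim, of \<infinity>] by simp
  \<comment> \<open>The second moment under \<open>N n\<close> may be infinite for finitely many n.
    There the residual is replaced by 0, so that the hypotheses of \<open>conditional_CLT\<close>
    hold for every n.\<close>
  define w where "w n z = (if M2 (N n) < \<infinity> then residual u ubar (N n) z else 0)" for n z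
  have w_meas: "w n \<in> borel_measurable (N n)" for n
    using residual_meas[OF N[of n]] unfolding w_def[abs_def] by (cases "M2 (N n) < \<infinity>") auto
  have w2: "integrable (N n) (\<lambda>z. (w n z)^2)" for n
  proof (cases "M2 (N n) < \<infinity>")
    case True
    then have "integrable (N n) (\<lambda>z. (residual u ubar (N n) z)^2)"
      using residual_meas[OF N[of n]] by (intro integrableI_bounded) (auto simp: M2_def)
    then show ?thesis using True by (simp add: w_def)
  qed (simp add: w_def)
  have "(\<lambda>n. enn2real (M2 (N n))) \<longlonglongrightarrow> enn2real (M2 F0)"
    using M2_lim M20 by (intro tendsto_enn2real) auto
  also have "enn2real (M2 F0) = sig2"
    using residual_F0_square by (simp add: M2_def nn_residual sig2_def)
  finally have lim: "(\<lambda>n. enn2real (M2 (N n))) \<longlonglongrightarrow> sig2" .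
  have "\<forall>\<^sub>F n in sequentially. enn2real (M2 (N n)) = (LINT z|N n. (w n z)^2)" using ev
  proof eventually_elim
    case (elim n)
    then show ?case
      using residual_meas[OF N[of n]] by (subst integral_eq_nn_integral) (auto simp: w_def M2_def)
  qed
  with lim have V: "(\<lambda>n. LINT z|N n. (w n z)^2) \<longlonglongrightarrow> sig2" by (rule Lim_transform_eventually)
  have cc: "cond_centered MX (N n) (w n)" for n
    using residual_cond_centered[OF N[of n]] unfolding w_def[abs_def]
    by (cases "M2 (N n) < \<infinity>") (auto simp: cond_centered_def)
  have law': "weakly_tends (\<lambda>n. distr (N n) borel (w n)) (distr F0 borel (residual u ubar F0)) sequentially"
    unfolding weakly_tends_def
  proof (intro allI impI)
    fix f :: "real \<Rightarrow> real" assume "continuous_on UNIV f \<and> bounded (range f)"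
    with law have "(\<lambda>n. LINT x|distr (N n) borel (residual u ubar (N n)). f x) \<longlonglongrightarrow> (LINT x|distr F0 borel (residual u ubar F0). f x)"
      by (simp add: weakly_tends_def)
    then show "(\<lambda>n. LINT x|distr (N n) borel (w n). f x) \<longlonglongrightarrow> (LINT x|distr F0 borel (residual u ubar F0). f x)"
    proof (rule Lim_transform_eventually)
      show "\<forall>\<^sub>F n in sequentially. (LINT x|distr (N n) borel (residual u ubar (N n)). f x) = (LINT x|distr (N n) borel (w n). f x)"
        using ev by eventually_elim (simp add: w_def[abs_def])
    qed
  qed
  have ui: "(\<lambda>n. LINT z|N n. (w n z)^2 * min 1 (\<bar>w n z\<bar> / sqrt (real n))) \<longlonglongrightarrow> 0"
    using V by (intro uniformly_integrable_square[OF w_meas w2 prob_F[OF N] residual_meas[OF F0] residual_F0_square law'])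
      (simp add: sig2_def)
  have "(\<lambda>n. (LINT zs|iid (N n). G n (observed n zs) * iexp (s * ((\<Sum>j<n. w n (zs j)) / sqrt (real n))))
      - of_real (exp (- (s^2 * sig2) / 2)) * (LINT zs|iid (N n). G n (observed n zs))) \<longlonglongrightarrow> 0"
    by (rule conditional_CLT[OF prob_F[OF N] sets_F[OF N] cc w2 V ui G])
  then show ?thesis
  proof (rule Lim_transform_eventually)
    show "\<forall>\<^sub>F n in sequentially. (LINT zs|iid (N n). G n (observed n zs) * iexp (s * ((\<Sum>j<n. w n (zs j)) / sqrt (real n))))
      - of_real (exp (- (s^2 * sig2) / 2)) * (LINT zs|iid (N n). G n (observed n zs)) =
       (LINT zs|iid (\<gamma> (t n)). G n (observed n zs) * iexp (s * ((\<Sum>j<n. residual u ubar (\<gamma> (t n)) (zs j)) / sqrt (real n))))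
      - of_real (exp (- (s^2 * sig2) / 2)) * (LINT zs|iid (\<gamma> (t n)). G n (observed n zs))"
      using ev by eventually_elim (simp add: w_def N_def)
  qed
qed

end

section \<open>Local asymptotic normality along a curve\<close>

context estimation_model
begin

lemma ac_part_facts:
  assumes F: "F \<in> \<F>" and ac: "is_ac_part_deriv M0 (marginal_X MX F) f"
  shows "f \<in> borel_measurable M0" "\<And>x. x \<in> space M0 \<Longrightarrow> 0 \<le> f x" "integrable M0 f"
  using ac observed_change_of_measure(1)[OF prob_F[OF F] sets_F[OF F] prob_F0 sets_F0 ac, of "\<lambda>_. 0" 0]
  by (auto simp: is_ac_part_deriv_def)

lemma local_parameter_rescale:
  fixes X :: "nat \<Rightarrow> real"
  assumes c: "c > 0" and X: "(\<lambda>n. X n / (min 1 (c / sqrt (real n)))^2) \<longlonglongrightarrow> L"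
  shows "(\<lambda>n. real n * X n) \<longlonglongrightarrow> c\<^sup>2 * L"
proof -
  have "(\<lambda>n. c\<^sup>2 * (X n / (min 1 (c / sqrt (real n)))^2)) \<longlonglongrightarrow> c\<^sup>2 * L" by (intro tendsto_intros X)
  then show ?thesis
  proof (rule Lim_transform_eventually)
    show "\<forall>\<^sub>F n in sequentially. c\<^sup>2 * (X n / (min 1 (c / sqrt (real n)))^2) = real n * X n"
      using local_parameter(2)[OF c]
    proof eventually_elim
      case (elim n)
      then have "(min 1 (c / sqrt (real n)))^2 = c^2 / real n" by (simp add: power_divide)
      then show ?case using c by simp
    qed
  qed
qed

text \<open>Local asymptotic normality in L2 form: the product of the root densities is
  asymptotically a constant times \<open>lik\<close>, and the mass lost to the singular part by n
  observations vanishes. The rates come from \<open>score_expansion\<close>.\<close>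

lemma score_LAN:
  assumes \<gamma>: "\<gamma> \<in> \<C>" and score: "has_score MX F0 \<gamma> \<rho>" and c: "c > 0"
  defines "t \<equiv> \<lambda>n::nat. min 1 (c / sqrt (real n))"
  shows "\<rho> \<in> L20"
    and "\<exists>f. (\<forall>n. is_ac_part_deriv M0 (marginal_X MX (\<gamma> (t n))) (f n)) \<and> (\<lambda>n. (LINT x|M0. f n x) ^ n) \<longlonglongrightarrow> 1 \<and>
      (\<lambda>n. LINT zs|P0. (norm ((\<Prod>j<n. complex_of_real (sqrt (f n (fst (zs j))))) -
         of_real (exp (- (c^2 * ip \<rho> \<rho>) / 8)) * lik n (\<lambda>x. of_real (c * \<rho> x)) zs))^2) \<longlonglongrightarrow> 0"
proof -
  have t: "\<And>n. t n \<in> {0..1}" "\<forall>\<^sub>F n in sequentially. t n = c / sqrt (real n) \<and> n > 0"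
    "filterlim t (at_right 0) sequentially" using local_parameter[OF c] unfolding t_def by auto
  obtain g where \<rho>2: "\<rho> \<in> L2_space M0"
    and g: "\<And>t. t \<in> {0..1} \<Longrightarrow> is_ac_part_deriv M0 (marginal_X MX (\<gamma> t)) (g t)"
    and g2: "(\<lambda>t. LINT x|M0. (sqrt (g t x) - 1 - t * \<rho> x / 2)^2) \<in> o[at_right 0](\<lambda>t. t\<^sup>2)"
    and g3: "(\<lambda>t. (LINT x|M0. g t x) - 1) \<in> o[at_right 0](\<lambda>t. t\<^sup>2)"
    using score unfolding has_score_def Let_def by blast
  define f where "f n = g (t n)" for n
  have ac: "is_ac_part_deriv M0 (marginal_X MX (\<gamma> (t n))) (f n)" for n
    unfolding f_def by (rule g[OF t(1)])
  note f = ac_part_facts[OF curveD(2)[OF \<gamma> t(1)] ac]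
  have f2: "(\<lambda>n. (LINT x|M0. (sqrt (f n x) - 1 - t n * \<rho> x / 2)^2) / (t n)^2) \<longlonglongrightarrow> 0"
    using filterlim_compose[OF smalloD_tendsto[OF g2] t(3)] by (simp add: f_def)
  have f3: "(\<lambda>n. ((LINT x|M0. f n x) - 1) / (t n)^2) \<longlonglongrightarrow> 0"
    using filterlim_compose[OF smalloD_tendsto[OF g3] t(3)] by (simp add: f_def)
  have \<rho>M0: "\<rho> \<in> borel_measurable M0" "integrable M0 (\<lambda>x. (\<rho> x)^2)" using \<rho>2 by (auto simp: L2_space_def)
  note exp = score_expansion[OF M0.prob_space_axioms \<rho>M0 f t(3) f2 f3]
  show \<rho>: "\<rho> \<in> L20" using exp(1) \<rho>2 by (simp add: L20_def L2_space_iff)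
  define h where "h x = c * \<rho> x" for x
  have h: "h \<in> L20" unfolding h_def by (rule L20_scale[OF \<rho>])
  have hh: "ip h h = c^2 * ip \<rho> \<rho>"
  proof -
    have "h x * h x = c^2 * (\<rho> x * \<rho> x)" for x by (simp add: h_def power2_eq_square)
    then show ?thesis by (simp add: ip_def)
  qed
  note H = CL20_of_real[OF h]
  have f_meas [measurable]: "f n \<in> borel_measurable MX" for n
    using f(1)[of n] by (simp add: measurable_cong_sets[OF sets_M0 refl])
  have mass: "(\<lambda>n. real n * ((LINT x|M0. f n x) - 1)) \<longlonglongrightarrow> 0"
    using local_parameter_rescale[OF c f3[unfolded t_def]] by simp
  have mix: "(\<lambda>n. real n * ((LINT x|M0. sqrt (f n x) * (1 + t n * \<rho> x / 2)) - 1)) \<longlonglongrightarrow> ip h h / 8"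
  proof -
    have "ip h h = c^2 * (LINT x|M0. (\<rho> x)^2)"
      using hh by (simp add: ip_def[of \<rho> \<rho>] power2_eq_square)
    then show ?thesis
      using local_parameter_rescale[OF c exp(2)[unfolded t_def]] by (simp add: t_def)
  qed
  define a where "a n z = complex_of_real (sqrt (f n (fst z)))" for n and z :: "'x \<times> 't"
  define b where "b n z = 1 + complex_of_real (h (fst z)) / of_real (2 * sqrt (real n))" for n and z :: "'x \<times> 't"
  have b: "b n \<in> borel_measurable F0" "integrable F0 (\<lambda>z. (norm (b n z))^2)" for n
    using lik_factor(1,2)[OF H H, of n] by (simp_all add: b_def[abs_def])
  have a: "a n \<in> borel_measurable F0" for n unfolding a_def by measurable
  have fst_space: "fst z \<in> space M0" if "z \<in> space F0" for z
    using measurable_space[OF measurable_fst_F0 that] by (simp add: space_marginal[OF prob_F0 sets_F0])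
  have norm_a: "(norm (a n z))^2 = f n (fst z)" if "z \<in> space F0" for n z
    using f(2)[OF fst_space[OF that]] by (simp add: a_def)
  have fF: "integrable F0 (\<lambda>z. f n (fst z))" "(LINT z|F0. f n (fst z)) = (LINT x|M0. f n x)" for n
    using f(3)[of n] integral_M0[of "f n"] by auto
  have a2: "integrable F0 (\<lambda>z. (norm (a n z))^2)" "(LINT z|F0. (norm (a n z))^2) = (LINT x|M0. f n x)" for n
    using fF[of n] by (simp_all add: norm_a cong: Bochner_Integration.integrable_cong Bochner_Integration.integral_cong)
  \<comment> \<open>The rates have the limits 0, 2q and q with \<open>q = ip h h / 8\<close>, and
    \<open>1 + k^2 e^(2q) - 2 k e^q\<close> vanishes at \<open>k = e^(-q)\<close>.\<close>
  define k where "k = exp (- (c^2 * ip \<rho> \<rho>) / 8)"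
  have "(\<lambda>n. LINT zs|iid F0. (norm ((\<Prod>j<n. a n (zs j)) - of_real k * (\<Prod>j<n. b n (zs j))))^2) \<longlonglongrightarrow>
     exp 0 + (norm (complex_of_real k))^2 * exp (ip h h / 4) - 2 * Re (cnj (of_real k) * exp (of_real (ip h h / 8)))"
  proof (rule iid_prod_approx[OF prob_F0 a b(1) a2(1) b(2)])
    show "(\<lambda>n. real n * ((LINT z|F0. (norm (a n z))^2) - 1)) \<longlonglongrightarrow> 0" unfolding a2(2) by (rule mass)
    show "(\<lambda>n. real n * ((LINT z|F0. (norm (b n z))^2) - 1)) \<longlonglongrightarrow> ip h h / 4"
      unfolding b_def lik_factor(4)[OF H H] using tendsto_eventually_mult_n[of "ip h h"] by (simp add: ip_def power2_eq_square)
    have "(\<lambda>n. complex_of_real (real n * ((LINT x|M0. sqrt (f n x) * (1 + t n * \<rho> x / 2)) - 1))) \<longlonglongrightarrow> of_real (ip h h / 8)"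
      by (rule tendsto_of_real[OF mix])
    then show "(\<lambda>n. of_nat n * ((LINT z|F0. a n z * cnj (b n z)) - 1)) \<longlonglongrightarrow> of_real (ip h h / 8)"
    proof (rule Lim_transform_eventually)
      show "\<forall>\<^sub>F n in sequentially. complex_of_real (real n * ((LINT x|M0. sqrt (f n x) * (1 + t n * \<rho> x / 2)) - 1)) = of_nat n * ((LINT z|F0. a n z * cnj (b n z)) - 1)"
        using t(2)
      proof eventually_elim
        case (elim n)
        \<comment> \<open>Eventually \<open>t n\<close> equals \<open>c / sqrt n\<close>, so
          \<open>b n\<close> is the factor \<open>1 + t n \<rho> / 2\<close> of the score
          expansion.\<close>
        then have "a n z * cnj (b n z) = of_real (sqrt (f n (fst z)) * (1 + t n * \<rho> (fst z) / 2))" for z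
          by (simp add: a_def b_def h_def)
        then have "(LINT z|F0. a n z * cnj (b n z)) = of_real (LINT z|F0. sqrt (f n (fst z)) * (1 + t n * \<rho> (fst z) / 2))"
          by (simp only: integral_complex_of_real)
        also have "(LINT z|F0. sqrt (f n (fst z)) * (1 + t n * \<rho> (fst z) / 2)) = (LINT x|M0. sqrt (f n x) * (1 + t n * \<rho> x / 2))"
          using L20D(1)[OF \<rho>] by (subst integral_M0(1)) auto
        finally show ?case by simp
      qed
    qed
  qed
  moreover have "exp 0 + (norm (complex_of_real k))^2 * exp (ip h h / 4) - 2 * Re (cnj (of_real k) * exp (of_real (ip h h / 8))) = 0"
  proof -
    have k: "k * exp (ip h h / 8) = 1" by (simp add: k_def hh flip: exp_add)
    have "k\<^sup>2 * exp (ip h h / 4) = (k * exp (ip h h / 8))^2"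
      by (simp add: power2_eq_square mult_ac flip: exp_add)
    then show ?thesis using k by (simp add: Re_exp)
  qed
  ultimately have "(\<lambda>n. LINT zs|P0. (norm ((\<Prod>j<n. a n (zs j)) - of_real k * (\<Prod>j<n. b n (zs j))))^2) \<longlonglongrightarrow> 0"
    by simp
  moreover have "(\<lambda>n. (LINT x|M0. f n x) ^ n) \<longlonglongrightarrow> 1" using power_tendsto_exp_real[OF mass] by simp
  ultimately show "\<exists>f. (\<forall>n. is_ac_part_deriv M0 (marginal_X MX (\<gamma> (t n))) (f n)) \<and> (\<lambda>n. (LINT x|M0. f n x) ^ n) \<longlonglongrightarrow> 1 \<and>
      (\<lambda>n. LINT zs|P0. (norm ((\<Prod>j<n. complex_of_real (sqrt (f n (fst (zs j))))) -
         of_real (exp (- (c^2 * ip \<rho> \<rho>) / 8)) * lik n (\<lambda>x. of_real (c * \<rho> x)) zs))^2) \<longlonglongrightarrow> 0"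
    using ac by (intro exI[of _ f]) (simp add: a_def b_def k_def h_def lik_def)
qed

text \<open>This is \<open>X\<^sub>n\<close> of the overview, centred with the conditional mean
  under F0; \<open>regular_good\<close> compares it with the centring that belongs to a local
  alternative.\<close>

definition stat :: "(nat \<Rightarrow> (nat \<Rightarrow> 'x) \<Rightarrow> real) \<Rightarrow> nat \<Rightarrow> (nat \<Rightarrow> 'x \<times> 't) \<Rightarrow> real" where
  "stat S n zs = (S n (observed n zs) - (\<Sum>j<n. ubar (fst (zs j)) F0)) / sqrt (real n)"

text \<open>The characteristic function of \<open>\<xi>\<close> with the Gaussian factor of the
  residual noise divided out. By \<open>regular_limits\<close> it is the limit of the characteristic
  functions of \<open>stat\<close> under F0.\<close>

definition \<Lambda> :: "'w measure \<Rightarrow> ('w \<Rightarrow> real) \<Rightarrow> real \<Rightarrow> complex" where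
  "\<Lambda> \<Omega> \<xi> s = char (distr \<Omega> borel \<xi>) s * of_real (exp (s^2 * sig2 / 2))"

lemma measurable_estimator:
  assumes S: "is_estimator MX S" and F: "F \<in> \<F>"
  shows "(\<lambda>zs. S n (observed n zs)) \<in> borel_measurable (iid F)"
  using measurable_compose[OF measurable_observed[OF prob_F[OF F] sets_F[OF F]]] S by (auto simp: is_estimator_def)

lemma stat_measurable:
  assumes "is_estimator MX S"
  shows "stat S n \<in> borel_measurable P0"
  using measurable_estimator[OF assms F0, of n] ubar_meas[OF F0] unfolding stat_def[abs_def] by measurable

lemma local_limit_stat:
  assumes "is_estimator MX S"
  shows "local_limit MX MT F0 (\<lambda>n zs. iexp (s * stat S n zs)) \<phi>"
proof
  note [measurable] = stat_measurable[OF assms]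
  show "(\<lambda>zs. iexp (s * stat S n zs)) \<in> borel_measurable P0" for n by measurable
qed (use phi_L2 in auto)

text \<open>
  Given the observations the residuals are asymptotically independent noise (\<open>residual_CLT\<close>), so they
  contribute a Gaussian factor that can be divided out.
\<close>

lemma regular_observed_limit:
  fixes s :: real
  assumes reg: "regular_estimator MX u \<C> S \<Omega> \<xi>" and \<gamma>: "\<gamma> \<in> \<C>" and c: "c > 0"
  defines "t \<equiv> \<lambda>n::nat. min 1 (c / sqrt (real n))"
  defines "G \<equiv> \<lambda>n x. iexp (s * ((S n x - (\<Sum>j<n. ubar (x j) (\<gamma> (t n)))) / sqrt (real n)))"
  shows "(\<lambda>n. LINT zs|iid (\<gamma> (t n)). G n (observed n zs)) \<longlonglongrightarrow> \<Lambda> \<Omega> \<xi> s"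
    and "G n \<in> borel_measurable (PiM {..<n} (\<lambda>_. MX))"
proof -
  have t: "\<And>n. t n \<in> {0..1}" "\<forall>\<^sub>F n in sequentially. t n = c / sqrt (real n) \<and> n > 0"
    "filterlim t (at_right 0) sequentially" using local_parameter[OF c] unfolding t_def by auto
  define N where "N n = \<gamma> (t n)" for n
  have N: "N n \<in> \<F>" for n unfolding N_def by (rule curveD(2)[OF \<gamma> t(1)])
  have est: "is_estimator MX S" and \<Omega>: "prob_space \<Omega>" and \<xi>: "\<xi> \<in> borel_measurable \<Omega>"
    and weak: "weak_conv_m (\<lambda>n. distr (iid (\<gamma> (c / sqrt (real n)))) borel
             (\<lambda>zs. (S n (observed n zs) - utility_sum u n (\<gamma> (c / sqrt (real n))) zs) / sqrt (real n))) (distr \<Omega> borel \<xi>)"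
    using reg \<gamma> c by (auto simp: regular_estimator_def)
  have S_meas [measurable]: "S n \<in> borel_measurable (PiM {..<n} (\<lambda>_. MX))" for n
    using est by (auto simp: is_estimator_def)
  have G_meas: "G n \<in> borel_measurable (PiM {..<n} (\<lambda>_. MX))" for n
    using ubar_meas[OF N[of n]] unfolding G_def N_def[symmetric] by measurable
  then show "G n \<in> borel_measurable (PiM {..<n} (\<lambda>_. MX))" .
  define T where "T n zs = (S n (observed n zs) - utility_sum u n (N n) zs) / sqrt (real n)" for n zs
  define \<mu> where "\<mu> n = distr (iid (N n)) borel (T n)" for n
  have T_meas: "T n \<in> borel_measurable (iid (N n))" for n
  proof -
    have [measurable]: "(\<lambda>zs. util u (N n) (zs j)) \<in> borel_measurable (iid (N n))" for j
      using utility[OF N[of n]] by (intro measurable_iid_component) simp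
    note [measurable] = measurable_estimator[OF est N]
    show ?thesis unfolding T_def[abs_def] utility_sum_def by measurable
  qed
  have \<mu>: "real_distribution (\<mu> n)" for n
    unfolding \<mu>_def using prob_space_iid[OF prob_F[OF N]] T_meas by (rule prob_space.real_distribution_distr)
  have \<xi>_dist: "real_distribution (distr \<Omega> borel \<xi>)"
    using \<Omega> \<xi> by (rule prob_space.real_distribution_distr)
  \<comment> \<open>Regularity is stated with the uncapped parameter \<open>c / sqrt n\<close>; the
    two sequences of laws agree from some n on.\<close>
  have "weak_conv_m \<mu> (distr \<Omega> borel \<xi>)" unfolding weak_conv_m_def weak_conv_def
  proof (intro allI impI)
    fix x assume "isCont (cdf (distr \<Omega> borel \<xi>)) x"
    with weak have "(\<lambda>n. cdf (distr (iid (\<gamma> (c / sqrt (real n)))) borel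
        (\<lambda>zs. (S n (observed n zs) - utility_sum u n (\<gamma> (c / sqrt (real n))) zs) / sqrt (real n))) x) \<longlonglongrightarrow> cdf (distr \<Omega> borel \<xi>) x"
      by (simp add: weak_conv_m_def weak_conv_def)
    then show "(\<lambda>n. cdf (\<mu> n) x) \<longlonglongrightarrow> cdf (distr \<Omega> borel \<xi>) x"
    proof (rule Lim_transform_eventually)
      show "\<forall>\<^sub>F n in sequentially. cdf (distr (iid (\<gamma> (c / sqrt (real n)))) borel
        (\<lambda>zs. (S n (observed n zs) - utility_sum u n (\<gamma> (c / sqrt (real n))) zs) / sqrt (real n))) x = cdf (\<mu> n) x"
        using t(2) by eventually_elim (simp add: \<mu>_def T_def[abs_def] N_def)
    qed
  qed
  from levy_continuity1[OF \<mu> \<xi>_dist this, of s]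
  have "(\<lambda>n. LINT zs|iid (N n). iexp (s * T n zs)) \<longlonglongrightarrow> char (distr \<Omega> borel \<xi>) s"
    using T_meas by (simp add: char_def \<mu>_def integral_distr)
  \<comment> \<open>The error is a function of the observations plus the normalised sum of the
    residuals.\<close>
  moreover have "iexp (s * T n zs) = G n (observed n zs) * iexp (s * ((\<Sum>j<n. residual u ubar (N n) (zs j)) / sqrt (real n)))" for n zs
  proof -
    have e1: "(\<Sum>j<n. residual u ubar (N n) (zs j)) = (\<Sum>j<n. ubar (fst (zs j)) (N n)) - utility_sum u n (N n) zs"
      by (simp add: residual_def utility_sum_def util_def split_beta sum_subtractf)
    have e2: "(\<Sum>j<n. ubar (observed n zs j) (N n)) = (\<Sum>j<n. ubar (fst (zs j)) (N n))"
      by (simp add: observed_def)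
    have "s * T n zs = s * ((S n (observed n zs) - (\<Sum>j<n. ubar (observed n zs j) (N n))) / sqrt (real n)) +
        s * ((\<Sum>j<n. residual u ubar (N n) (zs j)) / sqrt (real n))"
      unfolding T_def e1 e2 by (simp add: diff_divide_distrib algebra_simps)
    then show ?thesis
      unfolding G_def N_def[symmetric] by (simp only: of_real_add distrib_left exp_add)
  qed
  ultimately have X1: "(\<lambda>n. LINT zs|iid (N n). G n (observed n zs) * iexp (s * ((\<Sum>j<n. residual u ubar (N n) (zs j)) / sqrt (real n)))) \<longlonglongrightarrow> char (distr \<Omega> borel \<xi>) s"
    by simp
  have G_le: "norm (G n x) \<le> 1" for n x by (simp add: G_def del: of_real_mult of_real_divide of_real_diff)
  define E where "E = complex_of_real (exp (- (s^2 * sig2) / 2))"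
  define A where "A n = (LINT zs|iid (N n). G n (observed n zs))" for n
  have "(\<lambda>n. (LINT zs|iid (N n). G n (observed n zs) * iexp (s * ((\<Sum>j<n. residual u ubar (N n) (zs j)) / sqrt (real n)))) - E * A n) \<longlonglongrightarrow> 0"
    unfolding E_def A_def N_def using t(3) by (intro residual_CLT[OF \<gamma> t(1)] G_meas G_le) simp
  from tendsto_diff[OF X1 this] have "(\<lambda>n. E * A n) \<longlonglongrightarrow> char (distr \<Omega> borel \<xi>) s" by simp
  then have lim: "(\<lambda>n. of_real (exp (s^2 * sig2 / 2)) * (E * A n)) \<longlonglongrightarrow> of_real (exp (s^2 * sig2 / 2)) * char (distr \<Omega> borel \<xi>) s"
    by (intro tendsto_intros)
  have eq: "of_real (exp (s^2 * sig2 / 2)) * (E * A n) = A n" for n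
  proof -
    have "complex_of_real (exp (s^2 * sig2 / 2)) * E = of_real (exp (s^2 * sig2 / 2) * exp (- (s^2 * sig2) / 2))"
      by (simp add: E_def)
    also have "exp (s^2 * sig2 / 2) * exp (- (s^2 * sig2) / 2) = 1" by (simp flip: exp_add)
    finally show ?thesis by (simp add: mult.assoc[symmetric])
  qed
  have R: "of_real (exp (s^2 * sig2 / 2)) * char (distr \<Omega> borel \<xi>) s = \<Lambda> \<Omega> \<xi> s"
    by (simp only: \<Lambda>_def mult.commute)
  show "(\<lambda>n. LINT zs|iid (\<gamma> (t n)). G n (observed n zs)) \<longlonglongrightarrow> \<Lambda> \<Omega> \<xi> s"
    using lim[unfolded eq, unfolded R] unfolding A_def N_def .
qed

text \<open>Regularity is a statement under the local alternative. The densities transport it to F0,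
  and their product is replaced by a constant times the square of \<open>lik\<close>. The change of
  the conditional mean contributes a deterministic shift converging to \<open>ip \<phi> h\<close>
  and a centred fluctuation, which \<open>lik_perturbation\<close> absorbs. Dividing out the
  constant and the phase leaves the limit in \<open>good\<close>.\<close>

lemma regular_good:
  assumes reg: "regular_estimator MX u \<C> S \<Omega> \<xi>" and \<gamma>: "\<gamma> \<in> \<C>" and score: "has_score MX F0 \<gamma> \<rho>" and c: "c > 0"
  shows "local_limit.good MX F0 (\<lambda>n zs. iexp (s * stat S n zs)) \<phi> (\<i> * of_real s) (\<Lambda> \<Omega> \<xi> s) (\<lambda>x. c * \<rho> x)"
proof -
  have est: "is_estimator MX S" using reg by (simp add: regular_estimator_def)
  interpret L: local_limit MX MT F0 "\<lambda>n zs. iexp (s * stat S n zs)" \<phi> "\<i> * of_real s" "\<Lambda> \<Omega> \<xi> s"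
    by (rule local_limit_stat[OF est])
  define t where "t n = min 1 (c / sqrt (real n))" for n
  note t = local_parameter[OF c, folded t_def]
  define N where "N n = \<gamma> (t n)" for n
  have N: "N n \<in> \<F>" for n unfolding N_def by (rule curveD(2)[OF \<gamma> t(1)])
  define G where "G n x = iexp (s * ((S n x - (\<Sum>j<n. ubar (x j) (N n))) / sqrt (real n)))" for n x
  note rl = regular_observed_limit[OF reg \<gamma> c, where s=s, folded t_def N_def, folded G_def]
  have G_le: "norm (G n x) \<le> 1" for n x by (simp add: G_def del: of_real_mult of_real_divide of_real_diff)
  note \<rho> = score_LAN(1)[OF \<gamma> score c]
  obtain f where ac: "\<And>n. is_ac_part_deriv M0 (marginal_X MX (N n)) (f n)" and mass: "(\<lambda>n. (LINT x|M0. f n x) ^ n) \<longlonglongrightarrow> 1"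
    and lan: "(\<lambda>n. LINT zs|P0. (norm ((\<Prod>j<n. complex_of_real (sqrt (f n (fst (zs j))))) -
         of_real (exp (- (c^2 * ip \<rho> \<rho>) / 8)) * lik n (\<lambda>x. of_real (c * \<rho> x)) zs))^2) \<longlonglongrightarrow> 0"
    using score_LAN(2)[OF \<gamma> score c] unfolding t_def N_def by blast
  note f = ac_part_facts[OF N ac]
  have f_meas [measurable]: "f n \<in> borel_measurable MX" for n
    using f(1)[of n] by (simp add: measurable_cong_sets[OF sets_M0 refl])
  define h where "h x = c * \<rho> x" for x
  have h: "h \<in> L20" unfolding h_def by (rule L20_scale[OF \<rho>])
  have hh: "ip h h = c^2 * ip \<rho> \<rho>"
  proof -
    have "h x * h x = c^2 * (\<rho> x * \<rho> x)" for x by (simp add: h_def power2_eq_square)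
    then show ?thesis by (simp add: ip_def)
  qed
  note H = CL20_of_real[OF h]
  have [measurable]: "(\<lambda>x. complex_of_real (h x)) \<in> borel_measurable MX" using CL20D(1)[OF H] .
  define A where "A n zs = (\<Prod>j<n. complex_of_real (sqrt (f n (fst (zs j)))))" for n and zs :: "nat \<Rightarrow> 'x \<times> 't"
  define L where "L n = lik n (\<lambda>x. of_real (h x))" for n
  define k where "k = exp (- (ip h h) / 8)"
  have [measurable]: "A n \<in> borel_measurable P0" "L n \<in> borel_measurable P0" for n
    unfolding A_def L_def by measurable
  have Lfin: "integrable P0 (\<lambda>zs. (norm (L n zs))^2)" "(LINT zs|P0. (norm (L n zs))^2) \<le> exp (ip h h / 4)" for n
    using lik_norm2[OF H, of n] by (simp_all add: L_def ip_def power2_eq_square)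
  have L2i: "integrable P0 (\<lambda>zs. (L n zs)^2)" for n
    unfolding L_def by (rule L.lik_square_integrable[OF H])
  have lan': "(\<lambda>n. LINT zs|P0. (norm (A n zs - of_real k * L n zs))^2) \<longlonglongrightarrow> 0"
    using lan by (simp add: A_def L_def k_def h_def hh)
  have fst_space: "fst z \<in> space M0" if "z \<in> space F0" for z
    using measurable_space[OF measurable_fst_F0 that] by (simp add: space_marginal[OF prob_F0 sets_F0])
  have f0: "0 \<le> f n (fst (zs j))" if "zs \<in> space P0" for zs n j
    using that fst_space[of "zs j"] f(2)[of "fst (zs j)"] by (auto simp: iid_def space_PiM PiE_iff)
  have A2: "(norm (A n zs))^2 = (\<Prod>j<n. f n (fst (zs j)))" "(A n zs)^2 = of_real (\<Prod>j<n. f n (fst (zs j)))" if "zs \<in> space P0" for n zs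
    using f0[OF that] by (simp_all add: A_def prod_norm[symmetric] prod_power_distrib flip: of_real_power)
  have fF: "integrable F0 (\<lambda>z. f n (fst z))" "(LINT z|F0. f n (fst z)) = (LINT x|M0. f n x)" for n
    using f(3)[of n] integral_M0[of "f n"] by auto
  have A2i: "integrable P0 (\<lambda>zs. (norm (A n zs))^2)" "(LINT zs|P0. (norm (A n zs))^2) = (LINT x|M0. f n x) ^ n" for n
    using integrable_iid_prod[OF prob_F0 fF(1), of n n] integral_iid_prod[OF prob_F0 fF(1), of n n]
    by (simp_all add: A2 fF(2) cong: Bochner_Integration.integrable_cong Bochner_Integration.integral_cong)
  have g_meas [measurable]: "(\<lambda>zs. G n (observed n zs)) \<in> borel_measurable P0" for n
    using measurable_compose[OF measurable_observed[OF prob_F0 sets_F0] rl(2)] .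
  have G_int: "integrable P0 (\<lambda>zs. G n (observed n zs) * g zs)" if "integrable P0 g" for g n
    by (rule Bochner_Integration.integrable_bound[OF that])
      (use that G_le in \<open>auto simp: norm_mult intro!: mult_left_le_one_le\<close>)
  have G_le_int: "norm (LINT zs|P0. G n (observed n zs) * g zs) \<le> (LINT zs|P0. norm (g zs))" if "integrable P0 g" for g n
  proof -
    have "norm (LINT zs|P0. G n (observed n zs) * g zs) \<le> (LINT zs|P0. norm (G n (observed n zs) * g zs))"
      by (rule integral_norm_bound)
    also have "\<dots> \<le> (LINT zs|P0. norm (g zs))"
      using G_int[OF that] that G_le by (intro integral_mono integrable_norm) (auto simp: norm_mult intro!: mult_left_le_one_le)
    finally show ?thesis .
  qed
  have A2C: "integrable P0 (\<lambda>zs. (A n zs)^2)" for n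
    using integrable_mult_square[of "A n" P0 "A n"] A2i(1) by (simp add: power2_eq_square)
  \<comment> \<open>The product of the densities is \<open>A^2\<close>, and the mass of the
    alternative that is singular to F0 vanishes in the limit.\<close>
  have "(\<lambda>n. (LINT zs|iid (N n). G n (observed n zs)) - (LINT zs|P0. G n (observed n zs) * (A n zs)^2)) \<longlonglongrightarrow> 0"
  proof (rule Lim_null_comparison)
    show "(\<lambda>n. 1 - (LINT x|M0. f n x) ^ n) \<longlonglongrightarrow> 0" using tendsto_diff[OF tendsto_const mass, of 1] by simp
    show "\<forall>\<^sub>F n in sequentially. norm ((LINT zs|iid (N n). G n (observed n zs)) - (LINT zs|P0. G n (observed n zs) * (A n zs)^2)) \<le> 1 - (LINT x|M0. f n x) ^ n"
    proof (intro always_eventually allI)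
      fix n
      have "(LINT zs|P0. G n (observed n zs) * (A n zs)^2) = (LINT zs|P0. G n (observed n zs) * of_real (\<Prod>j<n. f n (fst (zs j))))"
        by (rule Bochner_Integration.integral_cong) (simp_all only: A2)
      then show "norm ((LINT zs|iid (N n). G n (observed n zs)) - (LINT zs|P0. G n (observed n zs) * (A n zs)^2)) \<le> 1 - (LINT x|M0. f n x) ^ n"
        using observed_change_of_measure(2)[OF prob_F[OF N] sets_F[OF N] prob_F0 sets_F0 ac rl(2) G_le, of n] by simp
    qed
  qed
  from tendsto_diff[OF rl(1) this] have X3: "(\<lambda>n. LINT zs|P0. G n (observed n zs) * (A n zs)^2) \<longlonglongrightarrow> \<Lambda> \<Omega> \<xi> s"
    by simp
  have "(\<lambda>n. (LINT zs|P0. G n (observed n zs) * (A n zs)^2) - (LINT zs|P0. G n (observed n zs) * (of_real k * L n zs)^2)) \<longlonglongrightarrow> 0"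
  proof (rule Lim_null_comparison)
    define D where "D n = (LINT zs|P0. (norm (A n zs - of_real k * L n zs))^2)" for n
    define U where "U n = sqrt ((LINT x|M0. f n x) ^ n) * sqrt (D n) + k * sqrt (exp (ip h h / 4)) * sqrt (D n)" for n
    have "U \<longlonglongrightarrow> sqrt 1 * sqrt 0 + k * sqrt (exp (ip h h / 4)) * sqrt 0"
      unfolding U_def by (intro tendsto_intros mass) (use lan' in \<open>simp_all add: D_def\<close>)
    then show "U \<longlonglongrightarrow> 0" by simp
    show "\<forall>\<^sub>F n in sequentially. norm ((LINT zs|P0. G n (observed n zs) * (A n zs)^2) - (LINT zs|P0. G n (observed n zs) * (of_real k * L n zs)^2)) \<le> U n"
    proof (intro always_eventually allI)
      fix n
      define d where "d zs = A n zs - of_real k * L n zs" for zs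
      have [measurable]: "d \<in> borel_measurable P0" unfolding d_def by measurable
      have d2: "integrable P0 (\<lambda>zs. (norm (d zs))^2)"
      proof (rule Bochner_Integration.integrable_bound)
        show "integrable P0 (\<lambda>zs. 2 * (norm (A n zs))^2 + 2 * (k^2 * (norm (L n zs))^2))"
          using A2i(1)[of n] Lfin(1)[of n] by simp
        show "AE zs in P0. norm ((norm (d zs))^2) \<le> norm (2 * (norm (A n zs))^2 + 2 * (k^2 * (norm (L n zs))^2))"
        proof (rule AE_I2)
          fix zs
          have "(norm (d zs))^2 \<le> (norm (A n zs) + norm (of_real k * L n zs))^2"
            unfolding d_def by (intro power_mono norm_triangle_ineq4) auto
          also have "\<dots> \<le> 2 * (norm (A n zs))^2 + 2 * (norm (of_real k * L n zs))^2"
            using sum_squares_bound[of "norm (A n zs)" "norm (of_real k * L n zs)"] by (simp add: power2_sum)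
          finally show "norm ((norm (d zs))^2) \<le> norm (2 * (norm (A n zs))^2 + 2 * (k^2 * (norm (L n zs))^2))"
            by (simp add: norm_mult power_mult_distrib)
        qed
      qed measurable
      have Ad: "integrable P0 (\<lambda>zs. A n zs * d zs)" and Ld: "integrable P0 (\<lambda>zs. L n zs * d zs)"
        using A2i(1) Lfin(1) d2 by (auto intro!: integrable_mult_square)
      \<comment> \<open>Both terms contain the factor \<open>d\<close>, which is small in L2, and
        the cofactors A and \<open>k L\<close> are bounded in L2.\<close>
      have eq: "(A n zs)^2 - (of_real k * L n zs)\<^sup>2 = A n zs * d zs + of_real k * (L n zs * d zs)" for zs
        by (simp add: d_def power2_eq_square algebra_simps)
      have i1: "integrable P0 (\<lambda>zs. G n (observed n zs) * (A n zs)^2)" "integrable P0 (\<lambda>zs. G n (observed n zs) * (of_real k * L n zs)^2)"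
        using A2C L2i by (auto intro!: G_int simp: power_mult_distrib)
      have "norm ((LINT zs|P0. G n (observed n zs) * (A n zs)^2) - (LINT zs|P0. G n (observed n zs) * (of_real k * L n zs)^2)) =
          norm (LINT zs|P0. G n (observed n zs) * (A n zs * d zs + of_real k * (L n zs * d zs)))"
        unfolding eq[symmetric] using i1 by (simp add: right_diff_distrib)
      also have "\<dots> \<le> (LINT zs|P0. norm (A n zs * d zs + of_real k * (L n zs * d zs)))"
        using Ad Ld by (intro G_le_int) auto
      also have "\<dots> \<le> (LINT zs|P0. norm (A n zs * d zs) + k * norm (L n zs * d zs))"
      proof (rule integral_mono)
        fix zs
        have "norm (A n zs * d zs + of_real k * (L n zs * d zs)) \<le> norm (A n zs * d zs) + norm (of_real k * (L n zs * d zs))"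
          by (rule norm_triangle_ineq)
        also have "norm (of_real k * (L n zs * d zs)) = k * norm (L n zs * d zs)"
          by (simp add: norm_mult k_def)
        finally show "norm (A n zs * d zs + of_real k * (L n zs * d zs)) \<le> norm (A n zs * d zs) + k * norm (L n zs * d zs)" .
      qed (use Ad Ld in auto)
      also have "\<dots> = (LINT zs|P0. norm (A n zs * d zs)) + k * (LINT zs|P0. norm (L n zs * d zs))"
        using integrable_norm[OF Ad] integrable_norm[OF Ld] by simp
      also have "\<dots> \<le> sqrt (LINT zs|P0. (norm (A n zs))^2) * sqrt (D n) + k * (sqrt (LINT zs|P0. (norm (L n zs))^2) * sqrt (D n))"
        unfolding D_def d_def[symmetric] using A2i(1) Lfin(1) d2
        by (intro add_mono mult_left_mono integral_norm_mult_le) (auto simp: k_def)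
      also have "\<dots> \<le> U n"
      proof -
        have "k * (sqrt (LINT zs|P0. (norm (L n zs))^2) * sqrt (D n)) \<le> k * (sqrt (exp (ip h h / 4)) * sqrt (D n))"
          using Lfin(2)[of n] by (intro mult_left_mono mult_right_mono) (auto simp: k_def D_def)
        then show ?thesis by (simp add: U_def A2i(2) mult.assoc)
      qed
      finally show "norm ((LINT zs|P0. G n (observed n zs) * (A n zs)^2) - (LINT zs|P0. G n (observed n zs) * (of_real k * L n zs)^2)) \<le> U n" .
    qed
  qed
  from tendsto_diff[OF X3 this] have "(\<lambda>n. LINT zs|P0. G n (observed n zs) * (of_real k * L n zs)^2) \<longlonglongrightarrow> \<Lambda> \<Omega> \<xi> s"
    by simp
  then have lim: "(\<lambda>n. of_real (1 / k^2) * (LINT zs|P0. G n (observed n zs) * (of_real k * L n zs)^2)) \<longlonglongrightarrow> of_real (1 / k^2) * \<Lambda> \<Omega> \<xi> s"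
    by (intro tendsto_intros)
  have eq: "of_real (1 / k^2) * (LINT zs|P0. G n (observed n zs) * (of_real k * L n zs)^2) = (LINT zs|P0. G n (observed n zs) * (L n zs)^2)" for n
  proof -
    have "G n (observed n zs) * (of_real k * L n zs)^2 = of_real (k^2) * (G n (observed n zs) * (L n zs)^2)" for zs
      by (simp add: power_mult_distrib)
    then have "(LINT zs|P0. G n (observed n zs) * (of_real k * L n zs)^2) = of_real (k^2) * (LINT zs|P0. G n (observed n zs) * (L n zs)^2)"
      by (simp only: integral_mult_right_zero)
    moreover have "k \<noteq> 0" by (simp add: k_def)
    ultimately show ?thesis by simp
  qed
  \<comment> \<open>This is the origin of \<open>exp (ip h h / 4)\<close> in the definition of
    \<open>good\<close>.\<close>
  have k2: "1 / k^2 = exp (ip h h / 4)"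
  proof -
    have "k\<^sup>2 = exp (- (ip h h / 4))" by (simp add: k_def power2_eq_square flip: exp_add)
    then show ?thesis by (simp add: exp_minus inverse_eq_divide)
  qed
  have X4: "(\<lambda>n. LINT zs|P0. G n (observed n zs) * (L n zs)^2) \<longlonglongrightarrow> of_real (exp (ip h h / 4)) * \<Lambda> \<Omega> \<xi> s"
    using lim unfolding eq unfolding k2 .
  define q where "q n x = ubar x (N n) - ubar x F0" for n x
  have q_meas [measurable]: "q n \<in> borel_measurable MX" for n
    unfolding q_def using ubar_meas[OF N] ubar_meas[OF F0] by measurable
  define m where "m n = (LINT x|M0. q n x)" for n
  have evar_lim: "(\<lambda>n. evar M0 (q n)) \<longlonglongrightarrow> 0"
    using filterlim_compose[OF var_diff[OF \<gamma>] t(3)] by (simp add: q_def[abs_def] N_def)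
  have ev_fin: "\<forall>\<^sub>F n in sequentially. evar M0 (q n) < \<infinity>"
    using order_tendstoD(2)[OF evar_lim, of \<infinity>] by simp
  \<comment> \<open>The centred difference of the conditional means, set to 0 for those n where its
    variance is infinite, so that it always lies in \<open>L20\<close>.\<close>
  define r where "r n x = (if evar M0 (q n) < \<infinity> then q n x - m n else 0)" for n x
  have r_fin: "integrable M0 (q n)" "integrable M0 (\<lambda>x. (q n x - m n)^2)"
    "ennreal (LINT x|M0. (q n x - m n)^2) = evar M0 (q n)" if "evar M0 (q n) < \<infinity>" for n
  proof -
    show i: "integrable M0 (q n)" using that by (auto simp: evar_def split: if_splits)
    with that have nn: "(\<integral>\<^sup>+x. ennreal ((q n x - m n)^2) \<partial>M0) = evar M0 (q n)" by (simp add: evar_def m_def)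
    with that show i2: "integrable M0 (\<lambda>x. (q n x - m n)^2)" by (intro integrableI_bounded) auto
    from i2 nn show "ennreal (LINT x|M0. (q n x - m n)^2) = evar M0 (q n)" by (subst nn_integral_eq_integral[symmetric]) auto
  qed
  have r: "r n \<in> L20" for n
  proof (cases "evar M0 (q n) < \<infinity>")
    case True
    then have "r n = (\<lambda>x. q n x - m n)" by (simp add: r_def[abs_def])
    then show ?thesis using r_fin[OF True] by (simp add: L20_def M0.prob_space) (simp add: m_def)
  next
    case False
    then have "r n = (\<lambda>_. 0)" by (simp add: r_def[abs_def])
    then show ?thesis by (simp add: L20_def)
  qed
  have r_lim: "(\<lambda>n. ip (r n) (r n)) \<longlonglongrightarrow> 0"
  proof -
    have "(\<lambda>n. enn2real (evar M0 (q n))) \<longlonglongrightarrow> 0" by (rule tendsto_enn2real) (use evar_lim in simp_all)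
    then show ?thesis
    proof (rule Lim_transform_eventually)
      show "\<forall>\<^sub>F n in sequentially. enn2real (evar M0 (q n)) = ip (r n) (r n)"
        using ev_fin by eventually_elim (use r_fin(3) in \<open>simp add: r_def ip_def power2_eq_square flip: r_fin(3)\<close>)
    qed
  qed
  \<comment> \<open>Here \<open>\<phi>\<close> enters: the mean difference is of order
    \<open>t n\<close>, so n times it, divided by sqrt n, has a limit.\<close>
  have m_lim: "(\<lambda>n. sqrt (real n) * m n) \<longlonglongrightarrow> ip \<phi> h"
  proof -
    have "(\<lambda>n. c * (m n / t n)) \<longlonglongrightarrow> c * (LINT x|M0. \<phi> x * \<rho> x)"
      using filterlim_compose[OF phi[OF \<gamma> score] t(3)] by (intro tendsto_intros) (simp add: m_def q_def N_def)
    moreover have "c * (LINT x|M0. \<phi> x * \<rho> x) = ip \<phi> h" by (simp add: ip_def h_def mult.left_commute)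
    moreover have "\<forall>\<^sub>F n in sequentially. c * (m n / t n) = sqrt (real n) * m n"
      using t(2) by eventually_elim (use c in simp)
    ultimately show ?thesis by (auto intro: Lim_transform_eventually)
  qed
  define sr where "sr n = (\<lambda>x. - s * r n x)" for n
  have sr: "sr n \<in> L20" for n unfolding sr_def by (rule L20_scale[OF r])
  have sr_lim: "(\<lambda>n. ip (sr n) (sr n)) \<longlonglongrightarrow> 0"
  proof -
    have "ip (sr n) (sr n) = s^2 * ip (r n) (r n)" for n
    proof -
      have "sr n x * sr n x = s^2 * (r n x * r n x)" for x by (simp add: sr_def power2_eq_square)
      then show ?thesis by (simp add: ip_def)
    qed
    then show ?thesis using tendsto_mult[OF tendsto_const r_lim, of "s\<^sup>2"] by simp
  qed
  note [measurable] = L20D(1)[OF sr]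
  \<comment> \<open>The phase coming from the deterministic shift; having modulus 1, it can be
    divided out.\<close>
  define \<epsilon> where "\<epsilon> n = iexp (- s * (sqrt (real n) * m n))" for n
  have G_eq: "G n (observed n zs) = iexp (s * stat S n zs) * \<epsilon> n * iexp (fluct n (sr n) zs)" if "evar M0 (q n) < \<infinity>" "n > 0" for n zs
  proof -
    have "(\<Sum>j<n. q n (fst (zs j))) / sqrt (real n) = fluct n (r n) zs + sqrt (real n) * m n"
    proof -
      have "(\<Sum>j<n. q n (fst (zs j))) = (\<Sum>j<n. r n (fst (zs j))) + real n * m n"
        using that by (simp add: r_def sum_subtractf)
      moreover have "real n * m n / sqrt (real n) = sqrt (real n) * m n"
        by (simp only: times_divide_eq_left[symmetric] real_div_sqrt[OF of_nat_0_le_iff])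
      ultimately show ?thesis by (simp add: fluct_def add_divide_distrib)
    qed
    moreover have "(\<Sum>j<n. ubar (observed n zs j) (N n)) = (\<Sum>j<n. ubar (fst (zs j)) F0) + (\<Sum>j<n. q n (fst (zs j)))"
      by (simp add: observed_def q_def sum_subtractf)
    ultimately have e1: "(S n (observed n zs) - (\<Sum>j<n. ubar (observed n zs j) (N n))) / sqrt (real n) = stat S n zs - (fluct n (r n) zs + sqrt (real n) * m n)"
      by (simp add: stat_def diff_divide_distrib add_divide_distrib)
    have e2: "fluct n (sr n) zs = - s * fluct n (r n) zs"
      using fluct_lincomb[of n "-s" "r n" 0 "r n" zs] by (simp add: sr_def)
    have "s * ((S n (observed n zs) - (\<Sum>j<n. ubar (observed n zs j) (N n))) / sqrt (real n)) =
       s * stat S n zs + (- s * (sqrt (real n) * m n)) + fluct n (sr n) zs"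
      unfolding e1 e2 by (simp add: algebra_simps)
    then show ?thesis unfolding G_def \<epsilon>_def by (simp only: of_real_add distrib_left exp_add)
  qed
  have "(\<lambda>n. (LINT zs|P0. iexp (s * stat S n zs) * (iexp (fluct n (sr n) zs) * L n zs * L n zs - (L n zs)\<^sup>2))) \<longlonglongrightarrow> 0"
  proof (rule Lim_null_comparison)
    define D where "D n = (LINT zs|P0. (norm (iexp (fluct n (sr n) zs) * L n zs - L n zs))^2)" for n
    have D: "D \<longlonglongrightarrow> 0" unfolding D_def L_def by (rule lik_perturbation[OF h sr sr_lim])
    show "(\<lambda>n. sqrt (D n) * sqrt (exp (ip h h / 4))) \<longlonglongrightarrow> 0"
      using tendsto_mult[OF tendsto_real_sqrt[OF D] tendsto_const] by simp
    show "\<forall>\<^sub>F n in sequentially. norm (LINT zs|P0. iexp (s * stat S n zs) * (iexp (fluct n (sr n) zs) * L n zs * L n zs - (L n zs)\<^sup>2)) \<le> sqrt (D n) * sqrt (exp (ip h h / 4))"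
    proof (intro always_eventually allI)
      fix n
      define d where "d zs = iexp (fluct n (sr n) zs) * L n zs - L n zs" for zs
      have [measurable]: "d \<in> borel_measurable P0" unfolding d_def by measurable
      have d2: "integrable P0 (\<lambda>zs. (norm (d zs))^2)"
      proof (rule Bochner_Integration.integrable_bound)
        show "integrable P0 (\<lambda>zs. 4 * (norm (L n zs))^2)" using Lfin(1)[of n] by simp
        show "AE zs in P0. norm ((norm (d zs))^2) \<le> norm (4 * (norm (L n zs))^2)"
        proof (rule AE_I2)
          fix zs
          have "norm (d zs) \<le> norm (iexp (fluct n (sr n) zs) * L n zs) + norm (L n zs)"
            unfolding d_def by (rule norm_triangle_ineq4)
          then have "norm (d zs) \<le> 2 * norm (L n zs)" by (simp add: norm_mult)
          then have "(norm (d zs))^2 \<le> (2 * norm (L n zs))^2" by (intro power_mono) auto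
          then show "norm ((norm (d zs))^2) \<le> norm (4 * (norm (L n zs))^2)" by (simp add: power_mult_distrib)
        qed
      qed measurable
      have eq: "iexp (fluct n (sr n) zs) * L n zs * L n zs - (L n zs)\<^sup>2 = d zs * L n zs" for zs
        by (simp add: d_def power2_eq_square algebra_simps)
      have "norm (LINT zs|P0. iexp (s * stat S n zs) * (d zs * L n zs)) \<le> (LINT zs|P0. norm (d zs * L n zs))"
        using d2 Lfin(1) by (intro L.\<Psi>_integral_le integrable_mult_square) auto
      also have "\<dots> \<le> sqrt (LINT zs|P0. (norm (d zs))^2) * sqrt (LINT zs|P0. (norm (L n zs))^2)"
        using d2 Lfin(1) by (intro integral_norm_mult_le) auto
      also have "\<dots> \<le> sqrt (D n) * sqrt (exp (ip h h / 4))"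
        unfolding D_def d_def[symmetric] using Lfin(2)[of n] by (intro mult_left_mono) auto
      finally show "norm (LINT zs|P0. iexp (s * stat S n zs) * (iexp (fluct n (sr n) zs) * L n zs * L n zs - (L n zs)\<^sup>2)) \<le> sqrt (D n) * sqrt (exp (ip h h / 4))"
        unfolding eq .
    qed
  qed
  note X5 = this
  have \<epsilon>: "(\<lambda>n. 1 / \<epsilon> n) \<longlonglongrightarrow> iexp (s * ip \<phi> h)"
  proof -
    have eq: "1 / \<epsilon> n = iexp (s * (sqrt (real n) * m n))" for n
      by (simp add: \<epsilon>_def exp_minus inverse_eq_divide)
    show ?thesis unfolding eq by (intro tendsto_intros m_lim)
  qed
  have \<epsilon>0: "\<epsilon> n \<noteq> 0" for n by (simp add: \<epsilon>_def)
  have "(\<lambda>n. (1 / \<epsilon> n) * (LINT zs|P0. G n (observed n zs) * (L n zs)^2) - (LINT zs|P0. iexp (s * stat S n zs) * (iexp (fluct n (sr n) zs) * L n zs * L n zs - (L n zs)\<^sup>2)))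
     \<longlonglongrightarrow> iexp (s * ip \<phi> h) * (of_real (exp (ip h h / 4)) * \<Lambda> \<Omega> \<xi> s) - 0"
    by (intro tendsto_intros \<epsilon> X4 X5)
  moreover have "\<forall>\<^sub>F n in sequentially. (1 / \<epsilon> n) * (LINT zs|P0. G n (observed n zs) * (L n zs)^2) - (LINT zs|P0. iexp (s * stat S n zs) * (iexp (fluct n (sr n) zs) * L n zs * L n zs - (L n zs)\<^sup>2))
     = (LINT zs|P0. iexp (s * stat S n zs) * (L n zs)^2)" using ev_fin eventually_gt_at_top[of 0]
  proof eventually_elim
    case (elim n)
    have i1: "integrable P0 (\<lambda>zs. iexp (s * stat S n zs) * (L n zs)^2)"
      by (rule L.\<Psi>_mult_integrable[OF L2i])
    have i2: "integrable P0 (\<lambda>zs. iexp (s * stat S n zs) * (iexp (fluct n (sr n) zs) * (L n zs)^2))"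
    proof (rule L.\<Psi>_mult_integrable)
      show "integrable P0 (\<lambda>zs. iexp (fluct n (sr n) zs) * (L n zs)^2)"
        by (rule Bochner_Integration.integrable_bound[OF L2i[of n]]) (auto simp: norm_mult)
    qed
    have "G n (observed n zs) * (L n zs)^2 = \<epsilon> n * (iexp (s * stat S n zs) * (iexp (fluct n (sr n) zs) * (L n zs)^2))" for zs
      unfolding G_eq[OF elim] by (simp only: mult_ac)
    then have "(LINT zs|P0. G n (observed n zs) * (L n zs)^2) = \<epsilon> n * (LINT zs|P0. iexp (s * stat S n zs) * (iexp (fluct n (sr n) zs) * (L n zs)^2))"
      by (simp only: integral_mult_right_zero)
    then have "(1 / \<epsilon> n) * (LINT zs|P0. G n (observed n zs) * (L n zs)^2) = (LINT zs|P0. iexp (s * stat S n zs) * (iexp (fluct n (sr n) zs) * (L n zs)^2))"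
      using \<epsilon>0[of n] by simp
    moreover have "(LINT zs|P0. iexp (s * stat S n zs) * (iexp (fluct n (sr n) zs) * L n zs * L n zs - (L n zs)\<^sup>2)) =
        (LINT zs|P0. iexp (s * stat S n zs) * (iexp (fluct n (sr n) zs) * (L n zs)^2)) - (LINT zs|P0. iexp (s * stat S n zs) * (L n zs)^2)"
      unfolding Bochner_Integration.integral_diff[OF i2 i1, symmetric]
      by (intro Bochner_Integration.integral_cong refl) (simp only: right_diff_distrib power2_eq_square mult.assoc)
    ultimately show ?case by simp
  qed
  ultimately have lim: "(\<lambda>n. LINT zs|P0. iexp (s * stat S n zs) * (L n zs)^2) \<longlonglongrightarrow> iexp (s * ip \<phi> h) * (of_real (exp (ip h h / 4)) * \<Lambda> \<Omega> \<xi> s) - 0"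
    by (rule Lim_transform_eventually)
  have eq: "iexp (s * ip \<phi> h) * (of_real (exp (ip h h / 4)) * \<Lambda> \<Omega> \<xi> s) - 0 = \<Lambda> \<Omega> \<xi> s * exp (of_real (ip h h) / 4 + \<i> * of_real s * of_real (ip \<phi> h))"
    by (simp add: exp_add exp_of_real[symmetric] mult_ac)
  have "L.good h" using h lim unfolding eq L.good_def L_def by (rule conjI)
  then show ?thesis by (simp add: h_def[abs_def])
qed

end

section \<open>Normal laws and tightness\<close>

text \<open>A single formula for the point mass at variance 0 and for the normal density, so that
  moments and characteristic functions follow without a case distinction.\<close>

lemma normal_law_eq_distr:
  assumes "0 \<le> v"
  shows "normal_law 0 v = distr std_normal_distribution borel (\<lambda>x. sqrt v * x)"
proof (cases "v = 0")
  case True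
  interpret prob_space std_normal_distribution by (rule prob_space_normal_density) simp
  have "distr std_normal_distribution borel (\<lambda>x. 0::real) = return borel 0"
    by (rule measure_eqI) (auto simp: emeasure_distr emeasure_space_1 indicator_def vimage_def)
  with True show ?thesis by (simp add: normal_law_def)
next
  case False
  interpret prob_space std_normal_distribution by (rule prob_space_normal_density) simp
  have "distributed std_normal_distribution lborel (\<lambda>x. x) std_normal_density"
    by (auto simp: distributed_def distr_id2 intro!: normal_density_nonneg)
  from normal_density_affine[OF this, of "sqrt v" 0]
  have "distributed std_normal_distribution lborel (\<lambda>x. sqrt v * x) (normal_density 0 (sqrt v))"
    using False assms by simp
  then have "distr std_normal_distribution lborel (\<lambda>x. sqrt v * x) = density lborel (normal_density 0 (sqrt v))"
    by (rule distributed_distr_eq_density)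
  moreover have "distr std_normal_distribution lborel (\<lambda>x. sqrt v * x) = distr std_normal_distribution borel (\<lambda>x. sqrt v * x)"
    by (rule distr_cong) auto
  ultimately show ?thesis using False by (simp add: normal_law_def)
qed

lemma
  assumes v: "0 \<le> v"
  shows real_distribution_normal_law: "real_distribution (normal_law 0 v)"
    and char_normal_law: "char (normal_law 0 v) s = of_real (exp (- (s^2 * v) / 2))"
    and second_moment_normal_law: "(\<integral>\<^sup>+x. ennreal (x^2) \<partial>normal_law 0 v) = ennreal v"
proof -
  interpret prob_space std_normal_distribution by (rule prob_space_normal_density) simp
  show "real_distribution (normal_law 0 v)"
    unfolding normal_law_eq_distr[OF v] by (rule real_distribution_distr) simp
  have "char (normal_law 0 v) s = char std_normal_distribution (s * sqrt v)"
    unfolding normal_law_eq_distr[OF v] char_def by (subst integral_distr) (simp_all add: mult.assoc)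
  then show "char (normal_law 0 v) s = of_real (exp (- (s^2 * v) / 2))"
    using v by (simp add: char_std_normal_distribution power_mult_distrib)
  have "integrable std_normal_distribution (\<lambda>x. x\<^sup>2)" "(LINT x|std_normal_distribution. x\<^sup>2) = 1"
    using std_normal_distribution_even_moments[of 1] by simp_all
  then have "(\<integral>\<^sup>+x. ennreal (v * x^2) \<partial>std_normal_distribution) = ennreal v"
    using v by (subst nn_integral_eq_integral) auto
  then show "(\<integral>\<^sup>+x. ennreal (x^2) \<partial>normal_law 0 v) = ennreal v"
    unfolding normal_law_eq_distr[OF v] using v by (subst nn_integral_distr) (simp_all add: power_mult_distrib)
qed

text \<open>The continuous truncation \<open>k\<close> dominates the indicator of the tail beyond
  \<open>R + 1\<close>, so a tail estimate for the limit law bounds the tails of the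
  sequence.\<close>

lemma small_probability_if_char_limit:
  fixes Y :: "nat \<Rightarrow> 'a \<Rightarrow> real"
  assumes N: "prob_space N" and Y: "\<And>n. Y n \<in> borel_measurable N" and \<nu>: "real_distribution \<nu>"
    and char: "\<And>s. (\<lambda>n. LINT x|N. iexp (s * Y n x)) \<longlonglongrightarrow> char \<nu> s" and "\<delta> > 0"
  shows "\<exists>R\<ge>0. \<forall>\<^sub>F n in sequentially. measure N {x \<in> space N. \<bar>Y n x\<bar> > R} < \<delta>"
proof -
  interpret N: prob_space N by fact
  interpret \<nu>: real_distribution \<nu> by fact
  note [measurable] = Y
  obtain R where R: "R \<ge> 0" "(LINT x|\<nu>. max 0 (min 1 (\<bar>x\<bar> - R))) < \<delta>"
    using \<nu>.small_tail[OF \<open>\<delta> > 0\<close>] order_refl by metis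
  define k :: "real \<Rightarrow> real" where "k x = max 0 (min 1 (\<bar>x\<bar> - R))" for x
  have [measurable]: "k \<in> borel_measurable borel" unfolding k_def by measurable
  have "(\<lambda>n. LINT x|N. 1 * k (Y n x)) \<longlonglongrightarrow> 1 * (LINT x|\<nu>. k x)"
    by (rule weighted_Levy_continuity[OF N Y, where w="\<lambda>_ _. 1" and C=1 and m=1 and \<nu>=\<nu> and g=k and B=1])
      (use char \<nu> in \<open>auto simp: N.prob_space k_def[abs_def] intro!: continuous_intros\<close>)
  then have "\<forall>\<^sub>F n in sequentially. (LINT x|N. k (Y n x)) < \<delta>"
    using R(2) by (intro order_tendstoD) (auto simp: k_def)
  then have "\<forall>\<^sub>F n in sequentially. measure N {x \<in> space N. \<bar>Y n x\<bar> > R + 1} < \<delta>"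
  proof eventually_elim
    case (elim n)
    have "measure N {x \<in> space N. \<bar>Y n x\<bar> > R + 1} = (LINT x|N. indicator {x \<in> space N. \<bar>Y n x\<bar> > R + 1} x)"
      by simp
    also have "\<dots> \<le> (LINT x|N. k (Y n x))"
      by (intro integral_mono N.integrable_bounded[where B=1]) (auto simp: k_def indicator_def)
    finally show ?case using elim by simp
  qed
  then show ?thesis using R(1) by (intro exI[of _ "R + 1"]) auto
qed

lemma (in prob_space) small_probability_add:
  assumes [measurable]: "X \<in> borel_measurable M" "Y \<in> borel_measurable M"
  shows "measure M {x \<in> space M. \<bar>X x + Y x\<bar> > a + b} \<le> measure M {x \<in> space M. \<bar>X x\<bar> > a} + measure M {x \<in> space M. \<bar>Y x\<bar> > (b::real)}"
proof -
  have "measure M {x \<in> space M. \<bar>X x + Y x\<bar> > a + b} \<le> measure M ({x \<in> space M. \<bar>X x\<bar> > a} \<union> {x \<in> space M. \<bar>Y x\<bar> > b})"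
    by (intro finite_measure_mono) auto
  also have "\<dots> \<le> measure M {x \<in> space M. \<bar>X x\<bar> > a} + measure M {x \<in> space M. \<bar>Y x\<bar> > b}"
    by (intro measure_Un_le) auto
  finally show ?thesis .
qed

lemma (in prob_space) Chebyshev_square:
  assumes [measurable]: "X \<in> borel_measurable M" and X2: "integrable M (\<lambda>x. (X x)^2)" and "a > (0::real)"
  shows "measure M {x \<in> space M. \<bar>X x\<bar> > a} \<le> (LINT x|M. (X x)^2) / a^2"
proof -
  have "measure M {x \<in> space M. \<bar>X x\<bar> > a} = (LINT x|M. indicator {x \<in> space M. \<bar>X x\<bar> > a} x)" by simp
  also have "\<dots> \<le> (LINT x|M. (X x)^2 / a^2)"
  proof (intro integral_mono)
    show "integrable M (\<lambda>x. (X x)^2 / a^2)" using X2 by simp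
    show "integrable M (indicat_real {x \<in> space M. \<bar>X x\<bar> > a})"
      by (rule integrable_bounded[where B=1]) (auto simp: indicator_def)
    fix x
    show "indicat_real {x \<in> space M. \<bar>X x\<bar> > a} x \<le> (X x)^2 / a^2"
    proof (cases "\<bar>X x\<bar> > a")
      case True
      then have "a\<^sup>2 \<le> \<bar>X x\<bar>\<^sup>2" using \<open>a > 0\<close> by (intro power_mono) auto
      then show ?thesis using \<open>a > 0\<close> by (simp add: indicator_def)
    qed (simp add: indicator_def)
  qed
  finally show ?thesis by simp
qed

text \<open>The third-order Taylor bound for the imaginary part of \<open>iexp (s x)\<close>, with
  the factor 1/6 dropped.\<close>

lemma abs_sin_scaled_diff_le:
  fixes s x :: real
  assumes "s > 0"
  shows "\<bar>x - sin (s * x) / s\<bar> \<le> s\<^sup>2 * \<bar>x\<bar> ^ 3"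
proof -
  have "\<bar>Im (iexp (s * x) - (\<Sum>k\<le>2. (\<i> * of_real (s * x)) ^ k / fact k))\<bar> \<le> \<bar>s * x\<bar> ^ Suc 2 / fact (Suc 2)"
    by (rule order_trans[OF abs_Im_le_cmod iexp_approx1])
  moreover have "Im (iexp (s * x) - (\<Sum>k\<le>2. (\<i> * of_real (s * x)) ^ k / fact k)) = sin (s * x) - s * x"
    by (simp add: numeral_2_eq_2 Im_exp)
  moreover have "\<bar>s * x\<bar> ^ Suc 2 / fact (Suc 2) \<le> \<bar>s * x\<bar> ^ 3"
  proof -
    have "z / fact (Suc 2) \<le> z" if "0 \<le> z" for z :: real
      using that by (simp add: numeral_2_eq_2 divide_le_eq)
    from this[of "\<bar>s * x\<bar> ^ 3"] show ?thesis by (simp add: numeral_3_eq_3)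
  qed
  ultimately have *: "\<bar>sin (s * x) - s * x\<bar> \<le> \<bar>s * x\<bar> ^ 3" by linarith
  have "\<bar>x - sin (s * x) / s\<bar> = \<bar>sin (s * x) - s * x\<bar> / s"
  proof -
    have "x - sin (s * x) / s = - ((sin (s * x) - s * x) / s)" using assms by (simp add: field_simps)
    then show ?thesis using assms by (simp only: abs_minus_cancel abs_divide abs_of_pos)
  qed
  also have "\<dots> \<le> \<bar>s * x\<bar> ^ 3 / s" using * assms by (intro divide_right_mono) auto
  also have "\<dots> = s^2 * \<bar>x\<bar> ^ 3"
    using assms by (simp add: abs_mult power_mult_distrib power2_eq_square power3_eq_cube)
  finally show ?thesis .
qed

lemma tightI:
  assumes \<mu>: "\<And>n. real_distribution (\<mu> n)"
    and ev: "\<And>\<epsilon>. \<epsilon> > 0 \<Longrightarrow> \<exists>R. \<forall>\<^sub>F n in sequentially. measure (\<mu> n) {x. \<bar>x\<bar> > R} < \<epsilon>"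
  shows "tight \<mu>"
  unfolding tight_def
proof (intro conjI allI impI \<mu>)
  fix \<epsilon> :: real assume "\<epsilon> > 0"
  \<comment> \<open>A single law is treated as a constant sequence, whose characteristic functions
    converge trivially.\<close>
  have single: "\<exists>R. measure (\<mu> n) {x. \<bar>x\<bar> > R} < \<epsilon>" for n
  proof -
    interpret real_distribution "\<mu> n" by (rule \<mu>)
    have "(\<lambda>n'. LINT x|\<mu> n. iexp (s * x)) \<longlonglongrightarrow> char (\<mu> n) s" for s by (simp add: char_def)
    from small_probability_if_char_limit[OF prob_space_axioms _ real_distribution_axioms this \<open>\<epsilon> > 0\<close>]
    show ?thesis by auto
  qed
  from ev[OF \<open>\<epsilon> > 0\<close>] obtain R0 n0 where R0: "\<And>n. n \<ge> n0 \<Longrightarrow> measure (\<mu> n) {x. \<bar>x\<bar> > R0} < \<epsilon>"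
    by (auto simp: eventually_sequentially)
  from single obtain R1 where R1: "\<And>n. measure (\<mu> n) {x. \<bar>x\<bar> > R1 n} < \<epsilon>" by metis
  define R where "R = Max (insert 1 (insert R0 (R1 ` {..<n0})))"
  have R: "1 \<le> R" "R0 \<le> R" "\<And>n. n < n0 \<Longrightarrow> R1 n \<le> R" unfolding R_def by (rule Max_ge; simp)+
  show "\<exists>a b. a < b \<and> (\<forall>n. 1 - \<epsilon> < measure (\<mu> n) {a<..b})"
  proof (intro exI conjI allI)
    show "- R - 1 < R" using R(1) by simp
    fix n
    interpret real_distribution "\<mu> n" by (rule \<mu>)
    have "measure (\<mu> n) {x. \<bar>x\<bar> > R} < \<epsilon>"
    proof (cases "n < n0")
      case True
      have "measure (\<mu> n) {x. \<bar>x\<bar> > R} \<le> measure (\<mu> n) {x. \<bar>x\<bar> > R1 n}"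
        using R(3)[OF True] by (intro finite_measure_mono) auto
      then show ?thesis using R1[of n] by simp
    next
      case False
      have "measure (\<mu> n) {x. \<bar>x\<bar> > R} \<le> measure (\<mu> n) {x. \<bar>x\<bar> > R0}"
        using R(2) by (intro finite_measure_mono) auto
      then show ?thesis using R0[of n] False by simp
    qed
    moreover have "1 = measure (\<mu> n) (space (\<mu> n))" by (simp only: prob_space)
    moreover have "measure (\<mu> n) (space (\<mu> n)) \<le> measure (\<mu> n) ({- R - 1<..R} \<union> {x. \<bar>x\<bar> > R})"
      by (intro finite_measure_mono) auto
    moreover have "measure (\<mu> n) ({- R - 1<..R} \<union> {x. \<bar>x\<bar> > R}) \<le> measure (\<mu> n) {- R - 1<..R} + measure (\<mu> n) {x. \<bar>x\<bar> > R}"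
      by (intro measure_Un_le) auto
    ultimately show "1 - \<epsilon> < measure (\<mu> n) {- R - 1<..R}" by linarith
  qed
qed

section \<open>The information bound\<close>

context local_model
begin

text \<open>The central limit theorem is a special case of the continuation argument: for
  \<open>\<Psi> = 1\<close>, \<open>\<kappa> = 0\<close> and \<open>\<Lambda> = 1\<close> every
  direction is \<open>good\<close>, by the limit of the second moment of \<open>lik\<close>.\<close>

lemma char_fluct_limit:
  assumes h: "h \<in> L20"
  shows "(\<lambda>n. LINT zs|P0. iexp (fluct n h zs)) \<longlonglongrightarrow> of_real (exp (- ip h h / 2))"
proof -
  interpret L: local_limit MX MT F0 "\<lambda>_ _. 1" "\<lambda>_. 0" 0 1
    by unfold_locales (auto simp: L2_space_iff)
  have good: "L.good k" if k: "k \<in> L20" for k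
  proof -
    have "(lik n (\<lambda>x. of_real (k x)) zs)^2 = of_real ((norm (lik n (\<lambda>x. of_real (k x)) zs))^2)" for n zs
    proof -
      have "lik n (\<lambda>x. of_real (k x)) zs = of_real (\<Prod>j<n. 1 + k (fst (zs j)) / (2 * sqrt (real n)))"
        by (simp add: lik_def)
      then show ?thesis by (simp only: norm_of_real power2_abs of_real_power)
    qed
    moreover have "(\<lambda>n. LINT zs|P0. (norm (lik n (\<lambda>x. of_real (k x)) zs))^2) \<longlonglongrightarrow> exp (ip k k / 4)"
      using lik_combination[OF k k, of 0] by simp
    then have "(\<lambda>n. complex_of_real (LINT zs|P0. (norm (lik n (\<lambda>x. of_real (k x)) zs))^2)) \<longlonglongrightarrow> of_real (exp (ip k k / 4))"
      by (rule tendsto_of_real)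
    ultimately show ?thesis
      using k by (simp add: L.good_def integral_complex_of_real[symmetric] exp_of_real[symmetric] del: integral_complex_of_real of_real_power)
  qed
  have z: "(\<lambda>_. 0) \<in> L20" by (simp add: L20_def)
  have "L.iexp_good (\<lambda>x. h x - 0)"
  proof (rule L.iexp_goodI[OF h z])
    fix z :: real
    show "L.good (\<lambda>x. z * h x + (1 - z + z^2) * 0)" using good[OF L20_scale[OF h, of z]] by simp
  qed
  then show ?thesis by (simp add: L.iexp_good_def ip_def exp_of_real[symmetric])
qed

end

context estimation_model
begin

lemma scores_L20: "score_set MX F0 \<C> \<subseteq> L20" "score_set MX F0 \<C> \<noteq> {}"
  using score_LAN(1)[where c=1] curves by (auto simp: score_set_def admissible_curves_def)

lemma tangent_L20: "tangent_space MX F0 \<C> \<subseteq> L20"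
  unfolding tangent_space_def using L2_closure_subset_L20(1)[OF linear_span_subset_L20[OF scores_L20(1)]] by blast

lemma projection_ip:
  assumes \<phi>0: "is_L2_projection M0 (tangent_space MX F0 \<C>) \<phi> \<phi>0" and h: "h \<in> tangent_space MX F0 \<C>"
  shows "\<phi>0 \<in> L20" "ip \<phi> h = ip \<phi>0 h"
proof -
  show p: "\<phi>0 \<in> L20" using \<phi>0 tangent_L20 by (auto simp: is_L2_projection_def)
  have "ip (\<lambda>x. \<phi> x - \<phi>0 x) h = 0" using \<phi>0 h by (simp add: is_L2_projection_def ip_def)
  moreover have "h \<in> L2_space M0" using h tangent_L20 L20D(5) by blast
  ultimately show "ip \<phi> h = ip \<phi>0 h"
    using ip_lincomb(1)[OF phi_L2 L20D(5)[OF p], of h 1 "-1"] by simp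
qed

text \<open>Conditional centring is stated for bounded test functions; truncation and dominated
  convergence extend it to square integrable ones.\<close>

lemma residual_uncorrelated:
  assumes h: "h \<in> L2_space M0"
  shows "integrable F0 (\<lambda>z. residual u ubar F0 z * h (fst z))" "(LINT z|F0. residual u ubar F0 z * h (fst z)) = 0"
proof -
  define w where "w = residual u ubar F0"
  have [measurable]: "w \<in> borel_measurable F0" "h \<in> borel_measurable MX"
    using residual_meas[OF F0] h by (auto simp: w_def L2_space_iff)
  have h2: "integrable F0 (\<lambda>z. (h (fst z))^2)"
    using h integral_M0(2)[of "\<lambda>x. (h x)^2"] by (simp add: L2_space_iff)
  show i: "integrable F0 (\<lambda>z. residual u ubar F0 z * h (fst z))"
    unfolding w_def[symmetric] using residual_F0_square h2 by (intro integrable_mult_square) (simp_all add: w_def[symmetric])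
  define k where "k i x = max (- real i) (min (real i) (h x))" for i x
  have [measurable]: "k i \<in> borel_measurable MX" for i unfolding k_def by measurable
  have cc: "cond_centered MX F0 w" using residual_cond_centered[OF F0] by (simp add: w_def)
  have zero: "(LINT z|F0. w z * k i (fst z)) = 0" for i
  proof -
    \<comment> \<open>Division by \<open>i + 1\<close> brings the truncated function into the range
      required by \<open>cond_centered\<close>, also for i = 0.\<close>
    have "\<bar>k i x / (real i + 1)\<bar> \<le> 1" for x by (simp add: k_def divide_le_eq)
    moreover have m: "(\<lambda>x. k i x / (real i + 1)) \<in> borel_measurable MX" by measurable
    note cc[unfolded cond_centered_def, THEN conjunct2, THEN bspec, OF m, THEN mp]
    ultimately have "(LINT z|F0. (k i (fst z) / (real i + 1)) * w z) = 0" by blast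
    moreover have "(k i (fst z) / (real i + 1)) * w z = (1 / (real i + 1)) * (w z * k i (fst z))" for z by simp
    ultimately have "(1 / (real i + 1)) * (LINT z|F0. w z * k i (fst z)) = 0" by (simp only: integral_mult_right_zero)
    moreover have "real i + 1 \<noteq> 0" by simp
    ultimately show ?thesis by (metis divide_eq_0_iff mult_eq_0_iff zero_neq_one)
  qed
  have "(\<lambda>i. LINT z|F0. w z * k i (fst z)) \<longlonglongrightarrow> (LINT z|F0. w z * h (fst z))"
  proof (rule integral_dominated_convergence[where w="\<lambda>z. \<bar>w z * h (fst z)\<bar>"])
    show "AE z in F0. (\<lambda>i. w z * k i (fst z)) \<longlonglongrightarrow> w z * h (fst z)"
    proof (intro AE_I2 tendsto_mult tendsto_const tendsto_eventually)
      fix z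
      show "\<forall>\<^sub>F i in sequentially. k i (fst z) = h (fst z)"
        using eventually_ge_at_top[of "nat \<lceil>\<bar>h (fst z)\<bar>\<rceil>"]
      proof eventually_elim
        case (elim i)
        then have "\<bar>h (fst z)\<bar> \<le> real i" by linarith
        then show ?case by (auto simp: k_def)
      qed
    qed
    show "AE z in F0. norm (w z * k i (fst z)) \<le> \<bar>w z * h (fst z)\<bar>" for i
      unfolding real_norm_def abs_mult by (intro AE_I2 mult_left_mono) (auto simp: k_def)
    show "integrable F0 (\<lambda>z. \<bar>w z * h (fst z)\<bar>)" using i by (simp add: w_def)
  qed auto
  then show "(LINT z|F0. residual u ubar F0 z * h (fst z)) = 0"
    unfolding zero by (simp add: w_def LIMSEQ_const_iff)
qed

lemma residual_mean: "integrable F0 (residual u ubar F0)" "(LINT z|F0. residual u ubar F0 z) = 0"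
  using residual_uncorrelated[of "\<lambda>_. 1"] by (simp_all add: L2_space_iff)

text \<open>Residuals are uncorrelated with functions of X, so the two variances add. The constant c
  allows for centring by the mean utility.\<close>

lemma sum_variance:
  fixes c :: real
  assumes h: "h \<in> L20"
  defines "g \<equiv> \<lambda>z. residual u ubar F0 z + h (fst z) + c"
  shows "integrable F0 g" "(LINT z|F0. g z) = c" "integrable F0 (\<lambda>z. (g z - c)^2)" "(LINT z|F0. (g z - c)^2) = sig2 + ip h h"
    "g \<in> L2_space F0"
proof -
  define w where "w = residual u ubar F0"
  have w: "integrable F0 w" "(LINT z|F0. w z) = 0" "integrable F0 (\<lambda>z. (w z)^2)"
    using residual_mean residual_F0_square by (simp_all add: w_def)
  note [measurable] = L20D(1)[OF h]
  have hF: "integrable F0 (\<lambda>z. h (fst z))" "(LINT z|F0. h (fst z)) = 0" "integrable F0 (\<lambda>z. (h (fst z))^2)" "(LINT z|F0. (h (fst z))^2) = ip h h"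
    using L20D[OF h] integral_M0[of h] integral_M0[of "\<lambda>x. (h x)^2"] by (simp_all add: ip_def power2_eq_square)
  have wh: "integrable F0 (\<lambda>z. w z * h (fst z))" "(LINT z|F0. w z * h (fst z)) = 0"
    using residual_uncorrelated[OF L20D(5)[OF h]] by (simp_all add: w_def)
  show gi: "integrable F0 g" "(LINT z|F0. g z) = c"
    unfolding g_def w_def[symmetric] using w hF by (simp_all add: F0.prob_space)
  have sq: "(g z - c)^2 = (w z)^2 + 2 * (w z * h (fst z)) + (h (fst z))^2" for z
    by (simp add: g_def w_def power2_eq_square algebra_simps)
  show i2: "integrable F0 (\<lambda>z. (g z - c)^2)" unfolding sq using w hF wh by simp
  show "(LINT z|F0. (g z - c)^2) = sig2 + ip h h"
    unfolding sq using w hF wh by (simp add: sig2_def w_def)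
  have "(g z)^2 = (g z - c)^2 + 2 * c * g z - c\<^sup>2" for z by (simp add: power2_eq_square algebra_simps)
  then have "integrable F0 (\<lambda>z. (g z)^2)" using i2 gi(1) by simp
  then show "g \<in> L2_space F0" using gi(1) by (simp add: L2_space_def)
qed

lemma bound_eq:
  assumes h: "h \<in> L20"
  shows "evar F0 (\<lambda>z. (ubar (fst z) F0 - mean_utility u F0 + h (fst z)) - util u F0 z) = ennreal (sig2 + ip h h)"
proof -
  have eq: "(\<lambda>z. (ubar (fst z) F0 - mean_utility u F0 + h (fst z)) - util u F0 z) =
      (\<lambda>z. residual u ubar F0 z + h (fst z) + (- mean_utility u F0))"
    by (auto simp: residual_def util_def)
  note v = sum_variance[OF h, of "- mean_utility u F0"]
  show ?thesis unfolding eq evar_def v(2) using v(1) nn_integral_eq_integral[OF v(3)] v(4) by simp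
qed

lemma regular_limits:
  assumes reg: "regular_estimator MX u \<C> S \<Omega> \<xi>"
  shows "(\<lambda>n. LINT zs|P0. iexp (s * stat S n zs)) \<longlonglongrightarrow> \<Lambda> \<Omega> \<xi> s"
    and "h \<in> tangent_space MX F0 \<C> \<Longrightarrow>
      (\<lambda>n. LINT zs|P0. iexp (s * stat S n zs) * of_real (fluct n h zs)) \<longlonglongrightarrow> \<Lambda> \<Omega> \<xi> s * (\<i> * of_real s) * of_real (ip \<phi> h)"
    and "convex_set_of_functions (L2_closure M0 (score_set MX F0 \<C>)) \<Longrightarrow> h \<in> tangent_space MX F0 \<C> \<Longrightarrow>
      (\<lambda>n. LINT zs|P0. iexp (s * stat S n zs) * iexp (fluct n h zs)) \<longlonglongrightarrow> \<Lambda> \<Omega> \<xi> s * of_real (exp (- ip h h / 2 - s * ip \<phi> h))"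
proof -
  have est: "is_estimator MX S" using reg by (simp add: regular_estimator_def)
  interpret L: local_limit MX MT F0 "\<lambda>n zs. iexp (s * stat S n zs)" \<phi> "\<i> * of_real s" "\<Lambda> \<Omega> \<xi> s"
    by (rule local_limit_stat[OF est])
  have good: "L.good (\<lambda>x. c * \<rho> x)" if "\<rho> \<in> score_set MX F0 \<C>" "0 < c" for \<rho> c
    using that regular_good[OF reg] by (auto simp: score_set_def)
  have score: "\<rho> \<in> L20" if "\<rho> \<in> score_set MX F0 \<C>" for \<rho> using that scores_L20 by blast
  obtain \<rho>0 where \<rho>0: "\<rho>0 \<in> score_set MX F0 \<C>" using scores_L20(2) by blast
  show "(\<lambda>n. LINT zs|P0. iexp (s * stat S n zs)) \<longlonglongrightarrow> \<Lambda> \<Omega> \<xi> s"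
    by (rule L.good_score_limits(1)[OF score[OF \<rho>0] good[OF \<rho>0]])
  show "(\<lambda>n. LINT zs|P0. iexp (s * stat S n zs) * of_real (fluct n h zs)) \<longlonglongrightarrow> \<Lambda> \<Omega> \<xi> s * (\<i> * of_real s) * of_real (ip \<phi> h)"
    if "h \<in> tangent_space MX F0 \<C>"
    using L.lin_good_tangent[OF scores_L20(1) _ that[unfolded tangent_space_def]] L.good_score_limits(2)[OF score good]
    unfolding L.lin_good_def by blast
  show "(\<lambda>n. LINT zs|P0. iexp (s * stat S n zs) * iexp (fluct n h zs)) \<longlonglongrightarrow> \<Lambda> \<Omega> \<xi> s * of_real (exp (- ip h h / 2 - s * ip \<phi> h))"
    if "convex_set_of_functions (L2_closure M0 (score_set MX F0 \<C>))" "h \<in> tangent_space MX F0 \<C>"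
  proof -
    have "L.iexp_good h"
      by (rule L.iexp_good_tangent[OF scores_L20 good that(1) that(2)[unfolded tangent_space_def]])
    \<comment> \<open>With \<open>\<kappa> = i s\<close> the factor \<open>i \<kappa>\<close> is -s,
      so the exponent becomes real.\<close>
    moreover have "exp (- of_real (ip h h) / 2 + \<i> * (\<i> * of_real s) * of_real (ip \<phi> h)) = complex_of_real (exp (- ip h h / 2 - s * ip \<phi> h))"
      by (simp add: exp_of_real[symmetric] mult.assoc[symmetric])
    ultimately show ?thesis unfolding L.iexp_good_def by simp
  qed
qed

text \<open>At this point \<open>\<Lambda>\<close> is not known to be a characteristic function.
  Tightness is therefore obtained by a detour: \<open>stat\<close> plus the noise converges in law
  to \<open>\<xi>\<close>, the noise alone to a normal law, and the difference of two tight
  sequences is tight.\<close>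

lemma stat_tight:
  assumes reg: "regular_estimator MX u \<C> S \<Omega> \<xi>" and "\<delta> > 0"
  shows "\<exists>R\<ge>0. \<forall>\<^sub>F n in sequentially. measure P0 {zs \<in> space P0. \<bar>stat S n zs\<bar> > R} < \<delta>"
proof -
  have est: "is_estimator MX S" and \<Omega>: "prob_space \<Omega>" and \<xi>: "\<xi> \<in> borel_measurable \<Omega>"
    using reg by (auto simp: regular_estimator_def)
  obtain \<gamma> where \<gamma>: "\<gamma> \<in> \<C>" using curves by (auto simp: admissible_curves_def)
  define W where "W n zs = (\<Sum>j<n. residual u ubar F0 (zs j)) / sqrt (real n)" for n zs
  have [measurable]: "(\<lambda>zs. residual u ubar F0 (zs j)) \<in> borel_measurable P0" for j
    by (intro measurable_iid_component residual_meas F0)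
  have W_meas [measurable]: "W n \<in> borel_measurable P0" for n unfolding W_def[abs_def] by measurable
  note [measurable] = stat_measurable[OF est]
  have S_meas [measurable]: "S n \<in> borel_measurable (PiM {..<n} (\<lambda>_. MX))" for n
    using est by (auto simp: is_estimator_def)
  define E where "E s = complex_of_real (exp (- (s^2 * sig2) / 2))" for s :: real
  have CLT: "(\<lambda>n. (LINT zs|P0. G n (observed n zs) * iexp (s * W n zs)) - E s * (LINT zs|P0. G n (observed n zs))) \<longlonglongrightarrow> 0"
    if "\<And>n. G n \<in> borel_measurable (PiM {..<n} (\<lambda>_. MX))" "\<And>n x. norm (G n x) \<le> 1" for G s
    using residual_CLT[OF \<gamma>, of "\<lambda>_. 0", OF _ _ that, of s] by (simp add: curveD(1)[OF \<gamma>] W_def E_def)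
  have sig2: "0 \<le> sig2" by (simp add: sig2_def)
  have W_char: "(\<lambda>n. LINT zs|P0. iexp (s * W n zs)) \<longlonglongrightarrow> char (normal_law 0 sig2) s" for s
    using CLT[of "\<lambda>_ _. 1" s] by (simp add: char_normal_law[OF sig2] E_def P0.prob_space LIM_zero_iff)
  have T_char: "(\<lambda>n. LINT zs|P0. iexp (s * (stat S n zs + W n zs))) \<longlonglongrightarrow> char (distr \<Omega> borel \<xi>) s" for s
  proof -
    define G where "G n x = iexp (s * ((S n x - (\<Sum>j<n. ubar (x j) F0)) / sqrt (real n)))" for n x
    have G: "G n \<in> borel_measurable (PiM {..<n} (\<lambda>_. MX))" for n
      using ubar_meas[OF F0] unfolding G_def by measurable
    have G_obs: "G n (observed n zs) = iexp (s * stat S n zs)" for n zs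
      by (simp add: G_def stat_def observed_def)
    have "(\<lambda>n. (LINT zs|P0. iexp (s * stat S n zs) * iexp (s * W n zs)) - E s * (LINT zs|P0. iexp (s * stat S n zs))) \<longlonglongrightarrow> 0"
      using CLT[OF G, of s] unfolding G_obs by (simp add: G_def del: of_real_mult of_real_divide of_real_diff)
    from tendsto_add[OF this tendsto_mult[OF tendsto_const regular_limits(1)[OF reg, of s], of "E s"]]
    have lim: "(\<lambda>n. LINT zs|P0. iexp (s * stat S n zs) * iexp (s * W n zs)) \<longlonglongrightarrow> E s * \<Lambda> \<Omega> \<xi> s" by simp
    have "E s * \<Lambda> \<Omega> \<xi> s = char (distr \<Omega> borel \<xi>) s * of_real (exp (- (s^2 * sig2) / 2) * exp (s^2 * sig2 / 2))"
      by (simp add: E_def \<Lambda>_def)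
    also have "exp (- (s^2 * sig2) / 2) * exp (s^2 * sig2 / 2) = 1" by (simp flip: exp_add)
    finally have eq: "E s * \<Lambda> \<Omega> \<xi> s = char (distr \<Omega> borel \<xi>) s" by simp
    have "iexp (s * (stat S n zs + W n zs)) = iexp (s * stat S n zs) * iexp (s * W n zs)" for n zs
      by (simp only: distrib_left of_real_add exp_add)
    with lim show ?thesis unfolding eq by simp
  qed
  obtain R1 where R1: "R1 \<ge> 0" "\<forall>\<^sub>F n in sequentially. measure P0 {zs \<in> space P0. \<bar>stat S n zs + W n zs\<bar> > R1} < \<delta> / 2"
    using small_probability_if_char_limit[OF P0.prob_space_axioms _ prob_space.real_distribution_distr[OF \<Omega> \<xi>] T_char, of "\<delta> / 2"] \<open>\<delta> > 0\<close>
    by auto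
  obtain R2 where R2: "R2 \<ge> 0" "\<forall>\<^sub>F n in sequentially. measure P0 {zs \<in> space P0. \<bar>W n zs\<bar> > R2} < \<delta> / 2"
    using small_probability_if_char_limit[OF P0.prob_space_axioms W_meas real_distribution_normal_law[OF sig2] W_char, of "\<delta> / 2"] \<open>\<delta> > 0\<close>
    by auto
  have "\<forall>\<^sub>F n in sequentially. measure P0 {zs \<in> space P0. \<bar>stat S n zs\<bar> > R1 + R2} < \<delta>"
    using R1(2) R2(2)
  proof eventually_elim
    case (elim n)
    have "measure P0 {zs \<in> space P0. \<bar>(stat S n zs + W n zs) + - W n zs\<bar> > R1 + R2} \<le>
        measure P0 {zs \<in> space P0. \<bar>stat S n zs + W n zs\<bar> > R1} + measure P0 {zs \<in> space P0. \<bar>- W n zs\<bar> > R2}"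
      by (rule P0.small_probability_add) measurable
    then show ?case using elim by simp
  qed
  then show ?thesis using R1(1) R2(1) by (intro exI[of _ "R1 + R2"]) auto
qed

end

section \<open>The variance bound\<close>

lemma tendsto_sin_scaled:
  fixes s :: "nat \<Rightarrow> real"
  assumes s: "\<And>i. s i > 0" "s \<longlonglongrightarrow> 0"
  shows "(\<lambda>i. sin (s i * x) / s i) \<longlonglongrightarrow> x"
proof -
  have "(\<lambda>i. (s i)^2 * \<bar>x\<bar> ^ 3) \<longlonglongrightarrow> 0\<^sup>2 * \<bar>x\<bar> ^ 3" by (intro tendsto_intros s)
  then have lim: "(\<lambda>i. (s i)^2 * \<bar>x\<bar> ^ 3) \<longlonglongrightarrow> 0" by simp
  have "(\<lambda>i. x - sin (s i * x) / s i) \<longlonglongrightarrow> 0"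
    by (rule Lim_null_comparison[OF _ lim]) (auto intro!: always_eventually abs_sin_scaled_diff_le s(1))
  from tendsto_diff[OF tendsto_const[of x] this] show ?thesis by simp
qed

lemma abs_sin_scaled_le: "s > 0 \<Longrightarrow> \<bar>sin (s * x) / s\<bar> \<le> \<bar>x :: real\<bar>"
  using abs_sin_x_le_abs_x[of "s * x"] by (simp add: abs_mult divide_le_eq mult.commute)

lemma sin_scaled_square: "(sin (s * x) / s)^2 = (1 - cos (2 * s * x)) / (2 * s^2 :: real)"
proof -
  have "cos (2 * (s * x)) = 1 - 2 * (sin (s * x))^2" by (rule cos_double_sin)
  then show ?thesis by (simp add: power_divide mult.assoc)
qed

text \<open>The moments are recovered through \<open>sin (s x) / s\<close>, which tends to x and is
  dominated by \<open>|x|\<close>. The square of this truncation involves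
  \<open>cos (2 s x)\<close>, hence the argument \<open>2 * s i\<close>, and the second-order term
  of the factor \<open>exp (r^2 v / 2)\<close> accounts for the subtracted v.\<close>

lemma (in real_distribution) char_second_order_limits:
  fixes s :: "nat \<Rightarrow> real" and v :: real
  assumes x2: "integrable M (\<lambda>x. x\<^sup>2)" and s: "\<And>i. s i > 0" "s \<longlonglongrightarrow> 0"
  defines "L \<equiv> \<lambda>r. char M r * of_real (exp (r^2 * v / 2))"
  shows "(\<lambda>i. Re (L (s i))) \<longlonglongrightarrow> 1"
    and "(\<lambda>i. Im (L (s i)) / s i) \<longlonglongrightarrow> (LINT x|M. x)"
    and "(\<lambda>i. (1 - Re (L (2 * s i))) / (2 * (s i)^2)) \<longlonglongrightarrow> (LINT x|M. x\<^sup>2) - v"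
proof -
  have x1: "integrable M (\<lambda>x. x)"
    using integrable_mult_square[of "\<lambda>_. 1::real" M "\<lambda>x. x"] x2 by simp
  have E: "(\<lambda>i. exp ((s i)^2 * v / 2)) \<longlonglongrightarrow> 1" "(\<lambda>i. exp ((2 * s i)^2 * v / 2)) \<longlonglongrightarrow> 1"
  proof -
    have "(\<lambda>i. exp ((s i)^2 * v / 2)) \<longlonglongrightarrow> exp (0\<^sup>2 * v / 2)" "(\<lambda>i. exp ((2 * s i)^2 * v / 2)) \<longlonglongrightarrow> exp ((2 * 0)^2 * v / 2)"
      by (intro tendsto_intros s; simp)+
    then show "(\<lambda>i. exp ((s i)^2 * v / 2)) \<longlonglongrightarrow> 1" "(\<lambda>i. exp ((2 * s i)^2 * v / 2)) \<longlonglongrightarrow> 1" by simp_all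
  qed
  have ie: "integrable M (\<lambda>x. iexp (r * x))" for r by (rule integrable_iexp) auto
  have Rc: "Re (char M r) = (LINT x|M. cos (r * x))" for r
    unfolding char_def by (subst integral_Re[symmetric, OF ie]) (simp add: Re_exp)
  have Ic: "Im (char M r) = (LINT x|M. sin (r * x))" for r
    unfolding char_def by (subst integral_Im[symmetric, OF ie]) (simp add: Im_exp)
  have bdd: "integrable M (\<lambda>x. cos (r * x))" "integrable M (\<lambda>x. sin (r * x))" for r
    by (auto intro!: integrable_bounded[where B=1])
  have "(\<lambda>i. char M (s i)) \<longlonglongrightarrow> char M 0" using isCont_tendsto_compose[OF isCont_char s(2)] .
  then have "(\<lambda>i. Re (char M (s i)) * exp ((s i)^2 * v / 2)) \<longlonglongrightarrow> Re (char M 0) * 1"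
    by (intro tendsto_mult E tendsto_Re)
  then show "(\<lambda>i. Re (L (s i))) \<longlonglongrightarrow> 1" by (simp add: L_def char_zero)
  have "(\<lambda>i. LINT x|M. sin (s i * x) / s i) \<longlonglongrightarrow> (LINT x|M. x)"
    by (rule integral_dominated_convergence[where w="\<lambda>x. \<bar>x\<bar>"])
      (auto intro!: tendsto_sin_scaled s abs_sin_scaled_le simp del: abs_divide simp: x1)
  from tendsto_mult[OF this E(1)]
  show "(\<lambda>i. Im (L (s i)) / s i) \<longlonglongrightarrow> (LINT x|M. x)" by (simp add: L_def Ic)
  have "(\<lambda>i. LINT x|M. (sin (s i * x) / s i)^2) \<longlonglongrightarrow> (LINT x|M. x\<^sup>2)"
  proof (rule integral_dominated_convergence[where w="\<lambda>x. x\<^sup>2"])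
    show "AE x in M. (\<lambda>i. (sin (s i * x) / s i)^2) \<longlonglongrightarrow> x\<^sup>2"
      by (intro AE_I2 tendsto_power tendsto_sin_scaled s)
    show "AE x in M. norm ((sin (s i * x) / s i)^2) \<le> x\<^sup>2" for i
    proof (rule AE_I2)
      fix x
      have "\<bar>sin (s i * x) / s i\<bar>\<^sup>2 \<le> \<bar>x\<bar>\<^sup>2" by (intro power_mono abs_sin_scaled_le s(1)) simp
      then show "norm ((sin (s i * x) / s i)^2) \<le> x\<^sup>2" unfolding power2_abs by simp
    qed
  qed (auto simp: x2)
  then have lim1: "(\<lambda>i. (1 - Re (char M (2 * s i))) / (2 * (s i)^2)) \<longlonglongrightarrow> (LINT x|M. x\<^sup>2)"
    unfolding sin_scaled_square Rc using bdd prob_space by simp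
  have "((\<lambda>y. exp (v * y)) has_real_derivative exp (v * 0) * v) (at 0)"
    by (auto intro!: derivative_eq_intros)
  then have "(\<lambda>y. (exp (v * y) - exp (v * 0)) / (y - 0)) \<midarrow>0\<rightarrow> exp (v * 0) * v"
    unfolding has_field_derivative_iff by simp
  then have der: "(\<lambda>y. (exp (v * y) - 1) / y) \<midarrow>0\<rightarrow> v" by simp
  have "(\<lambda>i. 2 * (s i)^2) \<longlonglongrightarrow> 2 * 0\<^sup>2" by (intro tendsto_intros s)
  then have s2: "(\<lambda>i. 2 * (s i)^2) \<longlonglongrightarrow> 0" by simp
  have "filterlim (\<lambda>i. 2 * (s i)^2) (at 0) sequentially"
    using s(1) by (intro filterlim_atI s2 always_eventually) (auto simp: less_imp_neq[THEN not_sym])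
  from filterlim_compose[OF der this]
  have lim2: "(\<lambda>i. (exp (v * (2 * (s i)^2)) - 1) / (2 * (s i)^2)) \<longlonglongrightarrow> v" .
  \<comment> \<open>The identity \<open>1 - c e = (1 - c) e - (e - 1)\<close> separates the
    characteristic function from the exponential factor.\<close>
  have eq: "(1 - Re (L (2 * s i))) / (2 * (s i)^2) =
      (1 - Re (char M (2 * s i))) / (2 * (s i)^2) * exp ((2 * s i)^2 * v / 2) - (exp (v * (2 * (s i)^2)) - 1) / (2 * (s i)^2)" for i
  proof -
    have e: "(2 * s i)^2 * v / 2 = v * (2 * (s i)^2)" by (simp add: power_mult_distrib)
    show ?thesis unfolding L_def e using s(1)[of i] by (simp add: field_simps)
  qed
  have "(\<lambda>i. (1 - Re (L (2 * s i))) / (2 * (s i)^2)) \<longlonglongrightarrow> (LINT x|M. x\<^sup>2) * 1 - v"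
    unfolding eq by (intro tendsto_diff tendsto_mult lim1 E(2) lim2)
  then show "(\<lambda>i. (1 - Re (L (2 * s i))) / (2 * (s i)^2)) \<longlonglongrightarrow> (LINT x|M. x\<^sup>2) - v" by simp
qed

context estimation_model
begin

text \<open>
  The statistic is truncated smoothly to \<open>sin (s X) / s\<close>, whose moments are read off the limits of
  the characteristic functions; the truncation is removed by \<open>s \<rightarrow> 0\<close> after \<open>n \<rightarrow> \<infinity>\<close>.
\<close>

lemma truncated_moment_limits:
  assumes reg: "regular_estimator MX u \<C> S \<Omega> \<xi>" and "s > 0"
  shows "(\<lambda>n. LINT zs|P0. sin (s * stat S n zs) / s) \<longlonglongrightarrow> Im (\<Lambda> \<Omega> \<xi> s) / s"
    and "(\<lambda>n. LINT zs|P0. (sin (s * stat S n zs) / s)^2) \<longlonglongrightarrow> (1 - Re (\<Lambda> \<Omega> \<xi> (2 * s))) / (2 * s^2)"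
    and "h \<in> tangent_space MX F0 \<C> \<Longrightarrow>
      (\<lambda>n. LINT zs|P0. sin (s * stat S n zs) / s * fluct n h zs) \<longlonglongrightarrow> ip \<phi> h * Re (\<Lambda> \<Omega> \<xi> s)"
    and "integrable P0 (\<lambda>zs. sin (s * stat S n zs) / s)" "integrable P0 (\<lambda>zs. (sin (s * stat S n zs) / s)^2)"
    and "g \<in> L20 \<Longrightarrow> integrable P0 (\<lambda>zs. sin (s * stat S n zs) / s * fluct n g zs)"
proof -
  have est: "is_estimator MX S" using reg by (simp add: regular_estimator_def)
  note [measurable] = stat_measurable[OF est]
  have ie: "integrable P0 (\<lambda>zs. iexp (r * stat S n zs))" for r n
    by (rule P0.integrable_bounded[where B=1]) auto
  have cb: "integrable P0 (\<lambda>zs. cos (r * stat S n zs))" for r n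
    by (rule P0.integrable_bounded[where B=1]) auto
  have sb: "integrable P0 (\<lambda>zs. sin (r * stat S n zs))" for r n
    by (rule P0.integrable_bounded[where B=1]) auto
  have c: "(\<lambda>n. LINT zs|P0. cos (r * stat S n zs)) \<longlonglongrightarrow> Re (\<Lambda> \<Omega> \<xi> r)" for r
  proof -
    have "Re (LINT zs|P0. iexp (r * stat S n zs)) = (LINT zs|P0. cos (r * stat S n zs))" for n
      by (subst integral_Re[symmetric, OF ie]) (simp add: Re_exp)
    with tendsto_Re[OF regular_limits(1)[OF reg, of r]] show ?thesis by simp
  qed
  have sn: "(\<lambda>n. LINT zs|P0. sin (r * stat S n zs)) \<longlonglongrightarrow> Im (\<Lambda> \<Omega> \<xi> r)" for r
  proof -
    have "Im (LINT zs|P0. iexp (r * stat S n zs)) = (LINT zs|P0. sin (r * stat S n zs))" for n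
      by (subst integral_Im[symmetric, OF ie]) (simp add: Im_exp)
    with tendsto_Im[OF regular_limits(1)[OF reg, of r]] show ?thesis by simp
  qed
  show "(\<lambda>n. LINT zs|P0. sin (s * stat S n zs) / s) \<longlonglongrightarrow> Im (\<Lambda> \<Omega> \<xi> s) / s"
    using tendsto_divide[OF sn[of s] tendsto_const[of s]] \<open>s > 0\<close> by simp
  have "(\<lambda>n. (1 - (LINT zs|P0. cos (2 * s * stat S n zs))) / (2 * s^2)) \<longlonglongrightarrow> (1 - Re (\<Lambda> \<Omega> \<xi> (2 * s))) / (2 * s^2)"
    by (intro tendsto_intros c) (use \<open>s > 0\<close> in simp)
  then show "(\<lambda>n. LINT zs|P0. (sin (s * stat S n zs) / s)^2) \<longlonglongrightarrow> (1 - Re (\<Lambda> \<Omega> \<xi> (2 * s))) / (2 * s^2)"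
    unfolding sin_scaled_square using cb by (simp add: P0.prob_space)
  show "integrable P0 (\<lambda>zs. sin (s * stat S n zs) / s)" using sb by simp
  show i2: "integrable P0 (\<lambda>zs. (sin (s * stat S n zs) / s)^2)" for n
    unfolding sin_scaled_square using cb by simp
  show yi: "integrable P0 (\<lambda>zs. sin (s * stat S n zs) / s * fluct n g zs)" if "g \<in> L20" for g n
    using fluct_norm2(1)[OF that, of n] i2[of n] L20D(1)[OF that]
    by (intro integrable_mult_square) (simp_all add: power_divide)
  show "(\<lambda>n. LINT zs|P0. sin (s * stat S n zs) / s * fluct n h zs) \<longlonglongrightarrow> ip \<phi> h * Re (\<Lambda> \<Omega> \<xi> s)"
    if h: "h \<in> tangent_space MX F0 \<C>"
  proof -
    have h0: "h \<in> L20" using h tangent_L20 by blast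
    note [measurable] = L20D(1)[OF h0]
    have int: "integrable P0 (\<lambda>zs. iexp (s * stat S n zs) * of_real (fluct n h zs))" for n
      by (rule Bochner_Integration.integrable_bound[OF fluct_integrable(1)[OF h0, of n]]) (auto simp: norm_mult)
    have "Im (LINT zs|P0. iexp (s * stat S n zs) * of_real (fluct n h zs)) = (LINT zs|P0. sin (s * stat S n zs) * fluct n h zs)" for n
      by (subst integral_Im[symmetric, OF int]) (simp add: Im_exp)
    with tendsto_Im[OF regular_limits(2)[OF reg h, of s]]
    have "(\<lambda>n. LINT zs|P0. sin (s * stat S n zs) * fluct n h zs) \<longlonglongrightarrow> Re (\<Lambda> \<Omega> \<xi> s) * s * ip \<phi> h" by simp
    from tendsto_divide[OF this tendsto_const[of s]] \<open>s > 0\<close> show ?thesis by (simp add: mult.commute)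
  qed
qed

text \<open>Let \<open>K = ip \<phi>0 \<phi>0\<close> and let V be the variance of
  \<open>\<xi>\<close>. For the truncated statistic the Cauchy-Schwarz inequality with
  \<open>fluct n \<phi>0\<close> reads \<open>(K Re L)^2 \<le> Q K\<close>, and as the truncation
  disappears it becomes \<open>K^2 \<le> (V - sig2) K\<close>. If the bound is attained without
  bias, the same limits show that the mean square distance from \<open>fluct n \<phi>0\<close> tends
  to \<open>K - 2 K + K = 0\<close>.\<close>

lemma
  assumes reg: "regular_estimator MX u \<C> S \<Omega> \<xi>"
    and proj: "is_L2_projection M0 (tangent_space MX F0 \<C>) \<phi> \<phi>0"
  shows variance_bound: "ennreal (sig2 + ip \<phi>0 \<phi>0) \<le> evar \<Omega> \<xi>"
    and efficient_linear: "(\<integral>\<^sup>+z. ennreal ((\<xi> z)^2) \<partial>\<Omega>) = ennreal (sig2 + ip \<phi>0 \<phi>0) \<Longrightarrow>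
      tends_to_0_in_prob P0 (\<lambda>n zs. stat S n zs - fluct n \<phi>0 zs)"
proof -
  have est: "is_estimator MX S" and \<Omega>: "prob_space \<Omega>" and \<xi> [measurable]: "\<xi> \<in> borel_measurable \<Omega>"
    using reg by (auto simp: regular_estimator_def)
  interpret \<Omega>: prob_space \<Omega> by fact
  interpret D: real_distribution "distr \<Omega> borel \<xi>" by (rule \<Omega>.real_distribution_distr) fact
  note [measurable] = stat_measurable[OF est]
  have tan: "\<phi>0 \<in> tangent_space MX F0 \<C>" using proj by (simp add: is_L2_projection_def)
  note p0 = projection_ip(1)[OF proj tan] and pK = projection_ip(2)[OF proj tan]
  note [measurable] = L20D(1)[OF p0]
  define K where "K = ip \<phi>0 \<phi>0"
  define s :: "nat \<Rightarrow> real" where "s i = inverse (real (Suc i))" for i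
  have s: "\<And>i. s i > 0" "s \<longlonglongrightarrow> 0" unfolding s_def by (simp, rule LIMSEQ_inverse_real_of_nat)
  define Y where "Y i n zs = sin (s i * stat S n zs) / s i" for i n zs
  have Y_meas [measurable]: "Y i n \<in> borel_measurable P0" for i n unfolding Y_def[abs_def] by measurable
  define L where "L = \<Lambda> \<Omega> \<xi>"
  note lims = truncated_moment_limits[OF reg s(1), folded Y_def L_def]
  note YD = lims(3)[OF tan, unfolded pK, folded K_def]
  have K0: "0 \<le> K" by (simp add: K_def ip_self_nonneg)
  have sig0: "0 \<le> sig2" by (simp add: sig2_def)
  note fl = fluct_integrable(1,3)[OF p0] fluct_norm2[OF p0, folded K_def]
  have small: "(\<lambda>i. Re (L (s i))) \<longlonglongrightarrow> 1" "(\<lambda>i. Im (L (s i)) / s i) \<longlonglongrightarrow> (LINT z|\<Omega>. \<xi> z)"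
    "(\<lambda>i. (1 - Re (L (2 * s i))) / (2 * (s i)^2)) \<longlonglongrightarrow> (LINT z|\<Omega>. (\<xi> z)^2) - sig2"
    if "integrable \<Omega> (\<lambda>z. (\<xi> z)^2)"
  proof -
    have "integrable (distr \<Omega> borel \<xi>) (\<lambda>x. x\<^sup>2)" using that by (simp add: integrable_distr_eq)
    from D.char_second_order_limits[OF this s, of sig2]
    show "(\<lambda>i. Re (L (s i))) \<longlonglongrightarrow> 1" "(\<lambda>i. Im (L (s i)) / s i) \<longlonglongrightarrow> (LINT z|\<Omega>. \<xi> z)"
      "(\<lambda>i. (1 - Re (L (2 * s i))) / (2 * (s i)^2)) \<longlonglongrightarrow> (LINT z|\<Omega>. (\<xi> z)^2) - sig2"
      by (simp_all add: L_def \<Lambda>_def integral_distr)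
  qed
  show "ennreal (sig2 + ip \<phi>0 \<phi>0) \<le> evar \<Omega> \<xi>"
  proof (cases "evar \<Omega> \<xi> = \<infinity>")
    case False
    define a where "a = (LINT z|\<Omega>. \<xi> z)"
    from False have i1: "integrable \<Omega> \<xi>" and ev: "evar \<Omega> \<xi> = (\<integral>\<^sup>+z. ennreal ((\<xi> z - a)^2) \<partial>\<Omega>)"
      by (auto simp: evar_def a_def split: if_splits)
    have iv: "integrable \<Omega> (\<lambda>z. (\<xi> z - a)^2)"
      using False ev by (intro integrableI_nonneg) (auto simp: less_top)
    have expand: "(\<xi> z)^2 = (\<xi> z - a)^2 + 2 * a * \<xi> z - a\<^sup>2" for z by (simp add: power2_eq_square algebra_simps)
    have i2: "integrable \<Omega> (\<lambda>z. (\<xi> z)^2)" unfolding expand using iv i1 by simp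
    define V where "V = (LINT z|\<Omega>. (\<xi> z - a)^2)"
    have V: "(LINT z|\<Omega>. (\<xi> z)^2) = V + a^2"
    proof -
      have "(LINT z|\<Omega>. (\<xi> z)^2) = V + 2 * a * a - a\<^sup>2"
        unfolding expand V_def using iv i1 by (simp add: \<Omega>.prob_space a_def)
      then show ?thesis by (simp add: power2_eq_square)
    qed
    \<comment> \<open>The limit in n of \<open>E (Y - a)^2\<close>. Centring at the mean a of
      \<open>\<xi>\<close> yields a bound for the variance, which is sharper than one for the second
      moment.\<close>
    define Q where "Q i = (1 - Re (L (2 * s i))) / (2 * (s i)^2) - 2 * a * (Im (L (s i)) / s i) + a^2" for i
    have Q_lim: "(\<lambda>n. LINT zs|P0. (Y i n zs - a)^2) \<longlonglongrightarrow> Q i" for i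
    proof -
      have e: "(Y i n zs - a)^2 = (Y i n zs)^2 - 2 * a * Y i n zs + a^2" for n zs
        by (simp add: power2_eq_square algebra_simps)
      have e': "(LINT zs|P0. (Y i n zs - a)^2) = (LINT zs|P0. (Y i n zs)^2) - 2 * a * (LINT zs|P0. Y i n zs) + a^2" for n
        unfolding e using lims(4,5) by (simp add: P0.prob_space)
      show ?thesis unfolding e' Q_def by (intro tendsto_intros lims(1,2))
    qed
    have CS: "(K * Re (L (s i)))^2 \<le> Q i * K" for i
    proof (rule LIMSEQ_le[OF tendsto_power[OF YD] tendsto_mult[OF Q_lim tendsto_const]])
      have "(LINT zs|P0. Y i n zs * fluct n \<phi>0 zs)^2 \<le> (LINT zs|P0. (Y i n zs - a)^2) * K" for n
      proof -
        have Ya2: "integrable P0 (\<lambda>zs. (Y i n zs - a)^2)"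
          using lims(4,5) by (simp add: power2_diff P0.prob_space)
        have e: "(Y i n zs - a) * fluct n \<phi>0 zs = Y i n zs * fluct n \<phi>0 zs - a * fluct n \<phi>0 zs" for zs
          by (simp add: left_diff_distrib)
        \<comment> \<open>Since \<open>fluct\<close> has mean 0, the centring does not change the
          covariance.\<close>
        have "(LINT zs|P0. (Y i n zs - a) * fluct n \<phi>0 zs) = (LINT zs|P0. Y i n zs * fluct n \<phi>0 zs)"
          unfolding e using fl(1,2) lims(6)[OF p0] by simp
        then have "(LINT zs|P0. Y i n zs * fluct n \<phi>0 zs)^2 \<le> (LINT zs|P0. (Y i n zs - a)^2) * (LINT zs|P0. (fluct n \<phi>0 zs)^2)"
          using integral_Cauchy_Schwarz[of "\<lambda>zs. Y i n zs - a" P0 "fluct n \<phi>0"] Ya2 fl(3) by simp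
        also have "\<dots> \<le> (LINT zs|P0. (Y i n zs - a)^2) * K" by (intro mult_left_mono fl(4)) simp
        finally show ?thesis .
      qed
      then show "\<exists>N. \<forall>n\<ge>N. (LINT zs|P0. Y i n zs * fluct n \<phi>0 zs)^2 \<le> (LINT zs|P0. (Y i n zs - a)^2) * K" by blast
    qed
    have Q0: "0 \<le> Q i" for i by (rule LIMSEQ_le_const[OF Q_lim]) (auto intro!: integral_nonneg)
    have "Q \<longlonglongrightarrow> ((LINT z|\<Omega>. (\<xi> z)^2) - sig2) - 2 * a * (LINT z|\<Omega>. \<xi> z) + a^2"
      unfolding Q_def by (intro tendsto_intros small[OF i2])
    then have Q_small: "Q \<longlonglongrightarrow> V - sig2" unfolding V a_def[symmetric] by (simp add: power2_eq_square)
    have "(\<lambda>i. (K * Re (L (s i)))^2) \<longlonglongrightarrow> (K * 1)\<^sup>2" by (intro tendsto_intros small[OF i2])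
    from LIMSEQ_le[OF this tendsto_mult[OF Q_small tendsto_const[of K]]] CS
    have "K * K \<le> (V - sig2) * K" by (auto simp: power2_eq_square)
    \<comment> \<open>For K = 0 the quadratic inequality is empty, and the nonnegativity of Q gives
      \<open>sig2 \<le> V\<close> instead.\<close>
    moreover have "0 \<le> V - sig2" using LIMSEQ_le_const[OF Q_small, of 0] Q0 by auto
    ultimately have "sig2 + K \<le> V" using K0 by (cases "K = 0") (auto simp: mult_le_cancel_right)
    moreover have "evar \<Omega> \<xi> = ennreal V"
      unfolding ev V_def by (rule nn_integral_eq_integral[OF iv]) simp
    ultimately show ?thesis by (simp add: K_def ennreal_leI)
  qed simp
  show "tends_to_0_in_prob P0 (\<lambda>n zs. stat S n zs - fluct n \<phi>0 zs)"
    if eq: "(\<integral>\<^sup>+z. ennreal ((\<xi> z)^2) \<partial>\<Omega>) = ennreal (sig2 + ip \<phi>0 \<phi>0)"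
  proof -
    have i2: "integrable \<Omega> (\<lambda>z. (\<xi> z)^2)" using eq by (intro integrableI_nonneg) auto
    have m2: "(LINT z|\<Omega>. (\<xi> z)^2) = sig2 + K"
    proof -
      have "ennreal (LINT z|\<Omega>. (\<xi> z)^2) = ennreal (sig2 + K)"
        using eq nn_integral_eq_integral[OF i2] unfolding K_def by simp
      then show ?thesis using K0 sig0 by (subst (asm) ennreal_inj) auto
    qed
    define q where "q i = (1 - Re (L (2 * s i))) / (2 * (s i)^2) - 2 * (K * Re (L (s i))) + K" for i
    have YDi: "integrable P0 (\<lambda>zs. (Y i n zs - fluct n \<phi>0 zs)^2)" for i n
      unfolding power2_diff using lims(5) lims(6)[OF p0] fl(3) by (simp add: mult.assoc)
    have q_lim: "(\<lambda>n. LINT zs|P0. (Y i n zs - fluct n \<phi>0 zs)^2) \<longlonglongrightarrow> q i" for i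
    proof -
      have e: "(Y i n zs - fluct n \<phi>0 zs)^2 = (Y i n zs)^2 - 2 * (Y i n zs * fluct n \<phi>0 zs) + (fluct n \<phi>0 zs)^2" for n zs
        by (simp add: power2_eq_square algebra_simps)
      have e': "(LINT zs|P0. (Y i n zs - fluct n \<phi>0 zs)^2) =
          (LINT zs|P0. (Y i n zs)^2) - 2 * (LINT zs|P0. Y i n zs * fluct n \<phi>0 zs) + (LINT zs|P0. (fluct n \<phi>0 zs)^2)" for n
        unfolding e using lims(5) lims(6)[OF p0] fl(3) by simp
      have "(\<lambda>n. LINT zs|P0. (fluct n \<phi>0 zs)^2) \<longlonglongrightarrow> K"
        by (intro tendsto_eventually eventually_mono[OF eventually_gt_at_top[of "0::nat"]] fl(5))
      then show ?thesis unfolding e' q_def by (intro tendsto_intros lims(2) YD)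
    qed
    have "q \<longlonglongrightarrow> (sig2 + K - sig2) - 2 * (K * 1) + K"
      unfolding q_def m2[symmetric] by (intro tendsto_intros small[OF i2])
    then have q_small: "q \<longlonglongrightarrow> 0" by simp
    show ?thesis unfolding tends_to_0_in_prob_def
    proof (intro allI impI)
      fix e :: real assume "e > 0"
      show "(\<lambda>n. measure P0 {zs \<in> space P0. \<bar>stat S n zs - fluct n \<phi>0 zs\<bar> > e}) \<longlonglongrightarrow> 0"
      proof (rule order_tendstoI)
        fix \<delta> :: real assume "0 < \<delta>"
        \<comment> \<open>R confines \<open>stat\<close> with high probability for all large n. The
          index i is then fixed so that on this range the truncation error is below e / 2 and the
          limiting mean square is small enough for Chebyshev's inequality.\<close>
        obtain R where R: "R \<ge> 0" "\<forall>\<^sub>F n in sequentially. measure P0 {zs \<in> space P0. \<bar>stat S n zs\<bar> > R} < \<delta> / 2"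
          using stat_tight[OF reg, of "\<delta> / 2"] \<open>0 < \<delta>\<close> by auto
        have "(\<lambda>i. (s i)^2 * R ^ 3) \<longlonglongrightarrow> 0\<^sup>2 * R ^ 3" by (intro tendsto_intros s)
        then have "\<forall>\<^sub>F i in sequentially. (s i)^2 * R ^ 3 < e / 2" using \<open>e > 0\<close> by (intro order_tendstoD) auto
        moreover have "\<forall>\<^sub>F i in sequentially. q i < \<delta> / 2 * (e / 2)^2"
          using q_small \<open>e > 0\<close> \<open>0 < \<delta>\<close> by (intro order_tendstoD) auto
        ultimately have "\<forall>\<^sub>F i in sequentially. (s i)^2 * R ^ 3 < e / 2 \<and> q i < \<delta> / 2 * (e / 2)^2"
          by (rule eventually_conj)
        then obtain i where i: "(s i)^2 * R ^ 3 < e / 2" "q i < \<delta> / 2 * (e / 2)^2"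
          using eventually_happens'[OF sequentially_bot] by blast
        have "\<forall>\<^sub>F n in sequentially. (LINT zs|P0. (Y i n zs - fluct n \<phi>0 zs)^2) < \<delta> / 2 * (e / 2)^2"
          using q_lim[of i] i(2) by (rule order_tendstoD)
        with R(2) show "\<forall>\<^sub>F n in sequentially. measure P0 {zs \<in> space P0. \<bar>stat S n zs - fluct n \<phi>0 zs\<bar> > e} < \<delta>"
        proof eventually_elim
          case (elim n)
          have "measure P0 {zs \<in> space P0. \<bar>(stat S n zs - Y i n zs) + (Y i n zs - fluct n \<phi>0 zs)\<bar> > e / 2 + e / 2} \<le>
              measure P0 {zs \<in> space P0. \<bar>stat S n zs - Y i n zs\<bar> > e / 2} + measure P0 {zs \<in> space P0. \<bar>Y i n zs - fluct n \<phi>0 zs\<bar> > e / 2}"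
            by (rule P0.small_probability_add) measurable
          also have "measure P0 {zs \<in> space P0. \<bar>stat S n zs - Y i n zs\<bar> > e / 2} \<le> measure P0 {zs \<in> space P0. \<bar>stat S n zs\<bar> > R}"
          proof (intro P0.finite_measure_mono)
            have "\<bar>stat S n zs\<bar> > R" if "\<bar>stat S n zs - Y i n zs\<bar> > e / 2" for zs
            proof (rule ccontr)
              assume "\<not> \<bar>stat S n zs\<bar> > R"
              then have "(s i)^2 * \<bar>stat S n zs\<bar> ^ 3 \<le> (s i)^2 * R ^ 3" by (intro mult_left_mono power_mono) auto
              with abs_sin_scaled_diff_le[OF s(1), of "stat S n zs" i] that i(1) show False by (simp add: Y_def)
            qed
            then show "{zs \<in> space P0. \<bar>stat S n zs - Y i n zs\<bar> > e / 2} \<subseteq> {zs \<in> space P0. \<bar>stat S n zs\<bar> > R}" by auto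
          qed measurable
          also have "measure P0 {zs \<in> space P0. \<bar>Y i n zs - fluct n \<phi>0 zs\<bar> > e / 2} \<le> (LINT zs|P0. (Y i n zs - fluct n \<phi>0 zs)^2) / (e / 2)^2"
            using \<open>e > 0\<close> YDi by (intro P0.Chebyshev_square) auto
          also have "\<dots> < \<delta> / 2" using elim(2) \<open>e > 0\<close> by (subst pos_divide_less_eq) auto
          finally show ?case using elim(1) by simp
        qed
      qed (simp add: less_le_trans[OF _ measure_nonneg])
    qed
  qed
qed

text \<open>Statistics whose difference vanishes in probability have the same limits of
  characteristic functions, so \<open>\<Lambda>\<close> is Gaussian with variance
  \<open>ip h h\<close>. Restoring the factor of the noise identifies the law of
  \<open>\<xi>\<close> as normal with variance \<open>sig2 + ip h h\<close>, and the second moment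
  follows.\<close>

lemma efficient_linear_converse:
  assumes reg: "regular_estimator MX u \<C> S \<Omega> \<xi>" and h: "h \<in> L20"
    and small: "tends_to_0_in_prob P0 (\<lambda>n zs. stat S n zs - fluct n h zs)"
  shows "(\<integral>\<^sup>+z. ennreal ((\<xi> z)^2) \<partial>\<Omega>) = ennreal (sig2 + ip h h)"
proof -
  have est: "is_estimator MX S" and \<Omega>: "prob_space \<Omega>" and \<xi> [measurable]: "\<xi> \<in> borel_measurable \<Omega>"
    using reg by (auto simp: regular_estimator_def)
  interpret \<Omega>: prob_space \<Omega> by fact
  note [measurable] = stat_measurable[OF est] L20D(1)[OF h]
  have v0: "0 \<le> sig2 + ip h h" by (simp add: sig2_def ip_self_nonneg)
  have "\<Lambda> \<Omega> \<xi> r = of_real (exp (- (r^2 * ip h h) / 2))" for r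
  proof -
    define d where "d n zs = iexp (r * stat S n zs) - iexp (r * fluct n h zs)" for n zs
    have ie: "integrable P0 (\<lambda>zs. iexp (r * stat S n zs))" "integrable P0 (\<lambda>zs. iexp (r * fluct n h zs))" for n
      by (rule P0.integrable_bounded[where B=1]; simp)+
    have di: "integrable P0 (d n)" for n unfolding d_def using ie by simp
    have "(\<lambda>n. LINT zs|P0. d n zs) \<longlonglongrightarrow> 0" unfolding tendsto_iff dist_norm diff_zero
    proof (intro allI impI)
      fix \<epsilon> :: real assume "\<epsilon> > 0"
      \<comment> \<open>The characters differ by at most \<open>|r| e \<le> \<epsilon> / 2\<close>
        off the exceptional event and by at most 2 on it. The 1 in the denominator covers r =
        0.\<close>
      define e where "e = \<epsilon> / (2 * (\<bar>r\<bar> + 1))"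
      have "e > 0" "\<bar>r\<bar> * e \<le> \<epsilon> / 2" using \<open>\<epsilon> > 0\<close> by (simp_all add: e_def field_simps)
      define A where "A n = {zs \<in> space P0. \<bar>stat S n zs - fluct n h zs\<bar> > e}" for n
      have [measurable]: "A n \<in> sets P0" for n unfolding A_def by measurable
      have "(\<lambda>n. measure P0 (A n)) \<longlonglongrightarrow> 0"
        using small \<open>e > 0\<close> by (auto simp: tends_to_0_in_prob_def A_def)
      then have "\<forall>\<^sub>F n in sequentially. measure P0 (A n) < \<epsilon> / 4" using \<open>\<epsilon> > 0\<close> by (intro order_tendstoD) auto
      then show "\<forall>\<^sub>F n in sequentially. norm (LINT zs|P0. d n zs) < \<epsilon>"
      proof eventually_elim
        case (elim n)
        have "norm (LINT zs|P0. d n zs) \<le> (LINT zs|P0. norm (d n zs))" by (rule integral_norm_bound)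
        also have "\<dots> \<le> (LINT zs|P0. \<epsilon> / 2 + 2 * indicator (A n) zs)"
        proof (intro integral_mono)
          fix zs assume zs: "zs \<in> space P0"
          have n2: "norm (d n zs) \<le> 2" unfolding d_def by (rule order_trans[OF norm_triangle_ineq4]) simp
          show "norm (d n zs) \<le> \<epsilon> / 2 + 2 * indicator (A n) zs"
          proof (cases "zs \<in> A n")
            case True
            with n2 \<open>\<epsilon> > 0\<close> show ?thesis by simp
          next
            case False
            then have "\<bar>r\<bar> * \<bar>stat S n zs - fluct n h zs\<bar> \<le> \<bar>r\<bar> * e" using zs by (intro mult_left_mono) (auto simp: A_def)
            moreover have "norm (d n zs) \<le> \<bar>r\<bar> * \<bar>stat S n zs - fluct n h zs\<bar>"
              using norm_iexp_diff[of "r * stat S n zs" "r * fluct n h zs"]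
              by (simp add: d_def abs_mult[symmetric] right_diff_distrib)
            ultimately show ?thesis using \<open>\<bar>r\<bar> * e \<le> \<epsilon> / 2\<close> False by simp
          qed
        qed (auto simp: di P0.emeasure_eq_measure)
        also have "\<dots> = \<epsilon> / 2 + 2 * measure P0 (A n)"
          by (subst Bochner_Integration.integral_add) (simp_all add: P0.prob_space P0.emeasure_eq_measure)
        finally show ?case using elim by simp
      qed
    qed
    from tendsto_diff[OF regular_limits(1)[OF reg, of r] this]
    have "(\<lambda>n. LINT zs|P0. iexp (r * fluct n h zs)) \<longlonglongrightarrow> \<Lambda> \<Omega> \<xi> r" using ie by (simp add: d_def)
    moreover have "(\<lambda>n. LINT zs|P0. iexp (r * fluct n h zs)) \<longlonglongrightarrow> of_real (exp (- (r^2 * ip h h) / 2))"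
    proof -
      have "fluct n (\<lambda>x. r * h x) zs = r * fluct n h zs" for n zs using fluct_lincomb[of n r h 0 h zs] by simp
      moreover have "ip (\<lambda>x. r * h x) (\<lambda>x. r * h x) = r^2 * ip h h"
      proof -
        have e: "r * h x * (r * h x) = r^2 * (h x * h x)" for x by (simp add: power2_eq_square)
        show ?thesis unfolding ip_def e by (rule integral_mult_right_zero)
      qed
      ultimately show ?thesis using char_fluct_limit[OF L20_scale[OF h, of r]] by simp
    qed
    ultimately show ?thesis by (rule LIMSEQ_unique)
  qed
  then have eq: "char (distr \<Omega> borel \<xi>) r * of_real (exp (r^2 * sig2 / 2)) = of_real (exp (- (r^2 * ip h h) / 2))" for r
    by (simp add: \<Lambda>_def)
  have "char (distr \<Omega> borel \<xi>) r = char (normal_law 0 (sig2 + ip h h)) r" for r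
  proof -
    have "char (normal_law 0 (sig2 + ip h h)) r * of_real (exp (r^2 * sig2 / 2)) = of_real (exp (- (r^2 * ip h h) / 2))"
      unfolding char_normal_law[OF v0] by (simp add: algebra_simps add_divide_distrib diff_divide_distrib flip: of_real_mult exp_add)
    with eq[of r] have "char (distr \<Omega> borel \<xi>) r * of_real (exp (r^2 * sig2 / 2)) = char (normal_law 0 (sig2 + ip h h)) r * of_real (exp (r^2 * sig2 / 2))"
      by simp
    then show ?thesis by simp
  qed
  then have "distr \<Omega> borel \<xi> = normal_law 0 (sig2 + ip h h)"
    using Levy_uniqueness[OF \<Omega>.real_distribution_distr[OF \<xi>] real_distribution_normal_law[OF v0]] by blast
  with second_moment_normal_law[OF v0] have "(\<integral>\<^sup>+x. ennreal (x^2) \<partial>distr \<Omega> borel \<xi>) = ennreal (sig2 + ip h h)" by simp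
  then show ?thesis by (simp add: nn_integral_distr)
qed

end

section \<open>The convolution theorem\<close>

lemma linear_span_lincomb:
  assumes "f \<in> linear_span A" "g \<in> linear_span A"
  shows "(\<lambda>x. c * f x + d * g x) \<in> linear_span A"
proof -
  obtain k :: nat and a r where f: "f = (\<lambda>x. \<Sum>i<k. a i * r i x)" "\<forall>i<k. r i \<in> A"
    using assms(1) unfolding linear_span_def by blast
  obtain l :: nat and b q where g: "g = (\<lambda>x. \<Sum>i<l. b i * q i x)" "\<forall>i<l. q i \<in> A"
    using assms(2) unfolding linear_span_def by blast
  \<comment> \<open>The two families of coefficients and functions are concatenated.\<close>
  define a' where "a' i = (if i < k then c * a i else d * b (i - k))" for i
  define r' where "r' i = (if i < k then r i else q (i - k))" for i
  have split: "(\<Sum>i<k + m. F i) = (\<Sum>i<k. F i) + (\<Sum>i<m. F (k + i))" for F :: "nat \<Rightarrow> real" and m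
    by (induction m) (simp_all add: add.assoc)
  have "(\<lambda>x. c * f x + d * g x) = (\<lambda>x. \<Sum>i<k + l. a' i * r' i x)"
    unfolding split f(1) g(1) by (simp add: a'_def r'_def sum_distrib_left mult.assoc)
  moreover have "\<forall>i<k + l. r' i \<in> A" using f(2) g(2) by (auto simp: r'_def)
  ultimately show ?thesis unfolding linear_span_def by blast
qed

lemma linear_span_superset: "A \<subseteq> linear_span A"
proof
  fix f assume "f \<in> A"
  moreover have "f = (\<lambda>x. \<Sum>i<Suc 0. 1 * f x)" by simp
  ultimately show "f \<in> linear_span A" unfolding linear_span_def by (intro CollectI exI[of _ "Suc 0"] exI[of _ "\<lambda>_. 1"] exI[of _ "\<lambda>_. f"]) auto
qed

lemma sqrt_scaled_mean: "sqrt (real n) * (x / real n) = x / sqrt (real n)"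
proof -
  have "sqrt (real n) * (x / (sqrt (real n) * sqrt (real n))) = x / sqrt (real n)"
    by (cases "n = 0") (simp_all del: real_sqrt_mult_self)
  then show ?thesis by simp
qed

context local_model
begin

lemma L2_closure_lincomb:
  assumes A: "\<And>f g c d. f \<in> A \<Longrightarrow> g \<in> A \<Longrightarrow> (\<lambda>x. c * f x + d * g x) \<in> A"
    and h: "h \<in> L2_closure M0 A" and k: "k \<in> L2_closure M0 A"
  shows "(\<lambda>x. a * h x + b * k x) \<in> L2_closure M0 A"
  unfolding L2_closure_def
proof (intro CollectI conjI allI impI)
  have hk: "h \<in> L2_space M0" "k \<in> L2_space M0" using h k by (auto simp: L2_closure_def)
  show "(\<lambda>x. a * h x + b * k x) \<in> L2_space M0" by (rule L2_lincomb[OF hk])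
  fix e :: real assume "e > 0"
  \<comment> \<open>Chosen so that \<open>2 (a^2 + b^2) d^2\<close> is at most
    \<open>e^2 / 2\<close>.\<close>
  define d where "d = e / (2 * (\<bar>a\<bar> + \<bar>b\<bar> + 1))"
  have "d > 0" using \<open>e > 0\<close> by (simp add: d_def)
  obtain f where f: "f \<in> A" "f \<in> L2_space M0" "sqrt (LINT x|M0. (h x - f x)^2) < d"
    using h \<open>d > 0\<close> unfolding L2_closure_def by blast
  obtain g where g: "g \<in> A" "g \<in> L2_space M0" "sqrt (LINT x|M0. (k x - g x)^2) < d"
    using k \<open>d > 0\<close> unfolding L2_closure_def by blast
  have i: "integrable M0 (\<lambda>x. (h x - f x)^2)" "integrable M0 (\<lambda>x. (k x - g x)^2)"
    using L2_lincomb[OF hk(1) f(2), of 1 "-1"] L2_lincomb[OF hk(2) g(2), of 1 "-1"] by (simp_all add: L2_space_iff)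
  have sq: "(x + y)^2 \<le> 2 * x^2 + 2 * y^2" for x y :: real
    using zero_le_power2[of "x - y"] by (simp add: power2_eq_square algebra_simps)
  have lt: "z < d\<^sup>2" if "sqrt z < d" for z using that \<open>d > 0\<close> by (metis real_less_rsqrt not_less less_imp_le real_sqrt_le_iff real_sqrt_unique)
  have "(LINT x|M0. ((a * h x + b * k x) - (a * f x + b * g x))^2) \<le> (LINT x|M0. 2 * a^2 * (h x - f x)^2 + 2 * b^2 * (k x - g x)^2)"
  proof (rule integral_mono)
    show "integrable M0 (\<lambda>x. ((a * h x + b * k x) - (a * f x + b * g x))^2)"
    proof -
      have e: "y - z = 1 * y + - 1 * z" for y z :: real by simp
      show ?thesis
        unfolding e using L2_lincomb[OF L2_lincomb[OF hk, of a b] L2_lincomb[OF f(2) g(2), of a b], of 1 "-1"] by (simp only: L2_space_iff)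
    qed
    show "((a * h x + b * k x) - (a * f x + b * g x))^2 \<le> 2 * a^2 * (h x - f x)^2 + 2 * b^2 * (k x - g x)^2" for x
    proof -
      have "(a * h x + b * k x) - (a * f x + b * g x) = a * (h x - f x) + b * (k x - g x)" by (simp add: algebra_simps)
      with sq[of "a * (h x - f x)" "b * (k x - g x)"] show ?thesis by (simp add: power_mult_distrib)
    qed
  qed (use i in simp)
  also have "\<dots> = 2 * a^2 * (LINT x|M0. (h x - f x)^2) + 2 * b^2 * (LINT x|M0. (k x - g x)^2)" using i by simp
  also have "\<dots> \<le> 2 * a^2 * d^2 + 2 * b^2 * d^2"
    using lt[OF f(3)] lt[OF g(3)] by (intro add_mono mult_left_mono) auto
  also have "\<dots> = 2 * (\<bar>a\<bar>\<^sup>2 + \<bar>b\<bar>\<^sup>2) * d^2" by (simp add: algebra_simps)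
  also have "\<dots> \<le> 2 * (\<bar>a\<bar> + \<bar>b\<bar> + 1)^2 * d^2"
  proof (intro mult_right_mono mult_left_mono)
    have "0 \<le> 2 * (\<bar>a\<bar> * \<bar>b\<bar>) + 2 * \<bar>a\<bar> + 2 * \<bar>b\<bar> + 1" by simp
    then show "\<bar>a\<bar>\<^sup>2 + \<bar>b\<bar>\<^sup>2 \<le> (\<bar>a\<bar> + \<bar>b\<bar> + 1)^2" unfolding power2_eq_square distrib_left distrib_right by simp
  qed auto
  also have "\<dots> = e^2 / 2"
  proof -
    have "c * (e / (2 * c)) = e / 2" if "c > 0" for c using that by simp
    from this[of "\<bar>a\<bar> + \<bar>b\<bar> + 1"] have "(\<bar>a\<bar> + \<bar>b\<bar> + 1) * d = e / 2"
      unfolding d_def by (simp only: add_nonneg_pos add_nonneg_nonneg abs_ge_zero zero_less_one)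
    then have "((\<bar>a\<bar> + \<bar>b\<bar> + 1) * d)^2 = (e / 2)^2" by (rule arg_cong)
    then show ?thesis by (simp add: power_mult_distrib power_divide)
  qed
  also have "\<dots> < e\<^sup>2" using \<open>e > 0\<close> by simp
  finally have "sqrt (LINT x|M0. ((a * h x + b * k x) - (a * f x + b * g x))^2) < e"
    using \<open>e > 0\<close> by (intro real_less_lsqrt) auto
  then show "\<exists>g'\<in>A \<inter> L2_space M0. sqrt (LINT x|M0. ((a * h x + b * k x) - g' x)^2) < e"
    using A[OF f(1) g(1), of a b] L2_lincomb[OF f(2) g(2), of a b] by (intro bexI[of _ "\<lambda>x. a * f x + b * g x"]) auto
qed

end

context estimation_model
begin

lemma tangent_lincomb:
  "h \<in> tangent_space MX F0 \<C> \<Longrightarrow> k \<in> tangent_space MX F0 \<C> \<Longrightarrow> (\<lambda>x. a * h x + b * k x) \<in> tangent_space MX F0 \<C>"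
  unfolding tangent_space_def by (rule L2_closure_lincomb[OF linear_span_lincomb])

lemma score_tangent: "has_score MX F0 \<gamma> \<rho> \<Longrightarrow> \<gamma> \<in> \<C> \<Longrightarrow> \<rho> \<in> tangent_space MX F0 \<C>"
proof -
  assume "has_score MX F0 \<gamma> \<rho>" "\<gamma> \<in> \<C>"
  then have s: "\<rho> \<in> score_set MX F0 \<C>" by (auto simp: score_set_def)
  then have "\<rho> \<in> L2_space M0" using scores_L20(1) L20D(5) by blast
  with s linear_span_superset show ?thesis
    unfolding tangent_space_def L2_closure_def by (auto intro!: bexI[of _ \<rho>])
qed

lemma linearized_statistic:
  "sqrt (real n) * (S n (observed n zs) / real n - emp_mean n (\<lambda>z. ubar (fst z) F0 - mean_utility u F0 + h (fst z)) zs - mean_utility u F0)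
    = stat S n zs - fluct n h zs"
proof (cases "n = 0")
  case False
  have "emp_mean n (\<lambda>z. ubar (fst z) F0 - mean_utility u F0 + h (fst z)) zs + mean_utility u F0 =
      ((\<Sum>j<n. ubar (fst (zs j)) F0) + (\<Sum>j<n. h (fst (zs j)))) / real n"
    using False by (simp add: emp_mean_def sum.distrib sum_subtractf add_divide_distrib diff_divide_distrib)
  then have e: "S n (observed n zs) / real n - emp_mean n (\<lambda>z. ubar (fst z) F0 - mean_utility u F0 + h (fst z)) zs - mean_utility u F0 =
      (S n (observed n zs) - (\<Sum>j<n. ubar (fst (zs j)) F0) - (\<Sum>j<n. h (fst (zs j)))) / real n"
    by (simp add: diff_divide_distrib add_divide_distrib)
  show ?thesis unfolding e sqrt_scaled_mean by (simp add: stat_def fluct_def diff_divide_distrib)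
qed (simp add: stat_def fluct_def)

lemma emp_process_eq:
  assumes h: "h \<in> L20"
  shows "emp_process F0 n (\<lambda>z. residual u ubar F0 z + h (fst z)) zs = (\<Sum>j<n. residual u ubar F0 (zs j)) / sqrt (real n) + fluct n h zs"
proof -
  have "emp_process F0 n (\<lambda>z. residual u ubar F0 z + h (fst z)) zs =
      sqrt (real n) * ((\<Sum>j<n. residual u ubar F0 (zs j) + h (fst (zs j))) / real n)"
    using sum_variance(2)[OF h, of 0] by (simp add: emp_process_def emp_mean_def)
  then show ?thesis unfolding sqrt_scaled_mean by (simp add: fluct_def sum.distrib add_divide_distrib)
qed

text \<open>For \<open>T = stat - fluct n \<phi>0\<close> the joint character with
  \<open>fluct n h\<close> is that of \<open>stat\<close> with the direction
  \<open>- s \<phi>0 + r h\<close>. Because \<open>\<phi>0\<close> is the projection of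
  \<open>\<phi>\<close>, the mixed terms in s and r cancel and the limit factorises; the residual
  noise adds a Gaussian factor in r. The convolution is then an identity of characteristic
  functions, with \<open>Z\<close> of variance \<open>sig2 + ip \<phi>0 \<phi>0\<close>.\<close>

lemma convolution_theorem:
  assumes reg: "regular_estimator MX u \<C> S (\<Omega> :: 'w measure) \<xi>"
    and proj: "is_L2_projection M0 (tangent_space MX F0 \<C>) \<phi> \<phi>0"
    and convex: "convex_set_of_functions (L2_closure M0 (score_set MX F0 \<C>))"
  shows "\<exists>(\<Omega>' :: (real \<times> real) measure) \<xi>' (Z :: ('x \<times> 't \<Rightarrow> real) \<Rightarrow> real \<times> real \<Rightarrow> real).
      prob_space \<Omega>' \<and> \<xi>' \<in> borel_measurable \<Omega>' \<and>
      (\<forall>g\<in>L2_space F0. Z g \<in> borel_measurable \<Omega>' \<and> distr \<Omega>' borel (Z g) = normal_law 0 (prob_space.variance F0 g)) \<and>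
      (\<forall>h\<in>tangent_space MX F0 \<C>. let g = (\<lambda>z. ubar (fst z) F0 + h (fst z) - util u F0 z) in
         weakly_tends (\<lambda>n. distr P0 borel (\<lambda>zs. (stat S n zs - fluct n \<phi>0 zs, emp_process F0 n g zs)))
           (distr \<Omega>' borel (\<lambda>y. (\<xi>' y, Z g y))) sequentially \<and>
         prob_space.indep_var \<Omega>' borel \<xi>' borel (Z g)) \<and>
      distr \<Omega> borel \<xi> =
        (distr \<Omega>' borel (Z (\<lambda>z. ubar (fst z) F0 - mean_utility u F0 + \<phi>0 (fst z) - util u F0 z)) \<star> distr \<Omega>' borel \<xi>')"
proof -
  have est: "is_estimator MX S" and \<Omega>: "prob_space \<Omega>" and \<xi> [measurable]: "\<xi> \<in> borel_measurable \<Omega>"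
    using reg by (auto simp: regular_estimator_def)
  interpret \<Omega>: prob_space \<Omega> by fact
  note [measurable] = stat_measurable[OF est]
  have tan: "\<phi>0 \<in> tangent_space MX F0 \<C>" using proj by (simp add: is_L2_projection_def)
  note p0 = projection_ip(1)[OF proj tan] and pI = projection_ip(2)[OF proj]
  note [measurable] = L20D(1)[OF p0]
  define K where "K = ip \<phi>0 \<phi>0"
  have K0: "0 \<le> K" by (simp add: K_def ip_self_nonneg)
  have sig0: "0 \<le> sig2" by (simp add: sig2_def)
  define L where "L = \<Lambda> \<Omega> \<xi>"
  define T where "T n zs = stat S n zs - fluct n \<phi>0 zs" for n zs
  have T_meas [measurable]: "T n \<in> borel_measurable P0" for n unfolding T_def[abs_def] by measurable
  \<comment> \<open>A limit law for T has to be produced before its characteristic function can be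
    used; tightness provides one along a subsequence.\<close>
  have T_tight: "tight (\<lambda>n. distr P0 borel (T n))"
  proof (rule tightI)
    show "real_distribution (distr P0 borel (T n))" for n by (rule P0.real_distribution_distr) measurable
    fix \<delta> :: real assume "\<delta> > 0"
    obtain R1 where R1: "\<forall>\<^sub>F n in sequentially. measure P0 {zs \<in> space P0. \<bar>stat S n zs\<bar> > R1} < \<delta> / 2"
      using stat_tight[OF reg, of "\<delta> / 2"] \<open>\<delta> > 0\<close> by auto
    define R2 where "R2 = sqrt (2 * K / \<delta>) + 1"
    have R2: "R2 > 0" "K / R2^2 \<le> \<delta> / 2"
    proof -
      show pos: "R2 > 0" using K0 \<open>\<delta> > 0\<close> by (auto simp: R2_def intro!: add_nonneg_pos)
      have "2 * K / \<delta> = (sqrt (2 * K / \<delta>))^2" using K0 \<open>\<delta> > 0\<close> by simp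
      also have "\<dots> \<le> R2\<^sup>2" unfolding R2_def using K0 \<open>\<delta> > 0\<close> by (intro power_mono) auto
      finally show "K / R2^2 \<le> \<delta> / 2" using pos \<open>\<delta> > 0\<close> by (simp add: field_simps)
    qed
    have "\<forall>\<^sub>F n in sequentially. measure (distr P0 borel (T n)) {x. \<bar>x\<bar> > R1 + R2} < \<delta>" using R1
    proof eventually_elim
      case (elim n)
      have "measure (distr P0 borel (T n)) {x. \<bar>x\<bar> > R1 + R2} = measure P0 {zs \<in> space P0. \<bar>stat S n zs + - fluct n \<phi>0 zs\<bar> > R1 + R2}"
        by (subst measure_distr) (auto simp: T_def vimage_def Int_def conj_commute)
      also have "\<dots> \<le> measure P0 {zs \<in> space P0. \<bar>stat S n zs\<bar> > R1} + measure P0 {zs \<in> space P0. \<bar>- fluct n \<phi>0 zs\<bar> > R2}"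
        by (rule P0.small_probability_add) measurable
      also have "measure P0 {zs \<in> space P0. \<bar>- fluct n \<phi>0 zs\<bar> > R2} \<le> (LINT zs|P0. (- fluct n \<phi>0 zs)^2) / R2^2"
        by (rule P0.Chebyshev_square) (use fluct_norm2(1)[OF p0] R2(1) in simp_all)
      also have "\<dots> \<le> K / R2^2"
        using fluct_norm2(2)[OF p0, of n] by (intro divide_right_mono) (simp_all add: K_def)
      finally show ?case using elim R2(2) by linarith
    qed
    then show "\<exists>R. \<forall>\<^sub>F n in sequentially. measure (distr P0 borel (T n)) {x. \<bar>x\<bar> > R} < \<delta>" by blast
  qed
  have joint: "(\<lambda>n. LINT zs|P0. iexp (s * T n zs + r * fluct n h zs)) \<longlonglongrightarrow> L s * of_real (exp (s^2 * K / 2 - r\<^sup>2 * ip h h / 2))"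
    and k_tan: "(\<lambda>x. - s * \<phi>0 x + r * h x) \<in> tangent_space MX F0 \<C>"
    if h: "h \<in> tangent_space MX F0 \<C>" for s r h
  proof -
    have h0: "h \<in> L20" using h tangent_L20 by blast
    define k where "k = (\<lambda>x. - s * \<phi>0 x + r * h x)"
    show k: "k \<in> tangent_space MX F0 \<C>" unfolding k_def by (rule tangent_lincomb[OF tan h])
    then have k0: "k \<in> L20" using tangent_L20 by blast
    note ip_k = ip_lincomb[OF L20D(5)[OF p0] L20D(5)[OF h0], of _ "- s" r, folded k_def]
    have a: "ip \<phi> k = - s * K + r * ip \<phi>0 h" unfolding pI[OF k] ip_k(2)[OF L20D(5)[OF p0]] K_def ..
    have b: "ip k k = s^2 * K - 2 * s * r * ip \<phi>0 h + r^2 * ip h h"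
      unfolding ip_k(1)[OF L20D(5)[OF k0]] ip_k(2)[OF L20D(5)[OF p0]] ip_k(2)[OF L20D(5)[OF h0]] K_def
      by (simp add: power2_eq_square algebra_simps ip_commute[of h \<phi>0])
    \<comment> \<open>This is the cancellation: the mixed terms in \<open>s r ip \<phi>0 h\<close>
      drop out.\<close>
    have e: "- ip k k / 2 - s * ip \<phi> k = s^2 * K / 2 - r\<^sup>2 * ip h h / 2"
      unfolding a b by (simp add: power2_eq_square field_simps)
    have arg: "iexp (s * T n zs + r * fluct n h zs) = iexp (s * stat S n zs) * iexp (fluct n k zs)" for n zs
    proof -
      have "s * T n zs + r * fluct n h zs = s * stat S n zs + fluct n k zs"
        unfolding k_def fluct_lincomb T_def by (simp add: algebra_simps)
      then show ?thesis by (simp only: distrib_left of_real_add exp_add)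
    qed
    show "(\<lambda>n. LINT zs|P0. iexp (s * T n zs + r * fluct n h zs)) \<longlonglongrightarrow> L s * of_real (exp (s^2 * K / 2 - r\<^sup>2 * ip h h / 2))"
      unfolding arg using regular_limits(3)[OF reg convex k, of s] unfolding e L_def .
  qed
  obtain \<alpha> \<sigma> where \<sigma>: "strict_mono \<sigma>" and \<alpha>: "real_distribution \<alpha>" "weak_conv_m ((\<lambda>n. distr P0 borel (T n)) \<circ> id \<circ> \<sigma>) \<alpha>"
    using tight_imp_convergent_subsubsequence[OF T_tight, of id] by (auto simp: strict_mono_def)
  interpret \<alpha>: real_distribution \<alpha> by fact
  \<comment> \<open>The characteristic functions converge along the full sequence, so the
    subsequential limit is the limit law of T.\<close>
  have char_\<alpha>: "char \<alpha> s = L s * of_real (exp (s^2 * K / 2))" for s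
  proof -
    have "(\<lambda>n. char (((\<lambda>n. distr P0 borel (T n)) \<circ> id \<circ> \<sigma>) n) s) \<longlonglongrightarrow> char \<alpha> s"
      by (rule levy_continuity1[OF _ \<alpha>]) (simp add: P0.real_distribution_distr)
    then have "(\<lambda>n. LINT zs|P0. iexp (s * T (\<sigma> n) zs)) \<longlonglongrightarrow> char \<alpha> s"
      by (simp add: char_def integral_distr)
    moreover have "(\<lambda>n. LINT zs|P0. iexp (s * T n zs)) \<longlonglongrightarrow> L s * of_real (exp (s^2 * K / 2))"
      using joint[OF tan, of s 0] by simp
    ultimately show ?thesis
      using LIMSEQ_subseq_LIMSEQ[OF _ \<sigma>] LIMSEQ_unique unfolding o_def by blast
  qed
  define N where "N = std_normal_distribution"
  interpret N: prob_space N unfolding N_def by (rule prob_space_normal_density) simp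
  define Q where "Q = \<alpha> \<Otimes>\<^sub>M N"
  interpret pair_prob_space \<alpha> N ..
  have Q: "prob_space Q" unfolding Q_def by (rule prob_space_axioms)
  interpret Q: prob_space Q by fact
  have setsN: "sets N = sets borel" by (simp add: N_def)
  have setsQ: "sets Q = sets (borel \<Otimes>\<^sub>M borel)" unfolding Q_def by (intro sets_pair_measure_cong setsN) simp
  have [measurable]: "fst \<in> borel_measurable Q" "snd \<in> borel_measurable Q"
    by (simp_all add: measurable_cong_sets[OF setsQ refl])
  have dfst: "distr Q borel fst = \<alpha>"
    using N.distr_pair_fst[of \<alpha>] unfolding Q_def by (simp cong: distr_cong)
  have "distr (\<alpha> \<Otimes>\<^sub>M N) N snd = N"
  proof (rule measure_eqI)
    fix A assume "A \<in> sets (distr (\<alpha> \<Otimes>\<^sub>M N) N snd)"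
    then have A: "A \<in> sets N" by simp
    have "snd -` A \<inter> space (\<alpha> \<Otimes>\<^sub>M N) = space \<alpha> \<times> A"
      using sets.sets_into_space[OF A] by (auto simp: space_pair_measure)
    then show "emeasure (distr (\<alpha> \<Otimes>\<^sub>M N) N snd) A = emeasure N A"
      using A N.emeasure_pair_measure_Times[OF sets.top A, of \<alpha>]
      by (simp only: emeasure_distr[OF measurable_snd] \<alpha>.emeasure_space_1 mult_1)
  qed simp
  then have dsnd: "distr Q borel snd = N"
    unfolding Q_def by (simp add: distr_cong[OF refl setsN[symmetric]])
  have "distr Q (borel \<Otimes>\<^sub>M borel) (\<lambda>y. (fst y, snd y)) = Q" by (simp add: distr_id2 setsQ)
  then have indep0: "Q.indep_var borel fst borel snd"
    unfolding Q.indep_var_distribution_eq dfst dsnd by (simp add: Q_def[symmetric])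
  \<comment> \<open>All \<open>Z g\<close> are multiples of one standard normal variable. The claims
    concern each \<open>Z g\<close> by itself, namely its law and its independence of
    \<open>\<xi>'\<close>, so a plane with product measure carries everything.\<close>
  define Z :: "('x \<times> 't \<Rightarrow> real) \<Rightarrow> real \<times> real \<Rightarrow> real" where
    "Z g y = sqrt (prob_space.variance F0 g) * snd y" for g y
  have Z_meas [measurable]: "Z g \<in> borel_measurable Q" for g unfolding Z_def[abs_def] by measurable
  have Z_law: "distr Q borel (Z g) = normal_law 0 (prob_space.variance F0 g)" for g
  proof -
    have v: "0 \<le> prob_space.variance F0 g" by simp
    have "distr Q borel (Z g) = distr (distr Q borel snd) borel (\<lambda>x. sqrt (prob_space.variance F0 g) * x)"
      by (subst distr_distr) (simp_all add: Z_def[abs_def] o_def)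
    then show ?thesis unfolding dsnd normal_law_eq_distr[OF v] N_def .
  qed
  have indep: "Q.indep_var borel fst borel (Z g)" for g
    using Q.indep_var_compose[OF indep0, of id borel "(*) (sqrt (prob_space.variance F0 g))" borel]
    by (simp add: o_def Z_def[abs_def])
  have g_eq: "(\<lambda>z. ubar (fst z) F0 + h (fst z) - util u F0 z) = (\<lambda>z. residual u ubar F0 z + h (fst z))" for h
    by (auto simp: residual_def util_def)
  have char_Z: "char (distr Q borel (Z (\<lambda>z. residual u ubar F0 z + h (fst z) + c))) r = of_real (exp (- (r^2 * (sig2 + ip h h)) / 2))"
    if "h \<in> L20" for h c r
  proof -
    note v = sum_variance[OF that, of c]
    have "prob_space.variance F0 (\<lambda>z. residual u ubar F0 z + h (fst z) + c) = sig2 + ip h h"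
      unfolding v(2) by (rule v(4))
    moreover have "0 \<le> sig2 + ip h h" using sig0 by (simp add: ip_self_nonneg)
    ultimately show ?thesis unfolding Z_law using char_normal_law by simp
  qed
  obtain \<gamma> where \<gamma>: "\<gamma> \<in> \<C>" using curves by (auto simp: admissible_curves_def)
  have S_meas [measurable]: "S n \<in> borel_measurable (PiM {..<n} (\<lambda>_. MX))" for n
    using est by (auto simp: is_estimator_def)
  have weak: "weakly_tends (\<lambda>n. distr P0 borel (\<lambda>zs. (T n zs, emp_process F0 n (\<lambda>z. residual u ubar F0 z + h (fst z)) zs)))
      (distr Q borel (\<lambda>y. (fst y, Z (\<lambda>z. residual u ubar F0 z + h (fst z)) y))) sequentially"
    if h: "h \<in> tangent_space MX F0 \<C>" for h
  proof (rule weakly_tends_pair[OF P0.prob_space_axioms _ _ Q indep])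
    have h0: "h \<in> L20" using h tangent_L20 by blast
    note [measurable] = L20D(1)[OF h0]
    define W where "W n zs = (\<Sum>j<n. residual u ubar F0 (zs j)) / sqrt (real n)" for n zs
    have [measurable]: "(\<lambda>zs. residual u ubar F0 (zs j)) \<in> borel_measurable P0" for j
      by (intro measurable_iid_component residual_meas F0)
    have W_meas [measurable]: "W n \<in> borel_measurable P0" for n unfolding W_def[abs_def] by measurable
    note ep = emp_process_eq[OF h0, folded W_def]
    show "T n \<in> borel_measurable P0" for n by measurable
    show "emp_process F0 n (\<lambda>z. residual u ubar F0 z + h (fst z)) \<in> borel_measurable P0" for n
      unfolding ep[abs_def] by measurable
    fix s r
    define k where "k = (\<lambda>x. - s * \<phi>0 x + r * h x)"
    note k_tan[OF h, of s r, folded k_def]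
    then have k0: "k \<in> L20" using tangent_L20 by blast
    \<comment> \<open>\<open>stat\<close> and \<open>fluct\<close> depend on the observations only,
      so their joint character is a bounded function of the kind to which
      \<open>residual_CLT\<close> applies.\<close>
    define G where "G n x = iexp (s * ((S n x - (\<Sum>j<n. ubar (x j) F0)) / sqrt (real n)) + (\<Sum>j<n. k (x j)) / sqrt (real n))" for n x
    have G: "G n \<in> borel_measurable (PiM {..<n} (\<lambda>_. MX))" for n
      using ubar_meas[OF F0] L20D(1)[OF k0] unfolding G_def by measurable
    have G1: "norm (G n x) \<le> 1" for n x by (simp add: G_def del: of_real_add of_real_mult of_real_divide of_real_diff)
    have G_obs: "G n (observed n zs) = iexp (s * T n zs + r * fluct n h zs)" for n zs
    proof -
      have "s * ((S n (observed n zs) - (\<Sum>j<n. ubar (observed n zs j) F0)) / sqrt (real n)) + (\<Sum>j<n. k (observed n zs j)) / sqrt (real n) =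
          s * stat S n zs + fluct n k zs" by (simp add: stat_def fluct_def observed_def)
      also have "\<dots> = s * T n zs + r * fluct n h zs"
        unfolding k_def fluct_lincomb T_def by (simp add: algebra_simps)
      finally show ?thesis unfolding G_def by (rule arg_cong)
    qed
    define E where "E = complex_of_real (exp (- (r^2 * sig2) / 2))"
    have "(\<lambda>n. (LINT zs|P0. iexp (s * T n zs + r * fluct n h zs) * iexp (r * W n zs)) - E * (LINT zs|P0. iexp (s * T n zs + r * fluct n h zs))) \<longlonglongrightarrow> 0"
      using residual_CLT[OF \<gamma>, of "\<lambda>_. 0", OF _ _ G G1, of r] unfolding G_obs curveD(1)[OF \<gamma>] W_def E_def by simp
    from tendsto_add[OF this tendsto_mult[OF tendsto_const joint[OF h, of s r], of E]]
    have lim: "(\<lambda>n. LINT zs|P0. iexp (s * T n zs + r * fluct n h zs) * iexp (r * W n zs)) \<longlonglongrightarrow> E * (L s * of_real (exp (s^2 * K / 2 - r\<^sup>2 * ip h h / 2)))"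
      by simp
    have val: "E * (L s * of_real (exp (s^2 * K / 2 - r\<^sup>2 * ip h h / 2))) =
        char (distr Q borel fst) s * char (distr Q borel (Z (\<lambda>z. residual u ubar F0 z + h (fst z)))) r"
    proof -
      have "exp (- (r^2 * sig2) / 2) * exp (s^2 * K / 2 - r\<^sup>2 * ip h h / 2) = exp (s^2 * K / 2) * exp (- (r^2 * (sig2 + ip h h)) / 2)"
        by (simp add: algebra_simps add_divide_distrib diff_divide_distrib flip: exp_add)
      then have "complex_of_real (exp (- (r^2 * sig2) / 2)) * of_real (exp (s^2 * K / 2 - r\<^sup>2 * ip h h / 2)) =
          of_real (exp (s^2 * K / 2)) * of_real (exp (- (r^2 * (sig2 + ip h h)) / 2))" unfolding of_real_mult[symmetric] by (rule arg_cong)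
      then show ?thesis using char_Z[OF h0, of 0 r] by (simp only: dfst char_\<alpha> E_def add_0_right mult_ac)
    qed
    have arg: "iexp (s * T n zs + r * emp_process F0 n (\<lambda>z. residual u ubar F0 z + h (fst z)) zs) =
        iexp (s * T n zs + r * fluct n h zs) * iexp (r * W n zs)" for n zs
    proof -
      have "s * T n zs + r * emp_process F0 n (\<lambda>z. residual u ubar F0 z + h (fst z)) zs = (s * T n zs + r * fluct n h zs) + r * W n zs"
        unfolding ep by (simp add: algebra_simps)
      then show ?thesis by (simp only: distrib_left[of \<i>] of_real_add[of "s * T n zs + r * fluct n h zs"] exp_add)
    qed
    show "(\<lambda>n. LINT zs|P0. iexp (s * T n zs + r * emp_process F0 n (\<lambda>z. residual u ubar F0 z + h (fst z)) zs))
        \<longlonglongrightarrow> char (distr Q borel fst) s * char (distr Q borel (Z (\<lambda>z. residual u ubar F0 z + h (fst z)))) r"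
      unfolding arg val[symmetric] by (rule lim)
  qed
  define gs where "gs = (\<lambda>z. ubar (fst z) F0 - mean_utility u F0 + \<phi>0 (fst z) - util u F0 z)"
  have gs_eq: "gs = (\<lambda>z. residual u ubar F0 z + \<phi>0 (fst z) + (- mean_utility u F0))"
    by (auto simp: gs_def residual_def util_def)
  have "distr \<Omega> borel \<xi> = distr Q borel (\<lambda>y. fst y + Z gs y)"
  proof (rule Levy_uniqueness)
    show "real_distribution (distr \<Omega> borel \<xi>)" by (rule \<Omega>.real_distribution_distr) fact
    show "real_distribution (distr Q borel (\<lambda>y. fst y + Z gs y))" by (rule Q.real_distribution_distr) measurable
    show "char (distr \<Omega> borel \<xi>) = char (distr Q borel (\<lambda>y. fst y + Z gs y))"
    proof
      fix s
      \<comment> \<open>The factors by which \<open>\<Lambda>\<close> and then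
        \<open>\<alpha>\<close> differ from the characteristic function of \<open>\<xi>\<close> are
        undone by the Gaussian factor of \<open>Z gs\<close>.\<close>
      have "exp (s^2 * sig2 / 2) * (exp (s^2 * K / 2) * exp (- (s^2 * (sig2 + K)) / 2)) = 1"
        by (simp add: algebra_simps add_divide_distrib diff_divide_distrib flip: exp_add)
      then have one: "of_real (exp (s^2 * sig2 / 2)) * (of_real (exp (s^2 * K / 2)) * of_real (exp (- (s^2 * (sig2 + K)) / 2))) = (1::complex)"
        unfolding of_real_mult[symmetric] by simp
      have "char (distr Q borel (\<lambda>y. fst y + Z gs y)) s = char \<alpha> s * char (distr Q borel (Z gs)) s"
        unfolding Q.char_distr_add[OF indep] dfst ..
      also have "\<dots> = char (distr \<Omega> borel \<xi>) s * (of_real (exp (s^2 * sig2 / 2)) * (of_real (exp (s^2 * K / 2)) * of_real (exp (- (s^2 * (sig2 + K)) / 2))))"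
        unfolding gs_eq char_Z[OF p0] char_\<alpha> L_def \<Lambda>_def K_def by (simp only: mult.assoc)
      finally show "char (distr \<Omega> borel \<xi>) s = char (distr Q borel (\<lambda>y. fst y + Z gs y)) s" unfolding one by simp
    qed
  qed
  also have "\<dots> = (distr Q borel fst \<star> distr Q borel (Z gs))"
    by (rule Q.sum_indep_random_variable[OF indep]) measurable
  also have "\<dots> = (distr Q borel (Z gs) \<star> distr Q borel fst)"
    by (rule convolution_commutative) (auto intro!: Q.finite_measure_distr)
  finally have conv: "distr \<Omega> borel \<xi> = (distr Q borel (Z gs) \<star> distr Q borel fst)" .
  show ?thesis
  proof (intro exI[of _ Q] exI[of _ fst] exI[of _ Z] conjI ballI Q)
    show "fst \<in> borel_measurable Q" by measurable
    show "Z g \<in> borel_measurable Q" "distr Q borel (Z g) = normal_law 0 (prob_space.variance F0 g)" for g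
      by (rule Z_meas, rule Z_law)
    fix h assume "h \<in> tangent_space MX F0 \<C>"
    from weak[OF this] indep show "let g = (\<lambda>z. ubar (fst z) F0 + h (fst z) - util u F0 z) in
        weakly_tends (\<lambda>n. distr P0 borel (\<lambda>zs. (stat S n zs - fluct n \<phi>0 zs, emp_process F0 n g zs)))
          (distr Q borel (\<lambda>y. (fst y, Z g y))) sequentially \<and> Q.indep_var borel fst borel (Z g)"
      unfolding Let_def g_eq T_def by blast
  qed (use conv in \<open>simp add: gs_def\<close>)
qed

end

section \<open>The efficient influence function\<close>

lemma power2_sum_le: "(x + y)^2 \<le> 2 * x^2 + 2 * y^2" for x y :: real
  using zero_le_power2[of "x - y"] by (simp add: power2_eq_square algebra_simps)

text \<open>On the complement A of the null set, N has density f, so \<open>f dM\<close> is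
  \<open>1_A dN\<close>. The contribution of N outside A is controlled by the Cauchy-Schwarz
  inequality through its mass \<open>1 - \<integral> f\<close>; along a curve this mass is o(t^2),
  which makes the contribution o(t) when the second moments stay bounded.\<close>

lemma ac_part_integral:
  fixes v :: "'a \<Rightarrow> real"
  assumes N: "prob_space N" and sets: "sets N = sets M" and ac: "is_ac_part_deriv M N f"
    and v: "v \<in> borel_measurable M" "integrable N (\<lambda>x. (v x)^2)"
  shows "integrable M f" "(LINT x|M. f x) \<le> 1"
    and "integrable M (\<lambda>x. f x * (v x)^2)" "(LINT x|M. f x * (v x)^2) \<le> (LINT x|N. (v x)^2)"
    and "integrable M (\<lambda>x. f x * v x)"
    and "\<bar>(LINT x|N. v x) - (LINT x|M. f x * v x)\<bar> \<le> sqrt (LINT x|N. (v x)^2) * sqrt (1 - (LINT x|M. f x))"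
proof -
  interpret N: prob_space N by fact
  note sets[measurable_cong]
  obtain S where S: "S \<in> null_sets M" "density N (indicator (space M - S)) = density M (\<lambda>x. ennreal (f x))"
    and f [measurable]: "f \<in> borel_measurable M" and f0: "\<And>x. x \<in> space M \<Longrightarrow> 0 \<le> f x"
    using ac by (auto simp: is_ac_part_deriv_def)
  define A where "A = space M - S"
  have [measurable]: "A \<in> sets M" using S(1) by (auto simp: A_def)
  have fAE: "AE x in M. 0 \<le> f x" using f0 by (intro AE_I2) auto
  have dens: "density N (\<lambda>x. ennreal (indicat_real A x)) = density M (\<lambda>x. ennreal (f x))"
    using S(2) by (simp add: A_def ennreal_indicator)
  have key: "integrable M (\<lambda>x. f x * g x) \<longleftrightarrow> integrable N (\<lambda>x. indicat_real A x * g x)"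
    "(LINT x|M. f x * g x) = (LINT x|N. indicat_real A x * g x)" if [measurable]: "g \<in> borel_measurable M" for g
    using integrable_real_density[of f M g] integrable_real_density[of "indicat_real A" N g]
      integral_real_density[of f M g] integral_real_density[of "indicat_real A" N g] fAE
    by (simp_all add: dens)
  note [measurable] = v(1)
  have vi: "integrable N v" using integrable_mult_square[of "\<lambda>_. 1::real" N v] v(2) by simp
  have bd: "integrable N (\<lambda>x. indicat_real A x * g x)" if "integrable N g" for g
    using integrable_mult_indicator[OF _ that, of A] by (simp add: sets)
  have iA: "integrable N (indicat_real A)" by (rule N.integrable_bounded[where B=1]) (auto simp: indicator_def)
  show "integrable M f" using key(1)[of "\<lambda>_. 1"] iA by simp
  have mass: "(LINT x|M. f x) = (LINT x|N. indicat_real A x)" using key(2)[of "\<lambda>_. 1"] by simp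
  have "(LINT x|N. indicat_real A x) \<le> (LINT x|N. 1)"
    by (intro integral_mono iA) (auto simp: indicator_def)
  then show "(LINT x|M. f x) \<le> 1" unfolding mass by (simp add: N.prob_space)
  show "integrable M (\<lambda>x. f x * (v x)^2)" "integrable M (\<lambda>x. f x * v x)"
    using bd[OF v(2)] bd[OF vi] by (simp_all add: key(1))
  have "(LINT x|N. indicat_real A x * (v x)^2) \<le> (LINT x|N. (v x)^2)"
    by (intro integral_mono bd v(2)) (auto simp: indicator_def)
  then show "(LINT x|M. f x * (v x)^2) \<le> (LINT x|N. (v x)^2)" by (simp add: key(2))
  have iC: "integrable N (\<lambda>x. (1 - indicat_real A x)^2)" by (rule N.integrable_bounded[where B=1]) (auto simp: indicator_def)
  have eC: "(LINT x|N. (1 - indicat_real A x)^2) = 1 - (LINT x|M. f x)"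
  proof -
    have "(1 - indicat_real A x)^2 = 1 - indicat_real A x" for x by (auto simp: indicator_def)
    then show ?thesis unfolding mass using iA by (simp add: N.prob_space)
  qed
  have "(LINT x|N. v x) - (LINT x|M. f x * v x) = (LINT x|N. v x * (1 - indicat_real A x))"
    using vi bd[OF vi] by (simp add: key(2) right_diff_distrib mult.commute)
  moreover have "(LINT x|N. v x * (1 - indicat_real A x))^2 \<le> (LINT x|N. (v x)^2) * (1 - (LINT x|M. f x))"
    using integral_Cauchy_Schwarz[of v N "\<lambda>x. 1 - indicat_real A x"] v(2) iC by (simp add: eC)
  ultimately show "\<bar>(LINT x|N. v x) - (LINT x|M. f x * v x)\<bar> \<le> sqrt (LINT x|N. (v x)^2) * sqrt (1 - (LINT x|M. f x))"
    unfolding real_sqrt_mult[symmetric] by (intro real_le_rsqrt) simp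
qed

text \<open>
  With \<open>R = sqrt f - 1 - t \<rho> / 2\<close> the second summand of
  \<open>\<integral>v dN - \<integral>v0 dM = \<integral>(v - v0) dM + \<integral>v (f - 1) dM + (singular part)\<close> is evaluated through
  \<open>f - 1 = (sqrt f + 1) (t \<rho> / 2 + R)\<close>.
\<close>

lemma mean_shift_estimate:
  fixes v v0 \<rho> :: "'a \<Rightarrow> real" and t :: real
  assumes M: "prob_space M" and N: "prob_space N" and sets: "sets N = sets M" and ac: "is_ac_part_deriv M N f"
    and v: "v \<in> borel_measurable M" "integrable N (\<lambda>x. (v x)^2)" "(LINT x|N. (v x)^2) \<le> B"
    and v0: "v0 \<in> borel_measurable M" "integrable M (\<lambda>x. (v0 x)^2)"
    and D: "integrable M (\<lambda>x. (v x - v0 x)^2)" "(LINT x|M. (v x - v0 x)^2) \<le> 1"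
    and \<rho>: "\<rho> \<in> borel_measurable M" "integrable M (\<lambda>x. (\<rho> x)^2)"
  defines "Y \<equiv> \<lambda>x. v x * (sqrt (f x) + 1) - 2 * v0 x"
    and "a \<equiv> LINT x|M. (v0 x)^2" and "r \<equiv> LINT x|M. (sqrt (f x) - 1 - t * \<rho> x / 2)^2"
  shows "Y \<in> borel_measurable M" "integrable M (\<lambda>x. (Y x)^2)" "(LINT x|M. (Y x)^2) \<le> 4 * B + 16 * a + 8"
    and "(LINT x|M. \<bar>Y x\<bar>) \<le> 2 * sqrt (LINT x|M. (v x - v0 x)^2) + sqrt a * sqrt (2 * r + t^2 / 2 * (LINT x|M. (\<rho> x)^2))"
    and "\<bar>(LINT x|N. v x) - (LINT x|M. v0 x) - (LINT x|M. v x - v0 x) - t * ((LINT x|M. v0 x * \<rho> x) + (LINT x|M. Y x * \<rho> x) / 2)\<bar>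
      \<le> sqrt B * sqrt (1 - (LINT x|M. f x)) + sqrt (2 * B + 4 * a + 4) * sqrt r"
proof -
  interpret M: prob_space M by fact
  note acf = ac_part_integral[OF N sets ac v(1,2)]
  have f [measurable]: "f \<in> borel_measurable M" and f0: "\<And>x. x \<in> space M \<Longrightarrow> 0 \<le> f x"
    using ac by (auto simp: is_ac_part_deriv_def)
  note [measurable] = v(1) v0(1) \<rho>(1)
  define R where "R x = sqrt (f x) - 1 - t * \<rho> x / 2" for x
  define Z where "Z x = v x * (sqrt (f x) + 1)" for x
  have [measurable]: "R \<in> borel_measurable M" "Z \<in> borel_measurable M" unfolding R_def Z_def by measurable
  show Y_meas [measurable]: "Y \<in> borel_measurable M" unfolding Y_def by measurable
  have i1: "integrable M (\<lambda>x. (1::real)^2)" by simp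
  have sf2: "integrable M (\<lambda>x. (sqrt (f x))^2)" "(LINT x|M. (sqrt (f x))^2) \<le> 1"
    using acf(1,2) f0 by (simp_all cong: Bochner_Integration.integrable_cong Bochner_Integration.integral_cong)
  have sq: "integrable M (\<lambda>x. (c * g x + d * h x)^2)" "(LINT x|M. (g x + h x)^2) \<le> 2 * (LINT x|M. (g x)^2) + 2 * (LINT x|M. (h x)^2)"
    if [measurable]: "g \<in> borel_measurable M" "h \<in> borel_measurable M" and i: "integrable M (\<lambda>x. (g x)^2)" "integrable M (\<lambda>x. (h x)^2)" for g h :: "'a \<Rightarrow> real" and c d
  proof -
    have b: "norm ((c * g x + d * h x)^2) \<le> norm (2 * c^2 * (g x)^2 + 2 * d^2 * (h x)^2)" for c d x
      using power2_sum_le[of "c * g x" "d * h x"] by (simp add: power_mult_distrib)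
    have j: "integrable M (\<lambda>x. (c * g x + d * h x)^2)" for c d
      by (rule Bochner_Integration.integrable_bound[OF _ _ AE_I2[OF b]]) (use i in simp_all)
    show "integrable M (\<lambda>x. (c * g x + d * h x)^2)" by (rule j)
    have "(LINT x|M. (g x + h x)^2) \<le> (LINT x|M. 2 * (g x)^2 + 2 * (h x)^2)"
      using i j[of 1 1] by (intro integral_mono power2_sum_le) simp_all
    then show "(LINT x|M. (g x + h x)^2) \<le> 2 * (LINT x|M. (g x)^2) + 2 * (LINT x|M. (h x)^2)" using i by simp
  qed
  have v2: "integrable M (\<lambda>x. (v x)^2)" "(LINT x|M. (v x)^2) \<le> 2 * a + 2"
  proof -
    have e: "v x = 1 * v0 x + 1 * (v x - v0 x)" "v x = v0 x + (v x - v0 x)" for x by simp_all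
    show "integrable M (\<lambda>x. (v x)^2)" by (subst e(1)) (intro sq v0 D(1); measurable)
    have "(LINT x|M. (v x)^2) \<le> 2 * a + 2 * (LINT x|M. (v x - v0 x)^2)"
      unfolding a_def by (subst (1) e(2)) (intro sq v0 D(1); measurable)
    then show "(LINT x|M. (v x)^2) \<le> 2 * a + 2" using D(2) by linarith
  qed
  have vf2: "integrable M (\<lambda>x. (v x * sqrt (f x))^2)" "(LINT x|M. (v x * sqrt (f x))^2) \<le> B"
  proof -
    have e: "(v x * sqrt (f x))^2 = f x * (v x)^2" if "x \<in> space M" for x using f0[OF that] by (simp add: power_mult_distrib)
    show "integrable M (\<lambda>x. (v x * sqrt (f x))^2)" "(LINT x|M. (v x * sqrt (f x))^2) \<le> B"
      using acf(3,4) v(3) e by (simp_all cong: Bochner_Integration.integrable_cong Bochner_Integration.integral_cong)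
  qed
  have Z2: "integrable M (\<lambda>x. (Z x)^2)" "(LINT x|M. (Z x)^2) \<le> 2 * B + 4 * a + 4"
  proof -
    have e: "Z x = 1 * (v x * sqrt (f x)) + 1 * v x" "Z x = v x * sqrt (f x) + v x" for x by (simp_all add: Z_def distrib_left)
    show "integrable M (\<lambda>x. (Z x)^2)" unfolding e(1) by (intro sq vf2 v2; measurable)
    have "(LINT x|M. (Z x)^2) \<le> 2 * (LINT x|M. (v x * sqrt (f x))^2) + 2 * (LINT x|M. (v x)^2)"
      unfolding e(2) by (intro sq vf2 v2; measurable)
    then show "(LINT x|M. (Z x)^2) \<le> 2 * B + 4 * a + 4" using vf2(2) v2(2) by linarith
  qed
  show Y2: "integrable M (\<lambda>x. (Y x)^2)" "(LINT x|M. (Y x)^2) \<le> 4 * B + 16 * a + 8"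
  proof -
    have e: "Y x = 1 * Z x + (- 2) * v0 x" "Y x = Z x + (- 2) * v0 x" for x by (simp_all add: Y_def Z_def)
    have m: "integrable M (\<lambda>x. ((- 2) * v0 x)^2)" "(LINT x|M. ((- 2) * v0 x)^2) = 4 * a"
      using v0(2) by (simp_all add: power_mult_distrib a_def)
    show "integrable M (\<lambda>x. (Y x)^2)" unfolding e(1) by (intro sq Z2 v0; measurable)
    have "(LINT x|M. (Y x)^2) \<le> 2 * (LINT x|M. (Z x)^2) + 2 * (LINT x|M. ((- 2) * v0 x)^2)"
      unfolding e(2) by (intro sq Z2 m; measurable)
    then show "(LINT x|M. (Y x)^2) \<le> 4 * B + 16 * a + 8" using Z2(2) m(2) by linarith
  qed
  have p2: "integrable M (\<lambda>x. (sqrt (f x) + 1)^2)" "(LINT x|M. (sqrt (f x) + 1)^2) \<le> 4"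
  proof -
    show "integrable M (\<lambda>x. (sqrt (f x) + 1)^2)"
      using sq(1)[of "\<lambda>x. sqrt (f x)" "\<lambda>_. 1" 1 1] sf2(1) by simp
    have "(LINT x|M. (sqrt (f x) + 1)^2) \<le> 2 * (LINT x|M. (sqrt (f x))^2) + 2 * (LINT x|M. (1::real)^2)"
      by (intro sq sf2 i1; measurable)
    then show "(LINT x|M. (sqrt (f x) + 1)^2) \<le> 4" using sf2(2) by (simp add: M.prob_space)
  qed
  have m2: "integrable M (\<lambda>x. (sqrt (f x) - 1)^2)"
    using sq(1)[of "\<lambda>x. sqrt (f x)" "\<lambda>_. 1" 1 "- 1"] sf2(1) by simp
  have t\<rho>: "integrable M (\<lambda>x. (t * \<rho> x / 2)^2)" "(LINT x|M. (t * \<rho> x / 2)^2) = t^2 / 4 * (LINT x|M. (\<rho> x)^2)"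
    using \<rho>(2) by (simp_all add: power_mult_distrib power_divide)
  have R2: "integrable M (\<lambda>x. (R x)^2)"
  proof -
    have e: "R x = 1 * (sqrt (f x) - 1) + (- 1) * (t * \<rho> x / 2)" for x by (simp add: R_def)
    show ?thesis unfolding e by (intro sq m2 t\<rho>(1); measurable)
  qed
  have m2': "(LINT x|M. (sqrt (f x) - 1)^2) \<le> 2 * r + t^2 / 2 * (LINT x|M. (\<rho> x)^2)"
  proof -
    have e: "sqrt (f x) - 1 = R x + t * \<rho> x / 2" for x by (simp add: R_def)
    have "(LINT x|M. (R x + t * \<rho> x / 2)^2) \<le> 2 * (LINT x|M. (R x)^2) + 2 * (LINT x|M. (t * \<rho> x / 2)^2)"
      by (intro sq R2 t\<rho>(1); measurable)
    then show ?thesis unfolding e r_def R_def[symmetric] t\<rho>(2) by simp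
  qed
  note nm = integral_norm_mult_le[where 'b=real, unfolded real_norm_def power2_abs]
  have a1: "integrable M (\<lambda>x. \<bar>(v x - v0 x) * (sqrt (f x) + 1)\<bar>)" "integrable M (\<lambda>x. \<bar>v0 x * (sqrt (f x) - 1)\<bar>)"
    using integrable_mult_square[of "\<lambda>x. v x - v0 x" M "\<lambda>x. sqrt (f x) + 1"] integrable_mult_square[of v0 M "\<lambda>x. sqrt (f x) - 1"] D(1) p2(1) v0(2) m2
    by (intro integrable_abs; simp)+
  have Yi: "integrable M Y" using integrable_mult_square[of "\<lambda>_. 1::real" M Y] Y2(1) by simp
  have "(LINT x|M. \<bar>Y x\<bar>) \<le> (LINT x|M. \<bar>(v x - v0 x) * (sqrt (f x) + 1)\<bar> + \<bar>v0 x * (sqrt (f x) - 1)\<bar>)"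
  proof (intro integral_mono)
    fix x
    \<comment> \<open>\<open>Y\<close> is the deviation of \<open>v (sqrt f + 1)\<close> from
      \<open>2 v0\<close>; along a curve, each summand has one factor that is small in L2.\<close>
    have "Y x = (v x - v0 x) * (sqrt (f x) + 1) + v0 x * (sqrt (f x) - 1)" by (simp add: Y_def algebra_simps)
    then show "\<bar>Y x\<bar> \<le> \<bar>(v x - v0 x) * (sqrt (f x) + 1)\<bar> + \<bar>v0 x * (sqrt (f x) - 1)\<bar>" by (simp only: abs_triangle_ineq)
  qed (use Yi a1 in auto)
  also have "\<dots> = (LINT x|M. \<bar>(v x - v0 x) * (sqrt (f x) + 1)\<bar>) + (LINT x|M. \<bar>v0 x * (sqrt (f x) - 1)\<bar>)"
    by (rule Bochner_Integration.integral_add[OF a1])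
  also have "(LINT x|M. \<bar>(v x - v0 x) * (sqrt (f x) + 1)\<bar>) \<le> sqrt (LINT x|M. (v x - v0 x)^2) * sqrt (LINT x|M. (sqrt (f x) + 1)^2)"
    using D(1) p2(1) by (intro nm) simp_all
  also have "\<dots> \<le> sqrt (LINT x|M. (v x - v0 x)^2) * 2"
    using p2(2) by (intro mult_left_mono) (auto intro!: real_le_lsqrt)
  also have "(LINT x|M. \<bar>v0 x * (sqrt (f x) - 1)\<bar>) \<le> sqrt a * sqrt (LINT x|M. (sqrt (f x) - 1)^2)"
    unfolding a_def using v0(2) m2 by (intro nm) simp_all
  also have "\<dots> \<le> sqrt a * sqrt (2 * r + t^2 / 2 * (LINT x|M. (\<rho> x)^2))"
    using m2' by (intro mult_left_mono) (auto simp: a_def)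
  finally show "(LINT x|M. \<bar>Y x\<bar>) \<le> 2 * sqrt (LINT x|M. (v x - v0 x)^2) + sqrt a * sqrt (2 * r + t^2 / 2 * (LINT x|M. (\<rho> x)^2))"
    by simp
  have L1: "integrable M v" "integrable M v0"
    using integrable_mult_square[of "\<lambda>_. 1::real" M v] integrable_mult_square[of "\<lambda>_. 1::real" M v0] v2(1) v0(2) by simp_all
  have Y\<rho>: "integrable M (\<lambda>x. Y x * \<rho> x)" and v0\<rho>: "integrable M (\<lambda>x. v0 x * \<rho> x)" and ZR: "integrable M (\<lambda>x. Z x * R x)"
    using integrable_mult_square[of Y M \<rho>] integrable_mult_square[of v0 M \<rho>] integrable_mult_square[of Z M R] Y2(1) v0(2) \<rho>(2) Z2(1) R2 by simp_all
  \<comment> \<open>From \<open>f - 1 = (sqrt f + 1) (sqrt f - 1)\<close>; in the part linear in t,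
    \<open>v (sqrt f + 1)\<close> is written as \<open>2 v0 + Y\<close>.\<close>
  have "(LINT x|M. f x * v x) = (LINT x|M. v x + (t * (v0 x * \<rho> x) + t / 2 * (Y x * \<rho> x)) + Z x * R x)"
  proof (rule Bochner_Integration.integral_cong[OF refl])
    fix x assume x: "x \<in> space M"
    have "f x * v x = v x + v x * ((sqrt (f x) + 1) * (sqrt (f x) - 1))"
      using f0[OF x] by (simp add: algebra_simps)
    also have "sqrt (f x) - 1 = t * \<rho> x / 2 + R x" by (simp add: R_def)
    finally show "f x * v x = v x + (t * (v0 x * \<rho> x) + t / 2 * (Y x * \<rho> x)) + Z x * R x"
      by (simp add: Y_def Z_def field_simps)
  qed
  also have "\<dots> = (LINT x|M. v x) + (t * (LINT x|M. v0 x * \<rho> x) + t / 2 * (LINT x|M. Y x * \<rho> x)) + (LINT x|M. Z x * R x)"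
    using L1 Y\<rho> v0\<rho> ZR by simp
  finally have fv: "(LINT x|M. f x * v x) = (LINT x|M. v x) + t * ((LINT x|M. v0 x * \<rho> x) + (LINT x|M. Y x * \<rho> x) / 2) + (LINT x|M. Z x * R x)"
    by (simp add: distrib_left)
  have "\<bar>\<integral>x. Z x * R x \<partial>M\<bar> \<le> (LINT x|M. \<bar>Z x * R x\<bar>)" by (rule integral_abs_bound)
  also have "\<dots> \<le> sqrt (LINT x|M. (Z x)^2) * sqrt (LINT x|M. (R x)^2)" using Z2(1) R2 by (intro nm) simp_all
  also have "\<dots> \<le> sqrt (2 * B + 4 * a + 4) * sqrt r"
    unfolding r_def R_def[symmetric] using Z2(2) by (intro mult_right_mono) auto
  finally have e2: "\<bar>\<integral>x. Z x * R x \<partial>M\<bar> \<le> sqrt (2 * B + 4 * a + 4) * sqrt r" .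
  have "sqrt (LINT x|N. (v x)^2) * sqrt (1 - (LINT x|M. f x)) \<le> sqrt B * sqrt (1 - (LINT x|M. f x))"
    using v(3) acf(2) by (intro mult_right_mono) auto
  with acf(6) have e1: "\<bar>(LINT x|N. v x) - (LINT x|M. f x * v x)\<bar> \<le> sqrt B * sqrt (1 - (LINT x|M. f x))" by linarith
  have "(LINT x|N. v x) - (LINT x|M. v0 x) - (LINT x|M. v x - v0 x) - t * ((LINT x|M. v0 x * \<rho> x) + (LINT x|M. Y x * \<rho> x) / 2) =
      ((LINT x|N. v x) - (LINT x|M. f x * v x)) + (LINT x|M. Z x * R x)"
    unfolding fv Bochner_Integration.integral_diff[OF L1] by simp
  with e1 e2 show "\<bar>(LINT x|N. v x) - (LINT x|M. v0 x) - (LINT x|M. v x - v0 x) - t * ((LINT x|M. v0 x * \<rho> x) + (LINT x|M. Y x * \<rho> x) / 2)\<bar>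
      \<le> sqrt B * sqrt (1 - (LINT x|M. f x)) + sqrt (2 * B + 4 * a + 4) * sqrt r" by linarith
qed

text \<open>Boundedness in L2 and convergence to 0 in L1 imply weak convergence to 0 in L2: with
  \<open>\<rho>\<close> truncated, the L1 limit handles the bounded part and the Cauchy-Schwarz
  inequality the rest.\<close>

lemma integral_mult_tendsto_0_if_bounded_L2:
  fixes Y :: "real \<Rightarrow> 'a \<Rightarrow> real" and \<rho> :: "'a \<Rightarrow> real"
  assumes \<rho>: "\<rho> \<in> borel_measurable M" "integrable M (\<lambda>x. (\<rho> x)^2)" and fin: "finite_measure M"
    and Y: "\<forall>\<^sub>F t in F. Y t \<in> borel_measurable M \<and> integrable M (\<lambda>x. (Y t x)^2) \<and> (LINT x|M. (Y t x)^2) \<le> C"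
    and lim: "((\<lambda>t. LINT x|M. \<bar>Y t x\<bar>) \<longlongrightarrow> 0) F"
  shows "((\<lambda>t. LINT x|M. Y t x * \<rho> x) \<longlongrightarrow> 0) F"
  unfolding tendsto_iff dist_norm diff_zero
proof (intro allI impI)
  fix e :: real assume "e > 0"
  interpret finite_measure M by fact
  note [measurable] = \<rho>(1)
  define k where "k i x = max (- real i) (min (real i) (\<rho> x))" for i x
  have [measurable]: "k i \<in> borel_measurable M" for i unfolding k_def by measurable
  have kd: "\<bar>\<rho> x - k i x\<bar> \<le> \<bar>\<rho> x\<bar>" and kb: "\<bar>k i x\<bar> \<le> real i" for i x by (auto simp: k_def)
  have kd2: "norm ((\<rho> x - k i x)^2) \<le> (\<rho> x)^2" for i x
  proof -
    have "\<bar>\<rho> x - k i x\<bar>\<^sup>2 \<le> \<bar>\<rho> x\<bar>\<^sup>2" by (intro power_mono kd) simp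
    then show ?thesis unfolding power2_abs by simp
  qed
  have k_int: "integrable M (\<lambda>x. (\<rho> x - k i x)^2)" for i
    by (rule Bochner_Integration.integrable_bound[OF \<rho>(2)]) (use kd2 in auto)
  have "(\<lambda>i. LINT x|M. (\<rho> x - k i x)^2) \<longlonglongrightarrow> (LINT x|M. 0)"
  proof (rule integral_dominated_convergence[where w="\<lambda>x. (\<rho> x)^2"])
    show "AE x in M. (\<lambda>i. (\<rho> x - k i x)^2) \<longlonglongrightarrow> 0"
    proof (intro AE_I2 tendsto_eventually)
      fix x
      show "\<forall>\<^sub>F i in sequentially. (\<rho> x - k i x)^2 = 0" using eventually_ge_at_top[of "nat \<lceil>\<bar>\<rho> x\<bar>\<rceil>"]
      proof eventually_elim
        case (elim i)
        then have "\<bar>\<rho> x\<bar> \<le> real i" by linarith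
        then show ?case by (auto simp: k_def)
      qed
    qed
  qed (use kd2 \<rho>(2) in auto)
  then have "(\<lambda>i. sqrt C * sqrt (LINT x|M. (\<rho> x - k i x)^2)) \<longlonglongrightarrow> sqrt C * sqrt 0" by (intro tendsto_intros) simp
  then have "\<forall>\<^sub>F i in sequentially. sqrt C * sqrt (LINT x|M. (\<rho> x - k i x)^2) < e / 2"
    using \<open>e > 0\<close> by (intro order_tendstoD) auto
  then obtain i where i: "sqrt C * sqrt (LINT x|M. (\<rho> x - k i x)^2) < e / 2"
    using eventually_happens'[OF sequentially_bot] by blast
  have "((\<lambda>t. real i * (LINT x|M. \<bar>Y t x\<bar>)) \<longlongrightarrow> real i * 0) F" by (intro tendsto_intros lim)
  then have "\<forall>\<^sub>F t in F. real i * (LINT x|M. \<bar>Y t x\<bar>) < e / 2" using \<open>e > 0\<close> by (intro order_tendstoD) auto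
  with Y show "\<forall>\<^sub>F t in F. norm (LINT x|M. Y t x * \<rho> x) < e"
  proof eventually_elim
    case (elim t)
    then have m [measurable]: "Y t \<in> borel_measurable M" and Y2: "integrable M (\<lambda>x. (Y t x)^2)" "(LINT x|M. (Y t x)^2) \<le> C" by auto
    have Yi: "integrable M (Y t)" using integrable_mult_square[of "\<lambda>_. 1::real" M "Y t"] Y2(1) by simp
    have p1: "integrable M (\<lambda>x. \<bar>Y t x * (\<rho> x - k i x)\<bar>)"
      using integrable_mult_square[of "Y t" M "\<lambda>x. \<rho> x - k i x"] Y2(1) k_int by (intro integrable_abs) simp
    have p3: "integrable M (\<lambda>x. Y t x * \<rho> x)"
      using integrable_mult_square[of "Y t" M \<rho>] Y2(1) \<rho> by simp
    have p2: "integrable M (\<lambda>x. real i * \<bar>Y t x\<bar>)" using Yi by simp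
    have "norm (LINT x|M. Y t x * \<rho> x) \<le> (LINT x|M. norm (Y t x * \<rho> x))" by (rule integral_norm_bound)
    also have "\<dots> \<le> (LINT x|M. \<bar>Y t x * (\<rho> x - k i x)\<bar> + real i * \<bar>Y t x\<bar>)"
    proof (intro integral_mono)
      fix x
      have "Y t x * \<rho> x = Y t x * (\<rho> x - k i x) + Y t x * k i x" by (simp add: algebra_simps)
      then have "norm (Y t x * \<rho> x) \<le> \<bar>Y t x * (\<rho> x - k i x)\<bar> + \<bar>Y t x * k i x\<bar>" by (simp only: real_norm_def abs_triangle_ineq)
      also have "\<bar>Y t x * k i x\<bar> \<le> real i * \<bar>Y t x\<bar>"
        using mult_left_mono[OF kb[of i x] abs_ge_zero[of "Y t x"]] by (simp add: abs_mult mult.commute)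
      finally show "norm (Y t x * \<rho> x) \<le> \<bar>Y t x * (\<rho> x - k i x)\<bar> + real i * \<bar>Y t x\<bar>" by simp
    qed (use p1 p2 p3 in auto)
    also have "\<dots> = (LINT x|M. \<bar>Y t x * (\<rho> x - k i x)\<bar>) + real i * (LINT x|M. \<bar>Y t x\<bar>)"
      using p1 p2 by simp
    also have "(LINT x|M. \<bar>Y t x * (\<rho> x - k i x)\<bar>) \<le> sqrt (LINT x|M. (Y t x)^2) * sqrt (LINT x|M. (\<rho> x - k i x)^2)"
      using integral_norm_mult_le[of "Y t" M "\<lambda>x. \<rho> x - k i x"] Y2(1) k_int by simp
    also have "\<dots> \<le> sqrt C * sqrt (LINT x|M. (\<rho> x - k i x)^2)" using Y2(2) by (intro mult_right_mono) auto
    finally show ?case using i elim(2) by linarith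
  qed
qed

lemma (in prob_space) second_moment_tendsto_0:
  fixes D :: "real \<Rightarrow> 'a \<Rightarrow> real"
  assumes var: "((\<lambda>t. evar M (D t)) \<longlongrightarrow> 0) F" and mean: "((\<lambda>t. LINT x|M. D t x) \<longlongrightarrow> 0) F"
  shows "\<forall>\<^sub>F t in F. integrable M (\<lambda>x. (D t x)^2)" "((\<lambda>t. LINT x|M. (D t x)^2) \<longlongrightarrow> 0) F"
proof -
  \<comment> \<open>A finite value of \<open>evar\<close> includes integrability, since the value is
    infinite when the mean does not exist.\<close>
  have "\<forall>\<^sub>F t in F. evar M (D t) < 1" using var by (rule order_tendstoD) simp
  then have ev: "\<forall>\<^sub>F t in F. integrable M (\<lambda>x. (D t x)^2) \<and>
      enn2real (evar M (D t)) + (LINT x|M. D t x)^2 = (LINT x|M. (D t x)^2)"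
  proof eventually_elim
    case (elim t)
    define m where "m = (LINT x|M. D t x)"
    have i: "integrable M (D t)" and e: "evar M (D t) = (\<integral>\<^sup>+x. ennreal ((D t x - m)^2) \<partial>M)"
      using elim by (auto simp: evar_def m_def split: if_splits)
    have c: "integrable M (\<lambda>x. (D t x - m)^2)"
    proof (rule integrableI_nonneg)
      show "(\<integral>\<^sup>+x. ennreal ((D t x - m)^2) \<partial>M) < \<infinity>" using elim unfolding e by (rule less_trans) simp
    qed (use i in auto)
    have ex: "(D t x)^2 = (D t x - m)^2 + 2 * m * D t x - m\<^sup>2" for x by (simp add: power2_eq_square algebra_simps)
    have "enn2real (evar M (D t)) = (LINT x|M. (D t x - m)^2)"
      unfolding e by (subst nn_integral_eq_integral[OF c]) auto
    moreover have "(LINT x|M. (D t x)^2) = (LINT x|M. (D t x - m)^2) + 2 * m * m - m\<^sup>2"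
      unfolding ex using c i by (simp add: prob_space m_def)
    moreover have "integrable M (\<lambda>x. (D t x)^2)" unfolding ex using c i by simp
    ultimately show ?case by (simp add: m_def power2_eq_square)
  qed
  then show "\<forall>\<^sub>F t in F. integrable M (\<lambda>x. (D t x)^2)" by (auto elim: eventually_mono)
  have "((\<lambda>t. evar M (D t)) \<longlongrightarrow> ennreal 0) F" unfolding ennreal_0 by (rule var)
  from tendsto_enn2real[OF this order_refl] have "((\<lambda>t. enn2real (evar M (D t))) \<longlongrightarrow> 0) F" .
  then have "((\<lambda>t. enn2real (evar M (D t)) + (LINT x|M. D t x)^2) \<longlongrightarrow> 0 + 0\<^sup>2) F" by (intro tendsto_add tendsto_power mean)
  then have "((\<lambda>t. enn2real (evar M (D t)) + (LINT x|M. D t x)^2) \<longlongrightarrow> 0) F" by simp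
  then show "((\<lambda>t. LINT x|M. (D t x)^2) \<longlongrightarrow> 0) F"
    by (rule Lim_transform_eventually) (use ev in \<open>auto elim: eventually_mono\<close>)
qed

context estimation_model
begin

lemma mean_utility_marginal: "F \<in> \<F> \<Longrightarrow> mean_utility u F = (LINT x|marginal_X MX F. ubar x F)"
  using integral_marginal(1)[OF prob_F sets_F ubar_meas] integral_ubar by simp

text \<open>The two summands of the derivative stem from the change of the integrand and from the
  change of the measure. After division by t the error terms of \<open>mean_shift_estimate\<close>
  are square roots of quantities that the score condition makes vanish, and \<open>Y\<close>
  vanishes in L1 while staying bounded in L2, so its pairing with \<open>\<rho>\<close> vanishes
  too.\<close>

lemma mean_utility_derivative:
  assumes \<gamma>: "\<gamma> \<in> \<C>" and score: "has_score MX F0 \<gamma> \<rho>"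
    and bound: "\<And>t. t \<in> {0..1} \<Longrightarrow> (\<integral>\<^sup>+x. ennreal ((ubar x (\<gamma> t))^2) \<partial>marginal_X MX (\<gamma> t)) \<le> ennreal B"
    and v0: "(\<lambda>x. ubar x F0) \<in> L2_space M0"
  shows "((\<lambda>t. (mean_utility u (\<gamma> t) - mean_utility u F0) / t) \<longlongrightarrow> ip \<phi> \<rho> + ip (\<lambda>x. ubar x F0) \<rho>) (at_right 0)"
proof -
  obtain f where \<rho>2: "\<rho> \<in> L2_space M0"
    and f: "\<And>t. t \<in> {0..1} \<Longrightarrow> is_ac_part_deriv M0 (marginal_X MX (\<gamma> t)) (f t)"
    and f2: "(\<lambda>t. LINT x|M0. (sqrt (f t x) - 1 - t * \<rho> x / 2)^2) \<in> o[at_right 0](\<lambda>t. t\<^sup>2)"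
    and f3: "(\<lambda>t. (LINT x|M0. f t x) - 1) \<in> o[at_right 0](\<lambda>t. t\<^sup>2)"
    using score unfolding has_score_def Let_def by blast
  define v where "v t x = ubar x (\<gamma> t)" for t x
  define D where "D t x = v t x - ubar x F0" for t x
  define a where "a = (LINT x|M0. (ubar x F0)^2)"
  define r where "r t = (LINT x|M0. (sqrt (f t x) - 1 - t * \<rho> x / 2)^2)" for t
  define Y where "Y t x = v t x * (sqrt (f t x) + 1) - 2 * ubar x F0" for t x
  \<comment> \<open>\<open>ennreal\<close> sends a negative bound to 0; the maximum keeps the
    corresponding real inequality valid.\<close>
  define B' where "B' = max B 0"
  have \<rho>M: "\<rho> \<in> borel_measurable M0" "integrable M0 (\<lambda>x. (\<rho> x)^2)" using \<rho>2 by (auto simp: L2_space_def)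
  have v0M: "(\<lambda>x. ubar x F0) \<in> borel_measurable M0" "integrable M0 (\<lambda>x. (ubar x F0)^2)" using v0 by (auto simp: L2_space_def)
  have slope: "((\<lambda>t. (LINT x|M0. D t x) / t) \<longlongrightarrow> ip \<phi> \<rho>) (at_right 0)"
    using phi[OF \<gamma> score] by (simp add: D_def v_def ip_def)
  have t0: "((\<lambda>t. t) \<longlongrightarrow> 0) (at_right (0::real))" by (rule tendsto_ident_at)
  have unit: "\<forall>\<^sub>F t in at_right (0::real). t \<in> {0<..<1}" by (rule eventually_at_right_real) simp
  have "((\<lambda>t. t * ((LINT x|M0. D t x) / t)) \<longlongrightarrow> 0 * ip \<phi> \<rho>) (at_right 0)" by (intro tendsto_mult t0 slope)
  then have "((\<lambda>t. t * ((LINT x|M0. D t x) / t)) \<longlongrightarrow> 0) (at_right 0)" by simp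
  then have mean: "((\<lambda>t. LINT x|M0. D t x) \<longlongrightarrow> 0) (at_right 0)"
    by (rule Lim_transform_eventually) (rule eventually_mono[OF unit], simp)
  have var: "((\<lambda>t. evar M0 (D t)) \<longlongrightarrow> 0) (at_right 0)"
    using var_diff[OF \<gamma>] by (simp add: D_def[abs_def] v_def)
  note D2 = M0.second_moment_tendsto_0[OF var mean]
  have "\<forall>\<^sub>F t in at_right 0. (LINT x|M0. (D t x)^2) < 1" using D2(2) by (rule order_tendstoD) simp
  with D2(1) unit have good: "\<forall>\<^sub>F t in at_right 0. 0 < t \<and> Y t \<in> borel_measurable M0 \<and> integrable M0 (\<lambda>x. (Y t x)^2) \<and>
      (LINT x|M0. (Y t x)^2) \<le> 4 * B' + 16 * a + 8 \<and>
      (LINT x|M0. \<bar>Y t x\<bar>) \<le> 2 * sqrt (LINT x|M0. (D t x)^2) + sqrt a * sqrt (2 * r t + t^2 / 2 * (LINT x|M0. (\<rho> x)^2)) \<and>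
      \<bar>mean_utility u (\<gamma> t) - mean_utility u F0 - (LINT x|M0. D t x) - t * (ip (\<lambda>x. ubar x F0) \<rho> + (LINT x|M0. Y t x * \<rho> x) / 2)\<bar>
        \<le> sqrt B' * sqrt (1 - (LINT x|M0. f t x)) + sqrt (2 * B' + 4 * a + 4) * sqrt (r t)"
  proof eventually_elim
    case (elim t)
    then have t: "t \<in> {0..1}" by simp
    note F = curveD(2)[OF \<gamma> t]
    note N = prob_space_marginal[OF prob_F[OF F] sets_F[OF F]] sets_marginal[OF prob_F[OF F] sets_F[OF F]]
    have sets: "sets (marginal_X MX (\<gamma> t)) = sets M0" unfolding N(2) sets_M0 ..
    have vm: "v t \<in> borel_measurable M0" using ubar_meas[OF F] by (simp add: v_def[abs_def] measurable_cong_sets[OF sets_M0 refl])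
    have vm': "v t \<in> borel_measurable (marginal_X MX (\<gamma> t))" using vm by (simp add: measurable_cong_sets[OF sets refl])
    have nn: "(\<integral>\<^sup>+x. ennreal ((v t x)^2) \<partial>marginal_X MX (\<gamma> t)) \<le> ennreal B'"
      using bound[OF t] by (auto simp: v_def B'_def intro: order_trans ennreal_leI)
    have vi: "integrable (marginal_X MX (\<gamma> t)) (\<lambda>x. (v t x)^2)"
    proof (rule integrableI_nonneg)
      show "(\<integral>\<^sup>+x. ennreal ((v t x)^2) \<partial>marginal_X MX (\<gamma> t)) < \<infinity>" using nn by (rule le_less_trans) simp
    qed (use vm' in auto)
    have vB: "(LINT x|marginal_X MX (\<gamma> t). (v t x)^2) \<le> B'"
      using nn unfolding nn_integral_eq_integral[OF vi AE_I2[OF zero_le_power2]]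
      by (subst (asm) ennreal_le_iff) (simp_all add: B'_def)
    have D1: "integrable M0 (\<lambda>x. (v t x - ubar x F0)^2)" "(LINT x|M0. (v t x - ubar x F0)^2) \<le> 1"
      using elim by (simp_all add: D_def)
    note est = mean_shift_estimate[OF M0.prob_space_axioms N(1) sets f[OF t] vm vi vB v0M D1 \<rho>M]
    show ?case
      using est(1-3) est(4,5)[of t] elim mean_utility_marginal[OF F] mean_utility_marginal[OF F0]
      unfolding Y_def[abs_def] D_def a_def r_def ip_def v_def by simp
  qed
  have r_lim: "((\<lambda>t. r t / t^2) \<longlongrightarrow> 0) (at_right 0)" unfolding r_def by (rule smalloD_tendsto[OF f2])
  have m_lim: "((\<lambda>t. ((LINT x|M0. f t x) - 1) / t^2) \<longlongrightarrow> 0) (at_right 0)" by (rule smalloD_tendsto[OF f3])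
  have "((\<lambda>t. t\<^sup>2 * (r t / t^2)) \<longlongrightarrow> 0\<^sup>2 * 0) (at_right 0)" by (intro tendsto_mult tendsto_power t0 r_lim)
  then have "((\<lambda>t. t\<^sup>2 * (r t / t^2)) \<longlongrightarrow> 0) (at_right 0)" by simp
  then have r0: "(r \<longlongrightarrow> 0) (at_right 0)"
    by (rule Lim_transform_eventually) (rule eventually_mono[OF unit], simp)
  have "((\<lambda>t. 2 * sqrt (LINT x|M0. (D t x)^2) + sqrt a * sqrt (2 * r t + t^2 / 2 * (LINT x|M0. (\<rho> x)^2))) \<longlongrightarrow>
      2 * sqrt 0 + sqrt a * sqrt (2 * 0 + 0\<^sup>2 / 2 * (LINT x|M0. (\<rho> x)^2))) (at_right 0)"
    by (intro tendsto_intros D2(2) r0 t0) simp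
  then have ub: "((\<lambda>t. 2 * sqrt (LINT x|M0. (D t x)^2) + sqrt a * sqrt (2 * r t + t^2 / 2 * (LINT x|M0. (\<rho> x)^2))) \<longlongrightarrow> 0) (at_right 0)"
    by simp
  have Y1: "((\<lambda>t. LINT x|M0. \<bar>Y t x\<bar>) \<longlongrightarrow> 0) (at_right 0)"
    by (rule Lim_null_comparison[OF _ ub]) (use good in \<open>auto elim!: eventually_mono\<close>)
  have Y\<rho>: "((\<lambda>t. LINT x|M0. Y t x * \<rho> x) \<longlongrightarrow> 0) (at_right 0)"
    by (rule integral_mult_tendsto_0_if_bounded_L2[OF \<rho>M M0.finite_measure_axioms _ Y1]) (use good in \<open>auto elim!: eventually_mono\<close>)
  define err where "err t = (mean_utility u (\<gamma> t) - mean_utility u F0) / t - (LINT x|M0. D t x) / t -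
      (ip (\<lambda>x. ubar x F0) \<rho> + (LINT x|M0. Y t x * \<rho> x) / 2)" for t
  have "((\<lambda>t. sqrt B' * sqrt (- (((LINT x|M0. f t x) - 1) / t^2)) + sqrt (2 * B' + 4 * a + 4) * sqrt (r t / t^2)) \<longlongrightarrow>
      sqrt B' * sqrt (- 0) + sqrt (2 * B' + 4 * a + 4) * sqrt 0) (at_right 0)"
    by (intro tendsto_intros m_lim r_lim)
  then have eb: "((\<lambda>t. sqrt B' * sqrt (- (((LINT x|M0. f t x) - 1) / t^2)) + sqrt (2 * B' + 4 * a + 4) * sqrt (r t / t^2)) \<longlongrightarrow> 0) (at_right 0)"
    by simp
  have err: "(err \<longlongrightarrow> 0) (at_right 0)"
  proof (rule Lim_null_comparison[OF _ eb])
    show "\<forall>\<^sub>F t in at_right 0. norm (err t) \<le> sqrt B' * sqrt (- (((LINT x|M0. f t x) - 1) / t^2)) + sqrt (2 * B' + 4 * a + 4) * sqrt (r t / t^2)"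
      using good
    proof eventually_elim
      case (elim t)
      then have "t > 0" by simp
      define E where "E = mean_utility u (\<gamma> t) - mean_utility u F0 - (LINT x|M0. D t x) - t * (ip (\<lambda>x. ubar x F0) \<rho> + (LINT x|M0. Y t x * \<rho> x) / 2)"
      have s: "sqrt (x / t^2) = sqrt x / t" for x using \<open>t > 0\<close> by (simp add: real_sqrt_divide)
      have n: "- (((LINT x|M0. f t x) - 1) / t^2) = (1 - (LINT x|M0. f t x)) / t^2" by (simp add: minus_divide_left)
      have "err t = E / t" using \<open>t > 0\<close> by (simp add: err_def E_def diff_divide_distrib)
      then have "norm (err t) = \<bar>E\<bar> / t" using \<open>t > 0\<close> by simp
      also have "\<dots> \<le> (sqrt B' * sqrt (1 - (LINT x|M0. f t x)) + sqrt (2 * B' + 4 * a + 4) * sqrt (r t)) / t"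
        using elim \<open>t > 0\<close> unfolding E_def by (intro divide_right_mono) simp_all
      finally show ?case unfolding n s by (simp add: add_divide_distrib)
    qed
  qed
  have "((\<lambda>t. err t + (LINT x|M0. D t x) / t + (ip (\<lambda>x. ubar x F0) \<rho> + (LINT x|M0. Y t x * \<rho> x) / 2)) \<longlongrightarrow>
      0 + ip \<phi> \<rho> + (ip (\<lambda>x. ubar x F0) \<rho> + 0 / 2)) (at_right 0)"
    by (intro tendsto_intros err slope Y\<rho>) simp
  then show ?thesis by (simp add: err_def)
qed

text \<open>Scores lie in the tangent space, so in a pairing with a score both \<open>\<phi>\<close>
  and the conditional mean may be replaced by their projections.\<close>

lemma efficient_influence_function_sum:
  assumes bound: "\<forall>\<gamma>\<in>\<C>. \<exists>B::real. \<forall>t\<in>{0..1}. (\<integral>\<^sup>+x. ennreal ((ubar x (\<gamma> t))^2) \<partial>marginal_X MX (\<gamma> t)) \<le> ennreal B"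
    and proj: "is_L2_projection M0 (tangent_space MX F0 \<C>) \<phi> \<phi>0"
    and proj_u: "is_L2_projection M0 (tangent_space MX F0 \<C>) (\<lambda>x. ubar x F0) ustar"
  shows "efficient_influence_function MX F0 \<C> (mean_utility u) (\<lambda>x. \<phi>0 x + ustar x)"
  unfolding efficient_influence_function_def
proof (intro conjI ballI allI impI)
  have tan: "\<phi>0 \<in> tangent_space MX F0 \<C>" "ustar \<in> tangent_space MX F0 \<C>"
    using proj proj_u by (simp_all add: is_L2_projection_def)
  show "(\<lambda>x. \<phi>0 x + ustar x) \<in> tangent_space MX F0 \<C>" using tangent_lincomb[OF tan, of 1 1] by simp
  have v0: "(\<lambda>x. ubar x F0) \<in> L2_space M0" using proj_u by (simp add: is_L2_projection_def)
  have L2: "\<phi>0 \<in> L2_space M0" "ustar \<in> L2_space M0" using tan tangent_L20 L20D(5) by blast+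
  fix \<gamma> \<rho> assume \<gamma>: "\<gamma> \<in> \<C>" and score: "has_score MX F0 \<gamma> \<rho>"
  obtain B where "\<And>t. t \<in> {0..1} \<Longrightarrow> (\<integral>\<^sup>+x. ennreal ((ubar x (\<gamma> t))^2) \<partial>marginal_X MX (\<gamma> t)) \<le> ennreal B"
    using bound \<gamma> by blast
  from mean_utility_derivative[OF \<gamma> score this v0]
  have lim: "((\<lambda>t. (mean_utility u (\<gamma> t) - mean_utility u F0) / t) \<longlongrightarrow> ip \<phi> \<rho> + ip (\<lambda>x. ubar x F0) \<rho>) (at_right 0)" .
  note \<rho> = score_tangent[OF score \<gamma>]
  have \<rho>2: "\<rho> \<in> L2_space M0" using \<rho> tangent_L20 L20D(5) by blast
  have "ip (\<lambda>x. ubar x F0 - ustar x) \<rho> = 0" using proj_u \<rho> by (simp add: is_L2_projection_def ip_def)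
  then have "ip (\<lambda>x. ubar x F0) \<rho> = ip ustar \<rho>" using ip_lincomb(1)[OF v0 L2(2) \<rho>2, of 1 "- 1"] by simp
  moreover have "ip (\<lambda>x. \<phi>0 x + ustar x) \<rho> = ip \<phi>0 \<rho> + ip ustar \<rho>" using ip_lincomb(1)[OF L2 \<rho>2, of 1 1] by simp
  ultimately have e: "ip \<phi> \<rho> + ip (\<lambda>x. ubar x F0) \<rho> = ip (\<lambda>x. \<phi>0 x + ustar x) \<rho>"
    unfolding projection_ip(2)[OF proj \<rho>] by simp
  show "((\<lambda>t. (mean_utility u (\<gamma> t) - mean_utility u F0) / t) \<longlongrightarrow> (LINT x|M0. (\<phi>0 x + ustar x) * \<rho> x)) (at_right 0)"
    using lim unfolding e unfolding ip_def .
qed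

end

theorem theorem6p1:
  fixes MX :: "'x measure" and MT :: "'t measure"
    and \<F> :: "('x \<times> 't) measure set" and F0 :: "('x \<times> 't) measure"
    and u :: "('x, 't) utility"
    and ubar :: "'x \<Rightarrow> ('x \<times> 't) measure \<Rightarrow> real"
    and \<C> :: "(real \<Rightarrow> ('x \<times> 't) measure) set"
    and \<phi> \<phi>0 \<phi>s :: "'x \<Rightarrow> real"
    and M0 :: "'x measure" and H :: "('x \<Rightarrow> real) set"
  assumes model: "\<And>F. F \<in> \<F> \<Longrightarrow> prob_space F \<and> sets F = sets (MX \<Otimes>\<^sub>M MT)"
    and utility: "\<And>F. F \<in> \<F> \<Longrightarrow> integrable F (util u F)"
    and ubar: "\<And>F. F \<in> \<F> \<Longrightarrow> is_cond_mean_utility MX u F (\<lambda>x. ubar x F)"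
    and F0: "F0 \<in> \<F>"
    and curves: "admissible_curves MX \<F> F0 \<C>"
    and M0: "M0 = marginal_X MX F0"
    and H: "H = tangent_space MX F0 \<C>"
    and var_diff: "\<And>\<gamma>. \<gamma> \<in> \<C> \<Longrightarrow>
          ((\<lambda>t. evar M0 (\<lambda>x. ubar x (\<gamma> t) - ubar x F0)) \<longlongrightarrow> 0) (at_right 0)"
    and law_w: "\<And>\<gamma>. \<gamma> \<in> \<C> \<Longrightarrow>
          weakly_tends (\<lambda>t. distr (\<gamma> t) borel (residual u ubar (\<gamma> t)))
            (distr F0 borel (residual u ubar F0)) (at_right 0)"
    and finite_w: "(\<integral>\<^sup>+z. ennreal ((residual u ubar F0 z)\<^sup>2) \<partial>F0) < \<infinity>"
    and moment_w: "\<And>\<gamma>. \<gamma> \<in> \<C> \<Longrightarrow>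
          ((\<lambda>t. \<integral>\<^sup>+z. ennreal ((residual u ubar (\<gamma> t) z)\<^sup>2) \<partial>\<gamma> t) \<longlongrightarrow>
             (\<integral>\<^sup>+z. ennreal ((residual u ubar F0 z)\<^sup>2) \<partial>F0)) (at_right 0)"
    and phi_L2: "\<phi> \<in> L2_space M0"
    and phi: "\<And>\<gamma> \<rho>. \<gamma> \<in> \<C> \<Longrightarrow> has_score MX F0 \<gamma> \<rho> \<Longrightarrow>
          ((\<lambda>t. (\<integral>x. ubar x (\<gamma> t) - ubar x F0 \<partial>M0) / t) \<longlongrightarrow> (\<integral>x. \<phi> x * \<rho> x \<partial>M0)) (at_right 0)"
    and phi0: "is_L2_projection M0 H \<phi> \<phi>0"
    and phis: "\<phi>s = (\<lambda>x. ubar x F0 - mean_utility u F0 + \<phi>0 x)"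
  shows
    "(\<forall>S (\<Omega> :: 'w measure) \<xi>. regular_estimator MX u \<C> S \<Omega> \<xi> \<longrightarrow>
        evar F0 (\<lambda>z. \<phi>s (fst z) - util u F0 z) \<le> evar \<Omega> \<xi> \<and>
        ((\<integral>\<^sup>+z. ennreal ((\<xi> z)\<^sup>2) \<partial>\<Omega>) = evar F0 (\<lambda>z. \<phi>s (fst z) - util u F0 z) \<longleftrightarrow>
          tends_to_0_in_prob (iid F0)
            (\<lambda>n \<omega>. sqrt (real n) *
               (S n (observed n \<omega>) / real n
                 - (mean_utility u F0 + (\<Sum>j<n. \<phi>s (fst (\<omega> j))) / real n)))))
     \<and>
     (\<forall>S (\<Omega> :: 'w measure) \<xi>.
        regular_estimator MX u \<C> S \<Omega> \<xi> \<and>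
        convex_set_of_functions (L2_closure M0 (score_set MX F0 \<C>)) \<longrightarrow>
        (\<exists>(\<Omega>' :: (real \<times> real) measure) \<xi>' (Z :: ('x \<times> 't \<Rightarrow> real) \<Rightarrow> real \<times> real \<Rightarrow> real).
           prob_space \<Omega>' \<and> \<xi>' \<in> borel_measurable \<Omega>' \<and>
           (\<forall>g\<in>L2_space F0. Z g \<in> borel_measurable \<Omega>' \<and>
              distr \<Omega>' borel (Z g) = normal_law 0 (prob_space.variance F0 g)) \<and>
           (\<forall>h\<in>H. let g = (\<lambda>z. ubar (fst z) F0 + h (fst z) - util u F0 z) in
              weakly_tends
                (\<lambda>n. distr (iid F0) borel
                   (\<lambda>\<omega>. (sqrt (real n) *
                            (S n (observed n \<omega>) / real n
                              - emp_mean n (\<lambda>z. \<phi>s (fst z)) \<omega> - mean_utility u F0),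
                          emp_process F0 n g \<omega>)))
                (distr \<Omega>' borel (\<lambda>y. (\<xi>' y, Z g y))) sequentially \<and>
              prob_space.indep_var \<Omega>' borel \<xi>' borel (Z g)) \<and>
           distr \<Omega> borel \<xi> =
             (distr \<Omega>' borel (Z (\<lambda>z. \<phi>s (fst z) - util u F0 z)) \<star> distr \<Omega>' borel \<xi>')))
     \<and>
     (\<forall>ustar.
        (\<forall>\<gamma>\<in>\<C>. \<exists>B::real. \<forall>t\<in>{0..1}.
           (\<integral>\<^sup>+x. ennreal ((ubar x (\<gamma> t))\<^sup>2) \<partial>marginal_X MX (\<gamma> t)) \<le> ennreal B) \<and>
        is_L2_projection M0 H (\<lambda>x. ubar x F0) ustar \<longrightarrow>
        (let \<psi> = (\<lambda>x. \<phi>0 x + ustar x) in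
           efficient_influence_function MX F0 \<C> (mean_utility u) \<psi> \<and>
           (\<forall>x. \<phi>s x = \<psi> x + ubar x F0 - mean_utility u F0 - ustar x)))"
proof -
  interpret estimation_model MX MT \<F> F0 u ubar \<C> \<phi>
    by (rule estimation_model.intro) (fact model utility ubar F0 curves finite_w moment_w law_w var_diff[unfolded M0] phi_L2[unfolded M0] phi[unfolded M0])+
  note proj = phi0[unfolded M0 H]
  have tan: "\<phi>0 \<in> tangent_space MX F0 \<C>" using proj by (simp add: is_L2_projection_def)
  note p0 = projection_ip(1)[OF proj tan]
  have bound: "evar F0 (\<lambda>z. \<phi>s (fst z) - util u F0 z) = ennreal (sig2 + ip \<phi>0 \<phi>0)"
    unfolding phis by (rule bound_eq[OF p0])
  \<comment> \<open>The normalised errors in the first two parts of the statement are the same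
    statistic: the mean utility cancels, and the conditional mean is absorbed into
    \<open>stat\<close>.\<close>
  have stat1: "sqrt (real n) * (S n (observed n zs) / real n - emp_mean n (\<lambda>z. \<phi>s (fst z)) zs - mean_utility u F0) = stat S n zs - fluct n \<phi>0 zs"
    for S n zs unfolding phis by (rule linearized_statistic)
  have stat2: "sqrt (real n) * (S n (observed n zs) / real n - (mean_utility u F0 + (\<Sum>j<n. \<phi>s (fst (zs j))) / real n)) = stat S n zs - fluct n \<phi>0 zs"
    for S n zs unfolding stat1[symmetric] emp_mean_def by (simp add: algebra_simps)
  have gs: "(\<lambda>z. \<phi>s (fst z) - util u F0 z) = (\<lambda>z. ubar (fst z) F0 - mean_utility u F0 + \<phi>0 (fst z) - util u F0 z)"
    unfolding phis ..
  show ?thesis unfolding bound unfolding stat1 stat2 gs M0 H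
  proof (intro conjI allI impI)
    fix S and \<Omega> :: "'w measure" and \<xi>
    assume reg: "regular_estimator MX u \<C> S \<Omega> \<xi>"
    show "ennreal (sig2 + ip \<phi>0 \<phi>0) \<le> evar \<Omega> \<xi>" by (rule variance_bound[OF reg proj])
    show "(\<integral>\<^sup>+z. ennreal ((\<xi> z)^2) \<partial>\<Omega>) = ennreal (sig2 + ip \<phi>0 \<phi>0) \<longleftrightarrow>
        tends_to_0_in_prob (iid F0) (\<lambda>n zs. stat S n zs - fluct n \<phi>0 zs)"
      using efficient_linear[OF reg proj] efficient_linear_converse[OF reg p0] by blast
  next
    fix S and \<Omega> :: "'w measure" and \<xi>
    assume "regular_estimator MX u \<C> S \<Omega> \<xi> \<and> convex_set_of_functions (L2_closure (marginal_X MX F0) (score_set MX F0 \<C>))"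
    then show "\<exists>(\<Omega>' :: (real \<times> real) measure) \<xi>' (Z :: ('x \<times> 't \<Rightarrow> real) \<Rightarrow> real \<times> real \<Rightarrow> real).
      prob_space \<Omega>' \<and> \<xi>' \<in> borel_measurable \<Omega>' \<and>
      (\<forall>g\<in>L2_space F0. Z g \<in> borel_measurable \<Omega>' \<and> distr \<Omega>' borel (Z g) = normal_law 0 (prob_space.variance F0 g)) \<and>
      (\<forall>h\<in>tangent_space MX F0 \<C>. let g = (\<lambda>z. ubar (fst z) F0 + h (fst z) - util u F0 z) in
         weakly_tends (\<lambda>n. distr (iid F0) borel (\<lambda>zs. (stat S n zs - fluct n \<phi>0 zs, emp_process F0 n g zs)))
           (distr \<Omega>' borel (\<lambda>y. (\<xi>' y, Z g y))) sequentially \<and>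
         prob_space.indep_var \<Omega>' borel \<xi>' borel (Z g)) \<and>
      distr \<Omega> borel \<xi> =
        (distr \<Omega>' borel (Z (\<lambda>z. ubar (fst z) F0 - mean_utility u F0 + \<phi>0 (fst z) - util u F0 z)) \<star> distr \<Omega>' borel \<xi>')"
      by (elim conjE) (rule convolution_theorem[OF _ proj])
  next
    fix ustar
    assume "(\<forall>\<gamma>\<in>\<C>. \<exists>B::real. \<forall>t\<in>{0..1}. (\<integral>\<^sup>+x. ennreal ((ubar x (\<gamma> t))^2) \<partial>marginal_X MX (\<gamma> t)) \<le> ennreal B) \<and>
      is_L2_projection (marginal_X MX F0) (tangent_space MX F0 \<C>) (\<lambda>x. ubar x F0) ustar"
    then show "let \<psi> = (\<lambda>x. \<phi>0 x + ustar x) in efficient_influence_function MX F0 \<C> (mean_utility u) \<psi> \<and>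
        (\<forall>x. \<phi>s x = \<psi> x + ubar x F0 - mean_utility u F0 - ustar x)"
      unfolding Let_def using efficient_influence_function_sum[OF _ proj] by (simp add: phis)
  qed
qed

end
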